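(* Let $k\geq 3$ be odd, let $j\geq 2$, let $n\ge 2$, let $G\times \mathbb{S}^k\to\mathbb{S}^k$ be a free action of a finite group $G$ on $\mathbb{S}^k$, and let $Q_1\in \mathbb{S}^k$. Let $\Delta_j^n(\mathbb{S}^k/G)$ denote the diagonal subgroup of $\prod_1^n\pi_j(\mathbb{S}^k/G)$. Then: (1) the image of the homomorphism $\pi_j(i_n(\mathbb{S}^k/G)):\pi_j(F_n(\mathbb{S}^k/G))\to \prod_1^n\pi_j(\mathbb{S}^k/G)$ is the diagonal subgroup $\Delta_j^n(\mathbb{S}^k/G)$. (2) there are split short exact sequences: $$0\to \Delta_j^n(\mathbb{S}^k/G) \to \pi_j\Bigl(\prod_1^n\mathbb{S}^k/G\Bigr)\to \pi_{j-1}\Bigl(\prod_1^{n-1}\Omega(\mathbb{S}^k/G)\Bigr)\to 0$$ and $$0\to \pi_j(F_{n-1}^G(\mathbb{S}^k\setminus GQ_1)) \to \pi_j(F_n(\mathbb{S}^k/G)) \to \Delta_j^n(\mathbb{S}^k/G) \to 0.$$ In particular, if $G$ is the trivial group then there is a split short exact sequence: $$0\to \pi_j(F_{n-1}(\mathbb{R}^k)) \to \pi_j(F_n(\mathbb{S}^k)) \to \Delta_j^n(\mathbb{S}^k) \to 0.$$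
   Context: $F_n(X)=\{(x_1,\dots,x_n)\in\prod_1^nX\mid x_i\ne x_j\text{ for }i\ne j\}$, with inclusion $i_n(X):F_n(X)\hookrightarrow\prod_1^nX$; for a free action of $G$ on $X$, $F^G_n(X)=\{(x_1,\dots,x_n)\in\prod_1^nX\mid Gx_i\cap Gx_j=\emptyset\text{ for }i\ne j\}$. $\Omega$ denotes the loop space. Base points: the base point $(x_1,\dots,x_n)$ of $F_n(\mathbb{S}^k/G)$ is chosen so that $\{x_1,\dots,x_n\}$ is contained in a small disc centred at a point $x_0\in\mathbb{S}^k/G$; paths inside this disc from $x_i$ to $x_0$ identify $\pi_j(\mathbb{S}^k/G,x_i)$ with $\pi_j(\mathbb{S}^k/G,x_0)$, and hence $\pi_j(\prod_1^n\mathbb{S}^k/G,(x_1,\dots,x_n))$ with $\prod_1^n\pi_j(\mathbb{S}^k/G,x_0)$. The notation $\pi_j(i_n(\mathbb{S}^k/G))$ refers to the induced homomorphism composed with this isomorphism, and the diagonal subgroup is $\{(\alpha,\dots,\alpha)\mid\alpha\in\pi_j(\mathbb{S}^k/G,x_0)\}$. *)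

theory Defs
  imports "HOL-Analysis.Analysis" "HOL-Algebra.Group_Action" "HOL-Algebra.Product_Groups"
begin

section \<open>Homotopy groups\<close>

definition cube :: "nat \<Rightarrow> (nat \<Rightarrow> real) topology" where
  "cube j = product_topology (\<lambda>_. top_of_set {0..1}) {..<j}"

definition cube_boundary :: "nat \<Rightarrow> (nat \<Rightarrow> real) set" where
  "cube_boundary j = {t \<in> topspace (cube j). \<exists>i<j. t i = 0 \<or> t i = 1}"

definition cube_loops :: "nat \<Rightarrow> 'a topology \<Rightarrow> 'a \<Rightarrow> ((nat \<Rightarrow> real) \<Rightarrow> 'a) set" where
  "cube_loops j X x = {f. continuous_map (cube j) X f \<and> (\<forall>t\<in>cube_boundary j. f t = x)}"

text \<open>Classes modulo homotopy relative to the boundary. Values outside the cube are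
  irrelevant: a class contains every function that agrees on the cube with one of its members.\<close>

definition cube_class ::
  "nat \<Rightarrow> 'a topology \<Rightarrow> 'a \<Rightarrow> ((nat \<Rightarrow> real) \<Rightarrow> 'a) \<Rightarrow> ((nat \<Rightarrow> real) \<Rightarrow> 'a) set" where
  "cube_class j X x f =
     {g. homotopic_with (\<lambda>h. \<forall>t\<in>cube_boundary j. h t = x) (cube j) X f g}"

definition cube_concat ::
  "((nat \<Rightarrow> real) \<Rightarrow> 'a) \<Rightarrow> ((nat \<Rightarrow> real) \<Rightarrow> 'a) \<Rightarrow> (nat \<Rightarrow> real) \<Rightarrow> 'a" where
  "cube_concat f g = (\<lambda>t. if t 0 \<le> 1/2 then f (t(0 := 2 * t 0)) else g (t(0 := 2 * t 0 - 1)))"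

text \<open>Meaningful as a group for \<open>j \<ge> 1\<close> and \<open>x \<in> topspace X\<close>.\<close>

definition homotopy_group ::
  "nat \<Rightarrow> 'a topology \<Rightarrow> 'a \<Rightarrow> ((nat \<Rightarrow> real) \<Rightarrow> 'a) set monoid" where
  "homotopy_group j X x =
     \<lparr>carrier = cube_class j X x ` cube_loops j X x,
      monoid.mult = (\<lambda>A B. \<Union>f\<in>A. \<Union>g\<in>B. cube_class j X x (cube_concat f g)),
      one = cube_class j X x (\<lambda>_. x)\<rparr>"

text \<open>The map induced by \<open>\<phi>\<close> on homotopy groups; \<open>Y\<close> and \<open>y\<close> are the target and its base point.\<close>

definition homotopy_hom ::
  "nat \<Rightarrow> 'b topology \<Rightarrow> 'b \<Rightarrow> ('a \<Rightarrow> 'b) \<Rightarrow> ((nat \<Rightarrow> real) \<Rightarrow> 'a) set \<Rightarrow> ((nat \<Rightarrow> real) \<Rightarrow> 'b) set" where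
  "homotopy_hom j Y y \<phi> A = (\<Union>f\<in>A. cube_class j Y y (\<phi> \<circ> f))"

text \<open>Change of base point along a path \<open>\<gamma>\<close>, from the homotopy group at \<open>\<gamma> 0\<close> to the one at
  \<open>\<gamma> 1\<close>: a class is dragged by a free homotopy whose boundary values follow \<open>\<gamma>\<close>.\<close>

definition base_transport ::
  "nat \<Rightarrow> 'a topology \<Rightarrow> (real \<Rightarrow> 'a) \<Rightarrow> ((nat \<Rightarrow> real) \<Rightarrow> 'a) set \<Rightarrow> ((nat \<Rightarrow> real) \<Rightarrow> 'a) set" where
  "base_transport j X \<gamma> A =
     {g. \<exists>f\<in>A. \<exists>H. continuous_map (prod_topology (top_of_set {0..1}) (cube j)) X H \<and>
           (\<forall>t\<in>topspace (cube j). H (0, t) = f t \<and> H (1, t) = g t) \<and>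
           (\<forall>s\<in>{0..1}. \<forall>t\<in>cube_boundary j. H (s, t) = \<gamma> s)}"


section \<open>Loop spaces\<close>

text \<open>Based loops with the compact-open topology. Paths are made extensional so that
  points of the loop space are determined by their values on the unit interval.\<close>

definition based_loops :: "'a topology \<Rightarrow> 'a \<Rightarrow> (real \<Rightarrow> 'a) set" where
  "based_loops X x = {p \<in> extensional {0..1}. pathin X p \<and> p 0 = x \<and> p 1 = x}"

definition loop_space :: "'a topology \<Rightarrow> 'a \<Rightarrow> (real \<Rightarrow> 'a) topology" where
  "loop_space X x = topology_generated_by
     {{p \<in> based_loops X x. p ` C \<subseteq> U} |C U. compact C \<and> C \<subseteq> {0..1} \<and> openin X U}"

lemma topspace_loop_space: "topspace (loop_space X x) = based_loops X x"
proof -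
  have "based_loops X x = {p \<in> based_loops X x. p ` {} \<subseteq> {}}"
    by simp
  moreover have "compact ({} :: real set)" "openin X {}"
    by simp_all
  ultimately have "based_loops X x \<in>
     {{p \<in> based_loops X x. p ` C \<subseteq> U} |C U. compact C \<and> C \<subseteq> {0..1} \<and> openin X U}"
    by blast
  then show ?thesis
    unfolding loop_space_def topology_generated_by_topspace by blast
qed


section \<open>Free actions and orbit spaces\<close>

text \<open>For a finite (discrete) group, continuity of the action \<open>G \<times> X \<rightarrow> X\<close> amounts to continuity of
  each translation.\<close>

definition free_continuous_action ::
  "('g, 'm) monoid_scheme \<Rightarrow> 'a topology \<Rightarrow> ('g \<Rightarrow> 'a \<Rightarrow> 'a) \<Rightarrow> bool" where
  "free_continuous_action G X \<phi> \<longleftrightarrow>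
     group_action G (topspace X) \<phi> \<and>
     (\<forall>g\<in>carrier G. continuous_map X X (\<phi> g)) \<and>
     (\<forall>g\<in>carrier G. \<forall>x\<in>topspace X. \<phi> g x = x \<longrightarrow> g = \<one>\<^bsub>G\<^esub>)"

definition orbit_space ::
  "('g, 'm) monoid_scheme \<Rightarrow> 'a topology \<Rightarrow> ('g \<Rightarrow> 'a \<Rightarrow> 'a) \<Rightarrow> 'a set topology" where
  "orbit_space G X \<phi> = topology (\<lambda>U. U \<subseteq> orbits G (topspace X) \<phi> \<and>
     openin X {x \<in> topspace X. orbit G \<phi> x \<in> U})"

lemma openin_orbit_space:
  "openin (orbit_space G X \<phi>) U \<longleftrightarrow>
     U \<subseteq> orbits G (topspace X) \<phi> \<and> openin X {x \<in> topspace X. orbit G \<phi> x \<in> U}"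
proof -
  have "istopology (\<lambda>U. U \<subseteq> orbits G (topspace X) \<phi> \<and> openin X {x \<in> topspace X. orbit G \<phi> x \<in> U})"
    unfolding istopology_def
  proof (intro conjI allI impI)
    fix S T
    assume S: "S \<subseteq> orbits G (topspace X) \<phi> \<and> openin X {x \<in> topspace X. orbit G \<phi> x \<in> S}"
      and T: "T \<subseteq> orbits G (topspace X) \<phi> \<and> openin X {x \<in> topspace X. orbit G \<phi> x \<in> T}"
    show "S \<inter> T \<subseteq> orbits G (topspace X) \<phi>"
      using S by blast
    have "{x \<in> topspace X. orbit G \<phi> x \<in> S \<inter> T} =
          {x \<in> topspace X. orbit G \<phi> x \<in> S} \<inter> {x \<in> topspace X. orbit G \<phi> x \<in> T}"
      by blast
    then show "openin X {x \<in> topspace X. orbit G \<phi> x \<in> S \<inter> T}"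
      using S T by (simp add: openin_Int)
  next
    fix K
    assume K: "\<forall>S\<in>K. S \<subseteq> orbits G (topspace X) \<phi> \<and> openin X {x \<in> topspace X. orbit G \<phi> x \<in> S}"
    show "\<Union>K \<subseteq> orbits G (topspace X) \<phi>"
      using K by blast
    have "{x \<in> topspace X. orbit G \<phi> x \<in> \<Union>K} = (\<Union>S\<in>K. {x \<in> topspace X. orbit G \<phi> x \<in> S})"
      by blast
    then show "openin X {x \<in> topspace X. orbit G \<phi> x \<in> \<Union>K}"
      using K by (auto intro!: openin_Union)
  qed
  then show ?thesis
    by (simp add: orbit_space_def)
qed

lemma topspace_orbit_space: "topspace (orbit_space G X \<phi>) = orbits G (topspace X) \<phi>"
proof -
  have "{x \<in> topspace X. orbit G \<phi> x \<in> orbits G (topspace X) \<phi>} = topspace X"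
    by (auto simp: orbits_def)
  then have "openin (orbit_space G X \<phi>) (orbits G (topspace X) \<phi>)"
    by (simp add: openin_orbit_space)
  then show ?thesis
    by (metis openin_orbit_space openin_subset openin_topspace subset_antisym)
qed

lemma quotient_map_orbit_space: "quotient_map X (orbit_space G X \<phi>) (orbit G \<phi>)"
  unfolding quotient_map_def openin_orbit_space topspace_orbit_space
  by (auto simp: orbits_def)


section \<open>Configuration spaces\<close>

text \<open>Coordinates are indexed by \<open>{..<n}\<close>, so the first point of a configuration has index 0.\<close>

abbreviation power_space :: "nat \<Rightarrow> 'a topology \<Rightarrow> (nat \<Rightarrow> 'a) topology" where
  "power_space n X \<equiv> product_topology (\<lambda>_. X) {..<n}"

definition conf_space :: "nat \<Rightarrow> 'a topology \<Rightarrow> (nat \<Rightarrow> 'a) topology" where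
  "conf_space n X = subtopology (power_space n X) {x. \<forall>i<n. \<forall>j<n. i \<noteq> j \<longrightarrow> x i \<noteq> x j}"

definition orbit_conf_space ::
  "('g, 'm) monoid_scheme \<Rightarrow> ('g \<Rightarrow> 'a \<Rightarrow> 'a) \<Rightarrow> nat \<Rightarrow> 'a topology \<Rightarrow> (nat \<Rightarrow> 'a) topology" where
  "orbit_conf_space G \<phi> n X = subtopology (power_space n X)
     {x. \<forall>i<n. \<forall>j<n. i \<noteq> j \<longrightarrow> orbit G \<phi> (x i) \<inter> orbit G \<phi> (x j) = {}}"

text \<open>The map \<open>(y\<^sub>2, \<dots>, y\<^sub>n) \<mapsto> (q, p y\<^sub>2, \<dots>, p y\<^sub>n)\<close>.\<close>

definition insert_first :: "nat \<Rightarrow> 'b \<Rightarrow> ('a \<Rightarrow> 'b) \<Rightarrow> (nat \<Rightarrow> 'a) \<Rightarrow> (nat \<Rightarrow> 'b)" where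
  "insert_first n q p y = (\<lambda>i\<in>{..<n}. case i of 0 \<Rightarrow> q | Suc m \<Rightarrow> p (y m))"


section \<open>Base points in a disc, and the diagonal subgroup\<close>

definition disc_centred_at :: "nat \<Rightarrow> 'a topology \<Rightarrow> 'a set \<Rightarrow> 'a \<Rightarrow> bool" where
  "disc_centred_at k X D x0 \<longleftrightarrow> openin X D \<and>
     (\<exists>h. homeomorphic_map (subtopology (Euclidean_space k) {v. (\<Sum>i<k. (v i)\<^sup>2) < 1})
            (subtopology X D) h \<and> h (\<lambda>_. 0) = x0)"

text \<open>\<open>x\<close> is a configuration inside a disc \<open>D\<close> centred at \<open>x0\<close>, and \<open>\<gamma> i\<close> is a path in \<open>D\<close> from
  \<open>x i\<close> to \<open>x0\<close>.\<close>

definition disc_base_point ::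
  "nat \<Rightarrow> nat \<Rightarrow> 'a topology \<Rightarrow> 'a set \<Rightarrow> 'a \<Rightarrow> (nat \<Rightarrow> 'a) \<Rightarrow> (nat \<Rightarrow> real \<Rightarrow> 'a) \<Rightarrow> bool" where
  "disc_base_point k n X D x0 x \<gamma> \<longleftrightarrow>
     disc_centred_at k X D x0 \<and> x \<in> topspace (conf_space n X) \<and>
     (\<forall>i<n. x i \<in> D \<and> pathin (subtopology X D) (\<gamma> i) \<and> \<gamma> i 0 = x i \<and> \<gamma> i 1 = x0)"

text \<open>The identification of \<open>\<pi>\<^sub>j(X\<^sup>n, x)\<close> with \<open>\<pi>\<^sub>j(X, x0)\<^sup>n\<close> along the paths \<open>\<gamma> i\<close>.\<close>

definition power_identification ::
  "nat \<Rightarrow> nat \<Rightarrow> 'a topology \<Rightarrow> (nat \<Rightarrow> 'a) \<Rightarrow> (nat \<Rightarrow> real \<Rightarrow> 'a) \<Rightarrow>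
   ((nat \<Rightarrow> real) \<Rightarrow> nat \<Rightarrow> 'a) set \<Rightarrow> nat \<Rightarrow> ((nat \<Rightarrow> real) \<Rightarrow> 'a) set" where
  "power_identification j n X x \<gamma> A =
     (\<lambda>i\<in>{..<n}. base_transport j X (\<gamma> i) (homotopy_hom j X (x i) (\<lambda>z. z i) A))"

text \<open>The homomorphism induced by the inclusion of \<open>conf_space n X\<close> into \<open>X\<^sup>n\<close>,
  followed by this identification.\<close>

definition conf_inclusion_hom ::
  "nat \<Rightarrow> nat \<Rightarrow> 'a topology \<Rightarrow> (nat \<Rightarrow> 'a) \<Rightarrow> (nat \<Rightarrow> real \<Rightarrow> 'a) \<Rightarrow>
   ((nat \<Rightarrow> real) \<Rightarrow> nat \<Rightarrow> 'a) set \<Rightarrow> nat \<Rightarrow> ((nat \<Rightarrow> real) \<Rightarrow> 'a) set" where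
  "conf_inclusion_hom j n X x \<gamma> A =
     power_identification j n X x \<gamma> (homotopy_hom j (power_space n X) x (\<lambda>z. z) A)"

definition diagonal_group ::
  "nat \<Rightarrow> nat \<Rightarrow> 'a topology \<Rightarrow> 'a \<Rightarrow> (nat \<Rightarrow> ((nat \<Rightarrow> real) \<Rightarrow> 'a) set) monoid" where
  "diagonal_group j n X x0 = (product_group {..<n} (\<lambda>_. homotopy_group j X x0))
     \<lparr>carrier := {\<lambda>i\<in>{..<n}. \<alpha> |\<alpha>. \<alpha> \<in> carrier (homotopy_group j X x0)}\<rparr>"


section \<open>Split short exact sequences\<close>

text \<open>\<open>1 \<rightarrow> A \<rightarrow> B \<rightarrow> C \<rightarrow> 1\<close> with a homomorphic section of \<open>g\<close>. The
  predicate \<open>exact_seq\<close> of HOL-Algebra requires all groups to have elements of the same type,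
  which fails here.\<close>

definition split_short_exact ::
  "('a, 'm) monoid_scheme \<Rightarrow> ('b, 'n) monoid_scheme \<Rightarrow> ('c, 'l) monoid_scheme \<Rightarrow>
   ('a \<Rightarrow> 'b) \<Rightarrow> ('b \<Rightarrow> 'c) \<Rightarrow> bool" where
  "split_short_exact A B C f g \<longleftrightarrow>
     group A \<and> group B \<and> group C \<and> f \<in> mon A B \<and> g \<in> epi B C \<and>
     f ` carrier A = kernel B C g \<and>
     (\<exists>s\<in>hom C B. \<forall>c\<in>carrier C. g (s c) = c)"

end

theory Submission
  imports Defs
begin

text \<open>Homotopies lift along the covering \<open>P\<close> from the sphere to its quotient \<open>X\<close> by a uniform local transport, so a
  map of a cube (of dimension at least 2) into the configuration space of \<open>X\<close> lifts to the space of \<open>n\<close>-tuples of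
  points of the sphere in distinct orbits. Two maps into the sphere that never agree are freely homotopic, because \<open>f\<close>
  is homotopic to the antipode of \<open>g\<close> along great circles and the antipodal map of an odd-dimensional sphere is
  homotopic to the identity by rotations; since \<open>\<pi>\<^sub>1\<close> of the sphere is trivial, this makes the image
  diagonal. Conversely, the rotations of a single point by \<open>n\<close> small angles give a map of the sphere into
  the orbit configurations, which yields a section over the diagonal. The kernel consists of the classes
  whose first coordinate is null homotopic; contracting the first point and carrying the other points along by
  locally supported pushes deforms them into the fibre. The section also shows that the fibre injects.\<close>

section \<open>Cubes as subsets of a function space\<close>

text \<open>Base points shape most of the work. Every group sits at a concrete point, so comparing
  two coordinates of a configuration means comparing maps with different boundary values; the path
  followed by the boundary is therefore carried along in each homotopy, and the effect of changing
  that path is controlled separately. The second sequence prescribes both of its maps, so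
  injectivity, image and kernel are checked on representatives instead of being read off from a long
  exact sequence. This requires lifts that stay put wherever the given homotopy is stationary, since
  otherwise the boundary of the cube would move. The action need not be isometric. All constants
  come from one number \<open>\<epsilon>\<close>: two points of one orbit closer than
  \<open>\<epsilon>\<close> coincide. Companion points are moved by injections supported in balls
  small with respect to \<open>\<epsilon>\<close> and extended equivariantly. The condition 2 \<le>
  j enters twice: the boundary of the cube is then connected, so that lifts of maps constant on the
  boundary are constant there, and the homotopy groups are commutative.\<close>

lemma topology_eq_identity:
  assumes "topspace X = topspace Y" "continuous_map X Y (\<lambda>x. x)" "continuous_map Y X (\<lambda>x. x)"
  shows "X = Y"
proof -
  have "{x \<in> topspace X. x \<in> U} = U" if "openin X U \<or> openin Y U" for U
    using that assms(1) openin_subset by fastforce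
  then show ?thesis
    using assms unfolding topology_eq continuous_map_def by metis
qed

text \<open>Outside \<open>I\<close> all members of the product are \<open>undefined\<close>, hence
  every coordinate is continuous for both topologies. Thanks to this, cubes, powers of spheres and
  configuration spaces become subsets of a function space, and continuity can be proved
  coordinatewise with \<open>continuous_on\<close>.\<close>

lemma product_topology_top_of_set:
  fixes S :: "'i \<Rightarrow> 'b::topological_space set"
  shows "product_topology (\<lambda>i. top_of_set (S i)) I = top_of_set (PiE I S)"
proof -
  have "product_topology (\<lambda>i. euclidean :: 'b topology) I = top_of_set (extensional I)"
  proof (rule topology_eq_identity)
    show "continuous_map (product_topology (\<lambda>i. euclidean :: 'b topology) I) (top_of_set (extensional I)) (\<lambda>x. x)"
    proof -
      have "continuous_map (product_topology (\<lambda>i. euclidean :: 'b topology) I) euclidean (\<lambda>x. x i)" for i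
      proof (cases "i \<in> I")
        case False
        have "continuous_map (product_topology (\<lambda>i. euclidean :: 'b topology) I) euclidean (\<lambda>x. undefined :: 'b)"
          by simp
        then show ?thesis
          by (rule continuous_map_eq) (use False in \<open>auto simp: PiE_def extensional_def\<close>)
      qed (rule continuous_map_product_projection)
      then have "continuous_map (product_topology (\<lambda>i. euclidean :: 'b topology) I)
           (product_topology (\<lambda>i. euclidean :: 'b topology) UNIV) (\<lambda>x. x)"
        by (simp add: continuous_map_componentwise_UNIV)
      then show ?thesis
        by (auto simp: euclidean_product_topology continuous_map_in_subtopology PiE_def)
    qed
    show "continuous_map (top_of_set (extensional I)) (product_topology (\<lambda>i. euclidean :: 'b topology) I) (\<lambda>x. x)"
      by (auto simp: continuous_map_componentwise
          intro: continuous_on_product_then_coordinatewise)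
  qed (auto simp: PiE_def)
  then have "subtopology (product_topology (\<lambda>i. euclidean :: 'b topology) I) (PiE I S) = top_of_set (PiE I S)"
    by (simp add: subtopology_subtopology PiE_def Int_absorb1 Int_commute inf.absorb2)
  then show ?thesis
    by (simp add: subtopology_product_topology)
qed

definition Cube :: "nat \<Rightarrow> (nat \<Rightarrow> real) set" where
  "Cube j = PiE {..<j} (\<lambda>_. {0..1})"

lemma cube_eq: "cube j = top_of_set (Cube j)"
  unfolding cube_def Cube_def by (rule product_topology_top_of_set)

lemma topspace_cube [simp]: "topspace (cube j) = Cube j"
  by (simp add: cube_eq)

lemma compact_Cube: "compact (Cube j)"
proof -
  have "compact_space (top_of_set {0..1::real})"
    by (simp add: compact_space_subtopology)
  then have "compact_space (cube j)"
    unfolding cube_def by (metis compact_space_product_topology)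
  then show ?thesis
    using compactin_subspace[of euclidean "Cube j"] by (simp add: cube_eq)
qed

lemma cube_boundary_iff: "t \<in> cube_boundary j \<longleftrightarrow> t \<in> Cube j \<and> (\<exists>i<j. t i = 0 \<or> t i = 1)"
  by (simp add: cube_boundary_def)

lemma Cube_iff: "t \<in> Cube j \<longleftrightarrow> (\<forall>i<j. 0 \<le> t i \<and> t i \<le> 1) \<and> (\<forall>i\<ge>j. t i = undefined)"
  by (auto simp: Cube_def PiE_def extensional_def Pi_iff)

lemma Cube_upd: "t \<in> Cube j \<Longrightarrow> i < j \<Longrightarrow> 0 \<le> u \<Longrightarrow> u \<le> 1 \<Longrightarrow> t(i := u) \<in> Cube j"
  by (auto simp: Cube_iff)

lemma boundary_upd_other:
  "t \<in> cube_boundary j \<Longrightarrow> i < j \<Longrightarrow> t i \<noteq> 0 \<Longrightarrow> t i \<noteq> 1 \<Longrightarrow> 0 \<le> u \<Longrightarrow> u \<le> 1 \<Longrightarrow> t(i := u) \<in> cube_boundary j"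
  by (auto simp: cube_boundary_iff Cube_iff)

lemma boundary_upd_end: "t \<in> Cube j \<Longrightarrow> i < j \<Longrightarrow> u = 0 \<or> u = 1 \<Longrightarrow> t(i := u) \<in> cube_boundary j"
  by (auto simp: cube_boundary_iff Cube_iff)

lemma boundary_subset: "t \<in> cube_boundary j \<Longrightarrow> t \<in> Cube j"
  by (simp add: cube_boundary_iff)

definition corner :: "nat \<Rightarrow> nat \<Rightarrow> real" where
  "corner j = (\<lambda>i. if i < j then 0 else undefined)"

lemma corner_boundary: "1 \<le> j \<Longrightarrow> corner j \<in> cube_boundary j"
  by (auto simp: cube_boundary_iff Cube_iff corner_def intro!: exI[of _ 0])

lemma corner_Cube: "corner j \<in> Cube j"
  by (auto simp: Cube_iff corner_def)

lemma continuous_on_coord [continuous_intros]: "continuous_on S (\<lambda>t. t i)"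
  using continuous_on_product_then_coordinatewise[OF continuous_on_id] .

lemma continuous_on_snd_coord [continuous_intros]: "continuous_on S (\<lambda>p. snd p i)"
  using continuous_on_product_then_coordinatewise[OF continuous_on_snd[OF continuous_on_id]] .

lemma continuous_on_fun_upd:
  fixes f :: "'a::topological_space \<Rightarrow> 'i \<Rightarrow> 'b::topological_space"
  assumes "continuous_on S f" "continuous_on S g"
  shows "continuous_on S (\<lambda>x. (f x)(i := g x))"
proof (rule continuous_on_coordinatewise_then_product)
  show "continuous_on S (\<lambda>x. ((f x)(i := g x)) k)" for k
    using assms by (cases "k = i") (auto intro: continuous_on_product_then_coordinatewise)
qed

lemma continuous_map_compose_on:
  assumes "continuous_map (top_of_set L) X f" "continuous_on K \<rho>" "\<And>z. z \<in> K \<Longrightarrow> \<rho> z \<in> L"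
  shows "continuous_map (top_of_set K) X (\<lambda>z. f (\<rho> z))"
proof -
  have "continuous_map (top_of_set K) (top_of_set L) \<rho>"
    using assms by (auto simp: continuous_map_in_subtopology)
  from continuous_map_compose[OF this assms(1)] show ?thesis
    by (simp add: o_def)
qed

lemma continuous_map_paste_le:
  assumes p: "continuous_on K p"
    and f: "continuous_map (top_of_set {z \<in> K. p z \<le> c}) X f"
    and g: "continuous_map (top_of_set {z \<in> K. c \<le> p z}) X g"
    and eq: "\<And>z. z \<in> K \<Longrightarrow> p z = c \<Longrightarrow> f z = g z"
  shows "continuous_map (top_of_set K) X (\<lambda>z. if p z \<le> (c::real) then f z else g z)"
proof (rule continuous_map_cases_le)
  have "K \<inter> {z \<in> K. p z \<le> c} = {z \<in> K. p z \<le> c}" "K \<inter> {z \<in> K. c \<le> p z} = {z \<in> K. c \<le> p z}"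
    by auto
  then show "continuous_map (subtopology (top_of_set K) {x \<in> topspace (top_of_set K). p x \<le> c}) X f"
    "continuous_map (subtopology (top_of_set K) {x \<in> topspace (top_of_set K). c \<le> p x}) X g"
    using f g by (simp_all add: subtopology_subtopology)
qed (use p eq in auto)

section \<open>Homotopies of cube maps that move the boundary along a path\<close>

text \<open>One relation with three uses: for a constant path it is homotopy relative to the
  boundary, for a given path it is the relation behind \<open>base_transport\<close>, and with the
  path quantified existentially it is free homotopy.\<close>

definition fhom :: "nat \<Rightarrow> 'a topology \<Rightarrow> (real \<Rightarrow> 'a) \<Rightarrow> ((nat \<Rightarrow> real) \<Rightarrow> 'a) \<Rightarrow> ((nat \<Rightarrow> real) \<Rightarrow> 'a) \<Rightarrow> bool" where
  "fhom j X \<gamma> f g \<longleftrightarrow> (\<exists>H. continuous_map (top_of_set ({0..1} \<times> Cube j)) X H \<and>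
     (\<forall>t\<in>Cube j. H (0, t) = f t \<and> H (1, t) = g t) \<and>
     (\<forall>s\<in>{0..1}. \<forall>t\<in>cube_boundary j. H (s, t) = \<gamma> s))"

lemma fhomI:
  assumes "continuous_map (top_of_set ({0..1} \<times> Cube j)) X H"
    "\<And>t. t \<in> Cube j \<Longrightarrow> H (0, t) = f t" "\<And>t. t \<in> Cube j \<Longrightarrow> H (1, t) = g t"
    "\<And>s t. s \<in> {0..1} \<Longrightarrow> t \<in> cube_boundary j \<Longrightarrow> H (s, t) = \<gamma> s"
  shows "fhom j X \<gamma> f g"
  using assms unfolding fhom_def by blast

lemma fhomE:
  assumes "fhom j X \<gamma> f g"
  obtains H where "continuous_map (top_of_set ({0..1} \<times> Cube j)) X H"
    "\<And>t. t \<in> Cube j \<Longrightarrow> H (0, t) = f t" "\<And>t. t \<in> Cube j \<Longrightarrow> H (1, t) = g t"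
    "\<And>s t. s \<in> {0..1} \<Longrightarrow> t \<in> cube_boundary j \<Longrightarrow> H (s, t) = \<gamma> s"
  using assms unfolding fhom_def by blast

lemma base_transport_eq: "base_transport j X \<gamma> A = {g. \<exists>f\<in>A. fhom j X \<gamma> f g}"
  by (simp add: base_transport_def fhom_def cube_eq)

lemma cube_loops_iff:
  "f \<in> cube_loops j X x \<longleftrightarrow> continuous_map (top_of_set (Cube j)) X f \<and> (\<forall>t\<in>cube_boundary j. f t = x)"
  by (simp add: cube_loops_def cube_eq)

lemma cube_class_eq: 
  assumes "f \<in> cube_loops j X x"
  shows "cube_class j X x f = {g. fhom j X (\<lambda>_. x) f g}"
proof -
  have "homotopic_with (\<lambda>h. \<forall>t\<in>cube_boundary j. h t = x) (cube j) X f g \<longleftrightarrow> fhom j X (\<lambda>_. x) f g" for g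
    by (subst homotopic_with) (auto simp: fhom_def cube_eq cube_boundary_iff)
  then show ?thesis
    by (simp add: cube_class_def)
qed

lemma fhom_cong:
  assumes "fhom j X \<gamma> f g" "\<And>t. t \<in> Cube j \<Longrightarrow> f t = f' t" "\<And>t. t \<in> Cube j \<Longrightarrow> g t = g' t"
    "\<And>s. s \<in> {0..1} \<Longrightarrow> \<gamma> s = \<gamma>' s"
  shows "fhom j X \<gamma>' f' g'"
  using assms unfolding fhom_def by auto

lemma fhom_loops:
  assumes "fhom j X \<gamma> f g"
  shows "f \<in> cube_loops j X (\<gamma> 0)" "g \<in> cube_loops j X (\<gamma> 1)"
proof -
  obtain H where H: "continuous_map (top_of_set ({0..1} \<times> Cube j)) X H"
    "\<And>t. t \<in> Cube j \<Longrightarrow> H (0, t) = f t" "\<And>t. t \<in> Cube j \<Longrightarrow> H (1, t) = g t"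
    "\<And>s t. s \<in> {0..1} \<Longrightarrow> t \<in> cube_boundary j \<Longrightarrow> H (s, t) = \<gamma> s"
    using assms by (rule fhomE) blast
  have c: "continuous_map (top_of_set (Cube j)) X (\<lambda>t. H (u, t))" if "u \<in> {0..1}" for u
    using that by (intro continuous_map_compose_on[OF H(1)] continuous_intros) auto
  show "f \<in> cube_loops j X (\<gamma> 0)"
    unfolding cube_loops_iff
    using continuous_map_eq[OF c[of 0], of f] H(2) H(4)[of 0] boundary_subset by force
  show "g \<in> cube_loops j X (\<gamma> 1)"
    unfolding cube_loops_iff
    using continuous_map_eq[OF c[of 1], of g] H(3) H(4)[of 1] boundary_subset by force
qed

lemma fhom_refl: "f \<in> cube_loops j X x \<Longrightarrow> fhom j X (\<lambda>_. x) f f"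
  by (rule fhomI[where H = "\<lambda>p. f (snd p)"], rule continuous_map_compose_on[where L = "Cube j"])
    (auto simp: cube_loops_iff continuous_on_snd)

lemma fhom_const_path:
  assumes "pathin X \<gamma>" "x = \<gamma> 0" "y = \<gamma> 1"
  shows "fhom j X \<gamma> (\<lambda>_. x) (\<lambda>_. y)"
  by (rule fhomI[where H = "\<lambda>p. \<gamma> (fst p)"], rule continuous_map_compose_on[where L = "{0..1}"])
    (use assms in \<open>auto simp: pathin_def continuous_on_fst\<close>)

definition path_join :: "(real \<Rightarrow> 'a) \<Rightarrow> (real \<Rightarrow> 'a) \<Rightarrow> real \<Rightarrow> 'a" where
  "path_join \<gamma> \<delta> = (\<lambda>s. if s \<le> 1/2 then \<gamma> (2 * s) else \<delta> (2 * s - 1))"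

definition path_rev :: "(real \<Rightarrow> 'a) \<Rightarrow> real \<Rightarrow> 'a" where
  "path_rev \<gamma> = (\<lambda>s. \<gamma> (1 - s))"

lemma path_join_const [simp]: "path_join (\<lambda>_. x) (\<lambda>_. x) = (\<lambda>_. x)"
  and path_rev_const [simp]: "path_rev (\<lambda>_. x) = (\<lambda>_. x)"
  and path_join_ends [simp]: "path_join \<gamma> \<delta> 0 = \<gamma> 0" "path_join \<gamma> \<delta> 1 = \<delta> 1"
  and path_rev_ends [simp]: "path_rev \<gamma> 0 = \<gamma> 1" "path_rev \<gamma> 1 = \<gamma> 0"
  by (auto simp: path_join_def path_rev_def)

lemma pathin_join:
  assumes "pathin X \<gamma>" "pathin X \<delta>" "\<gamma> 1 = \<delta> 0"
  shows "pathin X (path_join \<gamma> \<delta>)"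
  unfolding pathin_def path_join_def
  by (intro continuous_map_paste_le continuous_map_compose_on[OF assms(1)[unfolded pathin_def]]
      continuous_map_compose_on[OF assms(2)[unfolded pathin_def]] continuous_intros)
    (simp_all add: assms(3) field_simps)

lemma pathin_rev:
  assumes "pathin X \<gamma>"
  shows "pathin X (path_rev \<gamma>)"
  unfolding pathin_def path_rev_def
  by (intro continuous_map_compose_on[OF assms[unfolded pathin_def]] continuous_intros) auto

lemma fhom_trans:
  assumes "fhom j X \<gamma> f g" "fhom j X \<delta> g h" 
  shows "fhom j X (path_join \<gamma> \<delta>) f h"
proof -
  obtain H where H: "continuous_map (top_of_set ({0..1} \<times> Cube j)) X H"
    "\<And>t. t \<in> Cube j \<Longrightarrow> H (0, t) = f t" "\<And>t. t \<in> Cube j \<Longrightarrow> H (1, t) = g t"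
    "\<And>s t. s \<in> {0..1} \<Longrightarrow> t \<in> cube_boundary j \<Longrightarrow> H (s, t) = \<gamma> s"
    using assms(1) by (rule fhomE) blast
  obtain K where K: "continuous_map (top_of_set ({0..1} \<times> Cube j)) X K"
    "\<And>t. t \<in> Cube j \<Longrightarrow> K (0, t) = g t" "\<And>t. t \<in> Cube j \<Longrightarrow> K (1, t) = h t"
    "\<And>s t. s \<in> {0..1} \<Longrightarrow> t \<in> cube_boundary j \<Longrightarrow> K (s, t) = \<delta> s"
    using assms(2) by (rule fhomE) blast
  show ?thesis
  proof (rule fhomI)
    show "continuous_map (top_of_set ({0..1} \<times> Cube j)) X
      (\<lambda>p. if fst p \<le> 1/2 then H (2 * fst p, snd p) else K (2 * fst p - 1, snd p))"
      by (intro continuous_map_paste_le continuous_map_compose_on[OF H(1)]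
          continuous_map_compose_on[OF K(1)] continuous_intros) (auto simp: H K field_simps)
  qed (auto simp: H K path_join_def)
qed

lemma fhom_trans_const:
  "fhom j X (\<lambda>_. x) f g \<Longrightarrow> fhom j X (\<lambda>_. x) g h \<Longrightarrow> fhom j X (\<lambda>_. x) f h"
  using fhom_trans by fastforce

lemma fhom_rev:
  assumes "fhom j X \<gamma> f g"
  shows "fhom j X (path_rev \<gamma>) g f"
proof -
  obtain H where H: "continuous_map (top_of_set ({0..1} \<times> Cube j)) X H"
    "\<And>t. t \<in> Cube j \<Longrightarrow> H (0, t) = f t" "\<And>t. t \<in> Cube j \<Longrightarrow> H (1, t) = g t"
    "\<And>s t. s \<in> {0..1} \<Longrightarrow> t \<in> cube_boundary j \<Longrightarrow> H (s, t) = \<gamma> s"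
    using assms(1) by (rule fhomE) blast
  show ?thesis
  proof (rule fhomI)
    show "continuous_map (top_of_set ({0..1} \<times> Cube j)) X (\<lambda>p. H (1 - fst p, snd p))"
      by (intro continuous_map_compose_on[OF H(1)] continuous_intros) auto
  qed (auto simp: H path_rev_def)
qed

lemma fhom_sym_const: "fhom j X (\<lambda>_. x) f g \<Longrightarrow> fhom j X (\<lambda>_. x) g f"
  using fhom_rev by fastforce

lemma fhom_map:
  assumes "continuous_map X Y \<phi>" "fhom j X \<gamma> f g"
  shows "fhom j Y (\<lambda>s. \<phi> (\<gamma> s)) (\<lambda>t. \<phi> (f t)) (\<lambda>t. \<phi> (g t))"
proof -
  obtain H where H: "continuous_map (top_of_set ({0..1} \<times> Cube j)) X H"
    "\<And>t. t \<in> Cube j \<Longrightarrow> H (0, t) = f t" "\<And>t. t \<in> Cube j \<Longrightarrow> H (1, t) = g t"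
    "\<And>s t. s \<in> {0..1} \<Longrightarrow> t \<in> cube_boundary j \<Longrightarrow> H (s, t) = \<gamma> s"
    using assms(2) by (rule fhomE) blast
  show ?thesis
  proof (rule fhomI)
    show "continuous_map (top_of_set ({0..1} \<times> Cube j)) Y (\<lambda>p. \<phi> (H p))"
      using continuous_map_compose[OF H(1) assms(1)] by (simp add: o_def)
  qed (auto simp: H)
qed

lemma cube_loops_map:
  assumes "continuous_map X Y \<phi>" "f \<in> cube_loops j X x"
  shows "(\<lambda>t. \<phi> (f t)) \<in> cube_loops j Y (\<phi> x)"
  using fhom_loops(1)[OF fhom_map[OF assms(1) fhom_refl[OF assms(2)]]] by simp

lemma cube_loops_const: "x \<in> topspace X \<Longrightarrow> (\<lambda>_. x) \<in> cube_loops j X x"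
  by (simp add: cube_loops_iff)

lemma cube_loops_base:
  assumes "f \<in> cube_loops j X x" "1 \<le> j"
  shows "x \<in> topspace X"
proof -
  have "f (corner j) = x" "f (corner j) \<in> topspace X"
    using assms corner_boundary[of j] continuous_map_funspace[of "top_of_set (Cube j)" X f] corner_Cube[of j]
    by (auto simp: cube_loops_iff Pi_iff)
  then show ?thesis by simp
qed

text \<open>The cube is convex, so two reparametrisations are joined by segments. The last
  assumption says that both send a boundary point into one common face; as faces are convex, the
  segment stays in the boundary, where \<open>f\<close> equals \<open>x\<close>.\<close>

lemma fhom_line:
  assumes f: "f \<in> cube_loops j X x"
    and c: "continuous_on (Cube j) \<rho>" "continuous_on (Cube j) \<rho>'"
    and r: "\<And>t. t \<in> Cube j \<Longrightarrow> \<rho> t \<in> Cube j" "\<And>t. t \<in> Cube j \<Longrightarrow> \<rho>' t \<in> Cube j"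
    and b: "\<And>t. t \<in> cube_boundary j \<Longrightarrow> \<exists>i<j. \<exists>e. (e = 0 \<or> e = 1) \<and> \<rho> t i = e \<and> \<rho>' t i = e"
  shows "fhom j X (\<lambda>_. x) (\<lambda>t. f (\<rho> t)) (\<lambda>t. f (\<rho>' t))"
proof -
  define R where "R = (\<lambda>p::real \<times> (nat \<Rightarrow> real). \<lambda>i. (1 - fst p) * \<rho> (snd p) i + fst p * \<rho>' (snd p) i)"
  have R: "R (s, t) \<in> Cube j" if "s \<in> {0..1}" "t \<in> Cube j" for s t
  proof -
    have "(1 - s) * \<rho> t i + s * \<rho>' t i \<le> 1" if "i < j" for i
      using r[OF \<open>t \<in> Cube j\<close>] that \<open>s \<in> {0..1}\<close>
      by (intro convex_bound_le) (auto simp: Cube_iff)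
    \<comment> \<open>Beyond dimension \<open>j\<close> both maps take the value
      \<open>undefined\<close>, and a convex combination of equal numbers returns it, so
      extensionality survives.\<close>
    moreover have "(1 - s) * undefined + s * undefined = (undefined::real)"
      by (simp add: algebra_simps)
    ultimately show ?thesis
      using r[OF that(2)] that(1) by (auto simp: R_def Cube_iff)
  qed
  have co: "continuous_on ({0..1::real} \<times> Cube j) (\<lambda>p. \<rho> (snd p) i)" "continuous_on ({0..1::real} \<times> Cube j) (\<lambda>p. \<rho>' (snd p) i)" for i
    by (rule continuous_on_product_then_coordinatewise, rule continuous_on_compose2[OF c(1)], auto simp: continuous_on_snd,
      rule continuous_on_product_then_coordinatewise, rule continuous_on_compose2[OF c(2)], auto simp: continuous_on_snd)
  show ?thesis
  proof (rule fhomI)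
    show "continuous_map (top_of_set ({0..1} \<times> Cube j)) X (\<lambda>p. f (R p))"
    proof (rule continuous_map_compose_on[of "Cube j" X f])
      show "continuous_map (top_of_set (Cube j)) X f"
        using f by (simp add: cube_loops_iff)
      show "continuous_on ({0..1} \<times> Cube j) R"
        unfolding R_def by (intro continuous_intros co)
    qed (use R in auto)
    fix s :: real and t assume st: "s \<in> {0..1}" "t \<in> cube_boundary j"
    obtain i e where "i < j" "e = 0 \<or> e = 1" "\<rho> t i = e" "\<rho>' t i = e"
      using b[OF st(2)] by blast
    then have "R (s, t) i = e"
      by (simp add: R_def algebra_simps)
    then have "R (s, t) \<in> cube_boundary j"
      using R[of s t] st \<open>i < j\<close> \<open>e = 0 \<or> e = 1\<close> by (auto simp: cube_boundary_iff)
    then show "f (R (s, t)) = x"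
      using f by (simp add: cube_loops_iff)
  qed (simp_all add: R_def)
qed

subsection \<open>Concatenation\<close>

text \<open>The group law uses coordinate 0; the other coordinates are provided for the interchange
  argument behind commutativity.\<close>

definition concat_at :: "nat \<Rightarrow> ((nat \<Rightarrow> real) \<Rightarrow> 'a) \<Rightarrow> ((nat \<Rightarrow> real) \<Rightarrow> 'a) \<Rightarrow> (nat \<Rightarrow> real) \<Rightarrow> 'a" where
  "concat_at i f g = (\<lambda>t. if t i \<le> 1/2 then f (t(i := 2 * t i)) else g (t(i := 2 * t i - 1)))"

lemma cube_concat_eq: "cube_concat = concat_at 0"
  by (simp add: fun_eq_iff cube_concat_def concat_at_def)

text \<open>The boundary may move along \<open>\<gamma>\<close> as long as both homotopies move it
  alike. The moving case is what makes \<open>base_transport\<close> multiplicative.\<close>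

lemma fhom_concat:
  assumes i: "i < j" and "fhom j X \<gamma> f g" "fhom j X \<gamma> f' g'"
  shows "fhom j X \<gamma> (concat_at i f f') (concat_at i g g')"
proof -
  obtain H where H: "continuous_map (top_of_set ({0..1} \<times> Cube j)) X H"
    "\<And>t. t \<in> Cube j \<Longrightarrow> H (0, t) = f t" "\<And>t. t \<in> Cube j \<Longrightarrow> H (1, t) = g t"
    "\<And>s t. s \<in> {0..1} \<Longrightarrow> t \<in> cube_boundary j \<Longrightarrow> H (s, t) = \<gamma> s"
    using assms(2) by (rule fhomE) blast
  obtain K where K: "continuous_map (top_of_set ({0..1} \<times> Cube j)) X K"
    "\<And>t. t \<in> Cube j \<Longrightarrow> K (0, t) = f' t" "\<And>t. t \<in> Cube j \<Longrightarrow> K (1, t) = g' t"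
    "\<And>s t. s \<in> {0..1} \<Longrightarrow> t \<in> cube_boundary j \<Longrightarrow> K (s, t) = \<gamma> s"
    using assms(3) by (rule fhomE) blast
  show ?thesis
  proof (rule fhomI)
    have t0: "0 \<le> t i" "t i \<le> 1" if "t \<in> Cube j" for t
      using that i by (auto simp: Cube_iff)
    have u: "t \<in> Cube j \<Longrightarrow> t i \<le> 1/2 \<Longrightarrow> t(i := 2 * t i) \<in> Cube j"
      "t \<in> Cube j \<Longrightarrow> 1/2 \<le> t i \<Longrightarrow> t(i := 2 * t i - 1) \<in> Cube j" for t
      using t0[of t] i by (simp_all add: Cube_upd)
    \<comment> \<open>On the seam the two arguments lie on opposite faces of the cube, and there
      both homotopies equal \<open>\<gamma> s\<close>.\<close>
    have e: "H (s, t(i := 2 * t i)) = K (s, t(i := 2 * t i - 1))" if "s \<in> {0..1}" "t \<in> Cube j" "t i = 1/2" for s t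
      using H(4)[OF that(1) boundary_upd_end[OF that(2) i, of 1]] K(4)[OF that(1) boundary_upd_end[OF that(2) i, of 0]] that(3)
      by (simp add: that(3))
    show "continuous_map (top_of_set ({0..1} \<times> Cube j)) X
      (\<lambda>p. if snd p i \<le> 1/2 then H (fst p, (snd p)(i := 2 * snd p i)) else K (fst p, (snd p)(i := 2 * snd p i - 1)))"
    proof (intro continuous_map_paste_le)
      show "continuous_map (top_of_set {z \<in> {0..1} \<times> Cube j. snd z i \<le> 1/2}) X (\<lambda>p. H (fst p, (snd p)(i := 2 * snd p i)))"
        by (intro continuous_map_compose_on[OF H(1)] continuous_on_Pair continuous_on_fun_upd continuous_intros) (use u in auto)
      show "continuous_map (top_of_set {z \<in> {0..1} \<times> Cube j. 1/2 \<le> snd z i}) X (\<lambda>p. K (fst p, (snd p)(i := 2 * snd p i - 1)))"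
        by (intro continuous_map_compose_on[OF K(1)] continuous_on_Pair continuous_on_fun_upd continuous_intros) (use u in auto)
    qed (use e in \<open>auto intro: continuous_intros\<close>)
    fix s :: real and t assume st: "s \<in> {0..1}" "t \<in> cube_boundary j"
    then have t: "t \<in> Cube j" "0 \<le> t i" "t i \<le> 1"
      using i by (auto simp: cube_boundary_iff Cube_iff)
    have "t(i := 2 * t i) \<in> cube_boundary j" if "t i \<le> 1/2"
      using that t st i boundary_upd_other[of t j i "2 * t i"] boundary_upd_end[of t j i "2 * t i"] by (cases "t i = 0") auto
    moreover have "t(i := 2 * t i - 1) \<in> cube_boundary j" if "\<not> t i \<le> 1/2"
      using that t st i boundary_upd_other[of t j i "2 * t i - 1"] boundary_upd_end[of t j i "2 * t i - 1"] by (cases "t i = 1") auto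
    ultimately show "(if snd (s, t) i \<le> 1/2 then H (fst (s, t), (snd (s, t))(i := 2 * snd (s, t) i))
       else K (fst (s, t), (snd (s, t))(i := 2 * snd (s, t) i - 1))) = \<gamma> s"
      using st H K by auto
  next
    fix t assume t: "t \<in> Cube j"
    then have *: "0 \<le> t i" "t i \<le> 1" using i by (auto simp: Cube_iff)
    have "t i \<le> 1/2 \<Longrightarrow> t(i := 2 * t i) \<in> Cube j" "\<not> t i \<le> 1/2 \<Longrightarrow> t(i := 2 * t i - 1) \<in> Cube j"
      using t i * by (auto intro: Cube_upd)
    then show
     "(if snd (0, t) i \<le> 1/2 then H (fst (0, t), (snd (0, t))(i := 2 * snd (0, t) i))
       else K (fst (0, t), (snd (0, t))(i := 2 * snd (0, t) i - 1))) = concat_at i f f' t"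
     "(if snd (1, t) i \<le> 1/2 then H (fst (1, t), (snd (1, t))(i := 2 * snd (1, t) i))
       else K (fst (1, t), (snd (1, t))(i := 2 * snd (1, t) i - 1))) = concat_at i g g' t"
      using H K by (auto simp: concat_at_def)
  qed
qed

lemma concat_loops:
  assumes "i < j" "f \<in> cube_loops j X x" "g \<in> cube_loops j X x"
  shows "concat_at i f g \<in> cube_loops j X x"
  using fhom_loops(1)[OF fhom_concat[OF assms(1) fhom_refl[OF assms(2)] fhom_refl[OF assms(3)]]] by simp

text \<open>Common source of the unit laws and of associativity: each of them compares a loop with
  its composite with a piecewise linear self-map of the interval that fixes both ends.\<close>

lemma fhom_reparam:
  assumes f: "f \<in> cube_loops j X x" and i: "i < j"
    and a: "continuous_on {0..1} a" "\<And>u. u \<in> {0..1} \<Longrightarrow> a u \<in> {0..1}" "a 0 = 0" "a 1 = 1"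
  shows "fhom j X (\<lambda>_. x) (\<lambda>t. f (t(i := a (t i)))) f"
proof (rule fhom_line[OF f, where \<rho> = "\<lambda>t. t(i := a (t i))" and \<rho>' = "\<lambda>t. t"])
  show "continuous_on (Cube j) (\<lambda>t. t(i := a (t i)))"
    using i by (intro continuous_on_fun_upd continuous_on_compose2[OF a(1)] continuous_intros) (auto simp: Cube_iff)
  show "t(i := a (t i)) \<in> Cube j" if "t \<in> Cube j" for t
    using i a(2)[of "t i"] that by (auto simp: Cube_iff)
  show "\<exists>k<j. \<exists>e. (e = 0 \<or> e = 1) \<and> (t(i := a (t i))) k = e \<and> t k = e" if "t \<in> cube_boundary j" for t
    using that a unfolding cube_boundary_iff fun_upd_apply by (metis (full_types))
qed auto

lemma concat_const_right:
  assumes f: "f \<in> cube_loops j X x" and i: "i < j"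
  shows "fhom j X (\<lambda>_. x) (concat_at i f (\<lambda>_. x)) f"
proof (rule fhom_cong[OF fhom_reparam[OF f i, where a = "\<lambda>u. min 1 (2 * u)"]])
  fix t assume t: "t \<in> Cube j"
  have "f (t(i := 1)) = x"
    using f boundary_upd_end[OF t i, of 1] by (auto simp: cube_loops_iff)
  moreover have "min 1 (2 * t i) = 2 * t i" if "t i \<le> 1/2"
    using that by simp
  moreover have "min 1 (2 * t i) = 1" if "\<not> t i \<le> 1/2"
    using that by simp
  ultimately show "f (t(i := min 1 (2 * t i))) = concat_at i f (\<lambda>_. x) t"
    by (simp add: concat_at_def)
qed (auto, (intro continuous_intros)?)

lemma concat_const_left:
  assumes f: "f \<in> cube_loops j X x" and i: "i < j"
  shows "fhom j X (\<lambda>_. x) (concat_at i (\<lambda>_. x) f) f"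
proof (rule fhom_cong[OF fhom_reparam[OF f i, where a = "\<lambda>u. max 0 (2 * u - 1)"]])
  fix t assume t: "t \<in> Cube j"
  have "f (t(i := 0)) = x"
    using f boundary_upd_end[OF t i, of 0] by (auto simp: cube_loops_iff)
  then show "f (t(i := max 0 (2 * t i - 1))) = concat_at i (\<lambda>_. x) f t"
    by (cases "t i = 1/2") (simp add: concat_at_def, auto simp: concat_at_def max_def)
qed (auto, (intro continuous_intros)?)

lemma concat_assoc:
  assumes "f \<in> cube_loops j X x" "g \<in> cube_loops j X x" "h \<in> cube_loops j X x" and i: "i < j"
  shows "fhom j X (\<lambda>_. x) (concat_at i (concat_at i f g) h) (concat_at i f (concat_at i g h))"
\<comment> \<open>The concave piecewise linear map with slopes 2, 1, 1/2 takes [0,1/4], [1/4,1/2],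
  [1/2,1] onto [0,1/2], [1/2,3/4], [3/4,1], which are the pieces of the two bracketings.\<close>
proof (rule fhom_cong[OF fhom_reparam[OF _ i, where a = "\<lambda>u. min (2 * u) (min (u + 1/4) ((u + 1)/2))"]])
  show "concat_at i f (concat_at i g h) \<in> cube_loops j X x"
    using assms by (intro concat_loops)
  fix t assume t: "t \<in> Cube j"
  consider "t i \<le> 1/4" | "1/4 < t i" "t i \<le> 1/2" | "1/2 < t i" by linarith
  then show "concat_at i f (concat_at i g h) (t(i := min (2 * t i) (min (t i + 1/4) ((t i + 1)/2)))) = concat_at i (concat_at i f g) h t"
  proof cases
    case 1
    then have "min (2 * t i) (min (t i + 1/4) ((t i + 1)/2)) = 2 * t i" by (simp add: min_def)
    with 1 show ?thesis by (simp add: concat_at_def)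
  next
    case 2
    then have "min (2 * t i) (min (t i + 1/4) ((t i + 1)/2)) = t i + 1/4" by (simp add: min_def)
    with 2 show ?thesis by (simp add: concat_at_def algebra_simps)
  next
    case 3
    then have "min (2 * t i) (min (t i + 1/4) ((t i + 1)/2)) = (t i + 1)/2" by (simp add: min_def)
    with 3 show ?thesis by (simp add: concat_at_def field_simps)
  qed
next
  show "continuous_on {0..1} (\<lambda>u::real. min (2 * u) (min (u + 1/4) ((u + 1)/2)))"
    by (intro continuous_intros) auto
  show "min (2 * u) (min (u + 1/4) ((u + 1)/2)) \<in> {0..1}" if "u \<in> {0..1}" for u :: real
    using that by (auto simp: min_def)
qed auto

definition reverse_at :: "nat \<Rightarrow> ((nat \<Rightarrow> real) \<Rightarrow> 'a) \<Rightarrow> (nat \<Rightarrow> real) \<Rightarrow> 'a" where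
  "reverse_at i f = (\<lambda>t. f (t(i := 1 - t i)))"

lemma reverse_loops:
  assumes "f \<in> cube_loops j X x" "i < j"
  shows "reverse_at i f \<in> cube_loops j X x"
proof -
  have "continuous_map (top_of_set (Cube j)) X (\<lambda>t. f (t(i := 1 - t i)))"
  proof (rule continuous_map_compose_on[of "Cube j" X f])
    show "continuous_map (top_of_set (Cube j)) X f"
      using assms by (simp add: cube_loops_iff)
    show "continuous_on (Cube j) (\<lambda>t. t(i := 1 - t i))"
      by (intro continuous_on_fun_upd continuous_intros)
  qed (use assms(2) in \<open>auto simp: Cube_iff\<close>)
  moreover have "t(i := 1 - t i) \<in> cube_boundary j" if "t \<in> cube_boundary j" for t
    using that assms(2) by (auto simp: cube_boundary_iff Cube_iff)
  ultimately show ?thesis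
    using assms(1) by (auto simp: cube_loops_iff reverse_at_def)
qed

text \<open>The concatenation is \<open>f\<close> read along the tent function \<open>m\<close> in
  coordinate \<open>i\<close>. Scaling the tent by 1 - s lets it sink to height 0, which pushes
  everything into the face where coordinate \<open>i\<close> vanishes.\<close>

lemma concat_reverse:
  assumes f: "f \<in> cube_loops j X x" and i: "i < j"
  shows "fhom j X (\<lambda>_. x) (concat_at i f (reverse_at i f)) (\<lambda>_. x)"
proof -
  define m where "m = (\<lambda>u::real. min (2 * u) (2 - 2 * u))"
  have m: "0 \<le> m u" "m u \<le> 1" if "0 \<le> u" "u \<le> 1" for u
    using that by (auto simp: m_def)
  have C: "t(i := (1 - s) * m (t i)) \<in> Cube j" if "s \<in> {0..1}" "t \<in> Cube j" for s t
  proof (rule Cube_upd[OF that(2) i])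
    have "0 \<le> t i" "t i \<le> 1" using that i by (auto simp: Cube_iff)
    from m[OF this] show "0 \<le> (1 - s) * m (t i)" "(1 - s) * m (t i) \<le> 1"
      using that(1) mult_le_one[of "1 - s" "m (t i)"] by auto
  qed
  have B: "t(i := (1 - s) * m (t i)) \<in> cube_boundary j" if "s \<in> {0..1}" "t \<in> cube_boundary j" for s t
  proof -
    have "m 0 = 0" "m 1 = 0" by (auto simp: m_def)
    then show ?thesis
      using that C[OF that(1) boundary_subset[OF that(2)]] unfolding cube_boundary_iff fun_upd_apply
      by (metis mult_zero_right)
  qed
  have mc: "continuous_on ({0..1::real} \<times> Cube j) (\<lambda>p. m (snd p i))"
    unfolding m_def by (intro continuous_intros)
  show ?thesis
  proof (rule fhomI)
    show "continuous_map (top_of_set ({0..1} \<times> Cube j)) X (\<lambda>p. f ((snd p)(i := (1 - fst p) * m (snd p i))))"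
    proof (rule continuous_map_compose_on[of "Cube j" X f])
      show "continuous_map (top_of_set (Cube j)) X f"
        using f by (simp add: cube_loops_iff)
      show "continuous_on ({0..1} \<times> Cube j) (\<lambda>p. (snd p)(i := (1 - fst p) * m (snd p i)))"
        by (intro continuous_on_fun_upd continuous_intros mc)
    qed (use C in auto)
    fix t assume t: "t \<in> Cube j"
    have "m (t i) = 2 * t i" if "t i \<le> 1/2"
      using that by (simp add: m_def)
    moreover have "m (t i) = 1 - (2 * t i - 1)" if "\<not> t i \<le> 1/2"
      using that by (simp add: m_def)
    ultimately show "f ((snd (0, t))(i := (1 - fst (0::real, t)) * m (snd (0::real, t) i))) = concat_at i f (reverse_at i f) t"
      by (simp add: concat_at_def reverse_at_def)
    have "t(i := 0) \<in> cube_boundary j"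
      using t i boundary_upd_end by blast
    then show "f ((snd (1, t))(i := (1 - fst (1::real, t)) * m (snd (1::real, t) i))) = x"
      using f by (simp add: cube_loops_iff)
  next
    fix s :: real and t assume "s \<in> {0..1}" "t \<in> cube_boundary j"
    from B[OF this] show "f ((snd (s, t))(i := (1 - fst (s, t)) * m (snd (s, t) i))) = x"
      using f by (simp add: cube_loops_iff)
  qed
qed

text \<open>Eckmann--Hilton: concatenations in two different coordinates satisfy the interchange law.\<close>

lemma concat_commute:
  assumes f: "f \<in> cube_loops j X x" and g: "g \<in> cube_loops j X x" and ij: "i < j" "k < j" "i \<noteq> k"
  shows "fhom j X (\<lambda>_. x) (concat_at i f g) (concat_at i g f)"
proof -
  let ?c = "\<lambda>_::nat \<Rightarrow> real. x"
  have inter: "concat_at i (concat_at k p q) (concat_at k r s) = concat_at k (concat_at i p r) (concat_at i q s)"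
    for p q r s :: "(nat \<Rightarrow> real) \<Rightarrow> 'a"
    using ij(3) by (simp add: concat_at_def fun_eq_iff fun_upd_twist[OF ij(3)])
  have c: "?c \<in> cube_loops j X x"
    using f ij by (intro cube_loops_const cube_loops_base[of f j]) auto
  have f1: "fhom j X (\<lambda>_. x) (concat_at a f ?c) f" and f2: "fhom j X (\<lambda>_. x) (concat_at a ?c f) f"
    and g1: "fhom j X (\<lambda>_. x) (concat_at a g ?c) g" and g2: "fhom j X (\<lambda>_. x) (concat_at a ?c g) g" if "a < j" for a
    using concat_const_right[OF f that] concat_const_left[OF f that] concat_const_right[OF g that] concat_const_left[OF g that] .
  have 1: "fhom j X (\<lambda>_. x) (concat_at i f g) (concat_at k f g)"
    using fhom_trans_const[OF fhom_sym_const[OF fhom_concat[OF ij(1) f1[OF ij(2)] g2[OF ij(2)]]],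
        unfolded inter, OF fhom_concat[OF ij(2) f1[OF ij(1)] g2[OF ij(1)]]] .
  have 2: "fhom j X (\<lambda>_. x) (concat_at i g f) (concat_at k f g)"
    using fhom_trans_const[OF fhom_sym_const[OF fhom_concat[OF ij(1) g2[OF ij(2)] f1[OF ij(2)]]],
        unfolded inter, OF fhom_concat[OF ij(2) f2[OF ij(1)] g1[OF ij(1)]]] .
  show ?thesis
    by (rule fhom_trans_const[OF 1 fhom_sym_const[OF 2]])
qed

subsection \<open>Collars\<close>

text \<open>The distance to the boundary of the unit cube, negative outside of it (and cut off at 1).\<close>

primrec depth :: "nat \<Rightarrow> (nat \<Rightarrow> real) \<Rightarrow> real" where
  "depth 0 u = 1"
| "depth (Suc j) u = min (depth j u) (min (u j) (1 - u j))"

lemma depth_ge: "c \<le> 1 \<Longrightarrow> c \<le> depth j u \<longleftrightarrow> (\<forall>i<j. c \<le> u i \<and> u i \<le> 1 - c)"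
  by (induction j) (auto simp: less_Suc_eq)

lemma depth_le: "i < j \<Longrightarrow> depth j u \<le> u i \<and> depth j u \<le> 1 - u i"
  by (induction j) (auto simp: less_Suc_eq min_le_iff_disj)

lemma depth_attained: "depth j u = 1 \<or> (\<exists>i<j. depth j u = u i \<or> depth j u = 1 - u i)"
proof (induction j)
  case (Suc j)
  have "min a (min b c) = a \<or> min a (min b c) = b \<or> min a (min b c) = c" for a b c :: real
    by (auto simp: min_def)
  from this[of "depth j u" "u j" "1 - u j"] show ?case
    using Suc less_Suc_eq unfolding depth.simps by metis
qed simp

lemma continuous_on_depth:
  assumes "\<And>i. i < j \<Longrightarrow> continuous_on S (\<lambda>p. U p i)"
  shows "continuous_on S (\<lambda>p. depth j (U p))"
  using assms by (induction j) (auto intro!: continuous_on_min continuous_on_diff)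

text \<open>Dilation about the centre of the cube by the factor 1 + b. The image exceeds the unit
  cube by b/2 on every side, and this excess is the room for a collar.\<close>

definition blow :: "nat \<Rightarrow> real \<Rightarrow> (nat \<Rightarrow> real) \<Rightarrow> nat \<Rightarrow> real" where
  "blow j b t = (\<lambda>i. if i < j then (1 + b) * t i - b/2 else undefined)"

lemma blow_Cube: "0 \<le> depth j (blow j b t) \<Longrightarrow> blow j b t \<in> Cube j"
  unfolding Cube_iff using depth_ge[of 0 j "blow j b t"] by (auto simp: blow_def)

lemma blow_boundary:
  assumes "depth j (blow j b t) = 0"
  shows "blow j b t \<in> cube_boundary j"
  using depth_attained[of j "blow j b t"] assms blow_Cube[of j b t]
  by (auto simp: cube_boundary_iff)

lemma depth_blow_ge:
  assumes "t \<in> Cube j" "0 \<le> b"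
  shows "- (b/2) \<le> depth j (blow j b t)"
proof -
  have "- (b/2) \<le> blow j b t i \<and> blow j b t i \<le> 1 + b/2" if "i < j" for i
  proof -
    have "0 \<le> t i" "t i \<le> 1" using assms(1) that by (auto simp: Cube_iff)
    then have "0 \<le> (1 + b) * t i" "(1 + b) * t i \<le> (1 + b) * 1"
      using assms(2) by (auto intro: mult_left_mono simp del: mult_1_right)
    then show ?thesis using that by (simp add: blow_def)
  qed
  then show ?thesis
    using assms(2) by (subst depth_ge) auto
qed

text \<open>Hence minus twice the depth runs from 0 at the inner edge of the collar to exactly
  \<open>b\<close> on the boundary of the cube; this is the collar coordinate handed to
  \<open>W\<close>.\<close>

lemma depth_blow_boundary:
  assumes "t \<in> cube_boundary j" "0 \<le> b"
  shows "depth j (blow j b t) = - (b/2)"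
proof -
  obtain i where i: "i < j" "t i = 0 \<or> t i = 1"
    using assms(1) by (auto simp: cube_boundary_iff)
  then have "depth j (blow j b t) \<le> - (b/2)"
    using depth_le[of i j "blow j b t"] by (auto simp: blow_def)
  then show ?thesis
    using depth_blow_ge[OF boundary_subset[OF assms(1)] assms(2)] by simp
qed

lemma blow_0: "t \<in> Cube j \<Longrightarrow> blow j 0 t = t"
  by (auto simp: blow_def Cube_iff)

text \<open>A homotopy is shrunk to the inner part of the cube, which leaves a collar of width
  \<open>b s\<close> at time \<open>s\<close> that is filled with \<open>W\<close>.\<close>

definition collar :: "nat \<Rightarrow> (real \<Rightarrow> real) \<Rightarrow> (real \<times> (nat \<Rightarrow> real) \<Rightarrow> 'a) \<Rightarrow> (real \<times> real \<Rightarrow> 'a) \<Rightarrow> real \<times> (nat \<Rightarrow> real) \<Rightarrow> 'a" where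
  "collar j b L W = (\<lambda>p. if - depth j (blow j (b (fst p)) (snd p)) \<le> 0
     then L (fst p, blow j (b (fst p)) (snd p))
     else W (fst p, - (2 * depth j (blow j (b (fst p)) (snd p)))))"

text \<open>The two formulas meet where the dilated point has depth 0. Such a point lies on the
  boundary of the cube, where \<open>L\<close> is assumed to agree with
  \<open>W (s, 0)\<close>.\<close>

lemma collar_continuous:
  assumes L: "continuous_map (top_of_set ({0..1} \<times> Cube j)) X L"
    and Lb: "\<And>s t. s \<in> {0..1} \<Longrightarrow> t \<in> cube_boundary j \<Longrightarrow> L (s, t) = W (s, 0)"
    and b: "continuous_on {0..1} b" "\<And>s. s \<in> {0..1} \<Longrightarrow> 0 \<le> b s"
    and W: "continuous_map (top_of_set {p. fst p \<in> {0..1} \<and> 0 \<le> snd p \<and> snd p \<le> b (fst p)}) X W"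
  shows "continuous_map (top_of_set ({0..1} \<times> Cube j)) X (collar j b L W)"
proof -
  have bc: "continuous_on ({0..1} \<times> Cube j) (\<lambda>p. b (fst p))"
    by (rule continuous_on_compose2[OF b(1)]) (auto intro: continuous_intros)
  have uc: "continuous_on ({0..1} \<times> Cube j) (\<lambda>p. blow j (b (fst p)) (snd p) i)" for i
    unfolding blow_def by (cases "i < j") (auto intro!: continuous_intros bc)
  have dc: "continuous_on ({0..1} \<times> Cube j) (\<lambda>p. depth j (blow j (b (fst p)) (snd p)))"
    by (rule continuous_on_depth) (rule uc)
  have blc: "continuous_on ({0..1} \<times> Cube j) (\<lambda>p. (fst p, blow j (b (fst p)) (snd p)))"
    by (intro continuous_on_Pair continuous_on_fst continuous_on_id continuous_on_coordinatewise_then_product uc)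
  show ?thesis
    unfolding collar_def
  proof (rule continuous_map_paste_le)
    show "continuous_on ({0..1} \<times> Cube j) (\<lambda>p. - depth j (blow j (b (fst p)) (snd p)))"
      by (intro continuous_on_minus dc)
    show "continuous_map (top_of_set {z \<in> {0..1} \<times> Cube j. - depth j (blow j (b (fst z)) (snd z)) \<le> 0}) X
       (\<lambda>p. L (fst p, blow j (b (fst p)) (snd p)))"
      by (rule continuous_map_compose_on[OF L], rule continuous_on_subset[OF blc]) (auto intro: blow_Cube)
    show "continuous_map (top_of_set {z \<in> {0..1} \<times> Cube j. 0 \<le> - depth j (blow j (b (fst z)) (snd z))}) X
       (\<lambda>p. W (fst p, - (2 * depth j (blow j (b (fst p)) (snd p)))))"
    proof (rule continuous_map_compose_on[OF W])
      show "continuous_on {z \<in> {0..1} \<times> Cube j. 0 \<le> - depth j (blow j (b (fst z)) (snd z))}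
        (\<lambda>p. (fst p, - (2 * depth j (blow j (b (fst p)) (snd p)))))"
        by (intro continuous_on_Pair continuous_on_fst continuous_on_id continuous_on_minus continuous_on_mult
            continuous_on_const continuous_on_subset[OF dc]) auto
      show "(fst z, - (2 * depth j (blow j (b (fst z)) (snd z)))) \<in> {p. fst p \<in> {0..1} \<and> 0 \<le> snd p \<and> snd p \<le> b (fst p)}"
        if "z \<in> {z \<in> {0..1} \<times> Cube j. 0 \<le> - depth j (blow j (b (fst z)) (snd z))}" for z
        using that b(2)[of "fst z"] depth_blow_ge[of "snd z" j "b (fst z)"] by auto
    qed
  next
    fix z assume z: "z \<in> {0..1} \<times> Cube j" "- depth j (blow j (b (fst z)) (snd z)) = 0"
    then have "blow j (b (fst z)) (snd z) \<in> cube_boundary j"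
      by (intro blow_boundary) simp
    then show "L (fst z, blow j (b (fst z)) (snd z)) = W (fst z, - (2 * depth j (blow j (b (fst z)) (snd z))))"
      using z Lb by auto
  qed
qed

lemma collar_boundary:
  assumes "t \<in> cube_boundary j" "0 \<le> b s" "\<And>t. t \<in> cube_boundary j \<Longrightarrow> L (s, t) = W (s, 0)"
  shows "collar j b L W (s, t) = W (s, b s)"
proof (cases "b s = 0")
  case True
  then show ?thesis
    using depth_blow_boundary[OF assms(1,2)] assms blow_0[OF boundary_subset[OF assms(1)]] by (simp add: collar_def)
next
  case False
  then show ?thesis
    using depth_blow_boundary[OF assms(1,2)] assms(2) by (simp add: collar_def)
qed

lemma collar_0:
  assumes "t \<in> Cube j" "b s = 0"
  shows "collar j b L W (s, t) = L (s, t)"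
  using depth_blow_ge[OF assms(1), of 0] blow_0[OF assms(1)] assms(2) by (simp add: collar_def)

text \<open>A collar whose width grows with time from 0 to 1 is filled with the path travelled so
  far. The end map is itself a collar of width 1 and depends on no time, so \<open>u\<close> is a
  dummy.\<close>

lemma fhom_exists:
  assumes "pathin X \<gamma>" "f \<in> cube_loops j X (\<gamma> 0)"
  shows "fhom j X \<gamma> f (\<lambda>t. collar j (\<lambda>_. 1) (\<lambda>p. f (snd p)) (\<lambda>p. \<gamma> (snd p)) (u, t))"
proof (rule fhomI)
  have fc: "continuous_map (top_of_set (Cube j)) X f" and fb: "\<And>t. t \<in> cube_boundary j \<Longrightarrow> f t = \<gamma> 0"
    using assms(2) by (auto simp: cube_loops_iff)
  show "continuous_map (top_of_set ({0..1} \<times> Cube j)) X (collar j (\<lambda>s. s) (\<lambda>p. f (snd p)) (\<lambda>p. \<gamma> (snd p)))"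
    by (rule collar_continuous, rule continuous_map_compose_on[OF fc])
      (auto simp: fb intro!: continuous_map_compose_on[OF assms(1)[unfolded pathin_def]] continuous_on_snd)
  show "collar j (\<lambda>s. s) (\<lambda>p. f (snd p)) (\<lambda>p. \<gamma> (snd p)) (0, t) = f t" if "t \<in> Cube j" for t
    by (subst collar_0) (use that in auto)
  show "collar j (\<lambda>s. s) (\<lambda>p. f (snd p)) (\<lambda>p. \<gamma> (snd p)) (1, t) =
    collar j (\<lambda>_. 1) (\<lambda>p. f (snd p)) (\<lambda>p. \<gamma> (snd p)) (u, t)" for t
    by (simp add: collar_def)
  show "collar j (\<lambda>s. s) (\<lambda>p. f (snd p)) (\<lambda>p. \<gamma> (snd p)) (s, t) = \<gamma> s"
    if "s \<in> {0..1}" "t \<in> cube_boundary j" for s t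
    by (subst collar_boundary) (use that fb in auto)
qed

text \<open>\<open>W\<close> is a square with bottom \<open>\<omega>\<close>, constant top and two
  equal sides. A collar of constant width 1 filled with \<open>W\<close> replaces the moving
  boundary by the top value, at the price of transporting both end maps along the common side
  \<open>\<eta>\<close>.\<close>

lemma fhom_square:
  assumes "fhom j X \<omega> f f'"
    and W: "continuous_map (top_of_set ({0..1} \<times> {0..1})) X W"
    and W0: "\<And>s. s \<in> {0..1} \<Longrightarrow> W (s, 0) = \<omega> s" and W1: "\<And>s. s \<in> {0..1} \<Longrightarrow> W (s, 1) = c"
    and sides: "\<And>r. r \<in> {0..1} \<Longrightarrow> W (0, r) = \<eta> r \<and> W (1, r) = \<eta> r"
  obtains F F' where "fhom j X \<eta> f F" "fhom j X \<eta> f' F'" "fhom j X (\<lambda>_. c) F F'"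
proof -
  obtain H where H: "continuous_map (top_of_set ({0..1} \<times> Cube j)) X H"
    "\<And>t. t \<in> Cube j \<Longrightarrow> H (0, t) = f t" "\<And>t. t \<in> Cube j \<Longrightarrow> H (1, t) = f' t"
    "\<And>s t. s \<in> {0..1} \<Longrightarrow> t \<in> cube_boundary j \<Longrightarrow> H (s, t) = \<omega> s"
    using assms(1) by (rule fhomE) blast
  let ?C = "\<lambda>f t. collar j (\<lambda>_. 1) (\<lambda>p. f (snd p)) (\<lambda>p. \<eta> (snd p)) (0, t)"
  have \<eta>: "pathin X \<eta>"
    unfolding pathin_def
  proof (rule continuous_map_eq)
    show "continuous_map (top_of_set {0..1}) X (\<lambda>r. W (0, r))"
      by (rule continuous_map_compose_on[OF W]) (auto intro: continuous_intros)
  qed (use sides in auto)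
  have ends: "\<eta> 0 = \<omega> 0" "\<eta> 0 = \<omega> 1"
    using sides[of 0] W0[of 0] W0[of 1] by auto
  have *: "collar j (\<lambda>_. 1) H W (s, t) = ?C g t"
    if "s = 0 \<or> s = 1" "\<And>t. t \<in> Cube j \<Longrightarrow> H (s, t) = g t" "t \<in> Cube j" for s g t
    using that blow_Cube[of j 1 t] sides depth_blow_ge[OF that(3), of 1] by (auto simp: collar_def)
  have "fhom j X (\<lambda>_. c) (?C f) (?C f')"
  proof (rule fhomI)
    show "continuous_map (top_of_set ({0..1} \<times> Cube j)) X (collar j (\<lambda>_. 1) H W)"
    proof (rule collar_continuous[OF H(1)])
      have "{p. fst p \<in> {0..1::real} \<and> 0 \<le> snd p \<and> snd p \<le> (1::real)} = {0..1} \<times> {0..1}"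
        by auto
      then show "continuous_map (top_of_set {p. fst p \<in> {0..1} \<and> 0 \<le> snd p \<and> snd p \<le> 1}) X W"
        using W by simp
    qed (use H W0 in auto)
    show "collar j (\<lambda>_. 1) H W (s, t) = c" if "s \<in> {0..1}" "t \<in> cube_boundary j" for s t
      using collar_boundary[OF that(2), of "\<lambda>_. 1" s H W] that H(4) W0 W1 by auto
  qed (auto simp: * H)
  moreover have "fhom j X \<eta> f (?C f)" "fhom j X \<eta> f' (?C f')"
    using fhom_loops[OF assms(1)] ends by (auto intro!: fhom_exists \<eta>)
  ultimately show thesis
    using that by blast
qed

text \<open>A loop that factors through the interval contracts linearly to \<open>a 0\<close> with
  its ends fixed. In the resulting square the sides are constant, so the two transports of
  \<open>fhom_square\<close> change nothing up to homotopy.\<close>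

lemma fhom_trivial_loop:
  assumes "fhom j X (\<lambda>s. \<gamma> (a s)) f f'" "pathin X \<gamma>"
    and a: "continuous_on {0..1} a" "\<And>s. s \<in> {0..1} \<Longrightarrow> a s \<in> {0..1}" "a 0 = a 1"
  shows "fhom j X (\<lambda>_. \<gamma> (a 0)) f f'"
proof -
  define W where "W = (\<lambda>p. \<gamma> ((1 - snd p) * a (fst p) + snd p * a 0))"
  have W: "continuous_map (top_of_set ({0..1} \<times> {0..1})) X W"
    unfolding W_def
  proof (rule continuous_map_compose_on[OF assms(2)[unfolded pathin_def]])
    have "continuous_on ({0..1} \<times> {0..1}) (\<lambda>p. a (fst p))"
      by (rule continuous_on_compose2[OF a(1)]) (auto intro: continuous_intros)
    then show "continuous_on ({0..1} \<times> {0..1}) (\<lambda>p. (1 - snd p) * a (fst p) + snd p * a 0)"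
      by (intro continuous_intros)
    show "(1 - snd z) * a (fst z) + snd z * a 0 \<in> {0..1}" if "z \<in> {0..1} \<times> {0..1}" for z
      using that a(2)[of "fst z"] a(2)[of 0] by (auto intro!: convex_bound_le)
  qed
  obtain F F' where F: "fhom j X (\<lambda>_. \<gamma> (a 0)) f F" "fhom j X (\<lambda>_. \<gamma> (a 0)) f' F'" "fhom j X (\<lambda>_. \<gamma> (a 0)) F F'"
    by (rule fhom_square[OF assms(1) W, where c = "\<gamma> (a 0)" and \<eta> = "\<lambda>_. \<gamma> (a 0)"])
      (auto simp: W_def a(3) algebra_simps)
  show ?thesis
    using fhom_trans_const[OF fhom_trans_const[OF F(1,3)] fhom_sym_const[OF F(2)]] .
qed

text \<open>Going back along \<open>\<gamma>\<close> and then forth is \<open>\<gamma>\<close>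
  composed with |1 - 2 s|, a loop that factors through the interval.\<close>

lemma fhom_unique:
  assumes "fhom j X \<gamma> f g" "fhom j X \<gamma> f g'" "pathin X \<gamma>"
  shows "fhom j X (\<lambda>_. \<gamma> 1) g g'"
proof -
  define a where "a = (\<lambda>s::real. \<bar>1 - 2 * s\<bar>)"
  have "path_join (path_rev \<gamma>) \<gamma> = (\<lambda>s. \<gamma> (a s))"
    by (auto simp: path_join_def path_rev_def a_def fun_eq_iff abs_if)
  then have "fhom j X (\<lambda>s. \<gamma> (a s)) g g'"
    using fhom_trans[OF fhom_rev[OF assms(1)] assms(2)] by simp
  then have "fhom j X (\<lambda>_. \<gamma> (a 0)) g g'"
    by (rule fhom_trivial_loop[OF _ assms(3)]) (auto simp: a_def intro!: continuous_intros)
  then show ?thesis by (simp add: a_def)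
qed

text \<open>Composing the two homotopies makes the boundary run at double speed and then rest. A
  collar of width min s (1 - s) corrects this, because min 1 (2 s) minus that width equals s; the
  collar vanishes at both end times, so the end maps are kept.\<close>

lemma fhom_adjust_right:
  assumes "fhom j X \<gamma> f g" "fhom j X (\<lambda>_. \<gamma> 1) g g'" "pathin X \<gamma>"
  shows "fhom j X \<gamma> f g'"
proof -
  obtain H where H: "continuous_map (top_of_set ({0..1} \<times> Cube j)) X H"
    "\<And>t. t \<in> Cube j \<Longrightarrow> H (0, t) = f t" "\<And>t. t \<in> Cube j \<Longrightarrow> H (1, t) = g' t"
    "\<And>s t. s \<in> {0..1} \<Longrightarrow> t \<in> cube_boundary j \<Longrightarrow> H (s, t) = path_join \<gamma> (\<lambda>_. \<gamma> 1) s"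
    using fhom_trans[OF assms(1,2)] by (rule fhomE) blast
  define b where "b = (\<lambda>s::real. min s (1 - s))"
  define W where "W = (\<lambda>p::real \<times> real. \<gamma> (min 1 (2 * fst p) - snd p))"
  have H4: "H (s, t) = W (s, 0)" if "s \<in> {0..1}" "t \<in> cube_boundary j" for s t
    using H(4)[OF that] by (auto simp: W_def path_join_def min_def intro!: arg_cong[where f = \<gamma>])
  have W: "continuous_map (top_of_set {p. fst p \<in> {0..1} \<and> 0 \<le> snd p \<and> snd p \<le> b (fst p)}) X W"
    unfolding W_def
    by (rule continuous_map_compose_on[OF assms(3)[unfolded pathin_def]])
      (auto simp: b_def intro!: continuous_intros)
  show ?thesis
  proof (rule fhomI)
    show "continuous_map (top_of_set ({0..1} \<times> Cube j)) X (collar j b H W)"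
      by (rule collar_continuous[OF H(1) H4 _ _ W]) (auto simp: b_def intro!: continuous_intros)
    show "collar j b H W (0, t) = f t" "collar j b H W (1, t) = g' t" if "t \<in> Cube j" for t
      by (subst collar_0; use H that in \<open>simp add: b_def\<close>)+
    show "collar j b H W (s, t) = \<gamma> s" if "s \<in> {0..1}" "t \<in> cube_boundary j" for s t
    proof -
      have "min 1 (2 * s) - b s = s" "0 \<le> b s"
        using that by (auto simp: b_def min_def)
      then show ?thesis
        using collar_boundary[OF that(2), of b s H W] H4 that(1) by (simp add: W_def)
    qed
  qed
qed

lemma fhom_adjust_left:
  assumes "fhom j X (\<lambda>_. \<gamma> 0) f' f" "fhom j X \<gamma> f g" "pathin X \<gamma>"
  shows "fhom j X \<gamma> f' g"
proof -
  have "fhom j X (path_rev \<gamma>) g f'"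
    by (rule fhom_adjust_right[OF fhom_rev[OF assms(2)] _ pathin_rev[OF assms(3)]])
      (use fhom_sym_const[OF assms(1)] in simp)
  from fhom_rev[OF this] show ?thesis
    by (simp add: path_rev_def)
qed

text \<open>The loop \<open>\<omega>\<close> is contracted through loops whose base point may wander
  along the common side. After transport along this side the two maps are homotopic relative to the
  boundary, and uniqueness of transport brings the homotopy back.\<close>

lemma fhom_free_null:
  fixes W :: "real \<times> real \<Rightarrow> 'a"
  assumes "fhom j X \<omega> f f'"
    and W: "continuous_map (top_of_set ({0..1} \<times> {0..1})) X W"
    and W0: "\<And>s. s \<in> {0..1} \<Longrightarrow> W (s, 0) = \<omega> s" and W1: "\<And>s. s \<in> {0..1} \<Longrightarrow> W (s, 1) = c"
    and sides: "\<And>r. r \<in> {0..1} \<Longrightarrow> W (0, r) = W (1, r)"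
  shows "fhom j X (\<lambda>_. \<omega> 0) f f'"
proof -
  define \<eta> where "\<eta> = (\<lambda>r::real. W (0, r))"
  have \<eta>: "pathin X \<eta>"
    unfolding pathin_def \<eta>_def
    by (rule continuous_map_compose_on[OF W]) (auto intro: continuous_intros)
  obtain F F' where F: "fhom j X \<eta> f F" "fhom j X \<eta> f' F'" "fhom j X (\<lambda>_. c) F F'"
    by (rule fhom_square[OF assms(1) W W0 W1, where \<eta> = \<eta>]) (auto simp: \<eta>_def sides)
  have ends: "\<eta> 0 = \<omega> 0" "\<eta> 1 = c"
    using W0[of 0] W1[of 0] by (auto simp: \<eta>_def)
  have "fhom j X \<eta> f F'"
    using fhom_adjust_right[OF F(1) _ \<eta>] F(3) ends by simp
  then have "fhom j X (path_rev \<eta>) F' f" "fhom j X (path_rev \<eta>) F' f'"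
    using fhom_rev F(2) by blast+
  from fhom_unique[OF this pathin_rev[OF \<eta>]] show ?thesis
    using ends by simp
qed

section \<open>Homotopy groups\<close>

lemma cube_class_eq_iff:
  assumes "f \<in> cube_loops j X x" "g \<in> cube_loops j X x"
  shows "cube_class j X x f = cube_class j X x g \<longleftrightarrow> fhom j X (\<lambda>_. x) f g"
  unfolding cube_class_eq[OF assms(1)] cube_class_eq[OF assms(2)]
proof
  assume "{h. fhom j X (\<lambda>_. x) f h} = {h. fhom j X (\<lambda>_. x) g h}"
  then show "fhom j X (\<lambda>_. x) f g"
    using fhom_refl[OF assms(2)] by auto
next
  assume fg: "fhom j X (\<lambda>_. x) f g"
  show "{h. fhom j X (\<lambda>_. x) f h} = {h. fhom j X (\<lambda>_. x) g h}"
    using fhom_trans_const[OF fg] fhom_trans_const[OF fhom_sym_const[OF fg]] by auto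
qed

lemma cube_classI: "fhom j X (\<lambda>_. x) f g \<Longrightarrow> cube_class j X x f = cube_class j X x g"
  using fhom_loops[of j X "\<lambda>_. x" f g] cube_class_eq_iff[of f j X x g] by simp

lemma cube_class_carrier: "f \<in> cube_loops j X x \<Longrightarrow> cube_class j X x f \<in> carrier (homotopy_group j X x)"
  by (simp add: homotopy_group_def)

lemma carrier_homotopy_groupE:
  assumes "A \<in> carrier (homotopy_group j X x)"
  obtains f where "f \<in> cube_loops j X x" "A = cube_class j X x f"
  using assms by (auto simp: homotopy_group_def)

lemma one_homotopy_group: "\<one>\<^bsub>homotopy_group j X x\<^esub> = cube_class j X x (\<lambda>_. x)"
  by (simp add: homotopy_group_def)

text \<open>Maps on classes are defined as unions over all representatives. The union collapses to
  one value as soon as that value does not depend on the representative.\<close>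

lemma cube_class_UN:
  assumes "f \<in> cube_loops j X x" "\<And>f'. fhom j X (\<lambda>_. x) f f' \<Longrightarrow> F f' = F f"
  shows "(\<Union>f'\<in>cube_class j X x f. F f') = F f"
  unfolding cube_class_eq[OF assms(1)]
proof (rule UN_constant_eq)
  show "f \<in> {g. fhom j X (\<lambda>_. x) f g}"
    using fhom_refl[OF assms(1)] by simp
  show "\<forall>g\<in>{g. fhom j X (\<lambda>_. x) f g}. F g = F f"
    using assms(2) by (intro ballI) (elim CollectE)
qed

lemma mult_homotopy_group:
  assumes "1 \<le> j" "f \<in> cube_loops j X x" "g \<in> cube_loops j X x"
  shows "cube_class j X x f \<otimes>\<^bsub>homotopy_group j X x\<^esub> cube_class j X x g = cube_class j X x (concat_at 0 f g)"
proof -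
  have j: "0 < j" using assms(1) by simp
  have 1: "(\<Union>g'\<in>cube_class j X x g. cube_class j X x (concat_at 0 f' g')) = cube_class j X x (concat_at 0 f' g)"
    if "fhom j X (\<lambda>_. x) f f'" for f'
  proof (rule cube_class_UN[OF assms(3)])
    fix g' assume g': "fhom j X (\<lambda>_. x) g g'"
    show "cube_class j X x (concat_at 0 f' g') = cube_class j X x (concat_at 0 f' g)"
      by (rule cube_classI[OF fhom_concat[OF j fhom_refl[OF fhom_loops(2)[OF that]] fhom_sym_const[OF g']]])
  qed
  have "(\<Union>f'\<in>cube_class j X x f. \<Union>g'\<in>cube_class j X x g. cube_class j X x (concat_at 0 f' g')) =
     (\<Union>g'\<in>cube_class j X x g. cube_class j X x (concat_at 0 f g'))"
  proof (rule cube_class_UN[OF assms(2)])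
    fix f' assume f': "fhom j X (\<lambda>_. x) f f'"
    show "(\<Union>g'\<in>cube_class j X x g. cube_class j X x (concat_at 0 f' g')) =
      (\<Union>g'\<in>cube_class j X x g. cube_class j X x (concat_at 0 f g'))"
      unfolding 1[OF f'] 1[OF fhom_refl[OF assms(2)]]
      by (rule cube_classI[OF fhom_concat[OF j fhom_sym_const[OF f'] fhom_refl[OF assms(3)]]])
  qed
  also have "\<dots> = cube_class j X x (concat_at 0 f g)"
    by (rule 1[OF fhom_refl[OF assms(2)]])
  finally show ?thesis
    by (simp add: homotopy_group_def cube_concat_eq)
qed

lemma group_homotopy_group:
  assumes j: "1 \<le> j" and x: "x \<in> topspace X"
  shows "group (homotopy_group j X x)"
proof (rule groupI)
  let ?G = "homotopy_group j X x"
  have j0: "0 < j" using j by simp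
  note c = cube_loops_const[OF x, of j]
  show "\<one>\<^bsub>?G\<^esub> \<in> carrier ?G"
    using cube_class_carrier[OF c] by (simp add: one_homotopy_group)
  fix A assume "A \<in> carrier ?G"
  then obtain f where f: "f \<in> cube_loops j X x" "A = cube_class j X x f"
    by (rule carrier_homotopy_groupE)
  show "\<one>\<^bsub>?G\<^esub> \<otimes>\<^bsub>?G\<^esub> A = A"
    using cube_classI[OF concat_const_left[OF f(1) j0]]
    by (simp add: one_homotopy_group f(2) mult_homotopy_group[OF j c f(1)])
  have r: "reverse_at 0 f \<in> cube_loops j X x"
    using reverse_loops[OF f(1) j0] .
  have rr: "reverse_at 0 (reverse_at 0 f) = f"
    by (simp add: reverse_at_def)
  have "cube_class j X x (reverse_at 0 f) \<otimes>\<^bsub>?G\<^esub> A = \<one>\<^bsub>?G\<^esub>"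
    using cube_classI[OF concat_reverse[OF r j0]]
    by (simp add: one_homotopy_group f(2) mult_homotopy_group[OF j r f(1)] rr)
  then show "\<exists>B\<in>carrier ?G. B \<otimes>\<^bsub>?G\<^esub> A = \<one>\<^bsub>?G\<^esub>"
    using cube_class_carrier[OF r] by blast
  fix B assume "B \<in> carrier ?G"
  then obtain g where g: "g \<in> cube_loops j X x" "B = cube_class j X x g"
    by (rule carrier_homotopy_groupE)
  show "A \<otimes>\<^bsub>?G\<^esub> B \<in> carrier ?G"
    using cube_class_carrier[OF concat_loops[OF j0 f(1) g(1)]] by (simp add: f(2) g(2) mult_homotopy_group[OF j f(1) g(1)])
  fix C assume "C \<in> carrier ?G"
  then obtain h where h: "h \<in> cube_loops j X x" "C = cube_class j X x h"
    by (rule carrier_homotopy_groupE)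
  show "A \<otimes>\<^bsub>?G\<^esub> B \<otimes>\<^bsub>?G\<^esub> C = A \<otimes>\<^bsub>?G\<^esub> (B \<otimes>\<^bsub>?G\<^esub> C)"
    using cube_classI[OF concat_assoc[OF f(1) g(1) h(1) j0]]
    by (simp add: f(2) g(2) h(2) mult_homotopy_group[OF j] f(1) g(1) h(1) concat_loops[OF j0])
qed

lemma comm_group_homotopy_group:
  assumes j: "2 \<le> j" and x: "x \<in> topspace X"
  shows "comm_group (homotopy_group j X x)"
proof (rule group.group_comm_groupI)
  show "group (homotopy_group j X x)"
    using j x by (intro group_homotopy_group) auto
  fix A B assume "A \<in> carrier (homotopy_group j X x)" "B \<in> carrier (homotopy_group j X x)"
  then obtain f g where f: "f \<in> cube_loops j X x" "A = cube_class j X x f"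
    and g: "g \<in> cube_loops j X x" "B = cube_class j X x g"
    by (meson carrier_homotopy_groupE)
  have "fhom j X (\<lambda>_. x) (concat_at 0 f g) (concat_at 0 g f)"
    using j by (intro concat_commute[OF f(1) g(1), of 0 1]) auto
  then show "A \<otimes>\<^bsub>homotopy_group j X x\<^esub> B = B \<otimes>\<^bsub>homotopy_group j X x\<^esub> A"
    using j cube_classI by (simp add: f g mult_homotopy_group)
qed

lemma homotopy_hom_class:
  assumes "continuous_map X Y \<phi>" "f \<in> cube_loops j X x" "y = \<phi> x"
  shows "homotopy_hom j Y y \<phi> (cube_class j X x f) = cube_class j Y y (\<lambda>t. \<phi> (f t))"
proof -
  have "homotopy_hom j Y y \<phi> (cube_class j X x f) = cube_class j Y y (\<phi> \<circ> f)"
    unfolding homotopy_hom_def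
  proof (rule cube_class_UN[OF assms(2)])
    fix f' assume "fhom j X (\<lambda>_. x) f f'"
    from fhom_sym_const[OF fhom_map[OF assms(1) this]]
    show "cube_class j Y y (\<phi> \<circ> f') = cube_class j Y y (\<phi> \<circ> f)"
      by (intro cube_classI) (simp add: assms(3) o_def)
  qed
  then show ?thesis by (simp add: o_def)
qed

lemma homotopy_hom_hom:
  assumes "1 \<le> j" "continuous_map X Y \<phi>" "y = \<phi> x"
  shows "homotopy_hom j Y y \<phi> \<in> hom (homotopy_group j X x) (homotopy_group j Y y)"
proof (rule homI)
  fix A assume "A \<in> carrier (homotopy_group j X x)"
  then obtain f where f: "f \<in> cube_loops j X x" "A = cube_class j X x f"
    by (rule carrier_homotopy_groupE)
  have f': "(\<lambda>t. \<phi> (f t)) \<in> cube_loops j Y y"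
    using cube_loops_map[OF assms(2) f(1)] assms(3) by simp
  then show "homotopy_hom j Y y \<phi> A \<in> carrier (homotopy_group j Y y)"
    using homotopy_hom_class[OF assms(2) f(1) assms(3)] cube_class_carrier f(2) by metis
  fix B assume "B \<in> carrier (homotopy_group j X x)"
  then obtain g where g: "g \<in> cube_loops j X x" "B = cube_class j X x g"
    by (rule carrier_homotopy_groupE)
  have g': "(\<lambda>t. \<phi> (g t)) \<in> cube_loops j Y y"
    using cube_loops_map[OF assms(2) g(1)] assms(3) by simp
  have "(\<lambda>t. \<phi> (concat_at 0 f g t)) = concat_at 0 (\<lambda>t. \<phi> (f t)) (\<lambda>t. \<phi> (g t))"
    by (auto simp: concat_at_def)
  then show "homotopy_hom j Y y \<phi> (A \<otimes>\<^bsub>homotopy_group j X x\<^esub> B) =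
     homotopy_hom j Y y \<phi> A \<otimes>\<^bsub>homotopy_group j Y y\<^esub> homotopy_hom j Y y \<phi> B"
    using assms(1) by (simp add: f g mult_homotopy_group[OF assms(1)] f' g' homotopy_hom_class[OF assms(2) _ assms(3)] concat_loops)
qed

section \<open>Change of base point as an isomorphism\<close>

lemma base_transport_class:
  assumes "fhom j X \<gamma> f g" "pathin X \<gamma>" "x = \<gamma> 0" "y = \<gamma> 1"
  shows "base_transport j X \<gamma> (cube_class j X x f) = cube_class j X y g"
proof -
  note l = fhom_loops[OF assms(1)]
  have "(\<exists>f'. fhom j X (\<lambda>_. \<gamma> 0) f f' \<and> fhom j X \<gamma> f' h) \<longleftrightarrow> fhom j X (\<lambda>_. \<gamma> 1) g h" for h
  proof
    assume "\<exists>f'. fhom j X (\<lambda>_. \<gamma> 0) f f' \<and> fhom j X \<gamma> f' h"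
    then have "fhom j X \<gamma> f h"
      using fhom_adjust_left[OF _ _ assms(2)] by blast
    then show "fhom j X (\<lambda>_. \<gamma> 1) g h"
      by (rule fhom_unique[OF assms(1) _ assms(2)])
  next
    assume "fhom j X (\<lambda>_. \<gamma> 1) g h"
    then have "fhom j X \<gamma> f h"
      by (rule fhom_adjust_right[OF assms(1) _ assms(2)])
    then show "\<exists>f'. fhom j X (\<lambda>_. \<gamma> 0) f f' \<and> fhom j X \<gamma> f' h"
      using fhom_refl[OF l(1)] by blast
  qed
  then show ?thesis
    using l by (simp add: base_transport_eq cube_class_eq assms(3,4))
qed

lemma base_transport_iso:
  assumes j: "1 \<le> j" and \<gamma>: "pathin X \<gamma>" "x = \<gamma> 0" "y = \<gamma> 1"
  shows "base_transport j X \<gamma> \<in> iso (homotopy_group j X x) (homotopy_group j X y)"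
proof -
  have ex: "\<exists>g. fhom j X \<gamma> f g \<and> g \<in> cube_loops j X y" if "f \<in> cube_loops j X x" for f
  proof -
    have "f \<in> cube_loops j X (\<gamma> 0)"
      using that \<gamma>(2) by simp
    from fhom_exists[OF \<gamma>(1) this, of undefined] fhom_loops(2) show ?thesis
      unfolding \<gamma>(3) by blast
  qed
  note bt = base_transport_class[OF _ \<gamma>]
  have h: "base_transport j X \<gamma> \<in> hom (homotopy_group j X x) (homotopy_group j X y)"
  proof (rule homI)
    fix A assume "A \<in> carrier (homotopy_group j X x)"
    then obtain f where f: "f \<in> cube_loops j X x" "A = cube_class j X x f"
      by (rule carrier_homotopy_groupE)
    obtain f' where f': "fhom j X \<gamma> f f'" "f' \<in> cube_loops j X y"
      using ex[OF f(1)] by blast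
    show "base_transport j X \<gamma> A \<in> carrier (homotopy_group j X y)"
      using bt[OF f'(1)] cube_class_carrier[OF f'(2)] f(2) by simp
    fix B assume "B \<in> carrier (homotopy_group j X x)"
    then obtain g where g: "g \<in> cube_loops j X x" "B = cube_class j X x g"
      by (rule carrier_homotopy_groupE)
    obtain g' where g': "fhom j X \<gamma> g g'" "g' \<in> cube_loops j X y"
      using ex[OF g(1)] by blast
    have "fhom j X \<gamma> (concat_at 0 f g) (concat_at 0 f' g')"
      using j by (intro fhom_concat f' g') auto
    from bt[OF this]
    show "base_transport j X \<gamma> (A \<otimes>\<^bsub>homotopy_group j X x\<^esub> B) =
       base_transport j X \<gamma> A \<otimes>\<^bsub>homotopy_group j X y\<^esub> base_transport j X \<gamma> B"
      using bt[OF f'(1)] bt[OF g'(1)] by (simp add: f g f' g' mult_homotopy_group[OF j])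
  qed
  have inj: "inj_on (base_transport j X \<gamma>) (carrier (homotopy_group j X x))"
  proof (rule inj_onI)
    fix A B assume AB: "A \<in> carrier (homotopy_group j X x)" "B \<in> carrier (homotopy_group j X x)"
      and eq: "base_transport j X \<gamma> A = base_transport j X \<gamma> B"
    obtain f where f: "f \<in> cube_loops j X x" "A = cube_class j X x f"
      using AB(1) by (rule carrier_homotopy_groupE)
    obtain g where g: "g \<in> cube_loops j X x" "B = cube_class j X x g"
      using AB(2) by (rule carrier_homotopy_groupE)
    obtain f' where f': "fhom j X \<gamma> f f'" "f' \<in> cube_loops j X y"
      using ex[OF f(1)] by blast
    obtain g' where g': "fhom j X \<gamma> g g'" "g' \<in> cube_loops j X y"
      using ex[OF g(1)] by blast
    have "fhom j X (\<lambda>_. \<gamma> 1) f' g'"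
      using eq bt[OF f'(1)] bt[OF g'(1)] cube_class_eq_iff[OF f'(2) g'(2)] f g \<gamma>(3) by simp
    from fhom_adjust_right[OF f'(1) this \<gamma>(1)] have "fhom j X \<gamma> f g'" .
    from fhom_unique[OF fhom_rev[OF this] fhom_rev[OF g'(1)] pathin_rev[OF \<gamma>(1)]]
    show "A = B"
      using f g \<gamma>(2) by (simp add: cube_classI)
  qed
  have "carrier (homotopy_group j X y) \<subseteq> base_transport j X \<gamma> ` carrier (homotopy_group j X x)"
  proof
    fix B assume "B \<in> carrier (homotopy_group j X y)"
    then obtain g where g: "g \<in> cube_loops j X y" "B = cube_class j X y g"
      by (rule carrier_homotopy_groupE)
    obtain f where f: "fhom j X (path_rev \<gamma>) g f"
      using fhom_exists[OF pathin_rev[OF \<gamma>(1)], of g j] g(1) \<gamma>(3) by auto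
    have "fhom j X \<gamma> f g"
      using fhom_rev[OF f] by (simp add: path_rev_def)
    from bt[OF this] fhom_loops(1)[OF this] show "B \<in> base_transport j X \<gamma> ` carrier (homotopy_group j X x)"
      using cube_class_carrier[of f j X x] g(2) \<gamma>(2) by force
  qed
  with h inj show ?thesis
    by (auto simp: iso_def bij_betw_def hom_def Pi_iff)
qed

lemma fhomE_const:
  assumes "fhom j X (\<lambda>_. x) f g"
  obtains H where "continuous_map (top_of_set ({0..1::real} \<times> Cube j)) X H"
    "\<And>t. t \<in> Cube j \<Longrightarrow> H (0, t) = f t" "\<And>t. t \<in> Cube j \<Longrightarrow> H (1, t) = g t"
    "\<And>s t. s \<in> {0..1} \<Longrightarrow> t \<in> cube_boundary j \<Longrightarrow> H (s, t) = x"
  using assms unfolding fhom_def by auto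

subsection \<open>Products\<close>

lemma fhom_power:
  assumes "\<And>i. i < n \<Longrightarrow> fhom j X (\<lambda>s. \<gamma> s i) (\<lambda>t. f t i) (\<lambda>t. g t i)"
    and "\<And>s. s \<in> {0..1} \<Longrightarrow> \<gamma> s \<in> extensional {..<n}"
    and "\<And>t. t \<in> Cube j \<Longrightarrow> f t \<in> extensional {..<n} \<and> g t \<in> extensional {..<n}"
  shows "fhom j (power_space n X) \<gamma> f g"
proof -
  have "\<forall>i. \<exists>H. i < n \<longrightarrow> continuous_map (top_of_set ({0..1} \<times> Cube j)) X H \<and>
     (\<forall>t\<in>Cube j. H (0, t) = f t i \<and> H (1, t) = g t i) \<and>
     (\<forall>s\<in>{0..1}. \<forall>t\<in>cube_boundary j. H (s, t) = \<gamma> s i)"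
    using assms(1) by (auto simp: fhom_def)
  then obtain H where H: "\<And>i. i < n \<Longrightarrow> continuous_map (top_of_set ({0..1} \<times> Cube j)) X (H i)"
    "\<And>i t. i < n \<Longrightarrow> t \<in> Cube j \<Longrightarrow> H i (0, t) = f t i \<and> H i (1, t) = g t i"
    "\<And>i s t. i < n \<Longrightarrow> s \<in> {0..1} \<Longrightarrow> t \<in> cube_boundary j \<Longrightarrow> H i (s, t) = \<gamma> s i"
    by metis
  show ?thesis
  proof (rule fhomI)
    show "continuous_map (top_of_set ({0..1} \<times> Cube j)) (power_space n X) (\<lambda>p. \<lambda>i\<in>{..<n}. H i p)"
      using H(1) by (auto simp: continuous_map_componentwise)
    show "(\<lambda>i\<in>{..<n}. H i (0, t)) = f t" if "t \<in> Cube j" for t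
      by (rule extensionalityI[of _ "{..<n}"]) (use assms(3) that H(2) in auto)
    show "(\<lambda>i\<in>{..<n}. H i (1, t)) = g t" if "t \<in> Cube j" for t
      by (rule extensionalityI[of _ "{..<n}"]) (use assms(3) that H(2) in auto)
    show "(\<lambda>i\<in>{..<n}. H i (s, t)) = \<gamma> s" if "s \<in> {0..1}" "t \<in> cube_boundary j" for s t
      by (rule extensionalityI[of _ "{..<n}"]) (use assms(2) that H(3) in auto)
  qed
qed

lemma loops_power_extensional:
  assumes "f \<in> cube_loops j (power_space n X) x" "t \<in> Cube j"
  shows "f t \<in> extensional {..<n}"
proof -
  have "f t \<in> topspace (power_space n X)"
    using assms continuous_map_funspace[of "top_of_set (Cube j)" "power_space n X" f] by (auto simp: cube_loops_iff Pi_iff)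
  then show ?thesis by (simp add: PiE_def)
qed

lemma continuous_map_power_proj: "i < n \<Longrightarrow> continuous_map (power_space n X) X (\<lambda>z. z i)"
  using continuous_map_product_projection[of i "{..<n}" "\<lambda>_. X"] by simp

lemma loops_power_component:
  assumes "f \<in> cube_loops j (power_space n X) x" "i < n"
  shows "(\<lambda>t. f t i) \<in> cube_loops j X (x i)"
  by (rule cube_loops_map[OF continuous_map_power_proj[OF assms(2)] assms(1)])

text \<open>Used twice: for the base configuration with the given paths, and for a power of the loop
  space with constant paths.\<close>

locale power_paths =
  fixes j n :: nat and X :: "'a topology" and x :: "nat \<Rightarrow> 'a" and x0 :: 'a and \<gamma> :: "nat \<Rightarrow> real \<Rightarrow> 'a"
  assumes j: "1 \<le> j" and x: "x \<in> topspace (power_space n X)"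
    and \<gamma>: "\<And>i. i < n \<Longrightarrow> pathin X (\<gamma> i)" "\<And>i. i < n \<Longrightarrow> \<gamma> i 0 = x i" "\<And>i. i < n \<Longrightarrow> \<gamma> i 1 = x0"
begin

abbreviation "pid \<equiv> power_identification j n X x \<gamma>"

lemma pid_class:
  assumes f: "f \<in> cube_loops j (power_space n X) x"
    and g: "\<And>i. i < n \<Longrightarrow> fhom j X (\<gamma> i) (\<lambda>t. f t i) (g i)"
  shows "pid (cube_class j (power_space n X) x f) = (\<lambda>i\<in>{..<n}. cube_class j X x0 (g i))"
proof -
  have "base_transport j X (\<gamma> i) (homotopy_hom j X (x i) (\<lambda>z. z i) (cube_class j (power_space n X) x f)) = cube_class j X x0 (g i)"
    if "i < n" for i
  proof -
    from homotopy_hom_class[OF continuous_map_power_proj[OF that] f] base_transport_class[OF g[OF that] \<gamma>(1)[OF that]] show ?thesis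
      using \<gamma>(2,3)[OF that] by simp
  qed
  then show ?thesis
    by (simp add: power_identification_def fun_eq_iff)
qed

lemma ex_transports:
  assumes f: "f \<in> cube_loops j (power_space n X) x"
  obtains g where "\<And>i. i < n \<Longrightarrow> fhom j X (\<gamma> i) (\<lambda>t. f t i) (g i)" "\<And>i. i < n \<Longrightarrow> g i \<in> cube_loops j X x0"
proof -
  have "\<exists>g. fhom j X (\<gamma> i) (\<lambda>t. f t i) g \<and> g \<in> cube_loops j X x0" if "i < n" for i
  proof -
    have "(\<lambda>t. f t i) \<in> cube_loops j X (\<gamma> i 0)"
      using loops_power_component[OF f that] \<gamma>(2)[OF that] by simp
    from fhom_exists[OF \<gamma>(1)[OF that] this, of undefined] fhom_loops(2) \<gamma>(3)[OF that] show ?thesis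
      by metis
  qed
  then show thesis
    using that by metis
qed

lemma pid_hom: "pid \<in> hom (homotopy_group j (power_space n X) x) (product_group {..<n} (\<lambda>_. homotopy_group j X x0))"
proof (rule homI)
  fix A assume "A \<in> carrier (homotopy_group j (power_space n X) x)"
  then obtain f where f: "f \<in> cube_loops j (power_space n X) x" "A = cube_class j (power_space n X) x f"
    by (rule carrier_homotopy_groupE)
  obtain f' where f': "\<And>i. i < n \<Longrightarrow> fhom j X (\<gamma> i) (\<lambda>t. f t i) (f' i)" "\<And>i. i < n \<Longrightarrow> f' i \<in> cube_loops j X x0"
    using ex_transports[OF f(1)] by blast
  show "pid A \<in> carrier (product_group {..<n} (\<lambda>_. homotopy_group j X x0))"
    using pid_class[OF f(1) f'(1)] f(2) f'(2) cube_class_carrier by fastforce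
  fix B assume "B \<in> carrier (homotopy_group j (power_space n X) x)"
  then obtain g where g: "g \<in> cube_loops j (power_space n X) x" "B = cube_class j (power_space n X) x g"
    by (rule carrier_homotopy_groupE)
  obtain g' where g': "\<And>i. i < n \<Longrightarrow> fhom j X (\<gamma> i) (\<lambda>t. g t i) (g' i)" "\<And>i. i < n \<Longrightarrow> g' i \<in> cube_loops j X x0"
    using ex_transports[OF g(1)] by blast
  have fg: "concat_at 0 f g \<in> cube_loops j (power_space n X) x"
    using j by (intro concat_loops f g) auto
  have "fhom j X (\<gamma> i) (\<lambda>t. concat_at 0 f g t i) (concat_at 0 (f' i) (g' i))" if "i < n" for i
  proof -
    have "(\<lambda>t. concat_at 0 f g t i) = concat_at 0 (\<lambda>t. f t i) (\<lambda>t. g t i)"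
      by (auto simp: concat_at_def)
    then show ?thesis
      using fhom_concat[OF _ f'(1)[OF that] g'(1)[OF that], of 0] j by simp
  qed
  from pid_class[OF fg this] have "pid (cube_class j (power_space n X) x (concat_at 0 f g)) =
    (\<lambda>i\<in>{..<n}. cube_class j X x0 (concat_at 0 (f' i) (g' i)))" .
  then show "pid (A \<otimes>\<^bsub>homotopy_group j (power_space n X) x\<^esub> B) =
    pid A \<otimes>\<^bsub>product_group {..<n} (\<lambda>_. homotopy_group j X x0)\<^esub> pid B"
    using pid_class[OF f(1) f'(1)] pid_class[OF g(1) g'(1)] f'(2) g'(2)
    by (auto simp: f(2) g(2) mult_homotopy_group[OF j] f(1) g(1) fun_eq_iff)
qed

lemma pid_inj: "inj_on pid (carrier (homotopy_group j (power_space n X) x))"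
proof (rule inj_onI)
  fix A B assume AB: "A \<in> carrier (homotopy_group j (power_space n X) x)" "B \<in> carrier (homotopy_group j (power_space n X) x)"
    and eq: "pid A = pid B"
  obtain f where f: "f \<in> cube_loops j (power_space n X) x" "A = cube_class j (power_space n X) x f"
    using AB(1) by (rule carrier_homotopy_groupE)
  obtain f' where f': "\<And>i. i < n \<Longrightarrow> fhom j X (\<gamma> i) (\<lambda>t. f t i) (f' i)" "\<And>i. i < n \<Longrightarrow> f' i \<in> cube_loops j X x0"
    using ex_transports[OF f(1)] by blast
  obtain g where g: "g \<in> cube_loops j (power_space n X) x" "B = cube_class j (power_space n X) x g"
    using AB(2) by (rule carrier_homotopy_groupE)
  obtain g' where g': "\<And>i. i < n \<Longrightarrow> fhom j X (\<gamma> i) (\<lambda>t. g t i) (g' i)" "\<And>i. i < n \<Longrightarrow> g' i \<in> cube_loops j X x0"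
    using ex_transports[OF g(1)] by blast
  have "fhom j X (\<lambda>_. x i) (\<lambda>t. f t i) (\<lambda>t. g t i)" if "i < n" for i
  proof -
    have "cube_class j X x0 (f' i) = cube_class j X x0 (g' i)"
      using eq pid_class[OF f(1) f'(1)] pid_class[OF g(1) g'(1)] f(2) g(2) that by (metis lessThan_iff restrict_apply')
    then have "fhom j X (\<lambda>_. \<gamma> i 1) (f' i) (g' i)"
      using cube_class_eq_iff[OF f'(2)[OF that] g'(2)[OF that]] \<gamma>(3)[OF that] by simp
    from fhom_adjust_right[OF f'(1)[OF that] this \<gamma>(1)[OF that]]
    have "fhom j X (path_rev (\<gamma> i)) (g' i) (\<lambda>t. f t i)"
      by (rule fhom_rev)
    from fhom_unique[OF this fhom_rev[OF g'(1)[OF that]] pathin_rev[OF \<gamma>(1)[OF that]]]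
    show ?thesis
      using \<gamma>(2)[OF that] by simp
  qed
  then have "fhom j (power_space n X) (\<lambda>_. x) f g"
    by (rule fhom_power) (use x loops_power_extensional f(1) g(1) in \<open>auto simp: PiE_def\<close>)
  then show "A = B"
    using f(2) g(2) cube_classI by metis
qed

lemma pid_surj: "carrier (product_group {..<n} (\<lambda>_. homotopy_group j X x0)) \<subseteq> pid ` carrier (homotopy_group j (power_space n X) x)"
proof
  fix a assume a: "a \<in> carrier (product_group {..<n} (\<lambda>_. homotopy_group j X x0))"
  have "\<exists>f g. fhom j X (\<gamma> i) f g \<and> a i = cube_class j X x0 g" if i: "i < n" for i
  proof -
    have "a i \<in> carrier (homotopy_group j X x0)"
      using a i by auto
    then obtain g where g: "g \<in> cube_loops j X x0" "a i = cube_class j X x0 g"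
      by (rule carrier_homotopy_groupE)
    obtain f where "fhom j X (path_rev (\<gamma> i)) g f"
      using fhom_exists[OF pathin_rev[OF \<gamma>(1)[OF i]], of g j] g(1) \<gamma>(3)[OF i] by auto
    from fhom_rev[OF this] g(2) show ?thesis
      by (auto simp: path_rev_def)
  qed
  then obtain f g where fg: "\<And>i. i < n \<Longrightarrow> fhom j X (\<gamma> i) (f i) (g i)" "\<And>i. i < n \<Longrightarrow> a i = cube_class j X x0 (g i)"
    by metis
  define F where "F = (\<lambda>t. \<lambda>i\<in>{..<n}. f i t)"
  have "fhom j (power_space n X) (\<lambda>_. x) F F"
  proof (rule fhom_power)
    fix i assume i: "i < n"
    show "fhom j X (\<lambda>_. x i) (\<lambda>t. F t i) (\<lambda>t. F t i)"
      using fhom_refl[OF fhom_loops(1)[OF fg(1)[OF i]]] i \<gamma>(2)[OF i] by (simp add: F_def)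
  qed (use x in \<open>auto simp: F_def PiE_def\<close>)
  then have F: "F \<in> cube_loops j (power_space n X) x"
    using fhom_loops(1) by fastforce
  have "fhom j X (\<gamma> i) (\<lambda>t. F t i) (g i)" if "i < n" for i
    using fg(1)[OF that] that by (simp add: F_def)
  from pid_class[OF F this] have "pid (cube_class j (power_space n X) x F) = (\<lambda>i\<in>{..<n}. cube_class j X x0 (g i))" .
  also have "\<dots> = a"
    using a fg(2) by (auto simp: PiE_def extensional_def fun_eq_iff)
  finally show "a \<in> pid ` carrier (homotopy_group j (power_space n X) x)"
    using cube_class_carrier[OF F] by blast
qed

lemma pid_iso: "pid \<in> iso (homotopy_group j (power_space n X) x) (product_group {..<n} (\<lambda>_. homotopy_group j X x0))"
  using pid_hom pid_inj pid_surj by (auto simp: iso_def bij_betw_def hom_def)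

end

subsection \<open>Loop spaces\<close>

text \<open>The tube lemma in disguise: the parameters whose path violates a subbasic condition on
  \<open>C\<close> form the projection of a closed set along the compact set
  \<open>C\<close>.\<close>

lemma continuous_map_curry:
  fixes K :: "'k::topological_space set"
  assumes G: "continuous_map (top_of_set (K \<times> {0..1})) X G"
    and ends: "\<And>k. k \<in> K \<Longrightarrow> G (k, 0) = x \<and> G (k, 1) = x"
  shows "continuous_map (top_of_set K) (loop_space X x) (\<lambda>k. \<lambda>s\<in>{0..1}. G (k, s))"
proof -
  have path: "(\<lambda>s\<in>{0..1}. G (k, s)) \<in> based_loops X x" if "k \<in> K" for k
  proof -
    have "continuous_map (top_of_set {0..1}) X (\<lambda>s. G (k, s))"
      by (rule continuous_map_compose_on[OF G]) (use that in \<open>auto intro: continuous_intros\<close>)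
    then have "continuous_map (top_of_set {0..1}) X (\<lambda>s\<in>{0..1}. G (k, s))"
      by (rule continuous_map_eq) auto
    then show ?thesis
      using ends[OF that] by (auto simp: based_loops_def pathin_def)
  qed
  show ?thesis
    unfolding loop_space_def
  proof (rule continuous_on_generated_topo)
    fix U assume "U \<in> {{p \<in> based_loops X x. p ` C \<subseteq> U} |C U. compact C \<and> C \<subseteq> {0..1} \<and> openin X U}"
    then obtain C V where C: "U = {p \<in> based_loops X x. p ` C \<subseteq> V}" "compact C" "C \<subseteq> {0..1}" "openin X V"
      by blast
    have cl: "closedin (top_of_set (K \<times> C)) {p \<in> K \<times> C. G p \<in> topspace X - V}"
    proof -
      have "continuous_map (top_of_set (K \<times> C)) X G"
        by (rule continuous_map_compose_on[OF G, of _ "\<lambda>p. p"]) (use C(3) in auto)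
      from closedin_continuous_map_preimage[OF this, of "topspace X - V"] show ?thesis
        using C(4) by auto
    qed
    \<comment> \<open>Projection along a compact factor is closed.\<close>
    have "closed_map (prod_topology (top_of_set K) (top_of_set C)) (top_of_set K) fst"
      by (rule Abstract_Topological_Spaces.closed_map_fst) (use C(2) compactin_subspace[of euclidean C] in auto)
    then have "closedin (top_of_set K) (fst ` {p \<in> K \<times> C. G p \<in> topspace X - V})"
      using cl by (simp add: closed_map_def)
    then have "openin (top_of_set K) (K - fst ` {p \<in> K \<times> C. G p \<in> topspace X - V})"
      by (simp add: closedin_def)
    moreover have "K - fst ` {p \<in> K \<times> C. G p \<in> topspace X - V} = (\<lambda>k. \<lambda>s\<in>{0..1}. G (k, s)) -` U \<inter> topspace (top_of_set K)"
    proof -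
      have "G p \<in> topspace X" if "p \<in> K \<times> C" for p
        using continuous_map_funspace[OF G] that C(3) by auto
      then have 1: "k \<in> fst ` {p \<in> K \<times> C. G p \<in> topspace X \<and> G p \<notin> V} \<longleftrightarrow> k \<in> K \<and> \<not> (\<forall>s\<in>C. G (k, s) \<in> V)" for k
        by (force simp: image_iff)
      have 2: "(\<forall>s\<in>C. G (k, s) \<in> V) \<longleftrightarrow> (\<lambda>s\<in>{0..1}. G (k, s)) ` C \<subseteq> V" for k
      proof -
        have "(\<lambda>s\<in>{0..1}. G (k, s)) ` C = (\<lambda>s. G (k, s)) ` C"
          using C(3) by (intro image_cong) auto
        then show ?thesis by auto
      qed
      show ?thesis
        unfolding C(1) set_eq_iff Diff_iff Int_iff vimage_eq mem_Collect_eq topspace_euclidean_subtopology 1 2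
        using path by blast
    qed
    ultimately show "openin (top_of_set K) ((\<lambda>k. \<lambda>s\<in>{0..1}. G (k, s)) -` U \<inter> topspace (top_of_set K))"
      by simp
  next
    have "based_loops X x = \<Union> {{p \<in> based_loops X x. p ` C \<subseteq> U} |C U. compact C \<and> C \<subseteq> {0..1} \<and> openin X U}"
      using topspace_loop_space[of X x] unfolding loop_space_def topology_generated_by_topspace by simp
    then show "(\<lambda>k. \<lambda>s\<in>{0..1}. G (k, s)) ` topspace (top_of_set K)
       \<subseteq> \<Union> {{p \<in> based_loops X x. p ` C \<subseteq> U} |C U. compact C \<and> C \<subseteq> {0..1} \<and> openin X U}"
      using path by auto
  qed
qed

text \<open>Evaluation is continuous because the interval is locally compact: a compact
  neighbourhood of the time \<open>s\<close> yields a compact-open neighbourhood of the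
  path.\<close>

lemma continuous_map_uncurry:
  fixes K :: "'k::topological_space set"
  assumes F: "continuous_map (top_of_set K) (loop_space X x) F"
  shows "continuous_map (top_of_set (K \<times> {0..1})) X (\<lambda>p. F (fst p) (snd p))"
proof -
  have Fl: "F k \<in> based_loops X x" if "k \<in> K" for k
    using continuous_map_funspace[OF F] that by (auto simp: topspace_loop_space)
  then have Fp: "continuous_map (top_of_set {0..1}) X (F k)" if "k \<in> K" for k
    using that by (auto simp: based_loops_def pathin_def)
  show ?thesis
    unfolding continuous_map_def
  proof (intro conjI allI impI)
    show "(\<lambda>p. F (fst p) (snd p)) \<in> topspace (top_of_set (K \<times> {0..1})) \<rightarrow> topspace X"
      using Fp continuous_map_funspace by fastforce
    fix U assume U: "openin X U"
    show "openin (top_of_set (K \<times> {0..1})) {p \<in> topspace (top_of_set (K \<times> {0..1})). F (fst p) (snd p) \<in> U}"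
    proof (subst openin_subopen, intro ballI)
      fix p assume p: "p \<in> {p \<in> topspace (top_of_set (K \<times> {0..1})). F (fst p) (snd p) \<in> U}"
      then obtain k s where ks: "p = (k, s)" "k \<in> K" "s \<in> {0..1}" "F k s \<in> U"
        by auto
      have "openin (top_of_set {0..1}) {r \<in> {0..1}. F k r \<in> U}"
        using openin_continuous_map_preimage[OF Fp[OF ks(2)] U] by simp
      then obtain e where e: "e > 0" "\<And>r. r \<in> {0..1} \<Longrightarrow> dist r s < e \<Longrightarrow> F k r \<in> U"
        using ks unfolding openin_euclidean_subtopology_iff by auto
      \<comment> \<open>Half the radius makes the closed ball fit into the \<open>e\<close>-ball,
        while the open ball of the same radius is still a neighbourhood of \<open>s\<close>.\<close>
      define C where "C = {0..1} \<inter> cball s (e/2)"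
      have C: "compact C" "C \<subseteq> {0..1}" "F k ` C \<subseteq> U"
        using e by (auto simp: C_def dist_commute intro: compact_Int_closed)
      define N where "N = {p \<in> based_loops X x. p ` C \<subseteq> U}"
      have "openin (loop_space X x) N"
        unfolding loop_space_def N_def
        by (rule topology_generated_by_Basis) (use C U in blast)
      then have "openin (top_of_set K) {k \<in> K. F k \<in> N}"
        using openin_continuous_map_preimage[OF F] by simp
      moreover have "openin (top_of_set {0..1}) ({0..1} \<inter> ball s (e/2))"
        by (simp add: openin_open_Int)
      ultimately have "openin (top_of_set (K \<times> {0..1})) ({k \<in> K. F k \<in> N} \<times> ({0..1} \<inter> ball s (e/2)))"
        unfolding prod_topology_subtopology_eu[symmetric] openin_prod_Times_iff by blast
      moreover have "p \<in> {k \<in> K. F k \<in> N} \<times> ({0..1} \<inter> ball s (e/2))"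
        using ks e(1) Fl C(3) by (auto simp: N_def)
      moreover have "{k \<in> K. F k \<in> N} \<times> ({0..1} \<inter> ball s (e/2)) \<subseteq> {p \<in> topspace (top_of_set (K \<times> {0..1})). F (fst p) (snd p) \<in> U}"
        by (auto simp: N_def C_def)
      ultimately show "\<exists>T. openin (top_of_set (K \<times> {0..1})) T \<and> p \<in> T \<and>
           T \<subseteq> {p \<in> topspace (top_of_set (K \<times> {0..1})). F (fst p) (snd p) \<in> U}"
        by blast
    qed
  qed
qed

text \<open>The last coordinate becomes the loop parameter. Coordinate 0, in which the group law
  concatenates, thus remains a cube coordinate when \<open>m\<close> is positive.\<close>

definition curry_loop :: "nat \<Rightarrow> ((nat \<Rightarrow> real) \<Rightarrow> 'a) \<Rightarrow> (nat \<Rightarrow> real) \<Rightarrow> real \<Rightarrow> 'a" where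
  "curry_loop m f = (\<lambda>t. \<lambda>s\<in>{0..1}. f (t(m := s)))"

text \<open>Resetting coordinate \<open>m\<close> to \<open>undefined\<close> returns the point to
  the lower-dimensional cube, whose elements are extensional.\<close>

definition uncurry_loop :: "nat \<Rightarrow> ((nat \<Rightarrow> real) \<Rightarrow> real \<Rightarrow> 'a) \<Rightarrow> (nat \<Rightarrow> real) \<Rightarrow> 'a" where
  "uncurry_loop m F = (\<lambda>t. F (t(m := undefined)) (t m))"

lemma Cube_Suc_upd: "t \<in> Cube m \<Longrightarrow> s \<in> {0..1} \<Longrightarrow> t(m := s) \<in> Cube (Suc m)"
  and Cube_Suc_restrict: "t \<in> Cube (Suc m) \<Longrightarrow> t(m := undefined) \<in> Cube m \<and> t m \<in> {0..1}"
  by (auto simp: Cube_iff)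

lemma boundary_Suc: "t \<in> Cube m \<Longrightarrow> s \<in> {0..1} \<Longrightarrow> t(m := s) \<in> cube_boundary (Suc m) \<longleftrightarrow> t \<in> cube_boundary m \<or> s = 0 \<or> s = 1"
  by (auto simp: cube_boundary_iff Cube_Suc_upd less_Suc_eq)

lemma fhom_curry:
  assumes "fhom (Suc m) X (\<lambda>_. x) f g"
  shows "fhom m (loop_space X x) (\<lambda>_. \<lambda>s\<in>{0..1}. x) (curry_loop m f) (curry_loop m g)"
proof -
  obtain H where H: "continuous_map (top_of_set ({0..1::real} \<times> Cube (Suc m))) X H"
    "\<And>t. t \<in> Cube (Suc m) \<Longrightarrow> H (0, t) = f t" "\<And>t. t \<in> Cube (Suc m) \<Longrightarrow> H (1, t) = g t"
    "\<And>s t. s \<in> {0..1} \<Longrightarrow> t \<in> cube_boundary (Suc m) \<Longrightarrow> H (s, t) = x"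
    using assms by (rule fhomE_const) blast
  define G where "G = (\<lambda>q::(real \<times> (nat \<Rightarrow> real)) \<times> real. H (fst (fst q), (snd (fst q))(m := snd q)))"
  have G: "continuous_map (top_of_set (({0..1} \<times> Cube m) \<times> {0..1})) X G"
    unfolding G_def
    by (rule continuous_map_compose_on[OF H(1)])
      (auto simp: Cube_Suc_upd intro!: continuous_on_Pair continuous_on_fun_upd continuous_on_fst continuous_on_snd continuous_on_id)
  show ?thesis
  proof (rule fhomI)
    show "continuous_map (top_of_set ({0..1} \<times> Cube m)) (loop_space X x) (\<lambda>k. \<lambda>s\<in>{0..1}. G (k, s))"
      by (rule continuous_map_curry[OF G]) (auto simp: G_def boundary_Suc H(4))
    show "(\<lambda>s\<in>{0..1}. G ((0, t), s)) = curry_loop m f t" "(\<lambda>s\<in>{0..1}. G ((1, t), s)) = curry_loop m g t"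
      if "t \<in> Cube m" for t
      using that by (auto simp: G_def curry_loop_def H Cube_Suc_upd)
    show "(\<lambda>s\<in>{0..1}. G ((u, t), s)) = (\<lambda>s\<in>{0..1}. x)" if "u \<in> {0..1}" "t \<in> cube_boundary m" for u t
      using that boundary_subset[OF that(2)] by (auto simp: G_def boundary_Suc H(4))
  qed
qed

lemma fhom_uncurry:
  assumes "fhom m (loop_space X x) (\<lambda>_. \<lambda>s\<in>{0..1}. x) f g"
  shows "fhom (Suc m) X (\<lambda>_. x) (uncurry_loop m f) (uncurry_loop m g)"
proof -
  obtain H where H: "continuous_map (top_of_set ({0..1::real} \<times> Cube m)) (loop_space X x) H"
    "\<And>t. t \<in> Cube m \<Longrightarrow> H (0, t) = f t" "\<And>t. t \<in> Cube m \<Longrightarrow> H (1, t) = g t"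
    "\<And>s t. s \<in> {0..1} \<Longrightarrow> t \<in> cube_boundary m \<Longrightarrow> H (s, t) = (\<lambda>s\<in>{0..1}. x)"
    using assms by (rule fhomE_const) blast
  have loop: "H (s, t) 0 = x \<and> H (s, t) 1 = x" if "s \<in> {0..1}" "t \<in> Cube m" for s t
    using continuous_map_funspace[OF H(1)] that by (auto simp: topspace_loop_space based_loops_def)
  show ?thesis
  proof (rule fhomI)
    show "continuous_map (top_of_set ({0..1} \<times> Cube (Suc m))) X
      (\<lambda>p. H (fst (fst p, (snd p)(m := undefined)), snd (fst p, (snd p)(m := undefined))) (snd p m))"
    proof -
      have "continuous_on ({0..1} \<times> Cube (Suc m)) (\<lambda>p::real \<times> (nat \<Rightarrow> real). ((fst p, (snd p)(m := undefined)), snd p m))"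
        by (intro continuous_on_Pair continuous_on_fun_upd continuous_intros)
      from continuous_map_compose_on[OF continuous_map_uncurry[OF H(1)] this] Cube_Suc_restrict show ?thesis
        by force
    qed
    fix u :: real and t assume u: "u \<in> {0..1}" "t \<in> cube_boundary (Suc m)"
    then have t: "t(m := undefined) \<in> Cube m" "t m \<in> {0..1}"
      using Cube_Suc_restrict[OF boundary_subset[OF u(2)]] by auto
    have "t(m := undefined) \<in> cube_boundary m \<or> t m = 0 \<or> t m = 1"
      using boundary_Suc[OF t] u(2) by simp
    then have "H (u, t(m := undefined)) (t m) = x"
    proof (elim disjE)
      assume "t(m := undefined) \<in> cube_boundary m"
      from H(4)[OF u(1) this] show ?thesis
        by (simp only: restrict_apply' t(2))
    qed (simp_all only: loop[OF u(1) t(1)])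
    then show "H (fst (fst (u, t), (snd (u, t))(m := undefined)), snd (fst (u, t), (snd (u, t))(m := undefined))) (snd (u, t) m) = x"
      by (simp only: fst_conv snd_conv)
  next
    fix t assume "t \<in> Cube (Suc m)"
    then have "t(m := undefined) \<in> Cube m"
      using Cube_Suc_restrict by blast
    then show "H (fst (fst (0, t), (snd (0, t))(m := undefined)), snd (fst (0, t), (snd (0, t))(m := undefined))) (snd (0, t) m) = uncurry_loop m f t"
      "H (fst (fst (1, t), (snd (1, t))(m := undefined)), snd (fst (1, t), (snd (1, t))(m := undefined))) (snd (1, t) m) = uncurry_loop m g t"
      using H(2,3) by (simp_all add: uncurry_loop_def)
  qed
qed

lemma uncurry_curry: "t \<in> Cube (Suc m) \<Longrightarrow> uncurry_loop m (curry_loop m f) t = f t"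
  using Cube_Suc_restrict[of t m] by (simp add: uncurry_loop_def curry_loop_def)

lemma curry_uncurry:
  assumes "F \<in> cube_loops m (loop_space X x) c" "t \<in> Cube m"
  shows "curry_loop m (uncurry_loop m F) t = F t"
proof -
  have "F t \<in> extensional {0..1}"
    using assms continuous_map_funspace[of "top_of_set (Cube m)" "loop_space X x" F]
    by (auto simp: cube_loops_iff topspace_loop_space based_loops_def)
  moreover have "t(m := undefined) = t"
    using assms(2) by (auto simp: Cube_iff)
  ultimately show ?thesis
    by (auto simp: curry_loop_def uncurry_loop_def extensional_def)
qed

lemma homotopy_group_loop_space:
  assumes m: "1 \<le> m"
  obtains \<Theta> where "\<Theta> \<in> iso (homotopy_group (Suc m) X x) (homotopy_group m (loop_space X x) (\<lambda>s\<in>{0..1}. x))"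
proof -
  let ?c = "\<lambda>s\<in>{0..1::real}. x" and ?L = "loop_space X x"
  define \<Theta> where "\<Theta> = (\<lambda>A. \<Union>f\<in>A. cube_class m ?L ?c (curry_loop m f))"
  have cl: "curry_loop m f \<in> cube_loops m ?L ?c" if "f \<in> cube_loops (Suc m) X x" for f
    using fhom_loops(1)[OF fhom_curry[OF fhom_refl[OF that]]] .
  have \<Theta>: "\<Theta> (cube_class (Suc m) X x f) = cube_class m ?L ?c (curry_loop m f)" if "f \<in> cube_loops (Suc m) X x" for f
    unfolding \<Theta>_def
  proof (rule cube_class_UN[OF that])
    fix f' assume "fhom (Suc m) X (\<lambda>_. x) f f'"
    from cube_classI[OF fhom_curry[OF this]]
    show "cube_class m ?L ?c (curry_loop m f') = cube_class m ?L ?c (curry_loop m f)" by simp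
  qed
  have h: "\<Theta> \<in> hom (homotopy_group (Suc m) X x) (homotopy_group m ?L ?c)"
  proof (rule homI)
    fix A assume "A \<in> carrier (homotopy_group (Suc m) X x)"
    then obtain f where f: "f \<in> cube_loops (Suc m) X x" "A = cube_class (Suc m) X x f"
      by (rule carrier_homotopy_groupE)
    show "\<Theta> A \<in> carrier (homotopy_group m ?L ?c)"
      using \<Theta>[OF f(1)] f(2) cube_class_carrier[OF cl[OF f(1)]] by simp
    fix B assume "B \<in> carrier (homotopy_group (Suc m) X x)"
    then obtain g where g: "g \<in> cube_loops (Suc m) X x" "B = cube_class (Suc m) X x g"
      by (rule carrier_homotopy_groupE)
    have "curry_loop m (concat_at 0 f g) = concat_at 0 (curry_loop m f) (curry_loop m g)"
      using m by (auto simp: curry_loop_def concat_at_def fun_eq_iff fun_upd_twist[of m 0])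
    then show "\<Theta> (A \<otimes>\<^bsub>homotopy_group (Suc m) X x\<^esub> B) = \<Theta> A \<otimes>\<^bsub>homotopy_group m ?L ?c\<^esub> \<Theta> B"
      using concat_loops[OF _ f(1) g(1), of 0]
      by (simp add: f(2) g(2) mult_homotopy_group f(1) g(1) \<Theta> mult_homotopy_group[OF m] cl)
  qed
  have "inj_on \<Theta> (carrier (homotopy_group (Suc m) X x))"
  proof (rule inj_onI)
    fix A B assume AB: "A \<in> carrier (homotopy_group (Suc m) X x)" "B \<in> carrier (homotopy_group (Suc m) X x)" "\<Theta> A = \<Theta> B"
    obtain f where f: "f \<in> cube_loops (Suc m) X x" "A = cube_class (Suc m) X x f"
      using AB(1) by (rule carrier_homotopy_groupE)
    obtain g where g: "g \<in> cube_loops (Suc m) X x" "B = cube_class (Suc m) X x g"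
      using AB(2) by (rule carrier_homotopy_groupE)
    have "fhom m ?L (\<lambda>_. ?c) (curry_loop m f) (curry_loop m g)"
      using AB(3) cube_class_eq_iff[OF cl[OF f(1)] cl[OF g(1)]] by (simp add: f(2) g(2) \<Theta> f(1) g(1))
    from fhom_cong[OF fhom_uncurry[OF this] uncurry_curry uncurry_curry]
    have "fhom (Suc m) X (\<lambda>_. x) f g" by simp
    then show "A = B"
      using cube_classI f(2) g(2) by metis
  qed
  moreover have "carrier (homotopy_group m ?L ?c) \<subseteq> \<Theta> ` carrier (homotopy_group (Suc m) X x)"
  proof
    fix B assume "B \<in> carrier (homotopy_group m ?L ?c)"
    then obtain g where g: "g \<in> cube_loops m ?L ?c" "B = cube_class m ?L ?c g"
      by (rule carrier_homotopy_groupE)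
    have u: "uncurry_loop m g \<in> cube_loops (Suc m) X x"
      using fhom_loops(1)[OF fhom_uncurry[OF fhom_refl[OF g(1)]]] .
    have "fhom m ?L (\<lambda>_. ?c) g (curry_loop m (uncurry_loop m g))"
      by (rule fhom_cong[OF fhom_refl[OF g(1)]]) (simp_all add: curry_uncurry[OF g(1)])
    then have "B = \<Theta> (cube_class (Suc m) X x (uncurry_loop m g))"
      using cube_classI \<Theta>[OF u] g(2) by metis
    then show "B \<in> \<Theta> ` carrier (homotopy_group (Suc m) X x)"
      using cube_class_carrier[OF u] by blast
  qed
  ultimately have "\<Theta> \<in> iso (homotopy_group (Suc m) X x) (homotopy_group m ?L ?c)"
    using h by (auto simp: iso_def bij_betw_def hom_def)
  then show thesis
    by (rule that)
qed

section \<open>The diagonal subgroup of a power\<close>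

definition diagonal_subgroup :: "nat \<Rightarrow> ('a, 'm) monoid_scheme \<Rightarrow> (nat \<Rightarrow> 'a) monoid" where
  "diagonal_subgroup n A = (product_group {..<n} (\<lambda>_. A))\<lparr>carrier := {\<lambda>i\<in>{..<n}. \<alpha> |\<alpha>. \<alpha> \<in> carrier A}\<rparr>"

lemma diagonal_group_eq: "diagonal_group j n X x0 = diagonal_subgroup n (homotopy_group j X x0)"
  by (simp add: diagonal_group_def diagonal_subgroup_def)

lemma carrier_diagonal [simp]: "carrier (diagonal_subgroup n A) = {\<lambda>i\<in>{..<n}. \<alpha> |\<alpha>. \<alpha> \<in> carrier A}"
  and mult_diagonal [simp]: "monoid.mult (diagonal_subgroup n A) = monoid.mult (product_group {..<n} (\<lambda>_. A))"
  and one_diagonal [simp]: "one (diagonal_subgroup n A) = one (product_group {..<n} (\<lambda>_. A))"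
  by (simp_all add: diagonal_subgroup_def)

lemma (in group) group_diagonal: "group (diagonal_subgroup n G)"
proof (rule groupI)
  fix a assume "a \<in> carrier (diagonal_subgroup n G)"
  then obtain \<alpha> where "a = (\<lambda>i\<in>{..<n}. \<alpha>)" "\<alpha> \<in> carrier G"
    by auto
  then have "(\<lambda>i\<in>{..<n}. inv \<alpha>) \<otimes>\<^bsub>diagonal_subgroup n G\<^esub> a = \<one>\<^bsub>diagonal_subgroup n G\<^esub>"
    "(\<lambda>i\<in>{..<n}. inv \<alpha>) \<in> carrier (diagonal_subgroup n G)"
    by auto
  then show "\<exists>b\<in>carrier (diagonal_subgroup n G). b \<otimes>\<^bsub>diagonal_subgroup n G\<^esub> a = \<one>\<^bsub>diagonal_subgroup n G\<^esub>"
    by blast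
  fix b assume "b \<in> carrier (diagonal_subgroup n G)"
  then obtain \<beta> where "b = (\<lambda>i\<in>{..<n}. \<beta>)" "\<beta> \<in> carrier G"
    by auto
  then have "a \<otimes>\<^bsub>diagonal_subgroup n G\<^esub> b = (\<lambda>i\<in>{..<n}. \<alpha> \<otimes> \<beta>)" "\<alpha> \<otimes> \<beta> \<in> carrier G"
    using \<open>a = _\<close> \<open>\<alpha> \<in> carrier G\<close> by auto
  then show "a \<otimes>\<^bsub>diagonal_subgroup n G\<^esub> b \<in> carrier (diagonal_subgroup n G)"
    by auto
qed (auto simp: m_assoc)

text \<open>With \<open>B \<cong> A\<^sup>n\<close> and \<open>C \<cong> A\<^bsup>n-1\<^esup>\<close>, the quotient map is
  \<open>a \<mapsto> (a\<^sub>1 a\<^sub>0\<^sup>-\<^sup>1, \<dots>, a\<^sub>n\<^sub>-\<^sub>1 a\<^sub>0\<^sup>-\<^sup>1)\<close>, split by \<open>c \<mapsto> (1, c)\<close>.\<close>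

lemma split_short_exact_diagonal:
  assumes A: "comm_group A" and B: "group B" and C: "group C" and A': "group A'" and n: "1 \<le> n"
    and \<psi>: "\<psi> \<in> iso B (product_group {..<n} (\<lambda>_. A))"
    and \<theta>: "\<theta> \<in> iso C (product_group {..<n - 1} (\<lambda>_. A'))" and \<Theta>: "\<Theta> \<in> iso A A'"
  obtains f g where "split_short_exact (diagonal_subgroup n A) B C f g"
    "\<And>a. a \<in> carrier (diagonal_subgroup n A) \<Longrightarrow> \<psi> (f a) = a"
proof -
  interpret A: comm_group A by fact
  let ?P = "product_group {..<n} (\<lambda>_. A)" and ?P' = "product_group {..<n - 1} (\<lambda>_. A')"
  define \<psi>i where "\<psi>i = inv_into (carrier B) \<psi>"
  define \<theta>i where "\<theta>i = inv_into (carrier C) \<theta>"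
  define \<Theta>i where "\<Theta>i = inv_into (carrier A) \<Theta>"
  have \<psi>i: "\<psi>i \<in> iso ?P B" and \<theta>i: "\<theta>i \<in> iso ?P' C" and \<Theta>i: "\<Theta>i \<in> iso A' A"
    unfolding \<psi>i_def \<theta>i_def \<Theta>i_def
    using group.iso_set_sym[OF B \<psi>] group.iso_set_sym[OF C \<theta>] group.iso_set_sym[OF _ \<Theta>] A.is_group by auto
  have bij: "bij_betw \<psi> (carrier B) (carrier ?P)" "bij_betw \<theta> (carrier C) (carrier ?P')" "bij_betw \<Theta> (carrier A) (carrier A')"
    using \<psi> \<theta> \<Theta> by (auto simp: iso_def)
  have inv: "\<psi> (\<psi>i a) = a" if "a \<in> carrier ?P" for a
    unfolding \<psi>i_def using bij_betw_inv_into_right[OF bij(1) that] .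
  have inv': "\<psi>i (\<psi> b) = b" if "b \<in> carrier B" for b
    unfolding \<psi>i_def using bij_betw_inv_into_left[OF bij(1) that] .
  have inv2: "\<theta>i (\<theta> c) = c" if "c \<in> carrier C" for c
    unfolding \<theta>i_def using bij_betw_inv_into_left[OF bij(2) that] .
  have inv3: "\<Theta> (\<Theta>i a) = a" if "a \<in> carrier A'" for a
    unfolding \<Theta>i_def using bij_betw_inv_into_right[OF bij(3) that] .
  have inv3': "\<Theta>i (\<Theta> a) = a" if "a \<in> carrier A" for a
    unfolding \<Theta>i_def using bij_betw_inv_into_left[OF bij(3) that] .
  have \<Theta>h: "\<Theta> \<in> hom A A'" "\<Theta>i \<in> hom A' A" using \<Theta> \<Theta>i by (auto simp: iso_def)
  then have \<Theta>c: "\<Theta> a \<in> carrier A'" if "a \<in> carrier A" for a using that by (auto simp: hom_def)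
  have \<Theta>ic: "\<Theta>i a \<in> carrier A" if "a \<in> carrier A'" for a using that \<Theta>h by (auto simp: hom_def)
  define d where "d = (\<lambda>a. \<lambda>i\<in>{..<n - 1}. \<Theta> (a (Suc i) \<otimes>\<^bsub>A\<^esub> inv\<^bsub>A\<^esub> a 0))"
  define e where "e = (\<lambda>c. \<lambda>i\<in>{..<n}. case i of 0 \<Rightarrow> \<one>\<^bsub>A\<^esub> | Suc m \<Rightarrow> \<Theta>i (c m))"
  have ac: "a i \<in> carrier A" if "a \<in> carrier ?P" "i < n" for a i
    using that by auto
  have dh: "d \<in> hom ?P ?P'"
  proof (rule homI)
    show "d a \<in> carrier ?P'" if "a \<in> carrier ?P" for a
      using ac[OF that] n by (auto simp: d_def intro!: \<Theta>c)
    fix a b assume a: "a \<in> carrier ?P" "b \<in> carrier ?P"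
    have "\<Theta> (a (Suc i) \<otimes>\<^bsub>A\<^esub> b (Suc i) \<otimes>\<^bsub>A\<^esub> inv\<^bsub>A\<^esub> (a 0 \<otimes>\<^bsub>A\<^esub> b 0)) =
       \<Theta> (a (Suc i) \<otimes>\<^bsub>A\<^esub> inv\<^bsub>A\<^esub> a 0) \<otimes>\<^bsub>A'\<^esub> \<Theta> (b (Suc i) \<otimes>\<^bsub>A\<^esub> inv\<^bsub>A\<^esub> b 0)" if "i < n - 1" for i
    proof -
      have c: "a (Suc i) \<in> carrier A" "a 0 \<in> carrier A" "b (Suc i) \<in> carrier A" "b 0 \<in> carrier A"
        using that ac[OF a(1)] ac[OF a(2)] by auto
      \<comment> \<open>Regrouping the four factors needs commutativity of \<open>A\<close>; this is
        what makes the quotient map a homomorphism.\<close>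
      then have "a (Suc i) \<otimes>\<^bsub>A\<^esub> b (Suc i) \<otimes>\<^bsub>A\<^esub> inv\<^bsub>A\<^esub> (a 0 \<otimes>\<^bsub>A\<^esub> b 0) =
        (a (Suc i) \<otimes>\<^bsub>A\<^esub> inv\<^bsub>A\<^esub> a 0) \<otimes>\<^bsub>A\<^esub> (b (Suc i) \<otimes>\<^bsub>A\<^esub> inv\<^bsub>A\<^esub> b 0)"
        by (simp add: A.inv_mult A.m_ac)
      then show ?thesis
        using hom_mult[OF \<Theta>h(1)] c by simp
    qed
    then show "d (a \<otimes>\<^bsub>?P\<^esub> b) = d a \<otimes>\<^bsub>?P'\<^esub> d b"
      using n by (auto simp: d_def fun_eq_iff)
  qed
  have eh: "e \<in> hom ?P' ?P"
  proof (rule homI)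
    show "e c \<in> carrier ?P" if "c \<in> carrier ?P'" for c
    proof -
      have "(case i of 0 \<Rightarrow> \<one>\<^bsub>A\<^esub> | Suc m \<Rightarrow> \<Theta>i (c m)) \<in> carrier A" if i: "i < n" for i
      proof (cases i)
        case (Suc m)
        then have "c m \<in> carrier A'"
          using i \<open>c \<in> carrier ?P'\<close> PiE_mem[of c "{..<n - 1}" "\<lambda>_. carrier A'" m] by simp
        then show ?thesis
          by (simp only: Suc nat.case \<Theta>ic)
      qed simp
      then show ?thesis
        by (simp only: e_def carrier_product_group restrict_PiE_iff lessThan_iff) blast
    qed
    show "e (a \<otimes>\<^bsub>?P'\<^esub> b) = e a \<otimes>\<^bsub>?P\<^esub> e b" if "a \<in> carrier ?P'" "b \<in> carrier ?P'" for a b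
    proof (rule extensionalityI[of _ "{..<n}"])
      fix i assume i: "i \<in> {..<n}"
      show "e (a \<otimes>\<^bsub>?P'\<^esub> b) i = (e a \<otimes>\<^bsub>?P\<^esub> e b) i"
      proof (cases i)
        case (Suc m)
        then have "a m \<in> carrier A'" "b m \<in> carrier A'"
          using i that PiE_mem[of _ "{..<n - 1}" "\<lambda>_. carrier A'" m] by simp_all
        then show ?thesis
          using Suc i hom_mult[OF \<Theta>h(2)] by (auto simp: e_def)
      qed (use i in \<open>simp add: e_def\<close>)
    qed (auto simp: e_def)
  qed
  have de: "d (e c) = c" if "c \<in> carrier ?P'" for c
  proof (rule extensionalityI[of _ "{..<n - 1}"])
    fix i assume i: "i \<in> {..<n - 1}"
    then have "c i \<in> carrier A'" using that by auto
    then show "d (e c) i = c i"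
      using i n by (auto simp: d_def e_def inv3 \<Theta>ic)
  qed (use that in \<open>auto simp: d_def PiE_def\<close>)
  have kd: "d a = \<one>\<^bsub>?P'\<^esub> \<longleftrightarrow> a \<in> carrier (diagonal_subgroup n A)" if "a \<in> carrier ?P" for a
  proof
    have \<Theta>1: "\<Theta> \<one>\<^bsub>A\<^esub> = \<one>\<^bsub>A'\<^esub>"
      using hom_one[OF \<Theta>h(1) A.is_group A'] .
    {
      assume da: "d a = \<one>\<^bsub>?P'\<^esub>"
      have "a (Suc i) = a 0" if "Suc i < n" for i
      proof -
        have c: "a (Suc i) \<in> carrier A" "a 0 \<in> carrier A"
          using ac[OF \<open>a \<in> carrier ?P\<close>] that by auto
        have "\<Theta> (a (Suc i) \<otimes>\<^bsub>A\<^esub> inv\<^bsub>A\<^esub> a 0) = \<Theta> \<one>\<^bsub>A\<^esub>"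
          using fun_cong[OF da, of i] less_diff_conv[of i n 1] that by (simp add: d_def \<Theta>1)
        then have "a (Suc i) \<otimes>\<^bsub>A\<^esub> inv\<^bsub>A\<^esub> a 0 = \<one>\<^bsub>A\<^esub>"
          using inv3' c by (metis A.inv_closed A.m_closed A.one_closed)
        then show ?thesis
          using c by (metis A.inv_equality A.inv_inv A.inv_closed)
      qed
      then have a0: "a i = a 0" if "i < n" for i
        using that by (cases i) auto
      have "a = (\<lambda>i\<in>{..<n}. a 0)"
      proof (rule extensionalityI[of _ "{..<n}"])
        show "a \<in> extensional {..<n}"
          using \<open>a \<in> carrier ?P\<close> by (simp add: PiE_def)
        show "a i = (\<lambda>i\<in>{..<n}. a 0) i" if "i \<in> {..<n}" for i
          using a0[of i] that by (simp only: restrict_apply' lessThan_iff)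
      qed simp
      moreover have "a 0 \<in> carrier A"
        using ac[OF \<open>a \<in> carrier ?P\<close>] n by simp
      ultimately show "a \<in> carrier (diagonal_subgroup n A)"
        unfolding carrier_diagonal by blast
    }
    assume "a \<in> carrier (diagonal_subgroup n A)"
    then show "d a = \<one>\<^bsub>?P'\<^esub>"
      using n by (auto simp: d_def fun_eq_iff \<Theta>1)
  qed
  have P: "group ?P" "group ?P'"
    using A' A.is_group by auto
  have sub: "carrier (diagonal_subgroup n A) \<subseteq> carrier ?P"
  proof
    fix a assume "a \<in> carrier (diagonal_subgroup n A)"
    then obtain \<alpha> where "a = (\<lambda>i\<in>{..<n}. \<alpha>)" "\<alpha> \<in> carrier A"
      unfolding carrier_diagonal by blast
    then show "a \<in> carrier ?P"
      by simp
  qed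
  define g where "g = \<theta>i \<circ> (d \<circ> \<psi>)"
  define s where "s = \<psi>i \<circ> (e \<circ> \<theta>)"
  have hs: "\<psi> \<in> hom B ?P" "\<theta> \<in> hom C ?P'" "\<psi>i \<in> hom ?P B" "\<theta>i \<in> hom ?P' C"
    using \<psi> \<theta> \<psi>i \<theta>i by (auto simp: iso_def)
  have g: "g \<in> hom B C"
    unfolding g_def using hs dh by (intro hom_compose)
  have s: "s \<in> hom C B"
    unfolding s_def using hs eh by (intro hom_compose)
  have gs: "g (s c) = c" if "c \<in> carrier C" for c
  proof -
    have "\<theta> c \<in> carrier ?P'" "e (\<theta> c) \<in> carrier ?P"
      using hom_in_carrier[OF hs(2) that] hom_in_carrier[OF eh] by blast+
    then show ?thesis
      by (simp add: g_def s_def inv de inv2 that)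
  qed
  have f: "\<psi>i \<in> mon (diagonal_subgroup n A) B"
  proof -
    have "\<psi>i \<in> hom (diagonal_subgroup n A) B"
    proof (rule homI)
      fix a b assume ab: "a \<in> carrier (diagonal_subgroup n A)" "b \<in> carrier (diagonal_subgroup n A)"
      show "\<psi>i (a \<otimes>\<^bsub>diagonal_subgroup n A\<^esub> b) = \<psi>i a \<otimes>\<^bsub>B\<^esub> \<psi>i b"
        unfolding mult_diagonal using hom_mult[OF hs(3)] sub ab by blast
    qed (use hom_in_carrier[OF hs(3)] sub in blast)
    moreover have "inj_on \<psi>i (carrier (diagonal_subgroup n A))"
      using \<psi>i sub by (auto simp: iso_def bij_betw_def intro: inj_on_subset)
    ultimately show ?thesis by (simp add: mon_def)
  qed
  have "b \<in> \<psi>i ` carrier (diagonal_subgroup n A) \<longleftrightarrow> b \<in> kernel B C g" for b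
  proof -
    have "b \<in> \<psi>i ` carrier (diagonal_subgroup n A) \<longleftrightarrow> b \<in> carrier B \<and> \<psi> b \<in> carrier (diagonal_subgroup n A)"
    proof
      assume "b \<in> \<psi>i ` carrier (diagonal_subgroup n A)"
      then obtain a where "a \<in> carrier (diagonal_subgroup n A)" "b = \<psi>i a"
        by blast
      moreover from this have "a \<in> carrier ?P" using sub by blast
      ultimately show "b \<in> carrier B \<and> \<psi> b \<in> carrier (diagonal_subgroup n A)"
        using inv hs(3) by (auto simp del: carrier_diagonal carrier_product_group simp: hom_def)
    next
      assume "b \<in> carrier B \<and> \<psi> b \<in> carrier (diagonal_subgroup n A)"
      then show "b \<in> \<psi>i ` carrier (diagonal_subgroup n A)"
        using inv' by (metis image_eqI)
    qed
    also have "\<dots> \<longleftrightarrow> b \<in> carrier B \<and> d (\<psi> b) = \<one>\<^bsub>?P'\<^esub>"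
      using kd hs(1) by (auto simp del: carrier_diagonal carrier_product_group one_product_group simp: hom_def)
    also have "\<dots> \<longleftrightarrow> b \<in> carrier B \<and> g b = \<one>\<^bsub>C\<^esub>"
    proof -
      have "g b = \<one>\<^bsub>C\<^esub> \<longleftrightarrow> d (\<psi> b) = \<one>\<^bsub>?P'\<^esub>" if "b \<in> carrier B"
      proof -
        have c: "d (\<psi> b) \<in> carrier ?P'" "\<one>\<^bsub>?P'\<^esub> \<in> carrier ?P'"
          using dh hs(1) that P(2) by (auto simp: hom_def simp del: carrier_product_group one_product_group intro: group.is_monoid monoid.one_closed)
        have "\<theta>i \<one>\<^bsub>?P'\<^esub> = \<one>\<^bsub>C\<^esub>"
          using hom_one[OF hs(4) P(2) C] .
        moreover have "inj_on \<theta>i (carrier ?P')"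
          using \<theta>i by (auto simp: iso_def bij_betw_def)
        ultimately show ?thesis
          using c inj_on_eq_iff[of \<theta>i "carrier ?P'" "d (\<psi> b)" "\<one>\<^bsub>?P'\<^esub>"] by (simp add: g_def del: carrier_product_group one_product_group)
      qed
      then show ?thesis by blast
    qed
    finally show ?thesis
      by (auto simp: kernel_def)
  qed
  then have ker: "\<psi>i ` carrier (diagonal_subgroup n A) = kernel B C g"
    by blast
  have "g ` carrier B = carrier C"
    using gs g s by (auto simp: hom_def) (metis Pi_iff image_eqI)
  then have "split_short_exact (diagonal_subgroup n A) B C \<psi>i g"
    unfolding split_short_exact_def using A.group_diagonal B C f g ker bexI[OF _ s, of "\<lambda>s. \<forall>c\<in>carrier C. g (s c) = c"] gs
    by (auto simp: epi_def)
  moreover have "\<psi> (\<psi>i a) = a" if "a \<in> carrier (diagonal_subgroup n A)" for a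
    using inv sub that by blast
  ultimately show thesis
    by (rule that)
qed

text \<open>The algebraic splitting is fed with the identification of the homotopy group of the
  power, the same identification for loop spaces one dimension lower, and the adjunction between
  them. Commutativity comes from 2 \<le> j, and 1 \<le> j - 1 makes the third term a group.\<close>

theorem (in power_paths) split_short_exact_loop_space:
  assumes "2 \<le> j" "1 \<le> n"
  shows "\<exists>f g. split_short_exact (diagonal_group j n X x0) (homotopy_group j (power_space n X) x)
         (homotopy_group (j - 1) (power_space (n - 1) (loop_space X x0)) (\<lambda>i\<in>{..<n - 1}. \<lambda>t\<in>{0..1}. x0)) f g \<and>
       (\<forall>a\<in>carrier (diagonal_group j n X x0). power_identification j n X x \<gamma> (f a) = a)"
proof -
  let ?c = "\<lambda>t\<in>{0..1::real}. x0"
  have x0: "x0 \<in> topspace X"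
    using \<gamma>(1,3)[of 0] assms(2) continuous_map_funspace[of "top_of_set {0..1}" X "\<gamma> 0"] by (auto simp: pathin_def)
  have "continuous_map (top_of_set {0..1}) X ?c"
    by (rule continuous_map_eq[of _ _ "\<lambda>_. x0"]) (use x0 in auto)
  then have c: "?c \<in> topspace (loop_space X x0)"
    by (auto simp: topspace_loop_space based_loops_def pathin_def)
  interpret L: power_paths "j - 1" "n - 1" "loop_space X x0" "\<lambda>i\<in>{..<n - 1}. ?c" ?c "\<lambda>_ _. ?c"
    using assms(1) c by unfold_locales (auto simp: pathin_const)
  obtain m where m: "j = Suc m" "1 \<le> m"
    using assms(1) by (cases j) auto
  obtain \<Theta> where \<Theta>: "\<Theta> \<in> iso (homotopy_group j X x0) (homotopy_group (j - 1) (loop_space X x0) ?c)"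
    using homotopy_group_loop_space[OF m(2), of X x0] m(1) by auto
  obtain f g where "split_short_exact (diagonal_subgroup n (homotopy_group j X x0)) (homotopy_group j (power_space n X) x)
         (homotopy_group (j - 1) (power_space (n - 1) (loop_space X x0)) (\<lambda>i\<in>{..<n - 1}. ?c)) f g"
    "\<And>a. a \<in> carrier (diagonal_subgroup n (homotopy_group j X x0)) \<Longrightarrow> pid (f a) = a"
    using split_short_exact_diagonal[OF comm_group_homotopy_group[OF assms(1) x0] group_homotopy_group[OF j x]
        group_homotopy_group[OF L.j L.x] group_homotopy_group[OF L.j c] assms(2) pid_iso L.pid_iso \<Theta>] by blast
  then show ?thesis
    unfolding diagonal_group_eq by blast
qed

section \<open>Homotopy lifting by local transport\<close>

lemma compact_space_top_of_set: "compact_space (top_of_set A) \<longleftrightarrow> compact A"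
  using compactin_subspace[of euclidean A] by simp

lemma connected_space_top_of_set: "connected_space (top_of_set A) \<longleftrightarrow> connected A"
  using connectedin_def[of euclidean A] by simp

lemma openin_Collect_less:
  fixes f :: "'a::topological_space \<Rightarrow> real"
  assumes "continuous_on A f"
  shows "openin (top_of_set A) {q \<in> A. f q < c}"
proof -
  have "continuous_map (top_of_set A) euclideanreal f"
    using assms by simp
  from openin_continuous_map_preimage[OF this, of "{..<c}"] show ?thesis
    by simp
qed

text \<open>A Lebesgue number: the triples (s, s', t) violating the condition form a compact set off
  the diagonal, and the least distance between s and s' on it serves as
  \<open>\<delta>\<close>.\<close>

lemma homotopy_uniform:
  fixes K :: "'k::metric_space set" and h :: "real \<times> 'k \<Rightarrow> 'b"
  assumes K: "compact K" and h: "continuous_map (top_of_set ({0..1} \<times> K)) B h"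
    and V: "openin (prod_topology B B) V" "\<And>b. b \<in> topspace B \<Longrightarrow> (b, b) \<in> V"
  obtains \<delta> where "\<delta> > 0" "\<And>t s s'. t \<in> K \<Longrightarrow> s \<in> {0..1} \<Longrightarrow> s' \<in> {0..1} \<Longrightarrow> dist s s' < \<delta> \<Longrightarrow> (h (s, t), h (s', t)) \<in> V"
proof -
  define Q where "Q = ({0..1::real} \<times> {0..1::real}) \<times> K"
  define C where "C = {q \<in> Q. (h (fst (fst q), snd q), h (snd (fst q), snd q)) \<notin> V}"
  have hB: "h p \<in> topspace B" if "p \<in> {0..1} \<times> K" for p
    using continuous_map_funspace[OF h] that by auto
  have c: "continuous_map (top_of_set Q) (prod_topology B B) (\<lambda>q. (h (fst (fst q), snd q), h (snd (fst q), snd q)))"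
    by (intro continuous_map_pairedI; rule continuous_map_compose_on[OF h])
      (auto simp: Q_def intro!: continuous_on_Pair continuous_on_fst continuous_on_snd continuous_on_id)
  have "openin (top_of_set Q) {q \<in> Q. (h (fst (fst q), snd q), h (snd (fst q), snd q)) \<in> V}"
    using openin_continuous_map_preimage[OF c V(1)] by simp
  moreover have "C = Q - {q \<in> Q. (h (fst (fst q), snd q), h (snd (fst q), snd q)) \<in> V}"
    by (auto simp: C_def)
  ultimately have "closedin (top_of_set Q) C"
    by (simp add: closedin_diff)
  moreover have "compact Q"
    unfolding Q_def by (intro compact_Times compact_Icc K)
  ultimately have C: "compact C"
    using closedin_compact by blast
  show thesis
  proof (cases "C = {}")
    case True
    then show thesis
      by (intro that[of 1]) (auto simp: C_def Q_def)
  next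
    case False
    have "continuous_on C (\<lambda>q. dist (fst (fst q)) (snd (fst q)))"
      by (intro continuous_on_dist continuous_on_fst continuous_on_snd continuous_on_id)
    then obtain q where q: "q \<in> C" "\<And>r. r \<in> C \<Longrightarrow> dist (fst (fst q)) (snd (fst q)) \<le> dist (fst (fst r)) (snd (fst r))"
      using continuous_attains_inf[OF C False] by blast
    have "fst (fst q) \<noteq> snd (fst q)"
      using q(1) V(2) hB by (auto simp: C_def Q_def)
    then have "0 < dist (fst (fst q)) (snd (fst q))"
      by simp
    then show thesis
    proof (rule that)
      fix t and s s' :: real assume "t \<in> K" "s \<in> {0..1}" "s' \<in> {0..1}" "dist s s' < dist (fst (fst q)) (snd (fst q))"
      then show "(h (s, t), h (s', t)) \<in> V"
        using q(2)[of "((s, s'), t)"] by (auto simp: C_def Q_def)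
    qed
  qed
qed

text \<open>\<open>T\<close> is a local transport: it moves a point over \<open>p e\<close> to one over a nearby \<open>b\<close>.\<close>

lemma regular_homotopy_lift:
  fixes K :: "'k::metric_space set" and h :: "real \<times> 'k \<Rightarrow> 'b"
  assumes V: "openin (prod_topology B B) V" "\<And>b. b \<in> topspace B \<Longrightarrow> (b, b) \<in> V"
    and T: "continuous_map (subtopology (prod_topology E B) {(e, b). (p e, b) \<in> V}) E T"
    and Tp: "\<And>e b. e \<in> topspace E \<Longrightarrow> b \<in> topspace B \<Longrightarrow> (p e, b) \<in> V \<Longrightarrow> p (T (e, b)) = b"
    and T0: "\<And>e. e \<in> topspace E \<Longrightarrow> T (e, p e) = e"
    and K: "compact K" and h: "continuous_map (top_of_set ({0..1} \<times> K)) B h"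
    and e0: "continuous_map (top_of_set K) E e0" "\<And>t. t \<in> K \<Longrightarrow> p (e0 t) = h (0, t)"
  obtains H where "continuous_map (top_of_set ({0..1} \<times> K)) E H"
    "\<And>s t. s \<in> {0..1} \<Longrightarrow> t \<in> K \<Longrightarrow> p (H (s, t)) = h (s, t)" "\<And>t. t \<in> K \<Longrightarrow> H (0, t) = e0 t"
    "\<And>s t. s \<in> {0..1} \<Longrightarrow> t \<in> K \<Longrightarrow> (\<And>s'. s' \<in> {0..1} \<Longrightarrow> h (s', t) = h (0, t)) \<Longrightarrow> H (s, t) = e0 t"
proof -
  obtain \<delta> where \<delta>: "\<delta> > 0" "\<And>t s s'. t \<in> K \<Longrightarrow> s \<in> {0..1} \<Longrightarrow> s' \<in> {0..1} \<Longrightarrow> dist s s' < \<delta> \<Longrightarrow> (h (s, t), h (s', t)) \<in> V"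
    using homotopy_uniform[OF K h V] by blast
  obtain N where N: "N > 0" "1 / real N < \<delta>"
    using \<delta>(1) nat_approx_posE[OF \<delta>(1)] by (metis of_nat_0_less_iff zero_less_Suc)
  have hB: "h q \<in> topspace B" if "q \<in> {0..1} \<times> K" for q
    using continuous_map_funspace[OF h] that by auto
  \<comment> \<open>The last conjunct keeps every stationary track fixed; this is what later turns
    lifts into homotopies relative to the boundary.\<close>
  define good where "good = (\<lambda>i H. continuous_map (top_of_set ({0..real i / N} \<times> K)) E H \<and>
    (\<forall>s\<in>{0..real i / N}. \<forall>t\<in>K. p (H (s, t)) = h (s, t)) \<and> (\<forall>t\<in>K. H (0, t) = e0 t) \<and>
    (\<forall>s\<in>{0..real i / N}. \<forall>t\<in>K. (\<forall>s'\<in>{0..1}. h (s', t) = h (0, t)) \<longrightarrow> H (s, t) = e0 t))"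
  have "\<exists>H. good i H" if "i \<le> N" for i
    using that
  proof (induction i)
    case 0
    have "continuous_map (top_of_set ({0..0::real} \<times> K)) E (\<lambda>q. e0 (snd q))"
      by (rule continuous_map_compose_on[OF e0(1)]) (auto intro!: continuous_on_snd continuous_on_id)
    then show ?case
      using e0(2) by (intro exI[of _ "\<lambda>q. e0 (snd q)"]) (auto simp: good_def)
  next
    case (Suc i)
    then obtain H where H: "good i H" by auto
    define c where "c = real i / N"
    define c' where "c' = real (Suc i) / N"
    have c: "0 \<le> c" "c \<le> c'" "c' \<le> 1" "c' - c = 1 / N"
      using N(1) Suc.prems by (auto simp: c_def c'_def field_simps)
    note H = H[unfolded good_def c_def[symmetric]]
    have HE: "H q \<in> topspace E" if "q \<in> {0..c} \<times> K" for q
      using continuous_map_funspace[of "top_of_set ({0..c} \<times> K)" E H] H that by auto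
    have near: "(p (H (c, t)), h (s, t)) \<in> V" if "s \<in> {c..c'}" "t \<in> K" for s t
    proof -
      have "dist c s < \<delta>" using that c N by (auto simp: dist_real_def)
      then have "(h (c, t), h (s, t)) \<in> V" using \<delta>(2)[of t c s] that c by auto
      then show ?thesis using H that c by auto
    qed
    \<comment> \<open>On the new strip each point is transported directly from its position at time
      \<open>c\<close>. The strip is narrower than \<open>\<delta>\<close>, so the transport is
      defined, and at time \<open>c\<close> it is the identity by \<open>T0\<close>.\<close>
    define H' where "H' = (\<lambda>q. if fst q \<le> c then H q else T (H (c, snd q), h q))"
    have "continuous_map (top_of_set ({0..c'} \<times> K)) E H'"
      unfolding H'_def
    proof (rule continuous_map_paste_le)
      show "continuous_on ({0..c'} \<times> K) fst" by (intro continuous_on_fst continuous_on_id)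
      show "continuous_map (top_of_set {z \<in> {0..c'} \<times> K. fst z \<le> c}) E H"
        by (rule continuous_map_compose_on[of "{0..c} \<times> K" E H _ "\<lambda>z. z"]) (use H in auto)
      let ?Z = "{z \<in> {0..c'} \<times> K. c \<le> fst z}"
      have "continuous_map (top_of_set ?Z) E (\<lambda>z. H (c, snd z))"
        by (rule continuous_map_compose_on[of "{0..c} \<times> K" E H])
          (use H c in \<open>auto intro!: continuous_on_Pair continuous_on_snd continuous_on_id\<close>)
      moreover have "continuous_map (top_of_set ?Z) B h"
        by (rule continuous_map_compose_on[of "{0..1} \<times> K" B h _ "\<lambda>z. z"]) (use h c in auto)
      ultimately have "continuous_map (top_of_set ?Z) (prod_topology E B) (\<lambda>z. (H (c, snd z), h z))"
        by (rule continuous_map_pairedI)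
      then have "continuous_map (top_of_set ?Z) (subtopology (prod_topology E B) {(e, b). (p e, b) \<in> V}) (\<lambda>z. (H (c, snd z), h z))"
        unfolding continuous_map_in_subtopology using near by auto
      from continuous_map_compose[OF this T]
      show "continuous_map (top_of_set ?Z) E (\<lambda>z. T (H (c, snd z), h z))"
        by (simp add: o_def)
    next
      fix z assume "z \<in> {0..c'} \<times> K" "fst z = c"
      then show "H z = T (H (c, snd z), h z)"
        using T0[OF HE[of z]] H c by (cases z) auto
    qed
    moreover have "p (H' (s, t)) = h (s, t)" if "s \<in> {0..c'}" "t \<in> K" for s t
    proof (cases "s \<le> c")
      case False
      then show ?thesis
        using Tp[OF HE[of "(c, t)"] hB[of "(s, t)"] near] that c by (auto simp: H'_def)
    qed (use H that in \<open>auto simp: H'_def\<close>)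
    moreover have "H' (s, t) = e0 t" if st: "s \<in> {0..c'}" "t \<in> K" "\<forall>s'\<in>{0..1}. h (s', t) = h (0, t)" for s t
    proof -
      have stat: "H (r, t) = e0 t" if "r \<in> {0..c}" for r
        using H st(2,3) that by blast
      show ?thesis
      proof (cases "s \<le> c")
        case True
        then have "s \<in> {0..c}" using st(1) by simp
        with stat[OF this] True show ?thesis by (simp only: H'_def fst_conv if_True)
      next
        case False
        have cc: "c \<in> {0..c}" "c \<in> {0..1}" "s \<in> {0..1}" using c st(1) by auto
        have eq: "h (s, t) = h (c, t)"
          using bspec[OF st(3) cc(2)] bspec[OF st(3) cc(3)] by (simp only:)
        have ph: "p (H (c, t)) = h (c, t)"
          using H cc(1) st(2) by blast
        have "H (c, t) \<in> topspace E"
          using HE cc(1) st(2) by blast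
        from T0[OF this] have "T (H (c, t), h (s, t)) = H (c, t)"
          unfolding ph eq .
        with stat[OF cc(1)] False show ?thesis by (simp only: H'_def fst_conv snd_conv if_False)
      qed
    qed
    moreover have "H' (0, t) = e0 t" if "t \<in> K" for t
      using H that c by (auto simp: H'_def)
    ultimately have "good (Suc i) H'"
      unfolding good_def c'_def by blast
    then show ?case by blast
  qed
  from this[of N] obtain H where H: "good N H" by auto
  have N1: "real N / N = 1"
    using N(1) by simp
  note H = H[unfolded good_def N1]
  show thesis
    by (rule that[of H]) (use H in blast)+
qed

lemma open_map_prod_map:
  assumes f: "open_map X X' f" and g: "open_map Y Y' g"
  shows "open_map (prod_topology X Y) (prod_topology X' Y') (\<lambda>(x, y). (f x, g y))"
  unfolding open_map_def
proof (intro allI impI)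
  fix W assume W: "openin (prod_topology X Y) W"
  show "openin (prod_topology X' Y') ((\<lambda>(x, y). (f x, g y)) ` W)"
  proof (subst openin_subopen, intro ballI)
    fix q assume "q \<in> (\<lambda>(x, y). (f x, g y)) ` W"
    then obtain x y where xy: "(x, y) \<in> W" "q = (f x, g y)"
      by auto
    obtain A C where AC: "openin X A" "openin Y C" "x \<in> A" "y \<in> C" "A \<times> C \<subseteq> W"
      using openin_prod_topology_alt[THEN iffD1, OF W] xy(1) by metis
    have "openin (prod_topology X' Y') ((f ` A) \<times> (g ` C))"
      using f g AC by (simp add: open_map_def openin_prod_Times_iff)
    moreover have "q \<in> (f ` A) \<times> (g ` C)" using xy AC by auto
    moreover have "(f ` A) \<times> (g ` C) \<subseteq> (\<lambda>(x, y). (f x, g y)) ` W"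
      using AC(5) by force
    ultimately show "\<exists>T. openin (prod_topology X' Y') T \<and> q \<in> T \<and> T \<subseteq> (\<lambda>(x, y). (f x, g y)) ` W"
      by blast
  qed
qed

section \<open>The sphere\<close>

definition Sph :: "nat \<Rightarrow> (nat \<Rightarrow> real) set" where
  "Sph k = {x. (\<Sum>i\<le>k. (x i)\<^sup>2) = 1 \<and> (\<forall>i>k. x i = 0)}"

lemma nsphere_eq: "nsphere k = top_of_set (Sph k)"
  by (simp add: nsphere Sph_def euclidean_product_topology)

lemma topspace_nsphere [simp]: "topspace (nsphere k) = Sph k"
  by (simp add: nsphere_eq)

lemma compact_Sph: "compact (Sph k)"
proof -
  define A where "A = (\<lambda>i. if i \<le> k then {-1..1} else {0::real})"
  have "compact_space (product_topology (\<lambda>i. top_of_set (A i)) UNIV)"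
    unfolding compact_space_product_topology
    by (auto simp: A_def compact_space_top_of_set)
  then have "compact (PiE UNIV A)"
    by (simp add: product_topology_top_of_set compact_space_top_of_set)
  moreover have "closed (Sph k)"
  proof -
    have "Sph k = {x. (\<Sum>i\<le>k. (x i)\<^sup>2) = 1} \<inter> (\<Inter>i\<in>{k<..}. {x. x i = 0})"
      by (auto simp: Sph_def)
    also have "closed \<dots>"
      by (intro closed_Int closed_INT ballI closed_Collect_eq continuous_intros)
    finally show ?thesis .
  qed
  moreover have "Sph k \<subseteq> PiE UNIV A"
  proof
    fix x assume x: "x \<in> Sph k"
    have "\<bar>x i\<bar> \<le> 1" if "i \<le> k" for i
    proof -
      have "(x i)\<^sup>2 \<le> (\<Sum>i\<le>k. (x i)\<^sup>2)"
        using that by (intro member_le_sum) auto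
      then show ?thesis
        using x by (simp add: Sph_def abs_square_le_1)
    qed
    then show "x \<in> PiE UNIV A"
      using x by (auto simp: A_def Sph_def abs_le_iff minus_le_iff)
  qed
  ultimately show ?thesis
    using compact_Int_closed[of "PiE UNIV A" "Sph k"] by (simp add: Int_absorb1)
qed

definition edist :: "nat \<Rightarrow> (nat \<Rightarrow> real) \<Rightarrow> (nat \<Rightarrow> real) \<Rightarrow> real" where
  "edist k z w = L2_set (\<lambda>i. z i - w i) {..k}"

lemma edist_nonneg: "0 \<le> edist k z w"
  and edist_self [simp]: "edist k z z = 0"
  by (simp_all add: edist_def L2_set_0')

lemma edist_commute: "edist k z w = edist k w z"
  by (simp add: edist_def L2_set_def power2_commute)

lemma edist_triangle: "edist k z w \<le> edist k z u + edist k u w"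
  using L2_set_triangle_ineq[of "\<lambda>i. z i - u i" "\<lambda>i. u i - w i" "{..k}"] by (simp add: edist_def)

lemma edist_eq_0:
  assumes "z \<in> Sph k" "w \<in> Sph k"
  shows "edist k z w = 0 \<longleftrightarrow> z = w"
proof
  assume "edist k z w = 0"
  then have "z i = w i" if "i \<le> k" for i
    using that by (simp add: edist_def L2_set_eq_0_iff)
  moreover have "z i = w i" if "\<not> i \<le> k" for i
    using assms that by (simp add: Sph_def)
  ultimately show "z = w"
    by (intro ext) metis
qed simp

lemma continuous_on_edist:
  assumes "continuous_on A f" "continuous_on A g"
  shows "continuous_on A (\<lambda>p. edist k (f p) (g p))"
  unfolding edist_def L2_set_def
  by (intro continuous_intros continuous_on_product_then_coordinatewise[OF assms(1)]
      continuous_on_product_then_coordinatewise[OF assms(2)])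

section \<open>Free quotients of spheres\<close>

text \<open>The quotient is an abstract open surjection whose fibres are the orbits. Besides the
  orbit space this covers the sphere itself with the identity map for the trivial group, which is
  the form needed when base points are points of the sphere and not singleton orbits.\<close>

locale free_quotient =
  fixes k :: nat and G :: "('g, 'm) monoid_scheme" and \<phi> :: "'g \<Rightarrow> (nat \<Rightarrow> real) \<Rightarrow> (nat \<Rightarrow> real)"
    and X :: "'b topology" and P :: "(nat \<Rightarrow> real) \<Rightarrow> 'b"
  assumes k3: "3 \<le> k" and odd_k: "odd k"
    and G: "group G" "finite (carrier G)" "free_continuous_action G (nsphere k) \<phi>"
    and P: "continuous_map (nsphere k) X P" "open_map (nsphere k) X P" "P ` Sph k = topspace X"
    and P_eq: "\<And>z w. z \<in> Sph k \<Longrightarrow> w \<in> Sph k \<Longrightarrow> P z = P w \<longleftrightarrow> (\<exists>g\<in>carrier G. w = \<phi> g z)"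
begin

abbreviation "S \<equiv> Sph k"
abbreviation "d \<equiv> edist k"

lemma act: "g \<in> carrier G \<Longrightarrow> z \<in> S \<Longrightarrow> \<phi> g z \<in> S"
  and act_cont: "g \<in> carrier G \<Longrightarrow> continuous_on S (\<phi> g)"
  and act_one: "z \<in> S \<Longrightarrow> \<phi> \<one>\<^bsub>G\<^esub> z = z"
  and act_mult: "g \<in> carrier G \<Longrightarrow> g' \<in> carrier G \<Longrightarrow> z \<in> S \<Longrightarrow> \<phi> (g \<otimes>\<^bsub>G\<^esub> g') z = \<phi> g (\<phi> g' z)"
  and act_free: "g \<in> carrier G \<Longrightarrow> z \<in> S \<Longrightarrow> \<phi> g z = z \<Longrightarrow> g = \<one>\<^bsub>G\<^esub>"
proof -
  have ga: "group_action G S \<phi>"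
    using G(3) by (simp add: free_continuous_action_def)
  show "g \<in> carrier G \<Longrightarrow> z \<in> S \<Longrightarrow> \<phi> g z \<in> S"
    using group_action.surj_prop[OF ga] by blast
  show "g \<in> carrier G \<Longrightarrow> continuous_on S (\<phi> g)"
    using G(3) by (auto simp: free_continuous_action_def nsphere_eq continuous_map_in_subtopology)
  show "z \<in> S \<Longrightarrow> \<phi> \<one>\<^bsub>G\<^esub> z = z"
    using group_action.id_eq_one[OF ga] by (metis restrict_apply')
  show "g \<in> carrier G \<Longrightarrow> g' \<in> carrier G \<Longrightarrow> z \<in> S \<Longrightarrow> \<phi> (g \<otimes>\<^bsub>G\<^esub> g') z = \<phi> g (\<phi> g' z)"
    using group_action.composition_rule[OF ga] by blast
  show "g \<in> carrier G \<Longrightarrow> z \<in> S \<Longrightarrow> \<phi> g z = z \<Longrightarrow> g = \<one>\<^bsub>G\<^esub>"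
    using G(3) unfolding free_continuous_action_def topspace_nsphere by blast
qed

lemma act_inv: "g \<in> carrier G \<Longrightarrow> z \<in> S \<Longrightarrow> \<phi> (inv\<^bsub>G\<^esub> g) (\<phi> g z) = z"
  and act_inv': "g \<in> carrier G \<Longrightarrow> z \<in> S \<Longrightarrow> \<phi> g (\<phi> (inv\<^bsub>G\<^esub> g) z) = z"
  by (simp_all add: act_mult[symmetric] group.inv_closed[OF G(1)] group.l_inv[OF G(1)] group.r_inv[OF G(1)] act_one)

lemma P_act: "g \<in> carrier G \<Longrightarrow> z \<in> S \<Longrightarrow> P (\<phi> g z) = P z"
  using P_eq[of z "\<phi> g z"] act by fastforce

lemma P_in: "z \<in> S \<Longrightarrow> P z \<in> topspace X"
  using P(3) by blast

text \<open>A nontrivial group element has no fixed points, so its displacement has a positive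
  minimum on the compact sphere; the group is finite, so a least such minimum exists.\<close>

lemma separation: "\<exists>\<epsilon>>0. \<forall>z\<in>S. \<forall>w\<in>S. P z = P w \<longrightarrow> d z w < \<epsilon> \<longrightarrow> z = w"
proof -
  have one: "\<exists>\<epsilon>>0. \<forall>z\<in>S. d z (\<phi> g z) < \<epsilon> \<longrightarrow> g = \<one>\<^bsub>G\<^esub>" if g: "g \<in> carrier G" for g
  proof (cases "g = \<one>\<^bsub>G\<^esub>")
    case False
    have "continuous_on S (\<lambda>z. d z (\<phi> g z))"
      by (intro continuous_on_edist continuous_on_id act_cont g)
    moreover have "S \<noteq> {}"
      using in_topspace_nsphere[of k] by auto
    ultimately obtain z where z: "z \<in> S" "\<And>w. w \<in> S \<Longrightarrow> d z (\<phi> g z) \<le> d w (\<phi> g w)"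
      using continuous_attains_inf[OF compact_Sph] by blast
    have "d z (\<phi> g z) \<noteq> 0"
      using edist_eq_0[of z k "\<phi> g z"] act[OF g z(1)] z(1) act_free[OF g z(1)] False by auto
    then have "0 < d z (\<phi> g z)"
      using edist_nonneg[of k z "\<phi> g z"] by simp
    then show ?thesis
      using z(2) by (intro exI[of _ "d z (\<phi> g z)"]) (meson linorder_not_less)
  qed (auto intro: exI[of _ 1])
  then obtain e where e: "\<And>g. g \<in> carrier G \<Longrightarrow> 0 < e g" "\<And>g z. g \<in> carrier G \<Longrightarrow> z \<in> S \<Longrightarrow> d z (\<phi> g z) < e g \<Longrightarrow> g = \<one>\<^bsub>G\<^esub>"
    by metis
  have ne: "e ` carrier G \<noteq> {}"
    using group.is_monoid[OF G(1)] monoid.one_closed by blast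
  show ?thesis
  proof (intro exI[of _ "Min (e ` carrier G)"] conjI ballI impI)
    show "0 < Min (e ` carrier G)"
      using e(1) ne G(2) by (subst Min_gr_iff) auto
    fix z w assume zw: "z \<in> S" "w \<in> S" "P z = P w" "d z w < Min (e ` carrier G)"
    then obtain g where g: "g \<in> carrier G" "w = \<phi> g z"
      using P_eq by blast
    then have "Min (e ` carrier G) \<le> e g"
      using G(2) by (intro Min_le) auto
    with zw g e(2) have "g = \<one>\<^bsub>G\<^esub>"
      by force
    then show "z = w"
      using g act_one zw by simp
  qed
qed

definition \<epsilon> :: real where
  "\<epsilon> = (SOME \<epsilon>. \<epsilon> > 0 \<and> (\<forall>z\<in>S. \<forall>w\<in>S. P z = P w \<longrightarrow> d z w < \<epsilon> \<longrightarrow> z = w))"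

lemma \<epsilon>: "\<epsilon> > 0" "z \<in> S \<Longrightarrow> w \<in> S \<Longrightarrow> P z = P w \<Longrightarrow> d z w < \<epsilon> \<Longrightarrow> z = w"
  using someI_ex[OF separation] unfolding \<epsilon>_def by blast+

subsection \<open>Lifting to the sphere\<close>

text \<open>The point over \<open>snd q\<close> next to \<open>fst q\<close>. Radius \<epsilon>/2
  gives uniqueness: two candidates would be closer than \<epsilon> and lie in one orbit.\<close>

definition sheet :: "(nat \<Rightarrow> real) \<times> 'b \<Rightarrow> (nat \<Rightarrow> real)" where
  "sheet q = (THE z'. z' \<in> S \<and> P z' = snd q \<and> d (fst q) z' < \<epsilon>/2)"

text \<open>Closeness is demanded for all translates of the pair simultaneously. Therefore,
  whichever lift of the first point is prescribed, a lift of the second point is found within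
  \<epsilon>/2 of it, without an invariant metric.\<close>

definition near :: "('b \<times> 'b) set" where
  "near = (\<lambda>(z, z'). (P z, P z')) ` {q \<in> S \<times> S. \<forall>g\<in>carrier G. d (\<phi> g (fst q)) (\<phi> g (snd q)) < \<epsilon>/2}"

lemma openin_near: "openin (prod_topology X X) near"
proof -
  have "openin (top_of_set (S \<times> S)) {q \<in> S \<times> S. \<forall>g\<in>carrier G. d (\<phi> g (fst q)) (\<phi> g (snd q)) < \<epsilon>/2}"
  proof -
    have "openin (top_of_set (S \<times> S)) {q \<in> S \<times> S. d (\<phi> g (fst q)) (\<phi> g (snd q)) < \<epsilon>/2}" if "g \<in> carrier G" for g
      using that by (intro openin_Collect_less continuous_on_edist
          continuous_on_compose2[OF act_cont, of g] continuous_on_fst continuous_on_snd continuous_on_id) auto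
    then have "openin (top_of_set (S \<times> S)) (S \<times> S \<inter> (\<Inter>g\<in>carrier G. {q \<in> S \<times> S. d (\<phi> g (fst q)) (\<phi> g (snd q)) < \<epsilon>/2}))"
      using G(2) openin_Int_Inter[of "(\<lambda>g. {q \<in> S \<times> S. d (\<phi> g (fst q)) (\<phi> g (snd q)) < \<epsilon>/2}) ` carrier G" "top_of_set (S \<times> S)" "S \<times> S"]
      by auto
    moreover have "S \<times> S \<inter> (\<Inter>g\<in>carrier G. {q \<in> S \<times> S. d (\<phi> g (fst q)) (\<phi> g (snd q)) < \<epsilon>/2})
      = {q \<in> S \<times> S. \<forall>g\<in>carrier G. d (\<phi> g (fst q)) (\<phi> g (snd q)) < \<epsilon>/2}"
      by auto
    ultimately show ?thesis by simp
  qed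
  then show ?thesis
    using open_map_prod_map[OF P(2) P(2)] unfolding near_def open_map_def by (simp add: nsphere_eq)
qed

lemma near_refl: "b \<in> topspace X \<Longrightarrow> (b, b) \<in> near"
  unfolding near_def P(3)[symmetric] using \<epsilon>(1) by (auto intro!: image_eqI[of _ _ "(_, _)"])

lemma sheet_eq:
  assumes "z \<in> S" "z' \<in> S" "d z z' < \<epsilon>/2"
  shows "sheet (z, P z') = z'"
  unfolding sheet_def
proof (rule the_equality)
  fix w assume w: "w \<in> S \<and> P w = snd (z, P z') \<and> d (fst (z, P z')) w < \<epsilon>/2"
  then have "d w z' < \<epsilon>"
    using edist_triangle[of k w z' z] edist_commute[of k w z] assms(3) by auto
  then show "w = z'"
    using \<epsilon>(2)[of w z'] w assms by auto
qed (use assms in auto)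

lemma near_sheet:
  assumes "z \<in> S" "(P z, b) \<in> near"
  obtains z' where "z' \<in> S" "b = P z'" "d z z' < \<epsilon>/2"
proof -
  obtain w w' where w: "w \<in> S" "w' \<in> S" "P z = P w" "b = P w'" "\<And>g. g \<in> carrier G \<Longrightarrow> d (\<phi> g w) (\<phi> g w') < \<epsilon>/2"
    using assms(2) by (auto simp: near_def)
  then obtain g where "g \<in> carrier G" "z = \<phi> g w"
    using P_eq[of w z] assms(1) by auto
  then show thesis
    using w by (intro that[of "\<phi> g w'"]) (auto simp: act P_act)
qed

text \<open>The preimage of an open \<open>U\<close> consists of the admissible (z, P z') with z' in
  \<open>U\<close> close to z; it is the image of an open set under the open map that is the
  identity on the first factor and \<open>P\<close> on the second.\<close>

lemma sheet_cont: "continuous_map (subtopology (prod_topology (nsphere k) X) {(z, b). (P z, b) \<in> near}) (nsphere k) sheet"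
  (is "continuous_map ?Y _ _")
  unfolding continuous_map_def
proof (intro conjI allI impI)
  have Y: "topspace ?Y = {(z, b). z \<in> S \<and> b \<in> topspace X \<and> (P z, b) \<in> near}"
    by auto
  have near: "\<exists>z'. z' \<in> S \<and> b = P z' \<and> d z z' < \<epsilon>/2 \<and> sheet (z, b) = z'" if q: "(z, b) \<in> topspace ?Y" for z b
  proof -
    have zb: "z \<in> S" "(P z, b) \<in> near"
      using q by auto
    obtain z' where z': "z' \<in> S" "b = P z'" "d z z' < \<epsilon>/2"
      by (rule near_sheet[OF zb])
    show ?thesis
      using z' sheet_eq[OF zb(1) z'(1,3)] by (intro exI[of _ z']) simp
  qed
  show "sheet \<in> topspace ?Y \<rightarrow> topspace (nsphere k)"
  proof
    fix q assume q: "q \<in> topspace ?Y"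
    obtain z b where zb: "q = (z, b)" by (cases q)
    from near[OF q[unfolded zb]] show "sheet q \<in> topspace (nsphere k)"
      unfolding zb topspace_nsphere by auto
  qed
  fix U assume U: "openin (nsphere k) U"
  then have US: "U \<subseteq> S" using openin_subset by fastforce
  have "openin (top_of_set (S \<times> S)) {q \<in> S \<times> S. d (fst q) (snd q) < \<epsilon>/2}"
    by (intro openin_Collect_less continuous_on_edist continuous_on_fst continuous_on_snd continuous_on_id)
  moreover have "openin (top_of_set (S \<times> S)) (S \<times> U)"
    using U openin_prod_Times_iff[of "nsphere k" "nsphere k" S U] openin_topspace[of "nsphere k"] by (simp add: nsphere_eq)
  ultimately have "openin (prod_topology (nsphere k) (nsphere k)) ({q \<in> S \<times> S. d (fst q) (snd q) < \<epsilon>/2} \<inter> S \<times> U)"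
    by (simp add: nsphere_eq openin_Int)
  moreover have "open_map (prod_topology (nsphere k) (nsphere k)) (prod_topology (nsphere k) X) (\<lambda>(x, y). (x, P y))"
    using open_map_prod_map[OF open_map_id[unfolded id_def] P(2)] .
  ultimately have "openin (prod_topology (nsphere k) X) ((\<lambda>(x, y). (x, P y)) ` ({q \<in> S \<times> S. d (fst q) (snd q) < \<epsilon>/2} \<inter> S \<times> U))"
    by (simp add: open_map_def)
  moreover have "{q \<in> topspace ?Y. sheet q \<in> U} = (\<lambda>(x, y). (x, P y)) ` ({q \<in> S \<times> S. d (fst q) (snd q) < \<epsilon>/2} \<inter> S \<times> U) \<inter> {(z, b). (P z, b) \<in> near}" (is "?L = ?R")
  proof (intro equalityI subsetI)
    fix q assume q: "q \<in> ?L"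
    obtain z b where zb: "q = (z, b)" by (cases q)
    have q': "q \<in> topspace ?Y" "sheet q \<in> U" using q by blast+
    from near[OF q'(1)[unfolded zb]] obtain z' where z': "z' \<in> S" "b = P z'" "d z z' < \<epsilon>/2" "sheet (z, b) = z'"
      by blast
    have "z \<in> S" "(P z, b) \<in> local.near"
      using q'(1) zb by auto
    then show "q \<in> ?R"
      using q'(2) z' zb by (auto intro!: image_eqI[of _ _ "(z, z')"])
  next
    fix q assume "q \<in> ?R"
    then obtain z z' where z: "q = (z, P z')" "z \<in> S" "z' \<in> U" "z' \<in> S" "d z z' < \<epsilon>/2" "(P z, P z') \<in> near"
      by auto
    then show "q \<in> ?L"
      using sheet_eq[OF z(2,4,5)] P_in[OF z(4)] by simp
  qed
  ultimately show "openin ?Y {q \<in> topspace ?Y. sheet q \<in> U}"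
    by (auto simp: openin_subtopology)
qed

lemma lift_homotopy:
  fixes K :: "'k::metric_space set" and h :: "real \<times> 'k \<Rightarrow> 'b"
  assumes K: "compact K" and h: "continuous_map (top_of_set ({0..1} \<times> K)) X h"
    and e0: "continuous_map (top_of_set K) (nsphere k) e0" "\<And>t. t \<in> K \<Longrightarrow> P (e0 t) = h (0, t)"
  obtains H where "continuous_map (top_of_set ({0..1} \<times> K)) (nsphere k) H"
    "\<And>s t. s \<in> {0..1} \<Longrightarrow> t \<in> K \<Longrightarrow> P (H (s, t)) = h (s, t)" "\<And>t. t \<in> K \<Longrightarrow> H (0, t) = e0 t"
proof -
  have 1: "P (sheet (z, b)) = b" if zb: "z \<in> topspace (nsphere k)" "(P z, b) \<in> near" for z b
  proof -
    have z: "z \<in> S" using zb by simp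
    obtain z' where "z' \<in> S" "b = P z'" "d z z' < \<epsilon>/2"
      by (rule near_sheet[OF z zb(2)])
    with sheet_eq[OF z] show ?thesis by simp
  qed
  have 2: "sheet (z, P z) = z" if "z \<in> topspace (nsphere k)" for z
    using sheet_eq[of z z] \<epsilon>(1) that by simp
  show thesis
  proof (rule regular_homotopy_lift[of X near "nsphere k" P sheet K h e0])
    fix H assume "continuous_map (top_of_set ({0..1} \<times> K)) (nsphere k) H"
      "\<And>s t. s \<in> {0..1} \<Longrightarrow> t \<in> K \<Longrightarrow> P (H (s, t)) = h (s, t)" "\<And>t. t \<in> K \<Longrightarrow> H (0, t) = e0 t"
    then show thesis by (rule that)
  qed (rule openin_near near_refl sheet_cont 1 2 K h e0; assumption)+
qed

text \<open>The distance between two lifts is continuous on a connected set, vanishes somewhere, and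
  cannot take the value \<epsilon>/2, since two points of one orbit at that distance would
  coincide.\<close>

lemma lift_unique:
  fixes C :: "'c::topological_space set"
  assumes C: "connected C" and l: "continuous_map (top_of_set C) (nsphere k) l" "continuous_map (top_of_set C) (nsphere k) l'"
    and eq: "\<And>t. t \<in> C \<Longrightarrow> P (l t) = P (l' t)" and t0: "t0 \<in> C" "l t0 = l' t0" and t: "t \<in> C"
  shows "l t = l' t"
proof -
  have lS: "l t \<in> S" "l' t \<in> S" if "t \<in> C" for t
    using continuous_map_funspace[OF l(1)] continuous_map_funspace[OF l(2)] that by auto
  have "continuous_on C (\<lambda>t. d (l t) (l' t))"
    using l by (intro continuous_on_edist) (auto simp: nsphere_eq continuous_map_in_subtopology)
  then have con: "connected ((\<lambda>t. d (l t) (l' t)) ` C)"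
    by (rule connected_continuous_image) (rule C)
  have "d (l t) (l' t) < \<epsilon>"
  proof (rule ccontr)
    assume "\<not> d (l t) (l' t) < \<epsilon>"
    have "\<epsilon>/2 \<in> (\<lambda>t. d (l t) (l' t)) ` C"
    proof (rule connectedD_interval[OF con])
      show "0 \<in> (\<lambda>t. d (l t) (l' t)) ` C"
        using t0 by (intro image_eqI[of _ _ t0]) auto
      show "d (l t) (l' t) \<in> (\<lambda>t. d (l t) (l' t)) ` C"
        using t by blast
    qed (use \<open>\<not> d (l t) (l' t) < \<epsilon>\<close> \<epsilon>(1) in auto)
    then obtain u where u: "u \<in> C" "d (l u) (l' u) = \<epsilon>/2"
      by auto
    then have "l u = l' u"
      using \<epsilon>(2)[OF lS[OF u(1)] eq[OF u(1)]] \<epsilon>(1) by auto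
    with u \<epsilon>(1) show False by simp
  qed
  then show ?thesis
    using \<epsilon>(2) lS t eq by blast
qed

end

section \<open>Lifting cube maps that are constant on the boundary\<close>

lemma connected_Cube: "connected (Cube j)"
proof -
  have "connected_space (cube j)"
    unfolding cube_def connected_space_product_topology by (simp add: connected_space_top_of_set)
  then show ?thesis
    by (simp add: cube_eq connected_space_top_of_set)
qed

lemma fhom_pathin:
  assumes "fhom j X \<gamma> f g" "1 \<le> j"
  shows "pathin X \<gamma>"
proof -
  obtain H where H: "continuous_map (top_of_set ({0..1} \<times> Cube j)) X H"
    "\<And>s t. s \<in> {0..1} \<Longrightarrow> t \<in> cube_boundary j \<Longrightarrow> H (s, t) = \<gamma> s"
    using assms(1) by (rule fhomE) blast
  have "continuous_map (top_of_set {0..1}) X (\<lambda>s. H (s, corner j))"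
    by (rule continuous_map_compose_on[OF H(1)])
      (auto simp: corner_Cube intro!: continuous_on_Pair continuous_on_id continuous_on_const)
  then show ?thesis
    unfolding pathin_def by (rule continuous_map_eq) (simp add: H(2) corner_boundary[OF assms(2)])
qed

lemma loops_Sph:
  assumes "f \<in> cube_loops j (nsphere k) z"
  shows "continuous_on (Cube j) f" "t \<in> Cube j \<Longrightarrow> f t \<in> Sph k" "t \<in> cube_boundary j \<Longrightarrow> f t = z"
  using assms by (auto simp: cube_loops_iff nsphere_eq continuous_map_in_subtopology)

context free_quotient
begin

lemma lift_constant:
  assumes "continuous_map (top_of_set {0..1::real}) (nsphere k) l" "\<And>s. s \<in> {0..1} \<Longrightarrow> P (l s) = b" "s \<in> {0..1}"
  shows "l s = l 0"
proof -
  have "l 0 \<in> S"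
    using continuous_map_funspace[OF assms(1)] by auto
  then have "continuous_map (top_of_set {0..1::real}) (nsphere k) (\<lambda>_. l 0)"
    by simp
  from lift_unique[OF connected_Icc assms(1) this, of 0 s] show ?thesis
    using assms by simp
qed

text \<open>Any boundary point is joined to the corner by at most two segments inside the boundary,
  and along a path in the boundary the lift of a constant is constant.\<close>

lemma lift_boundary_constant:
  assumes l: "continuous_map (top_of_set (Cube j)) (nsphere k) l" and b: "\<And>t. t \<in> cube_boundary j \<Longrightarrow> P (l t) = b"
    and j: "2 \<le> j" and t: "t \<in> cube_boundary j"
  shows "l t = l (corner j)"
proof -
  have along: "l (q 1) = l (q 0)" if q: "continuous_on {0..1::real} q" "\<And>s. s \<in> {0..1} \<Longrightarrow> q s \<in> cube_boundary j" for q
  proof (rule lift_constant[of "\<lambda>s. l (q s)"])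
    show "continuous_map (top_of_set {0..1}) (nsphere k) (\<lambda>s. l (q s))"
      by (rule continuous_map_compose_on[OF l q(1)]) (rule boundary_subset[OF q(2)])
  qed (auto simp: b q(2))
  obtain i where i: "i < j" "t i = 0 \<or> t i = 1"
    using t by (auto simp: cube_boundary_iff)
  have tC: "t \<in> Cube j" using t by (rule boundary_subset)
  \<comment> \<open>Coordinate \<open>i\<close> is frozen and the others shrink to 0, so the path
    never leaves the face of \<open>t\<close>.\<close>
  define q where "q = (\<lambda>s m. if m < j then if m = i then t i else s * t m else undefined)"
  define r where "r = (\<lambda>s m. if m < j then if m = i then s else (0::real) else undefined)"
  have "continuous_on {0..1} (\<lambda>s. q s m)" for m
    unfolding q_def by (cases "m < j"; cases "m = i"; simp add: continuous_on_mult_right)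
  then have "continuous_on {0..1} q"
    by (rule continuous_on_coordinatewise_then_product)
  moreover have "q s \<in> cube_boundary j" if "s \<in> {0..1}" for s
    using that i tC by (auto simp: q_def cube_boundary_iff Cube_iff mult_le_one)
  ultimately have "l (q 1) = l (q 0)" by (rule along)
  moreover have "q 1 = t"
    using tC by (auto simp: q_def Cube_iff)
  ultimately have tq: "l t = l (q 0)" by simp
  show ?thesis
  proof (cases "t i = 0")
    case True
    then have "q 0 = corner j" by (auto simp: q_def corner_def)
    with tq show ?thesis by simp
  next
    case False
    then have q0: "q 0 = r 1" using i by (auto simp: q_def r_def)
    \<comment> \<open>From the face with coordinate 1 the path follows the edge in direction
      \<open>i\<close>. It stays in the boundary because some other coordinate is 0, which is where
      2 \<le> j is used.\<close>
    obtain m where m: "m < j" "m \<noteq> i"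
    proof (cases "i = 0")
      case True then show thesis using that[of 1] j by simp
    next
      case False then show thesis using that[of 0] j by simp
    qed
    have "continuous_on {0..1} (\<lambda>s. r s m)" for m
      unfolding r_def by (cases "m < j"; cases "m = i"; simp)
    then have "continuous_on {0..1} r"
      by (rule continuous_on_coordinatewise_then_product)
    moreover have "r s \<in> cube_boundary j" if "s \<in> {0..1}" for s
      using that m by (auto simp: r_def cube_boundary_iff Cube_iff intro!: exI[of _ m])
    ultimately have "l (r 1) = l (r 0)" by (rule along)
    moreover have "r 0 = corner j" by (auto simp: r_def corner_def)
    ultimately show ?thesis using tq q0 by simp
  qed
qed

text \<open>Scaling the cube towards its corner presents \<open>f\<close> as the end of a homotopy
  that starts at a constant map. The constant lifts, hence so does the homotopy, and the corner does
  not move during it.\<close>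

lemma lift_cube:
  assumes f: "f \<in> cube_loops j X (P z)" and z: "z \<in> S" and j: "2 \<le> j"
  obtains f' where "f' \<in> cube_loops j (nsphere k) z" "\<And>t. t \<in> Cube j \<Longrightarrow> P (f' t) = f t"
proof -
  have fc: "continuous_map (top_of_set (Cube j)) X f" and fb: "\<And>t. t \<in> cube_boundary j \<Longrightarrow> f t = P z"
    using f by (auto simp: cube_loops_iff)
  define c where "c = (\<lambda>p::real \<times> (nat \<Rightarrow> real). \<lambda>i. if i < j then fst p * snd p i else undefined)"
  have cb: "corner j \<in> cube_boundary j" using corner_boundary j by simp
  have h: "continuous_map (top_of_set ({0..1} \<times> Cube j)) X (\<lambda>p. f (c p))"
  proof (rule continuous_map_compose_on[OF fc])
    have "continuous_on ({0..1} \<times> Cube j) (\<lambda>p. if i < j then fst p * snd p i else undefined)" for i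
      by (cases "i < j") (auto intro!: continuous_intros)
    then show "continuous_on ({0..1} \<times> Cube j) c"
      unfolding c_def by (rule continuous_on_coordinatewise_then_product)
  qed (auto simp: c_def Cube_iff mult_le_one)
  have c0: "c (0, t) = corner j" for t
    by (auto simp: c_def corner_def)
  have c1: "c (1, t) = t" if "t \<in> Cube j" for t
    using that by (auto simp: c_def Cube_iff)
  have cc: "c (s, corner j) = corner j" for s
    by (auto simp: c_def corner_def)
  have e0: "continuous_map (top_of_set (Cube j)) (nsphere k) (\<lambda>_. z)"
    using z by simp
  have h0: "P z = f (c (0, t))" for t
    using fb[OF cb] by (simp add: c0)
  obtain H where H: "continuous_map (top_of_set ({0..1} \<times> Cube j)) (nsphere k) H"
    "\<And>s t. s \<in> {0..1} \<Longrightarrow> t \<in> Cube j \<Longrightarrow> P (H (s, t)) = f (c (s, t))" "\<And>t. t \<in> Cube j \<Longrightarrow> H (0, t) = z"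
    using lift_homotopy[OF compact_Cube h e0 h0] by blast
  define f' where "f' = (\<lambda>t. H (1, t))"
  have f': "continuous_map (top_of_set (Cube j)) (nsphere k) f'"
    unfolding f'_def by (rule continuous_map_compose_on[OF H(1)]) (auto intro!: continuous_on_Pair continuous_on_id continuous_on_const)
  have Pf': "P (f' t) = f t" if "t \<in> Cube j" for t
    using H(2)[of 1 t] that by (simp add: f'_def c1)
  have "H (1, corner j) = H (0, corner j)"
  proof (rule lift_constant[of "\<lambda>s. H (s, corner j)"])
    show "continuous_map (top_of_set {0..1}) (nsphere k) (\<lambda>s. H (s, corner j))"
      by (rule continuous_map_compose_on[OF H(1)]) (auto simp: corner_Cube intro!: continuous_on_Pair continuous_on_id continuous_on_const)
    show "P (H (s, corner j)) = f (corner j)" if "s \<in> {0..1}" for s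
      using H(2)[OF that corner_Cube] by (simp add: cc)
  qed auto
  then have "f' (corner j) = z"
    using H(3)[OF corner_Cube] by (simp add: f'_def)
  moreover have "f' t = f' (corner j)" if "t \<in> cube_boundary j" for t
    by (rule lift_boundary_constant[OF f' _ j that, of "P z"]) (simp add: Pf' fb boundary_subset)
  ultimately have "f' \<in> cube_loops j (nsphere k) z"
    using f' by (simp add: cube_loops_iff)
  then show thesis
    using Pf' by (rule that)
qed

text \<open>At each time the lifted map projects to a single point on the boundary and is therefore
  constant there; the track of the corner is the boundary path of the lift.\<close>

lemma lift_fhom:
  assumes fh: "fhom j X \<gamma> f g" and f': "f' \<in> cube_loops j (nsphere k) z" "\<And>t. t \<in> Cube j \<Longrightarrow> P (f' t) = f t" and j: "2 \<le> j"
  obtains \<gamma>' g' where "fhom j (nsphere k) \<gamma>' f' g'" "\<And>s. s \<in> {0..1} \<Longrightarrow> P (\<gamma>' s) = \<gamma> s" "\<And>t. t \<in> Cube j \<Longrightarrow> P (g' t) = g t"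
proof -
  obtain h where h: "continuous_map (top_of_set ({0..1} \<times> Cube j)) X h"
    "\<And>t. t \<in> Cube j \<Longrightarrow> h (0, t) = f t" "\<And>t. t \<in> Cube j \<Longrightarrow> h (1, t) = g t"
    "\<And>s t. s \<in> {0..1} \<Longrightarrow> t \<in> cube_boundary j \<Longrightarrow> h (s, t) = \<gamma> s"
    using fh by (rule fhomE) blast
  have f'c: "continuous_map (top_of_set (Cube j)) (nsphere k) f'"
    using f'(1) by (simp add: cube_loops_iff)
  have h0: "P (f' t) = h (0, t)" if "t \<in> Cube j" for t
    using f'(2)[OF that] h(2)[OF that] by simp
  obtain H where H: "continuous_map (top_of_set ({0..1} \<times> Cube j)) (nsphere k) H"
    "\<And>s t. s \<in> {0..1} \<Longrightarrow> t \<in> Cube j \<Longrightarrow> P (H (s, t)) = h (s, t)" "\<And>t. t \<in> Cube j \<Longrightarrow> H (0, t) = f' t"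
    using lift_homotopy[OF compact_Cube h(1) f'c h0] by blast
  have "fhom j (nsphere k) (\<lambda>s. H (s, corner j)) f' (\<lambda>t. H (1, t))"
  proof (rule fhomI[OF H(1)])
    fix s :: real and t assume st: "s \<in> {0..1}" "t \<in> cube_boundary j"
    have "continuous_map (top_of_set (Cube j)) (nsphere k) (\<lambda>t. H (s, t))"
      by (rule continuous_map_compose_on[OF H(1)]) (use st in \<open>auto intro!: continuous_on_Pair continuous_on_id continuous_on_const\<close>)
    then show "H (s, t) = H (s, corner j)"
    proof (rule lift_boundary_constant[OF _ _ j st(2), of "\<lambda>t. H (s, t)"])
      show "P (H (s, t)) = \<gamma> s" if "t \<in> cube_boundary j" for t
        using H(2)[OF st(1) boundary_subset[OF that]] h(4)[OF st(1) that] by simp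
    qed
  qed (auto simp: H(3))
  moreover have "P (H (s, corner j)) = \<gamma> s" if "s \<in> {0..1}" for s
    using H(2)[OF that corner_Cube] h(4)[OF that corner_boundary] j by simp
  moreover have "P (H (1, t)) = g t" if "t \<in> Cube j" for t
    using H(2)[of 1 t] h(3) that by simp
  ultimately show thesis
    by (rule that)
qed

lemma lift_fhom_const:
  assumes fh: "fhom j X (\<lambda>_. b) (\<lambda>t. P (f t)) (\<lambda>t. P (g t))"
    and f: "f \<in> cube_loops j (nsphere k) z" and g: "g \<in> cube_loops j (nsphere k) z" and j: "2 \<le> j"
  shows "fhom j (nsphere k) (\<lambda>_. z) f g"
proof -
  obtain \<gamma> g' where \<gamma>: "fhom j (nsphere k) \<gamma> f g'" "\<And>s. s \<in> {0..1} \<Longrightarrow> P (\<gamma> s) = b" "\<And>t. t \<in> Cube j \<Longrightarrow> P (g' t) = P (g t)"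
    using lift_fhom[OF fh f _ j] by blast
  have cb: "corner j \<in> cube_boundary j" using j by (simp add: corner_boundary)
  have p: "pathin (nsphere k) \<gamma>"
    using fhom_pathin[OF \<gamma>(1)] j by simp
  have z: "\<gamma> 0 = z"
    using fhom_loops(1)[OF \<gamma>(1)] f cb by (auto simp: cube_loops_iff)
  then have \<gamma>z: "\<gamma> s = z" if "s \<in> {0..1}" for s
    using lift_constant[OF p[unfolded pathin_def] \<gamma>(2) that] by simp
  have g': "g' \<in> cube_loops j (nsphere k) z"
    using fhom_loops(2)[OF \<gamma>(1)] \<gamma>z[of 1] by simp
  have "g' t = g t" if "t \<in> Cube j" for t
  proof (rule lift_unique[OF connected_Cube _ _ \<gamma>(3) corner_Cube _ that])
    show "continuous_map (top_of_set (Cube j)) (nsphere k) g'" "continuous_map (top_of_set (Cube j)) (nsphere k) g"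
      using g g' by (simp_all add: cube_loops_iff)
    show "g' (corner j) = g (corner j)"
      using g g' cb by (simp add: cube_loops_iff)
  qed
  then show ?thesis
    by (intro fhom_cong[OF \<gamma>(1)]) (auto simp: \<gamma>z)
qed

end

section \<open>Geometry of the sphere\<close>

definition dot :: "nat \<Rightarrow> (nat \<Rightarrow> real) \<Rightarrow> (nat \<Rightarrow> real) \<Rightarrow> real" where
  "dot k x y = (\<Sum>i\<le>k. x i * y i)"

definition nz :: "nat \<Rightarrow> (nat \<Rightarrow> real) \<Rightarrow> nat \<Rightarrow> real" where
  "nz k u = (\<lambda>i. u i / L2_set u {..k})"

lemma L2_set_dot: "L2_set u {..k} = sqrt (dot k u u)"
  by (simp add: L2_set_def dot_def power2_eq_square)

lemma Sph_iff: "x \<in> Sph k \<longleftrightarrow> dot k x x = 1 \<and> (\<forall>i>k. x i = 0)"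
  by (simp add: Sph_def dot_def power2_eq_square)

lemma dot_comb:
  "dot k x (\<lambda>i. a * u i + b * v i) = a * dot k x u + b * dot k x v"
  "dot k (\<lambda>i. a * u i + b * v i) x = a * dot k u x + b * dot k v x"
  by (simp_all add: dot_def sum_distrib_left sum.distrib algebra_simps)

lemma dot_commute: "dot k x y = dot k y x"
  by (simp add: dot_def mult.commute)

lemma L2_set_Sph: "x \<in> Sph k \<Longrightarrow> L2_set x {..k} = 1"
  by (simp add: L2_set_dot Sph_iff)

lemma nz_Sph:
  assumes "L2_set u {..k} \<noteq> 0" "\<And>i. i > k \<Longrightarrow> u i = 0"
  shows "nz k u \<in> Sph k"
proof -
  have "(\<Sum>i\<le>k. (u i)\<^sup>2) = (L2_set u {..k})\<^sup>2"
    by (simp add: L2_set_def sum_nonneg)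
  then have "(\<Sum>i\<le>k. (nz k u i)\<^sup>2) = 1"
    using assms(1) by (simp add: nz_def power_divide flip: sum_divide_distrib)
  then show ?thesis
    using assms(2) by (simp add: Sph_def nz_def)
qed

lemma nz_id: "x \<in> Sph k \<Longrightarrow> nz k x = x"
  by (simp add: nz_def L2_set_Sph)

lemma continuous_on_nz:
  assumes "continuous_on A f" "\<And>p. p \<in> A \<Longrightarrow> L2_set (f p) {..k} \<noteq> 0"
  shows "continuous_on A (\<lambda>p. nz k (f p))"
proof -
  note c = continuous_on_product_then_coordinatewise[OF assms(1)]
  have "continuous_on A (\<lambda>p. L2_set (f p) {..k})"
    unfolding L2_set_def by (intro continuous_intros c)
  then show ?thesis
    unfolding nz_def using assms(2) by (intro continuous_on_coordinatewise_then_product continuous_on_divide c) auto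
qed

lemma Sph_minus: "x \<in> Sph k \<Longrightarrow> (\<lambda>i. - x i) \<in> Sph k"
  by (simp add: Sph_def)

lemma Sph_eqI:
  assumes "x \<in> Sph k" "y \<in> Sph k" "\<And>i. i \<le> k \<Longrightarrow> x i = y i"
  shows "x = y"
proof
  fix i show "x i = y i"
    using assms by (cases "i \<le> k") (auto simp: Sph_def)
qed

text \<open>Central projection of the chord: the short great-circle arc between points that are not
  antipodal, not traversed at constant speed.\<close>

definition seg :: "nat \<Rightarrow> (nat \<Rightarrow> real) \<Rightarrow> (nat \<Rightarrow> real) \<Rightarrow> real \<Rightarrow> nat \<Rightarrow> real" where
  "seg k x y s = nz k (\<lambda>i. (1 - s) * x i + s * y i)"

text \<open>If the chord meets the origin, comparing the norms of its two summands gives s = 1/2 and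
  hence y = -x.\<close>

lemma seg_nonzero:
  assumes "x \<in> Sph k" "y \<in> Sph k" "y \<noteq> (\<lambda>i. - x i)" "s \<in> {0..1}"
  shows "L2_set (\<lambda>i. (1 - s) * x i + s * y i) {..k} \<noteq> 0"
proof
  assume "L2_set (\<lambda>i. (1 - s) * x i + s * y i) {..k} = 0"
  then have z: "s * y i = - ((1 - s) * x i)" if "i \<le> k" for i
    using that by (force simp: L2_set_eq_0_iff)
  have "s\<^sup>2 * (\<Sum>i\<le>k. (y i)\<^sup>2) = (\<Sum>i\<le>k. (s * y i)\<^sup>2)"
    by (simp add: sum_distrib_left power_mult_distrib)
  also have "\<dots> = (\<Sum>i\<le>k. ((1 - s) * x i)\<^sup>2)"
    using z by (intro sum.cong) (auto simp: power2_eq_square)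
  also have "\<dots> = (1 - s)\<^sup>2 * (\<Sum>i\<le>k. (x i)\<^sup>2)"
    by (simp add: sum_distrib_left power_mult_distrib)
  finally have "s\<^sup>2 = (1 - s)\<^sup>2"
    using assms(1,2) by (simp add: Sph_def)
  then have "s = 1/2"
    by (simp add: power2_eq_square algebra_simps)
  with z have "y i = - x i" if "i \<le> k" for i
    using that by fastforce
  then have "y = (\<lambda>i. - x i)"
    by (rule Sph_eqI[OF assms(2) Sph_minus[OF assms(1)]])
  with assms(3) show False by contradiction
qed

lemma seg_Sph:
  assumes "x \<in> Sph k" "y \<in> Sph k" "y \<noteq> (\<lambda>i. - x i)" "s \<in> {0..1}"
  shows "seg k x y s \<in> Sph k"
  unfolding seg_def by (rule nz_Sph[OF seg_nonzero[OF assms]]) (use assms in \<open>simp add: Sph_def\<close>)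

lemma seg_ends: "x \<in> Sph k \<Longrightarrow> seg k x y 0 = x" "y \<in> Sph k \<Longrightarrow> seg k x y 1 = y"
  by (simp_all add: seg_def nz_id)

lemma continuous_on_seg:
  assumes "continuous_on A f" "continuous_on A g" "continuous_on A r"
    "\<And>p. p \<in> A \<Longrightarrow> f p \<in> Sph k \<and> g p \<in> Sph k \<and> g p \<noteq> (\<lambda>i. - f p i) \<and> r p \<in> {0..1}"
  shows "continuous_on A (\<lambda>p. seg k (f p) (g p) (r p))"
  unfolding seg_def
proof (rule continuous_on_nz)
  show "continuous_on A (\<lambda>p i. (1 - r p) * f p i + r p * g p i)"
    by (intro continuous_on_coordinatewise_then_product continuous_intros assms(3)
        continuous_on_product_then_coordinatewise[OF assms(1)] continuous_on_product_then_coordinatewise[OF assms(2)])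
qed (use seg_nonzero assms(4) in blast)

lemma fhom_seg:
  assumes f: "f \<in> cube_loops j (nsphere k) z" and g: "g \<in> cube_loops j (nsphere k) w"
    and ne: "\<And>t. t \<in> Cube j \<Longrightarrow> g t \<noteq> (\<lambda>i. - f t i)"
  shows "fhom j (nsphere k) (seg k z w) f g"
proof -
  note F = loops_Sph[OF f] and G = loops_Sph[OF g]
  have "continuous_on ({0..1} \<times> Cube j) (\<lambda>p. seg k (f (snd p)) (g (snd p)) (fst p))"
    by (intro continuous_on_seg continuous_on_compose2[OF F(1)] continuous_on_compose2[OF G(1)] continuous_on_fst continuous_on_snd continuous_on_id)
      (auto simp: F G ne)
  then have "continuous_map (top_of_set ({0..1} \<times> Cube j)) (nsphere k) (\<lambda>p. seg k (f (snd p)) (g (snd p)) (fst p))"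
    by (auto simp: nsphere_eq continuous_map_in_subtopology F G ne intro!: seg_Sph)
  then show ?thesis
    by (rule fhomI) (simp_all add: seg_ends F G)
qed

subsection \<open>Rotations of odd-dimensional spheres\<close>

text \<open>Multiplication by \<open>exp (i a)\<close>, where the coordinates \<open>2 l\<close> and \<open>2 l + 1\<close> are
  the real and imaginary part of a complex coordinate.\<close>

definition rot :: "real \<Rightarrow> (nat \<Rightarrow> real) \<Rightarrow> nat \<Rightarrow> real" where
  "rot a z = (\<lambda>i. if even i then cos a * z i - sin a * z (Suc i) else cos a * z i + sin a * z (i - 1))"

lemma sum_pairs: "(\<Sum>i\<le>Suc (2 * m). f i) = (\<Sum>l\<le>m. f (2 * l) + f (Suc (2 * l)))" for f :: "nat \<Rightarrow> real"
  by (induction m) (simp_all add: add.assoc)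

lemma rot_Sph:
  assumes "odd k" "z \<in> Sph k"
  shows "rot a z \<in> Sph k"
proof -
  obtain m where m: "k = Suc (2 * m)"
    using assms(1) oddE by fastforce
  have "(c * x - s * y)\<^sup>2 + (c * y + s * x)\<^sup>2 = (c\<^sup>2 + s\<^sup>2) * (x\<^sup>2 + y\<^sup>2)" for c s x y :: real
    by (simp add: power2_eq_square algebra_simps)
  from this[of "cos a" _ "sin a"] have "(cos a * x - sin a * y)\<^sup>2 + (cos a * y + sin a * x)\<^sup>2 = x\<^sup>2 + y\<^sup>2" for x y
    by simp
  then have "(\<Sum>i\<le>k. (rot a z i)\<^sup>2) = (\<Sum>i\<le>k. (z i)\<^sup>2)"
    unfolding m sum_pairs by (intro sum.cong) (auto simp: rot_def)
  moreover have "rot a z i = 0" if "i > k" for i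
  proof (cases "even i")
    case False
    then have "i \<noteq> Suc k" using assms(1) by auto
    then have "i - 1 > k" using that by linarith
    then show ?thesis using assms(2) that by (simp add: rot_def Sph_def False)
  qed (use assms(2) that in \<open>simp add: rot_def Sph_def\<close>)
  ultimately show ?thesis
    using assms(2) by (simp add: Sph_def)
qed

lemma rot_0 [simp]: "rot 0 z = z"
  and rot_pi: "rot pi z = (\<lambda>i. - z i)"
  by (auto simp: rot_def)

lemma rot_rot: "rot a (rot b z) = rot (a + b) z"
  by (auto simp: rot_def fun_eq_iff cos_add sin_add algebra_simps elim!: oddE)

lemma continuous_on_rot:
  fixes A :: "'p::t2_space set"
  assumes "continuous_on A f" "continuous_on A r"
  shows "continuous_on A (\<lambda>p. rot (r p) (f p))"
proof (rule continuous_on_coordinatewise_then_product)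
  show "continuous_on A (\<lambda>p. rot (r p) (f p) i)" for i
    unfolding rot_def by (cases "even i"; simp only: if_True if_False)
      (intro continuous_on_add continuous_on_diff continuous_on_mult continuous_on_cos[OF assms(2)]
        continuous_on_sin[OF assms(2)] continuous_on_product_then_coordinatewise[OF assms(1)])+
qed

text \<open>The inner product of \<open>z\<close> with its rotation is cos a.\<close>

lemma rot_fixed:
  assumes "odd k" "z \<in> Sph k" "rot a z = z"
  shows "cos a = 1"
proof -
  obtain m where m: "k = Suc (2 * m)"
    using assms(1) oddE by fastforce
  have "dot k z (rot a z) = cos a * dot k z z"
    unfolding dot_def m sum_pairs sum_distrib_left
    by (intro sum.cong) (auto simp: rot_def algebra_simps)
  then show ?thesis
    using assms(2,3) by (simp add: Sph_iff)
qed

lemma fhom_rot: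
  assumes k: "odd k" and f: "f \<in> cube_loops j (nsphere k) z"
  shows "fhom j (nsphere k) (\<lambda>s. rot (s * a) z) f (\<lambda>t. rot a (f t))"
proof -
  note F = loops_Sph[OF f]
  have "continuous_on ({0..1} \<times> Cube j) (\<lambda>p. rot (fst p * a) (f (snd p)))"
    by (intro continuous_on_rot continuous_on_compose2[OF F(1)] continuous_intros) auto
  then have "continuous_map (top_of_set ({0..1} \<times> Cube j)) (nsphere k) (\<lambda>p. rot (fst p * a) (f (snd p)))"
    using F(2) by (auto simp: nsphere_eq continuous_map_in_subtopology intro!: rot_Sph[OF k])
  then show ?thesis
    by (rule fhomI) (simp_all add: F)
qed

definition freely_homotopic :: "nat \<Rightarrow> nat \<Rightarrow> ((nat \<Rightarrow> real) \<Rightarrow> nat \<Rightarrow> real) \<Rightarrow> ((nat \<Rightarrow> real) \<Rightarrow> nat \<Rightarrow> real) \<Rightarrow> bool" where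
  "freely_homotopic j k f g \<longleftrightarrow> (\<exists>\<omega>. fhom j (nsphere k) \<omega> f g)"

lemma freely_homotopic_trans: "freely_homotopic j k f g \<Longrightarrow> freely_homotopic j k g h \<Longrightarrow> freely_homotopic j k f h"
  unfolding freely_homotopic_def using fhom_trans by blast

lemma freely_homotopic_sym: "freely_homotopic j k f g \<Longrightarrow> freely_homotopic j k g f"
  unfolding freely_homotopic_def using fhom_rev by blast

text \<open>Both maps are compared with the antipode of the second one: it is nowhere antipodal to the
  first, and the antipodal map is isotopic to the identity because \<open>k\<close> is odd.\<close>

lemma freely_homotopic_distinct:
  assumes k: "odd k" and f: "f \<in> cube_loops j (nsphere k) z" and g: "g \<in> cube_loops j (nsphere k) w"
    and ne: "\<And>t. t \<in> Cube j \<Longrightarrow> f t \<noteq> g t"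
  shows "freely_homotopic j k f g"
proof -
  have gr: "fhom j (nsphere k) (\<lambda>s. rot (s * pi) w) g (\<lambda>t. rot pi (g t))"
    by (rule fhom_rot[OF k g])
  have "fhom j (nsphere k) (seg k z (rot (1 * pi) w)) f (\<lambda>t. rot pi (g t))"
  proof (rule fhom_seg[OF f fhom_loops(2)[OF gr]])
    show "rot pi (g t) \<noteq> (\<lambda>i. - f t i)" if "t \<in> Cube j" for t
      using ne[OF that] by (auto simp: rot_pi fun_eq_iff) metis
  qed
  then show ?thesis
    using gr freely_homotopic_trans freely_homotopic_sym unfolding freely_homotopic_def by meson
qed

subsection \<open>Points in general position\<close>

text \<open>The cross product of the two triples, when it is nonzero. Otherwise they are parallel,
  and a vector orthogonal to a nonzero one of them is orthogonal to both.\<close>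

lemma exists_orthogonal3:
  fixes u v :: "nat \<Rightarrow> real"
  obtains a b c where "a * u 0 + b * u 1 + c * u 2 = 0" "a * v 0 + b * v 1 + c * v 2 = 0" "(a, b, c) \<noteq> (0, 0, 0)"
proof (cases "u 1 * v 2 - u 2 * v 1 = 0 \<and> u 2 * v 0 - u 0 * v 2 = 0 \<and> u 0 * v 1 - u 1 * v 0 = 0")
  case False
  then show thesis
    by (intro that[of "u 1 * v 2 - u 2 * v 1" "u 2 * v 0 - u 0 * v 2" "u 0 * v 1 - u 1 * v 0"]) (auto simp: algebra_simps)
next
  case True
  have perp: "\<exists>a b c. a * x + b * y + c * z = (0::real) \<and> (a, b, c) \<noteq> (0, 0, 0)" for x y z
  proof (cases "x = 0 \<and> y = 0")
    case True then show ?thesis by (rule_tac exI[of _ 1], rule_tac exI[of _ 0], rule_tac exI[of _ 0]) auto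
  next
    case False then show ?thesis by (rule_tac exI[of _ y], rule_tac exI[of _ "-x"], rule_tac exI[of _ 0]) auto
  qed
  show thesis
  proof (cases "u 0 = 0 \<and> u 1 = 0 \<and> u 2 = 0")
    case True
    obtain a b c where "a * v 0 + b * v 1 + c * v 2 = 0" "(a, b, c) \<noteq> (0, 0, 0)"
      using perp[of "v 0" "v 1" "v 2"] by blast
    with True show thesis by (intro that[of a b c]) auto
  next
    case nz: False
    obtain a b c where abc: "a * u 0 + b * u 1 + c * u 2 = 0" "(a, b, c) \<noteq> (0, 0, 0)"
      using perp[of "u 0" "u 1" "u 2"] by blast
    let ?D = "a * v 0 + b * v 1 + c * v 2"
    have "u 0 * ?D = v 0 * (a * u 0 + b * u 1 + c * u 2)" "u 1 * ?D = v 1 * (a * u 0 + b * u 1 + c * u 2)"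
      "u 2 * ?D = v 2 * (a * u 0 + b * u 1 + c * u 2)"
      using True by (algebra, algebra, algebra)
    then have "?D = 0" using abc nz by auto
    with abc show thesis by (intro that[of a b c]) auto
  qed
qed

text \<open>The moment curve \<open>(1, t, t\<^sup>2)\<close> meets every plane in finitely many points.\<close>

lemma exists_generic_point:
  assumes k: "2 \<le> k" and F: "finite F"
  obtains c where "c \<in> Sph k" "\<And>u v \<alpha> \<beta>. (u, v) \<in> F \<Longrightarrow> \<exists>i\<le>k. c i \<noteq> \<alpha> * u i + \<beta> * v i"
proof -
  define m where "m = (\<lambda>t::real. \<lambda>i::nat. if i \<le> 2 then t ^ i else 0)"
  define bad where "bad = (\<lambda>q. {t. \<exists>\<alpha> \<beta>. \<forall>i\<le>k. m t i = \<alpha> * fst q i + \<beta> * snd q i})"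
  have fin: "finite (bad q)" for q
  proof -
    obtain a b c where abc: "a * fst q 0 + b * fst q 1 + c * fst q 2 = 0" "a * snd q 0 + b * snd q 1 + c * snd q 2 = 0" "(a, b, c) \<noteq> (0, 0, 0)"
      by (rule exists_orthogonal3[of "fst q" "snd q"])
    \<comment> \<open>The coefficients form a normal vector of the plane, so parameters at which the
      curve meets the plane are roots of a nonzero quadratic polynomial.\<close>
    have "poly [:a, b, c:] t = 0" if tb: "t \<in> bad q" for t
    proof -
      obtain \<alpha> \<beta> where ab: "\<And>i. i \<le> k \<Longrightarrow> m t i = \<alpha> * fst q i + \<beta> * snd q i"
        using tb unfolding bad_def by blast
      have e: "1 = \<alpha> * fst q 0 + \<beta> * snd q 0" "t = \<alpha> * fst q 1 + \<beta> * snd q 1" "t\<^sup>2 = \<alpha> * fst q 2 + \<beta> * snd q 2"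
        using ab[of 0] ab[of 1] ab[of 2] k by (simp_all add: m_def)
      have "poly [:a, b, c:] t = a * 1 + b * t + c * t\<^sup>2"
        by (simp add: power2_eq_square algebra_simps)
      also have "\<dots> = \<alpha> * (a * fst q 0 + b * fst q 1 + c * fst q 2) + \<beta> * (a * snd q 0 + b * snd q 1 + c * snd q 2)"
        by (subst e(1), subst (1) e(2), subst e(3)) (simp add: algebra_simps)
      finally show ?thesis using abc by simp
    qed
    moreover have "finite {t. poly [:a, b, c:] t = 0}"
      by (rule poly_roots_finite) (use abc(3) in auto)
    ultimately show ?thesis
      by (meson finite_subset mem_Collect_eq subsetI)
  qed
  have "infinite (UNIV :: real set)" by (rule infinite_UNIV_char_0)
  moreover have "finite (\<Union>q\<in>F. bad q)" using F fin by blast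
  ultimately obtain t where t: "t \<notin> (\<Union>q\<in>F. bad q)"
    by (metis UNIV_eq_I)
  have n0: "L2_set (m t) {..k} \<noteq> 0"
    by (auto simp: L2_set_eq_0_iff m_def intro!: bexI[of _ 0])
  show thesis
  proof (rule that)
    show "nz k (m t) \<in> Sph k"
      using k by (intro nz_Sph[OF n0]) (simp add: m_def)
    fix u v \<alpha> \<beta> assume uv: "(u, v) \<in> F"
    show "\<exists>i\<le>k. nz k (m t) i \<noteq> \<alpha> * u i + \<beta> * v i"
    proof (rule ccontr)
      assume "\<not> ?thesis"
      then have "\<And>i. i \<le> k \<Longrightarrow> m t i / L2_set (m t) {..k} = \<alpha> * u i + \<beta> * v i"
        by (auto simp: nz_def)
      then have "\<And>i. i \<le> k \<Longrightarrow> m t i = (L2_set (m t) {..k} * \<alpha>) * u i + (L2_set (m t) {..k} * \<beta>) * v i"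
        using n0 by (simp add: field_simps)
      then have "t \<in> bad (u, v)"
        unfolding bad_def by auto
      with t uv show False by blast
    qed
  qed
qed

text \<open>Both ends are joined to a generic point \<open>c\<close> by great-circle arcs. If the
  arc from x met a forbidden point r after its start, \<open>c\<close> would be a linear combination
  of x and r; the pairs (x, x) in the exclusion list rule out that \<open>c\<close> is antipodal to
  an end.\<close>

lemma path_avoiding_finite:
  assumes k: "2 \<le> k" and R: "finite R" and ab: "a \<in> Sph k - R" "b \<in> Sph k - R"
  obtains \<gamma> where "pathin (top_of_set (Sph k - R)) \<gamma>" "\<gamma> 0 = a" "\<gamma> 1 = b"
proof -
  obtain c where c: "c \<in> Sph k" "\<And>u v \<alpha> \<beta>. (u, v) \<in> {a, b} \<times> ({a, b} \<union> R) \<Longrightarrow> \<exists>i\<le>k. c i \<noteq> \<alpha> * u i + \<beta> * v i"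
    using exists_generic_point[OF k, of "{a, b} \<times> ({a, b} \<union> R)"] R by auto
  have path: "pathin (top_of_set (Sph k - R)) (seg k x c)" if x: "x \<in> {a, b}" for x
  proof -
    have xS: "x \<in> Sph k" "x \<notin> R" using x ab by auto
    have xc: "c \<noteq> (\<lambda>i. - x i)"
      using c(2)[of x x "-1" 0] x by auto
    have "seg k x c s \<notin> R" if s: "s \<in> {0..1}" for s
    proof
      assume o: "seg k x c s \<in> R"
      show False
      proof (cases "s = 0")
        case True
        then show False using o xS seg_ends by simp
      next
        case False
        define n where "n = L2_set (\<lambda>i. (1 - s) * x i + s * c i) {..k}"
        have "n \<noteq> 0" unfolding n_def by (rule seg_nonzero[OF xS(1) c(1) xc s])
        have "seg k x c s i = ((1 - s) * x i + s * c i) / n" for i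
          unfolding seg_def nz_def n_def ..
        then have "n * seg k x c s i = (1 - s) * x i + s * c i" for i
          using \<open>n \<noteq> 0\<close> by simp
        then have "c i = (n * seg k x c s i - (1 - s) * x i) / s" for i
          using False by simp
        then have "c i = (- (1 - s) / s) * x i + (n / s) * seg k x c s i" for i
          using False by (simp add: diff_divide_distrib add_divide_distrib algebra_simps)
        then show False
          using c(2)[of x "seg k x c s" "- (1 - s) / s" "n / s"] o x by auto
      qed
    qed
    moreover have "continuous_on {0..1} (seg k x c)"
      using continuous_on_seg[of "{0..1}" "\<lambda>_. x" "\<lambda>_. c" "\<lambda>s. s" k] xS c(1) xc by auto
    ultimately show ?thesis
      unfolding pathin_def continuous_map_in_subtopology using seg_Sph[OF xS(1) c(1) xc] by auto
  qed
  have "pathin (top_of_set (Sph k - R)) (path_join (seg k a c) (path_rev (seg k b c)))"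
    using seg_ends c(1) by (intro pathin_join pathin_rev path) auto
  then show thesis
    by (rule that) (use ab c(1) seg_ends in auto)
qed

subsection \<open>Simple connectivity\<close>

text \<open>Hat functions at the integers. The sum over all of them is piecewise linear
  interpolation, so continuity of a polygon is evident while on each interval just two vertices
  contribute.\<close>

lemma sum_hat:
  assumes s: "0 \<le> s" "s \<le> real N" and N: "N > 0"
  obtains i u where "i < N" "0 \<le> u" "u \<le> 1" "s = real i + u"
    "\<And>g. (\<Sum>l\<le>N. max 0 (1 - \<bar>s - real l\<bar>) * g l) = (1 - u) * g i + u * g (Suc i)"
proof -
  obtain i where i: "i < N" "real i \<le> s" "s \<le> real i + 1"
  proof (cases "s = real N")
    case True
    then show thesis using N that[of "N - 1"] by (simp add: of_nat_diff)
  next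
    case False
    have "nat \<lfloor>s\<rfloor> < N" "real (nat \<lfloor>s\<rfloor>) \<le> s" "s \<le> real (nat \<lfloor>s\<rfloor>) + 1"
      using s False by linarith+
    then show thesis by (rule that)
  qed
  define u where "u = s - real i"
  have "(\<Sum>l\<le>N. max 0 (1 - \<bar>s - real l\<bar>) * g l) = (1 - u) * g i + u * g (Suc i)" for g
  proof -
    have "(\<Sum>l\<le>N. max 0 (1 - \<bar>s - real l\<bar>) * g l) = (\<Sum>l\<in>{i, Suc i}. max 0 (1 - \<bar>s - real l\<bar>) * g l)"
    proof (rule sum.mono_neutral_right)
      show "\<forall>l\<in>{..N} - {i, Suc i}. max 0 (1 - \<bar>s - real l\<bar>) * g l = 0"
      proof
        fix l assume "l \<in> {..N} - {i, Suc i}"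
        then have "l < i \<or> Suc i < l" by auto
        then have "real l + 1 \<le> real i \<or> real i + 2 \<le> real l" by linarith
        then have "1 - \<bar>s - real l\<bar> \<le> 0" using i by linarith
        then show "max 0 (1 - \<bar>s - real l\<bar>) * g l = 0" by simp
      qed
    qed (use i in auto)
    also have "\<dots> = (1 - u) * g i + u * g (Suc i)"
    proof -
      have "max 0 (1 - \<bar>s - real i\<bar>) = 1 - u" "max 0 (1 - \<bar>s - real (Suc i)\<bar>) = u"
        using i by (simp_all add: u_def)
      then show ?thesis by (simp add: u_def)
    qed
    finally show ?thesis .
  qed
  then show thesis
    by (rule that[of i u, rotated 4]) (use i in \<open>auto simp: u_def\<close>)
qed

text \<open>The loop is replaced by a nearby spherical polygon, which misses some point \<open>- c\<close>
  and is then contracted to \<open>c\<close>.\<close>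

lemma loop_contraction:
  assumes k: "2 \<le> k" and \<omega>: "pathin (nsphere k) \<omega>" "\<omega> 0 = \<omega> 1"
  obtains W :: "real \<times> real \<Rightarrow> nat \<Rightarrow> real" and c where "continuous_map (top_of_set ({0..1} \<times> {0..1})) (nsphere k) W"
    "\<And>s. s \<in> {0..1} \<Longrightarrow> W (s, 0) = \<omega> s" "\<And>s. s \<in> {0..1} \<Longrightarrow> W (s, 1) = c"
    "\<And>r. r \<in> {0..1} \<Longrightarrow> W (0, r) = W (1, r)"
proof -
  let ?I = "{0..1::real}"
  have \<omega>c: "continuous_on ?I \<omega>" and \<omega>S: "\<And>s. s \<in> ?I \<Longrightarrow> \<omega> s \<in> Sph k"
    using \<omega>(1) by (auto simp: pathin_def nsphere_eq continuous_map_in_subtopology)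
  define V where "V = {q \<in> Sph k \<times> Sph k. - dot k (fst q) (snd q) < 0}"
  have "continuous_on (Sph k \<times> Sph k) (\<lambda>q. - dot k (fst q) (snd q))"
    unfolding dot_def by (intro continuous_intros continuous_on_product_then_coordinatewise[OF continuous_on_fst[OF continuous_on_id]])
  from openin_Collect_less[OF this, of 0] have V: "openin (prod_topology (nsphere k) (nsphere k)) V"
    unfolding V_def by (simp add: nsphere_eq)
  have Vd: "(x, x) \<in> V" if "x \<in> topspace (nsphere k)" for x
    using that by (simp add: V_def Sph_iff)
  \<comment> \<open>A one-point parameter space turns the uniformity of homotopies into uniform
    continuity of a path.\<close>
  have h: "continuous_map (top_of_set (?I \<times> {0::real})) (nsphere k) (\<lambda>p. \<omega> (fst p))"
    by (rule continuous_map_compose_on[OF \<omega>(1)[unfolded pathin_def]]) (auto intro: continuous_on_fst continuous_on_id)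
  have "compact {0::real}" by simp
  obtain \<delta> where \<delta>: "\<delta> > 0" "\<And>t s s'. t \<in> {0::real} \<Longrightarrow> s \<in> ?I \<Longrightarrow> s' \<in> ?I \<Longrightarrow> dist s s' < \<delta> \<Longrightarrow> (\<omega> (fst (s, t)), \<omega> (fst (s', t))) \<in> V"
  proof (rule homotopy_uniform[OF \<open>compact {0::real}\<close> h V Vd])
    fix \<delta> assume "0 < \<delta>" "\<And>t s s'. t \<in> {0::real} \<Longrightarrow> s \<in> ?I \<Longrightarrow> s' \<in> ?I \<Longrightarrow> dist s s' < \<delta> \<Longrightarrow> (\<omega> (fst (s, t)), \<omega> (fst (s', t))) \<in> V"
    then show thesis by (rule that)
  qed
  have near: "dot k (\<omega> s) (\<omega> s') > 0" if "s \<in> ?I" "s' \<in> ?I" "dist s s' < \<delta>" for s s'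
    using \<delta>(2)[of 0 s s'] that by (simp add: V_def)
  obtain N where N: "N > 0" "1 / real N < \<delta>"
    using nat_approx_posE[OF \<delta>(1)] by (metis of_nat_0_less_iff zero_less_Suc)
  define pl where "pl = (\<lambda>(s::real) i. \<Sum>l\<le>N. max 0 (1 - \<bar>s * real N - real l\<bar>) * \<omega> (real l / N) i)"
  have pl: "\<exists>m u. m < N \<and> 0 \<le> u \<and> u \<le> 1 \<and> s * N = real m + u \<and>
      pl s = (\<lambda>i. (1 - u) * \<omega> (real m / N) i + u * \<omega> (real (Suc m) / N) i)" if s: "s \<in> ?I" for s
  proof -
    have sN: "0 \<le> s * real N" "s * real N \<le> real N"
      using s N(1) by (auto intro: mult_left_le_one_le)
    obtain m u where mu: "m < N" "0 \<le> u" "u \<le> 1" "s * real N = real m + u"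
      "\<And>g. (\<Sum>l\<le>N. max 0 (1 - \<bar>s * real N - real l\<bar>) * g l) = (1 - u) * g m + u * g (Suc m)"
      by (rule sum_hat[OF sN N(1)]) blast
    have "pl s = (\<lambda>i. (1 - u) * \<omega> (real m / N) i + u * \<omega> (real (Suc m) / N) i)"
      unfolding pl_def using mu(5) by (intro ext)
    with mu show ?thesis by blast
  qed
  \<comment> \<open>Near time \<open>s\<close> both vertices of the current edge make an acute angle
    with the loop. Hence no segment from the loop to the polygon meets the origin, and normalisation
    is allowed.\<close>
  have pldot: "0 < dot k (\<omega> s) (pl s)" if s: "s \<in> ?I" for s
  proof -
    obtain m u where mu: "m < N" "0 \<le> u" "u \<le> 1" "s * N = real m + u"
      "pl s = (\<lambda>i. (1 - u) * \<omega> (real m / N) i + u * \<omega> (real (Suc m) / N) i)"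
      using pl[OF s] by blast
    have "s = (real m + u) / N"
      using mu(4) N(1) by (simp add: field_simps)
    then have d: "s - real m / N = u / N" "real (Suc m) / N - s = (1 - u) / N"
      by (simp_all add: add_divide_distrib diff_divide_distrib)
    have "u / N \<le> 1 / N" "(1 - u) / N \<le> 1 / N" "0 \<le> u / N" "0 \<le> (1 - u) / N"
      using mu(2,3) by (auto intro: divide_right_mono)
    then have "dist s (real m / N) < \<delta>" "dist s (real (Suc m) / N) < \<delta>"
      using d N(2) unfolding dist_real_def by linarith+
    moreover have "real m / N \<in> ?I" "real (Suc m) / N \<in> ?I"
      using mu(1) by auto
    ultimately have "0 < dot k (\<omega> s) (\<omega> (real m / N))" "0 < dot k (\<omega> s) (\<omega> (real (Suc m) / N))"
      using near s by blast+
    moreover have "0 < u \<or> 0 < 1 - u" by linarith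
    ultimately show ?thesis
      unfolding mu(5) dot_comb using mu(2,3) by (auto intro: add_pos_nonneg add_nonneg_pos)
  qed
  have pl0: "pl s i = 0" if "i > k" "s \<in> ?I" for s i
  proof -
    have "real l / N \<in> ?I" if "l \<le> N" for l using that N(1) by simp
    then show ?thesis
      unfolding pl_def using \<omega>S that(1) by (intro sum.neutral) (auto simp: Sph_def)
  qed
  define A where "A = (\<lambda>s r i. (1 - r) * \<omega> s i + r * pl s i)"
  have A: "L2_set (A s r) {..k} \<noteq> 0" if "s \<in> ?I" "r \<in> ?I" for s r
  proof
    assume "L2_set (A s r) {..k} = 0"
    then have "dot k (\<omega> s) (A s r) = 0"
      by (simp add: L2_set_eq_0_iff dot_def)
    moreover have "dot k (\<omega> s) (A s r) = (1 - r) + r * dot k (\<omega> s) (pl s)"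
      unfolding A_def dot_comb using \<omega>S[OF that(1)] by (simp add: Sph_iff)
    moreover have "0 < (1 - r) + r * dot k (\<omega> s) (pl s)"
    proof (cases "r = 0")
      case False
      then have "0 < r * dot k (\<omega> s) (pl s)" using pldot[OF that(1)] that(2) by simp
      then show ?thesis using that(2) by simp
    qed simp
    ultimately show False by simp
  qed
  have plc: "continuous_on ?I (\<lambda>s. pl s i)" for i
    unfolding pl_def by (intro continuous_intros)
  have Ac: "continuous_on B (\<lambda>p. A (f p) (g p))"
    if "continuous_on B f" "continuous_on B g" "\<And>p. p \<in> B \<Longrightarrow> f p \<in> ?I" for B :: "(real \<times> real) set" and f g
    unfolding A_def
    by (intro continuous_on_coordinatewise_then_product continuous_intros that(2)
        continuous_on_compose2[OF plc that(1)] continuous_on_compose2[OF continuous_on_product_then_coordinatewise[OF \<omega>c] that(1)])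
      (use that(3) in auto)
  have AS: "nz k (A s r) \<in> Sph k" if "s \<in> ?I" "r \<in> ?I" for s r
    by (rule nz_Sph[OF A[OF that]]) (use \<omega>S[OF that(1)] pl0 that in \<open>simp add: A_def Sph_def\<close>)
  have A1: "A s 1 = pl s" and A0: "A s 0 = \<omega> s" for s
    by (auto simp: A_def)
  \<comment> \<open>Generic with respect to the planes spanned by the edges; as the polygon lies in
    these planes, its normalisation never reaches the antipode of \<open>c\<close>.\<close>
  obtain c where c: "c \<in> Sph k" "\<And>u v \<alpha> \<beta>. (u, v) \<in> (\<lambda>m. (\<omega> (real m / N), \<omega> (real (Suc m) / N))) ` {..<N} \<Longrightarrow> \<exists>i\<le>k. c i \<noteq> \<alpha> * u i + \<beta> * v i"
    using exists_generic_point[OF k, of "(\<lambda>m. (\<omega> (real m / N), \<omega> (real (Suc m) / N))) ` {..<N}"] by auto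
  have cne: "c \<noteq> (\<lambda>i. - nz k (A s 1) i)" if s: "s \<in> ?I" for s
  proof
    assume eq: "c = (\<lambda>i. - nz k (A s 1) i)"
    obtain m u where mu: "m < N" "pl s = (\<lambda>i. (1 - u) * \<omega> (real m / N) i + u * \<omega> (real (Suc m) / N) i)"
      using pl[OF s] by blast
    let ?n = "L2_set (pl s) {..k}"
    have "c i = (- (1 - u) / ?n) * \<omega> (real m / N) i + (- u / ?n) * \<omega> (real (Suc m) / N) i" for i
    proof -
      have "c i = - (pl s i / ?n)" using eq by (simp add: nz_def A1)
      also have "\<dots> = - (((1 - u) * \<omega> (real m / N) i + u * \<omega> (real (Suc m) / N) i) / ?n)"
        using fun_cong[OF mu(2), of i] by (simp only:)
      finally show ?thesis
        by (simp add: add_divide_distrib algebra_simps minus_divide_left[symmetric] diff_divide_distrib)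
    qed
    moreover have "(\<omega> (real m / N), \<omega> (real (Suc m) / N)) \<in> (\<lambda>m. (\<omega> (real m / N), \<omega> (real (Suc m) / N))) ` {..<N}"
      using mu(1) by blast
    ultimately show False using c(2) by blast
  qed
  define W where "W = (\<lambda>p. if snd p \<le> 1/2 then nz k (A (fst p) (2 * snd p)) else seg k (nz k (A (fst p) 1)) c (2 * snd p - 1))"
  show thesis
  proof (rule that)
    show "continuous_map (top_of_set (?I \<times> ?I)) (nsphere k) W"
      unfolding W_def
    proof (rule continuous_map_paste_le)
      show "continuous_on (?I \<times> ?I) snd" by (intro continuous_intros)
      let ?B = "{z \<in> ?I \<times> ?I. snd z \<le> 1/2}"
      have "continuous_on ?B (\<lambda>p. nz k (A (fst p) (2 * snd p)))"
        by (intro continuous_on_nz Ac continuous_intros A) auto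
      then show "continuous_map (top_of_set ?B) (nsphere k) (\<lambda>p. nz k (A (fst p) (2 * snd p)))"
        using AS by (auto simp: nsphere_eq continuous_map_in_subtopology)
      let ?B' = "{z \<in> ?I \<times> ?I. 1/2 \<le> snd z}"
      have "continuous_on ?B' (\<lambda>p. nz k (A (fst p) 1))"
        by (intro continuous_on_nz Ac continuous_intros A) auto
      then have "continuous_on ?B' (\<lambda>p. seg k (nz k (A (fst p) 1)) c (2 * snd p - 1))"
      proof (rule continuous_on_seg)
        fix p assume p: "p \<in> ?B'"
        then have p1: "fst p \<in> ?I" by auto
        show "nz k (A (fst p) 1) \<in> Sph k \<and> c \<in> Sph k \<and> c \<noteq> (\<lambda>i. - nz k (A (fst p) 1) i) \<and> 2 * snd p - 1 \<in> ?I"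
          using AS[OF p1, of 1] cne[OF p1] c(1) p by auto
      qed (intro continuous_intros)+
      then show "continuous_map (top_of_set ?B') (nsphere k) (\<lambda>p. seg k (nz k (A (fst p) 1)) c (2 * snd p - 1))"
        using seg_Sph[OF AS[of _ 1] c(1) cne] by (auto simp: nsphere_eq continuous_map_in_subtopology)
      fix z assume z: "z \<in> ?I \<times> ?I" "snd z = 1/2"
      then have e: "2 * snd z = 1" "(1::real) - 1 = 0" and z1: "fst z \<in> ?I" by auto
      show "nz k (A (fst z) (2 * snd z)) = seg k (nz k (A (fst z) 1)) c (2 * snd z - 1)"
        unfolding e using seg_ends(1)[OF AS[OF z1, of 1]] by simp
    qed
    show "W (s, 0) = \<omega> s" if "s \<in> ?I" for s
      using nz_id[OF \<omega>S[OF that]] by (simp add: W_def A0)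
    show "W (s, 1) = c" if "s \<in> ?I" for s
      using seg_ends(2)[OF c(1)] by (simp add: W_def)
    have "pl 0 = \<omega> 0"
    proof -
      obtain m u where "0 \<le> u" "0 * N = real m + u" "pl 0 = (\<lambda>i. (1 - u) * \<omega> (real m / N) i + u * \<omega> (real (Suc m) / N) i)"
        using pl[of 0] by auto
      moreover from this have "u = 0" "m = 0" by auto
      ultimately show ?thesis by simp
    qed
    moreover have "pl 1 = \<omega> 1"
    proof -
      obtain m u where mu: "m < N" "u \<le> 1" "real N = real m + u" "pl 1 = (\<lambda>i. (1 - u) * \<omega> (real m / N) i + u * \<omega> (real (Suc m) / N) i)"
        using pl[of 1] by auto
      moreover from mu have "u = 1" "Suc m = N" by linarith+
      ultimately show ?thesis using N(1) by simp
    qed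
    ultimately have "A 0 = A 1" using \<omega>(2) by (simp add: A_def fun_eq_iff)
    then show "W (0, r) = W (1, r)" if "r \<in> ?I" for r
      by (simp add: W_def)
  qed
qed

lemma fhom_sphere_loop:
  assumes k: "2 \<le> k" and f: "fhom j (nsphere k) \<omega> f g" and \<omega>: "\<omega> 0 = \<omega> 1" and j: "1 \<le> j"
  shows "fhom j (nsphere k) (\<lambda>_. \<omega> 0) f g"
proof -
  obtain W :: "real \<times> real \<Rightarrow> nat \<Rightarrow> real" and c where "continuous_map (top_of_set ({0..1} \<times> {0..1})) (nsphere k) W"
    "\<And>s. s \<in> {0..1} \<Longrightarrow> W (s, 0) = \<omega> s" "\<And>s. s \<in> {0..1} \<Longrightarrow> W (s, 1) = c"
    "\<And>r. r \<in> {0..1} \<Longrightarrow> W (0, r) = W (1, r)"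
    by (rule loop_contraction[OF k fhom_pathin[OF f j] \<omega>]) blast
  then show ?thesis
    by (rule fhom_free_null[OF f])
qed

lemma freely_homotopic_based:
  assumes k: "2 \<le> k" and j: "1 \<le> j" and "freely_homotopic j k f g"
    and f: "f \<in> cube_loops j (nsphere k) z" and g: "g \<in> cube_loops j (nsphere k) z"
  shows "fhom j (nsphere k) (\<lambda>_. z) f g"
proof -
  obtain \<omega> where \<omega>: "fhom j (nsphere k) \<omega> f g"
    using assms(3) by (auto simp: freely_homotopic_def)
  have "\<omega> 0 = z" "\<omega> 1 = z"
    using fhom_loops[OF \<omega>] f g corner_boundary[OF j] by (auto simp: cube_loops_iff)
  with fhom_sphere_loop[OF k \<omega> _ j] show ?thesis
    by simp
qed

section \<open>Transport of spherical classes in the quotient\<close>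

context free_quotient
begin

lemma act_continuous_map: "g \<in> carrier G \<Longrightarrow> continuous_map (nsphere k) (nsphere k) (\<phi> g)"
  using act_cont act by (auto simp: nsphere_eq continuous_map_in_subtopology)

lemma k2: "2 \<le> k"
  using k3 by simp

text \<open>A nontrivial element moves every point, so the map and its translate never agree;
  freeness of the action thus feeds the comparison of nowhere equal maps.\<close>

lemma freely_homotopic_act:
  assumes g: "g \<in> carrier G" and f: "f \<in> cube_loops j (nsphere k) z"
  shows "freely_homotopic j k (\<lambda>t. \<phi> g (f t)) f"
proof (cases "g = \<one>\<^bsub>G\<^esub>")
  case True
  have "fhom j (nsphere k) (\<lambda>_. z) (\<lambda>t. \<phi> g (f t)) f"
    by (rule fhom_cong[OF fhom_refl[OF f]]) (simp_all add: True act_one loops_Sph[OF f])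
  then show ?thesis
    unfolding freely_homotopic_def by blast
next
  case False
  have "\<phi> g (f t) \<noteq> f t" if "t \<in> Cube j" for t
    using act_free[OF g loops_Sph(2)[OF f that]] False by blast
  then show ?thesis
    by (rule freely_homotopic_distinct[OF odd_k cube_loops_map[OF act_continuous_map[OF g] f] f])
qed

text \<open>Free homotopy classes in the sphere do not see base points, and the group acts trivially on
  them; hence transports of a spherical class along arbitrary paths of the quotient agree.\<close>

lemma transports_agree:
  assumes f: "f \<in> cube_loops j (nsphere k) z" "f' \<in> cube_loops j (nsphere k) z'" and ff': "freely_homotopic j k f f'"
    and g: "fhom j X \<gamma> (\<lambda>t. P (f t)) g" "fhom j X \<gamma>' (\<lambda>t. P (f' t)) g'" and e: "\<gamma> 1 = b" "\<gamma>' 1 = b" and j: "2 \<le> j"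
  shows "fhom j X (\<lambda>_. b) g g'"
proof -
  have j1: "1 \<le> j" using j by simp
  obtain \<delta> h where h: "fhom j (nsphere k) \<delta> f h" "\<And>s. s \<in> {0..1} \<Longrightarrow> P (\<delta> s) = \<gamma> s" "\<And>t. t \<in> Cube j \<Longrightarrow> P (h t) = g t"
    using lift_fhom[OF g(1) f(1) _ j] by blast
  obtain \<delta>' h' where h': "fhom j (nsphere k) \<delta>' f' h'" "\<And>s. s \<in> {0..1} \<Longrightarrow> P (\<delta>' s) = \<gamma>' s" "\<And>t. t \<in> Cube j \<Longrightarrow> P (h' t) = g' t"
    using lift_fhom[OF g(2) f(2) _ j] by blast
  note l = fhom_loops(2)[OF h(1)] fhom_loops(2)[OF h'(1)]
  have S1: "\<delta> 1 \<in> S" "\<delta>' 1 \<in> S"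
    using cube_loops_base[OF l(1) j1] cube_loops_base[OF l(2) j1] by simp_all
  have "P (\<delta> 1) = P (\<delta>' 1)"
    using h(2)[of 1] h'(2)[of 1] e by simp
  then obtain u where u: "u \<in> carrier G" "\<delta>' 1 = \<phi> u (\<delta> 1)"
    using P_eq[OF S1] by blast
  have lu: "(\<lambda>t. \<phi> u (h t)) \<in> cube_loops j (nsphere k) (\<delta>' 1)"
    using cube_loops_map[OF act_continuous_map[OF u(1)] l(1)] u(2) by simp
  have "freely_homotopic j k (\<lambda>t. \<phi> u (h t)) h"
    by (rule freely_homotopic_act[OF u(1) l(1)])
  moreover have "freely_homotopic j k h f" "freely_homotopic j k f' h'"
    using freely_homotopic_sym[of j k f h] h(1) h'(1) unfolding freely_homotopic_def by blast+
  ultimately have "freely_homotopic j k (\<lambda>t. \<phi> u (h t)) h'"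
    using ff' by (meson freely_homotopic_trans)
  then have "fhom j (nsphere k) (\<lambda>_. \<delta>' 1) (\<lambda>t. \<phi> u (h t)) h'"
    by (rule freely_homotopic_based[OF k2 j1 _ lu l(2)])
  from fhom_map[OF P(1) this] show ?thesis
  proof (rule fhom_cong)
    show "P (\<phi> u (h t)) = g t" if "t \<in> Cube j" for t
      using P_act[OF u(1) loops_Sph(2)[OF l(1) that]] h(3)[OF that] by simp
  qed (use h'(2)[of 1] h'(3) e in auto)
qed

text \<open>Surjectivity is lifting of cubes, injectivity is lifting of homotopies; both need 2
  \<le> j because lifts have to be constant on the boundary.\<close>

lemma P_iso:
  assumes z: "z \<in> S" and j: "2 \<le> j"
  shows "homotopy_hom j X (P z) P \<in> iso (homotopy_group j (nsphere k) z) (homotopy_group j X (P z))"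
proof -
  let ?h = "homotopy_hom j X (P z) P"
  have c: "?h (cube_class j (nsphere k) z f) = cube_class j X (P z) (\<lambda>t. P (f t))" if "f \<in> cube_loops j (nsphere k) z" for f
    by (rule homotopy_hom_class[OF P(1) that]) simp
  have "inj_on ?h (carrier (homotopy_group j (nsphere k) z))"
  proof (rule inj_onI)
    fix A B assume AB: "A \<in> carrier (homotopy_group j (nsphere k) z)" "B \<in> carrier (homotopy_group j (nsphere k) z)" "?h A = ?h B"
    obtain f where f: "f \<in> cube_loops j (nsphere k) z" "A = cube_class j (nsphere k) z f"
      using AB(1) by (rule carrier_homotopy_groupE)
    obtain g where g: "g \<in> cube_loops j (nsphere k) z" "B = cube_class j (nsphere k) z g"
      using AB(2) by (rule carrier_homotopy_groupE)
    have "fhom j X (\<lambda>_. P z) (\<lambda>t. P (f t)) (\<lambda>t. P (g t))"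
      using AB(3) cube_class_eq_iff[OF cube_loops_map[OF P(1) f(1)] cube_loops_map[OF P(1) g(1)]]
      by (simp add: f(2) g(2) c f(1) g(1))
    from lift_fhom_const[OF this f(1) g(1) j] show "A = B"
      unfolding f(2) g(2) by (rule cube_classI)
  qed
  moreover have "carrier (homotopy_group j X (P z)) \<subseteq> ?h ` carrier (homotopy_group j (nsphere k) z)"
  proof
    fix B assume "B \<in> carrier (homotopy_group j X (P z))"
    then obtain g where g: "g \<in> cube_loops j X (P z)" "B = cube_class j X (P z) g"
      by (rule carrier_homotopy_groupE)
    obtain f where f: "f \<in> cube_loops j (nsphere k) z" "\<And>t. t \<in> Cube j \<Longrightarrow> P (f t) = g t"
      using lift_cube[OF g(1) z j] by blast
    have "fhom j X (\<lambda>_. P z) g (\<lambda>t. P (f t))"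
      by (rule fhom_cong[OF fhom_refl[OF g(1)]]) (simp_all add: f(2))
    then have "B = ?h (cube_class j (nsphere k) z f)"
      unfolding g(2) c[OF f(1)] by (rule cube_classI)
    then show "B \<in> ?h ` carrier (homotopy_group j (nsphere k) z)"
      using cube_class_carrier[OF f(1)] by blast
  qed
  moreover have "?h \<in> hom (homotopy_group j (nsphere k) z) (homotopy_group j X (P z))"
    using homotopy_hom_hom[OF _ P(1), of j "P z" z] j by simp
  ultimately show ?thesis
    by (auto simp: iso_def bij_betw_def hom_def)
qed

text \<open>The chord belonging to the angle \<open>a\<close> has length 2 |sin (a/2)|.\<close>

lemma edist_rot: 
  assumes "z \<in> S"
  shows "d z (rot a z) \<le> \<bar>a\<bar>"
proof -
  obtain m where m: "k = Suc (2 * m)"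
    using odd_k oddE by fastforce
  have "dot k z (rot a z) = cos a * dot k z z"
    unfolding dot_def m sum_pairs sum_distrib_left
    by (intro sum.cong) (auto simp: rot_def algebra_simps)
  then have dz: "dot k z (rot a z) = cos a"
    using assms by (simp add: Sph_iff)
  have r: "dot k (rot a z) (rot a z) = 1" "dot k z z = 1"
    using assms rot_Sph[OF odd_k assms, of a] by (simp_all add: Sph_iff)
  have "(\<Sum>i\<le>k. (z i - rot a z i)\<^sup>2) = dot k z z + dot k (rot a z) (rot a z) - 2 * dot k z (rot a z)"
    unfolding dot_def by (simp add: power2_eq_square algebra_simps sum.distrib sum_subtractf sum_distrib_left)
  also have "\<dots> = 2 - 2 * cos (2 * (a/2))"
    by (simp add: dz r)
  also have "\<dots> = (2 * sin (a/2))\<^sup>2"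
    unfolding cos_double_sin by (simp add: power2_eq_square)
  finally have e: "(\<Sum>i\<le>k. (z i - rot a z i)\<^sup>2) = (2 * sin (a/2))\<^sup>2" .
  have "d z (rot a z) = \<bar>2 * sin (a/2)\<bar>"
    unfolding edist_def L2_set_def e by (rule real_sqrt_abs)
  also have "\<dots> \<le> \<bar>a\<bar>"
    using abs_sin_x_le_abs_x[of "a/2"] by (simp add: abs_mult)
  finally show ?thesis .
qed

text \<open>The bound \<epsilon> keeps small rotations within separation distance. The bound 1 keeps
  the angle below \<pi>, where a nonzero angle has cosine less than 1.\<close>

definition \<eta> :: real where "\<eta> = min 1 \<epsilon>"

text \<open>The two rotated points are closer than \<epsilon>. In a common orbit they would
  coincide, but rotation by their nonzero angle difference has no fixed points.\<close>

lemma rot_separates: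
  assumes z: "z \<in> S" and a: "a \<noteq> b" "\<bar>a - b\<bar> < \<eta>"
  shows "P (rot a z) \<noteq> P (rot b z)"
proof
  define w where "w = rot b z"
  have w: "w \<in> S" unfolding w_def by (rule rot_Sph[OF odd_k z])
  have wa: "rot a z = rot (a - b) w" by (simp add: w_def rot_rot)
  assume "P (rot a z) = P (rot b z)"
  moreover have "d (rot b z) (rot a z) < \<epsilon>"
    using edist_rot[OF w, of "a - b"] a(2) unfolding wa w_def[symmetric] by (simp add: \<eta>_def)
  ultimately have "rot (a - b) w = w"
    using \<epsilon>(2)[of w "rot (a - b) w"] rot_Sph[OF odd_k w] w unfolding wa w_def[symmetric] by simp
  then have "cos \<bar>a - b\<bar> = 1"
    using rot_fixed[OF odd_k w] by simp
  moreover have "cos \<bar>a - b\<bar> < cos 0"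
    using a pi_gt3 by (intro cos_monotone_0_pi) (auto simp: \<eta>_def)
  ultimately show False by simp
qed

subsection \<open>Orbit configurations\<close>

text \<open>For \<open>R\<close> empty this is the total space over configurations of the quotient;
  for \<open>R\<close> the orbit of a point q, it is the fibre over the configurations that start at
  q.\<close>

definition OC :: "nat \<Rightarrow> (nat \<Rightarrow> real) set \<Rightarrow> (nat \<Rightarrow> nat \<Rightarrow> real) set" where
  "OC m R = {z \<in> PiE {..<m} (\<lambda>_. S - R). \<forall>i<m. \<forall>l<m. i \<noteq> l \<longrightarrow> P (z i) \<noteq> P (z l)}"

lemma OC_iff: "z \<in> OC m R \<longleftrightarrow> z \<in> extensional {..<m} \<and> (\<forall>i<m. z i \<in> S \<and> z i \<notin> R) \<and> (\<forall>i<m. \<forall>l<m. i \<noteq> l \<longrightarrow> P (z i) \<noteq> P (z l))"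
  by (auto simp: OC_def PiE_def Pi_iff)

lemma orbit_disjoint:
  assumes "z \<in> S" "w \<in> S"
  shows "orbit G \<phi> z \<inter> orbit G \<phi> w = {} \<longleftrightarrow> P z \<noteq> P w"
proof -
  have "P z = P w" if meet: "orbit G \<phi> z \<inter> orbit G \<phi> w \<noteq> {}"
  proof -
    obtain g h where "g \<in> carrier G" "h \<in> carrier G" "\<phi> g z = \<phi> h w"
      using meet unfolding orbit_def by blast
    then show ?thesis
      using P_act[of g z] P_act[of h w] assms by simp
  qed
  moreover have "orbit G \<phi> z \<inter> orbit G \<phi> w \<noteq> {}" if eq: "P z = P w"
  proof -
    obtain g where g: "g \<in> carrier G" "w = \<phi> g z"
      using P_eq[OF assms] eq by blast
    have "w = \<phi> \<one>\<^bsub>G\<^esub> w" "\<one>\<^bsub>G\<^esub> \<in> carrier G"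
      using act_one[OF assms(2)] group.is_monoid[OF G(1)] monoid.one_closed by auto
    then have "w \<in> orbit G \<phi> z" "w \<in> orbit G \<phi> w"
      unfolding orbit_def using g by blast+
    then show ?thesis by blast
  qed
  ultimately show ?thesis by blast
qed

lemma orbit_conf_space_eq: "orbit_conf_space G \<phi> m (subtopology (nsphere k) (S - R)) = top_of_set (OC m R)"
proof -
  have "subtopology (nsphere k) (S - R) = top_of_set (S - R)"
    by (simp add: nsphere_eq subtopology_subtopology Int_absorb1)
  then have "orbit_conf_space G \<phi> m (subtopology (nsphere k) (S - R)) =
    top_of_set (PiE {..<m} (\<lambda>_. S - R) \<inter> {x. \<forall>i<m. \<forall>j<m. i \<noteq> j \<longrightarrow> orbit G \<phi> (x i) \<inter> orbit G \<phi> (x j) = {}})"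
    by (simp add: orbit_conf_space_def product_topology_top_of_set subtopology_subtopology)
  moreover have "PiE {..<m} (\<lambda>_. S - R) \<inter> {x. \<forall>i<m. \<forall>j<m. i \<noteq> j \<longrightarrow> orbit G \<phi> (x i) \<inter> orbit G \<phi> (x j) = {}} = OC m R"
  proof -
    have Q: "(\<forall>i<m. \<forall>j<m. i \<noteq> j \<longrightarrow> orbit G \<phi> (x i) \<inter> orbit G \<phi> (x j) = {}) \<longleftrightarrow> (\<forall>i<m. \<forall>j<m. i \<noteq> j \<longrightarrow> P (x i) \<noteq> P (x j))"
      if "x \<in> PiE {..<m} (\<lambda>_. S - R)" for x
    proof -
      have "x i \<in> S" if "i < m" for i
        using PiE_mem[OF \<open>x \<in> _\<close>, of i] that by simp
      then have od: "orbit G \<phi> (x i) \<inter> orbit G \<phi> (x l) = {} \<longleftrightarrow> P (x i) \<noteq> P (x l)" if "i < m" "l < m" for i l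
        using that by (intro orbit_disjoint)
      show ?thesis
        by (rule all_cong, rule all_cong, rule imp_cong[OF refl], rule od)
    qed
    show ?thesis
      unfolding OC_def by (rule Set.set_eqI) (simp only: Int_iff mem_Collect_eq Q cong: conj_cong)
  qed
  ultimately show ?thesis by simp
qed

definition Pn :: "nat \<Rightarrow> (nat \<Rightarrow> nat \<Rightarrow> real) \<Rightarrow> nat \<Rightarrow> 'b" where
  "Pn m z = (\<lambda>i\<in>{..<m}. P (z i))"

lemma topspace_conf_space: "topspace (conf_space m X) = {x \<in> PiE {..<m} (\<lambda>_. topspace X). \<forall>i<m. \<forall>l<m. i \<noteq> l \<longrightarrow> x i \<noteq> x l}"
  by (auto simp: conf_space_def)

lemma continuous_OC_component:
  assumes "i < m"
  shows "continuous_map (top_of_set (OC m R)) (nsphere k) (\<lambda>z. z i)"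
  using assms by (auto simp: nsphere_eq continuous_map_in_subtopology OC_iff intro!: continuous_on_coord)

lemma Pn_continuous: "continuous_map (top_of_set (OC m R)) (conf_space m X) (Pn m)"
  unfolding conf_space_def continuous_map_in_subtopology
proof (intro conjI)
  have "continuous_map (top_of_set (OC m R)) X (\<lambda>z. P (z i))" if "i < m" for i
    using continuous_map_compose[OF continuous_OC_component[OF that] P(1)] by (simp add: o_def)
  then show "continuous_map (top_of_set (OC m R)) (power_space m X) (Pn m)"
    by (auto simp: continuous_map_componentwise Pn_def)
  show "Pn m \<in> topspace (top_of_set (OC m R)) \<rightarrow> {x. \<forall>i<m. \<forall>j<m. i \<noteq> j \<longrightarrow> x i \<noteq> x j}"
    by (auto simp: Pn_def OC_iff)
qed

lemma ex_Pn:
  assumes "x \<in> topspace (conf_space m X)"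
  obtains e where "e \<in> OC m {}" "Pn m e = x"
proof -
  have x: "x \<in> PiE {..<m} (\<lambda>_. topspace X)" "\<And>i l. i < m \<Longrightarrow> l < m \<Longrightarrow> i \<noteq> l \<Longrightarrow> x i \<noteq> x l"
    using assms by (auto simp: topspace_conf_space)
  have "\<exists>z. z \<in> S \<and> P z = x i" if "i < m" for i
  proof -
    have "x i \<in> P ` S" unfolding P(3) using x(1) that by auto
    then show ?thesis by auto
  qed
  then obtain f where f: "\<And>i. i < m \<Longrightarrow> f i \<in> S \<and> P (f i) = x i"
    by metis
  show thesis
  proof (rule that[of "\<lambda>i\<in>{..<m}. f i"])
    show "(\<lambda>i\<in>{..<m}. f i) \<in> OC m {}"
      using f x(2) by (auto simp: OC_iff)
    show "Pn m (\<lambda>i\<in>{..<m}. f i) = x"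
      by (rule extensionalityI[of _ "{..<m}"]) (use f x(1) in \<open>auto simp: Pn_def PiE_def\<close>)
  qed
qed

lemma finite_orbit:
  assumes "z \<in> S"
  shows "finite {w \<in> S. P w = P z}"
proof (rule finite_subset)
  show "{w \<in> S. P w = P z} \<subseteq> (\<lambda>g. \<phi> g z) ` carrier G"
  proof
    fix w assume "w \<in> {w \<in> S. P w = P z}"
    then have "w \<in> S" "P z = P w" by auto
    with P_eq[OF assms] show "w \<in> (\<lambda>g. \<phi> g z) ` carrier G" by blast
  qed
qed (use G(2) in simp)

section \<open>Path-connectedness of orbit configurations\<close>

lemma ex_generic:
  assumes "finite B"
  obtains w where "w \<in> S" "w \<notin> B"
proof -
  obtain c where c: "c \<in> S" "\<And>u v \<alpha> \<beta>. (u, v) \<in> B \<times> B \<Longrightarrow> \<exists>i\<le>k. c i \<noteq> \<alpha> * u i + \<beta> * v i"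
    using exists_generic_point[OF k2, of "B \<times> B"] assms by auto
  have "c \<notin> B"
    using c(2)[of c c 1 0] by auto
  with c(1) show thesis by (rule that)
qed

lemma ex_generic_family:
  fixes m :: nat
  assumes "finite B"
  shows "\<exists>w. \<forall>i<m. w i \<in> S - B \<and> (\<forall>l<m. i \<noteq> l \<longrightarrow> P (w i) \<noteq> P (w l))"
proof (induction m)
  case (Suc m)
  then obtain w where w: "\<And>i. i < m \<Longrightarrow> w i \<in> S - B" "\<And>i l. i < m \<Longrightarrow> l < m \<Longrightarrow> i \<noteq> l \<Longrightarrow> P (w i) \<noteq> P (w l)"
    by blast
  have "finite (B \<union> (\<Union>i<m. {v \<in> S. P v = P (w i)}))"
    using assms w(1) finite_orbit by auto
  then obtain v where v: "v \<in> S" "v \<notin> B \<union> (\<Union>i<m. {v \<in> S. P v = P (w i)})"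
    by (rule ex_generic)
  then have "P v \<noteq> P (w i)" "P (w i) \<noteq> P v" if "i < m" for i
    using that w(1)[OF that] by fastforce+
  then show ?case
    using v w by (intro exI[of _ "w(m := v)"]) (auto simp: less_Suc_eq)
qed simp

definition joined :: "nat \<Rightarrow> (nat \<Rightarrow> real) set \<Rightarrow> (nat \<Rightarrow> nat \<Rightarrow> real) \<Rightarrow> (nat \<Rightarrow> nat \<Rightarrow> real) \<Rightarrow> bool" where
  "joined m R e e' \<longleftrightarrow> (\<exists>\<gamma>. pathin (top_of_set (OC m R)) \<gamma> \<and> \<gamma> 0 = e \<and> \<gamma> 1 = e')"

lemma joined_sym: "joined m R e e' \<Longrightarrow> joined m R e' e"
  unfolding joined_def by (metis pathin_rev path_rev_ends)

lemma joined_trans: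
  assumes "joined m R e e'" "joined m R e' e''"
  shows "joined m R e e''"
proof -
  obtain \<gamma> \<delta> where "pathin (top_of_set (OC m R)) \<gamma>" "\<gamma> 0 = e" "\<gamma> 1 = e'"
    "pathin (top_of_set (OC m R)) \<delta>" "\<delta> 0 = e'" "\<delta> 1 = e''"
    using assms unfolding joined_def by blast
  then show ?thesis
    unfolding joined_def by (intro exI[of _ "path_join \<gamma> \<delta>"]) (simp add: pathin_join)
qed

text \<open>A single point travels while the others rest. It must avoid \<open>R\<close> and the
  orbits of the other points, altogether a finite set, which does not separate the sphere.\<close>

lemma joined_update:
  assumes e: "e \<in> OC m R" and R: "finite R" and i: "i < m" and w: "w \<in> S - R" "\<And>l. l < m \<Longrightarrow> l \<noteq> i \<Longrightarrow> P w \<noteq> P (e l)"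
  shows "joined m R e (e(i := w))"
proof -
  let ?B = "R \<union> (\<Union>l\<in>{..<m} - {i}. {v \<in> S. P v = P (e l)})"
  have eS: "e l \<in> S" if "l < m" for l
    using e that by (simp add: OC_iff)
  have B: "finite ?B"
    using R finite_orbit eS by auto
  have ei: "e i \<in> S - ?B" "w \<in> S - ?B"
    using e i w by (auto simp: OC_iff)
  obtain \<gamma> where \<gamma>: "pathin (top_of_set (S - ?B)) \<gamma>" "\<gamma> 0 = e i" "\<gamma> 1 = w"
    by (rule path_avoiding_finite[OF k2 B ei])
  have "continuous_on {0..1} \<gamma>" and \<gamma>B: "\<And>s. s \<in> {0..1} \<Longrightarrow> \<gamma> s \<in> S - ?B"
    using \<gamma>(1) by (auto simp: pathin_def continuous_map_in_subtopology)
  then have "continuous_on {0..1} (\<lambda>s. e(i := \<gamma> s))"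
    by (intro continuous_on_fun_upd continuous_on_const)
  moreover have "e(i := \<gamma> s) \<in> OC m R" if "s \<in> {0..1}" for s
  proof -
    have "P (\<gamma> s) \<noteq> P (e l)" if "l < m" "l \<noteq> i" for l
      using \<gamma>B[OF \<open>s \<in> {0..1}\<close>] that by auto
    then show ?thesis
      using e i \<gamma>B[OF that] by (auto simp: OC_iff extensional_def) (metis+)?
  qed
  ultimately have "pathin (top_of_set (OC m R)) (\<lambda>s. e(i := \<gamma> s))"
    by (auto simp: pathin_def continuous_map_in_subtopology)
  then show ?thesis
    unfolding joined_def using \<gamma>(2,3) by (intro exI[of _ "\<lambda>s. e(i := \<gamma> s)"]) auto
qed

text \<open>Coordinates are replaced one at a time. Since the new points avoid the orbits of all old
  ones, every mixed tuple is again a configuration.\<close>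

lemma joined_generic:
  assumes e: "e \<in> OC m R" and R: "finite R"
    and w: "\<And>i. i < m \<Longrightarrow> w i \<in> S - R" "\<And>i l. i < m \<Longrightarrow> l < m \<Longrightarrow> i \<noteq> l \<Longrightarrow> P (w i) \<noteq> P (w l)"
      "\<And>i l. i < m \<Longrightarrow> l < m \<Longrightarrow> P (w i) \<noteq> P (e l)"
  shows "joined m R e (\<lambda>i\<in>{..<m}. w i)"
proof -
  define c where "c = (\<lambda>r i. if i < r then w i else e i)"
  have c: "c r \<in> OC m R" if "r \<le> m" for r
  proof -
    have "P (c r i) \<noteq> P (c r l)" if il: "i < m" "l < m" "i \<noteq> l" for i l
    proof -
      have "P (e i) \<noteq> P (e l)" "P (w i) \<noteq> P (w l)" "P (w i) \<noteq> P (e l)" "P (w l) \<noteq> P (e i)"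
        using e w(2,3) il by (auto simp: OC_iff)
      then show ?thesis unfolding c_def by metis
    qed
    moreover have "c r \<in> extensional {..<m}" "\<And>i. i < m \<Longrightarrow> c r i \<in> S \<and> c r i \<notin> R"
      using e w(1) that by (auto simp: OC_iff c_def extensional_def)
    ultimately show ?thesis by (simp add: OC_iff)
  qed
  have "joined m R e (c r)" if "r \<le> m" for r
    using that
  proof (induction r)
    case 0
    have "c 0 = e" by (auto simp: c_def)
    moreover have "pathin (top_of_set (OC m R)) (\<lambda>_. e)"
      using e by simp
    ultimately show ?case unfolding joined_def by metis
  next
    case (Suc r)
    have "joined m R (c r) ((c r)(r := w r))"
    proof (rule joined_update[OF c R])
      fix l assume l: "l < m" "l \<noteq> r"
      have "P (w r) \<noteq> P (w l)" "P (w r) \<noteq> P (e l)"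
        using w(2,3) l Suc.prems by auto
      then show "P (w r) \<noteq> P (c r l)" unfolding c_def by simp
    qed (use Suc.prems w in auto)
    moreover have "(c r)(r := w r) = c (Suc r)"
      by (auto simp: c_def)
    ultimately show ?case
      using Suc joined_trans by (metis Suc_leD)
  qed
  moreover have "c m = (\<lambda>i\<in>{..<m}. w i)"
    using e by (auto simp: c_def OC_iff extensional_def)
  ultimately show ?thesis by (metis order_refl)
qed

text \<open>Both configurations are moved to a third one that is generic with respect to the
  two.\<close>

lemma OC_path_connected:
  assumes e: "e \<in> OC m R" "e' \<in> OC m R" and R: "finite R"
  shows "joined m R e e'"
proof -
  let ?B = "R \<union> (\<Union>l<m. {v \<in> S. P v = P (e l)}) \<union> (\<Union>l<m. {v \<in> S. P v = P (e' l)})"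
  have "finite {v \<in> S. P v = P (e l)}" "finite {v \<in> S. P v = P (e' l)}" if "l < m" for l
    using e that by (intro finite_orbit; simp add: OC_iff)+
  then have B: "finite ?B"
    using R by (intro finite_UnI finite_UN_I) (simp_all only: lessThan_iff finite_lessThan)
  obtain w where wall: "\<forall>i<m. w i \<in> S - ?B \<and> (\<forall>l<m. i \<noteq> l \<longrightarrow> P (w i) \<noteq> P (w l))"
    using ex_generic_family[OF B] ..
  have w1: "w i \<in> S - ?B" if "i < m" for i
    using wall[rule_format, OF that] by (rule conjunct1)
  have w2: "P (w i) \<noteq> P (w l)" if "i < m" "l < m" "i \<noteq> l" for i l
    using wall[rule_format, OF that(1), THEN conjunct2, rule_format, OF that(2,3)] .
  have wR: "w i \<in> S - R" if "i < m" for i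
    using w1[OF that] by blast
  have we: "P (w i) \<noteq> P (e l)" and we': "P (w i) \<noteq> P (e' l)" if "i < m" "l < m" for i l
    using w1[OF that(1)] that(2) by blast+
  have "joined m R e (\<lambda>i\<in>{..<m}. w i)"
    by (rule joined_generic[OF e(1) R]) (fact wR w2 we)+
  moreover have "joined m R e' (\<lambda>i\<in>{..<m}. w i)"
    by (rule joined_generic[OF e(2) R]) (fact wR w2 we')+
  ultimately show ?thesis
    using joined_trans joined_sym by blast
qed

lemma conf_space_path:
  assumes "e \<in> OC m {}" "x \<in> topspace (conf_space m X)"
  obtains \<delta> where "pathin (conf_space m X) \<delta>" "\<delta> 0 = Pn m e" "\<delta> 1 = x"
proof -
  obtain e' where e': "e' \<in> OC m {}" "Pn m e' = x"
    by (rule ex_Pn[OF assms(2)])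
  obtain \<gamma> where \<gamma>: "pathin (top_of_set (OC m {})) \<gamma>" "\<gamma> 0 = e" "\<gamma> 1 = e'"
    using OC_path_connected[OF assms(1) e'(1)] by (auto simp: joined_def)
  show thesis
  proof (rule that)
    show "pathin (conf_space m X) (\<lambda>s. Pn m (\<gamma> s))"
      using continuous_map_compose[OF \<gamma>(1)[unfolded pathin_def] Pn_continuous] by (simp add: pathin_def o_def)
  qed (use \<gamma> e' in auto)
qed

text \<open>Close rotations of a point form a configuration, which gives a section of the projections
  of configurations to their first point.\<close>

definition \<sigma> :: "nat \<Rightarrow> (nat \<Rightarrow> real) \<Rightarrow> nat \<Rightarrow> nat \<Rightarrow> real" where
  "\<sigma> m z = (\<lambda>i\<in>{..<m}. rot (\<eta> * (real i / real m)) z)"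

lemma \<sigma>_OC: "z \<in> S \<Longrightarrow> \<sigma> m z \<in> OC m {}"
proof -
  assume z: "z \<in> S"
  have \<eta>: "\<eta> > 0" using \<epsilon>(1) by (simp add: \<eta>_def)
  have "P (rot (\<eta> * (real i / real m)) z) \<noteq> P (rot (\<eta> * (real l / real m)) z)" if "i < m" "l < m" "i \<noteq> l" for i l
  proof (rule rot_separates[OF z])
    have "0 \<le> real i / m" "real i / m < 1" "0 \<le> real l / m" "real l / m < 1"
      using that by auto
    then have "\<bar>real i / m - real l / m\<bar> < 1" by linarith
    then have "\<eta> * \<bar>real i / m - real l / m\<bar> < \<eta> * 1"
      using \<eta> by (intro mult_strict_left_mono) auto
    moreover have "\<eta> * (real i / m) - \<eta> * (real l / m) = \<eta> * (real i / m - real l / m)"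
      by (rule right_diff_distrib[symmetric])
    ultimately show "\<bar>\<eta> * (real i / m) - \<eta> * (real l / m)\<bar> < \<eta>"
      using \<eta> by (simp only: abs_mult)
  qed (use that \<eta> in auto)
  then show ?thesis
    using rot_Sph[OF odd_k z] by (auto simp: \<sigma>_def OC_iff)
qed

lemma \<sigma>_continuous: "continuous_map (nsphere k) (top_of_set (OC m {})) (\<sigma> m)"
proof -
  have "continuous_on S (\<lambda>z. \<sigma> m z i)" for i
    unfolding \<sigma>_def by (cases "i < m") (auto intro!: continuous_on_rot continuous_on_id continuous_on_const)
  then have "continuous_on S (\<sigma> m)"
    by (rule continuous_on_coordinatewise_then_product)
  then show ?thesis
    using \<sigma>_OC by (auto simp: nsphere_eq continuous_map_in_subtopology)
qed

lemma \<sigma>_0: "0 < m \<Longrightarrow> \<sigma> m z 0 = z"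
  by (simp add: \<sigma>_def)

end

section \<open>Moving configurations along with their first point\<close>

text \<open>From the equation, z - \<mu> z' is (\<mu> l' - l) v. With D the distance of z and z' and
  a = 1 - \<mu>, the squared norm of the left side is a^2 + \<mu> D^2. The right side is at most ((D
  + a) / 4)^2, hence at most (D^2 + a^2) / 8, by the Lipschitz bound 1/r and the bound r/4 on v. As
  \<mu> is at least 1/2, this forces D = 0.\<close>

lemma nz_inj_estimate:
  fixes \<mu> l l' r :: real
  assumes z: "z \<in> Sph k" "z' \<in> Sph k" and l: "0 \<le> l" "l \<le> 1" "\<bar>l' - l\<bar> \<le> edist k z z' / r"
    and r: "0 < r" "r \<le> 1" and v: "L2_set v {..k} \<le> r/4" and \<mu>: "1/2 \<le> \<mu>" "\<mu> \<le> 1"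
    and eq: "\<And>i. i \<le> k \<Longrightarrow> z i + l * v i = \<mu> * (z' i + l' * v i)"
  shows "z = z'"
proof -
  define D where "D = edist k z z'"
  define a where "a = 1 - \<mu>"
  have D0: "0 \<le> D" by (simp add: D_def edist_nonneg)
  have a0: "0 \<le> a" using \<mu> by (simp add: a_def)
  have D2: "D\<^sup>2 = 2 - 2 * dot k z z'"
  proof -
    have "D\<^sup>2 = (\<Sum>i\<le>k. (z i - z' i)\<^sup>2)"
      by (simp add: D_def edist_def L2_set_def sum_nonneg)
    also have "\<dots> = dot k z z + dot k z' z' - 2 * dot k z z'"
      unfolding dot_def by (simp add: power2_eq_square algebra_simps sum.distrib sum_subtractf sum_distrib_left)
    finally show ?thesis using z by (simp add: Sph_iff)
  qed
  have "(\<Sum>i\<le>k. (z i - \<mu> * z' i)\<^sup>2) = (\<Sum>i\<le>k. (\<mu> * l' - l)\<^sup>2 * (v i)\<^sup>2)"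
  proof (rule sum.cong)
    fix i assume "i \<in> {..k}"
    then have "z i - \<mu> * z' i = (\<mu> * l' - l) * v i"
      using eq[of i] by (simp add: algebra_simps)
    then show "(z i - \<mu> * z' i)\<^sup>2 = (\<mu> * l' - l)\<^sup>2 * (v i)\<^sup>2"
      by (simp add: power_mult_distrib)
  qed simp
  also have "\<dots> = (\<mu> * l' - l)\<^sup>2 * (L2_set v {..k})\<^sup>2"
    by (simp add: L2_set_def sum_nonneg sum_distrib_left)
  finally have 1: "(\<Sum>i\<le>k. (z i - \<mu> * z' i)\<^sup>2) = (\<mu> * l' - l)\<^sup>2 * (L2_set v {..k})\<^sup>2" .
  have "(\<Sum>i\<le>k. (z i - \<mu> * z' i)\<^sup>2) = dot k z z + \<mu>\<^sup>2 * dot k z' z' - 2 * \<mu> * dot k z z'"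
    unfolding dot_def by (simp add: power2_eq_square algebra_simps sum.distrib sum_subtractf sum_distrib_left)
  also have "\<dots> = a\<^sup>2 + \<mu> * D\<^sup>2"
    using z unfolding D2 a_def by (simp add: Sph_iff power2_eq_square algebra_simps)
  finally have 2: "a\<^sup>2 + \<mu> * D\<^sup>2 = (\<mu> * l' - l)\<^sup>2 * (L2_set v {..k})\<^sup>2"
    using 1 by simp
  have "\<bar>\<mu> * l' - l\<bar> \<le> D / r + a"
  proof -
    have "\<mu> * l' - l = \<mu> * (l' - l) - a * l" by (simp add: a_def algebra_simps)
    then have "\<bar>\<mu> * l' - l\<bar> \<le> \<mu> * \<bar>l' - l\<bar> + a * l"
      using \<mu> l a0 abs_triangle_ineq4[of "\<mu> * (l' - l)" "a * l"] by (simp add: abs_mult)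
    also have "\<dots> \<le> 1 * \<bar>l' - l\<bar> + a * 1"
      using \<mu> l a0 by (intro add_mono mult_right_mono mult_left_mono) auto
    finally show ?thesis using l(3) by (simp add: D_def)
  qed
  then have "\<bar>\<mu> * l' - l\<bar> * L2_set v {..k} \<le> (D / r + a) * (r/4)"
    using v r D0 a0 by (intro mult_mono) auto
  also have "\<dots> = (D + a * r) / 4" using r by (simp add: field_simps)
  also have "\<dots> \<le> (D + a) / 4" using r a0 by (simp add: mult_left_le)
  finally have "(\<bar>\<mu> * l' - l\<bar> * L2_set v {..k})\<^sup>2 \<le> ((D + a) / 4)\<^sup>2"
    by (intro power_mono) auto
  then have "a\<^sup>2 + \<mu> * D\<^sup>2 \<le> ((D + a) / 4)\<^sup>2"
    by (simp only: 2 power_mult_distrib power2_abs)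
  moreover have "((D + a) / 4)\<^sup>2 \<le> (D\<^sup>2 + a\<^sup>2) / 8"
    using sum_squares_bound[of D a] by (simp add: power2_eq_square algebra_simps)
  moreover have "1/2 * D\<^sup>2 \<le> \<mu> * D\<^sup>2"
    using \<mu>(1) by (intro mult_right_mono) auto
  moreover have "0 \<le> a\<^sup>2" by simp
  moreover have "x \<le> 0" if "y + m \<le> c" "c \<le> (x + y) / 8" "1/2 * x \<le> m" "0 \<le> y" for x y m c :: real
  proof -
    have "8 * c \<le> x + y" "x \<le> 2 * m"
      using that by simp_all
    then show ?thesis using that(1,4) by linarith
  qed
  ultimately have "D\<^sup>2 \<le> 0" by blast
  then have "D = 0" by simp
  then show ?thesis
    using edist_eq_0[OF z] by (simp add: D_def)
qed

section \<open>Equivariant pushes supported near an orbit\<close>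

context free_quotient
begin

text \<open>Twice the radius is at most \<epsilon>, so a ball of this radius meets each orbit at
  most once; the bound 1 keeps the displacements of a push far from the radius of the
  sphere.\<close>

definition rad :: real where "rad = min 1 (\<epsilon>/2)"

lemma rad: "0 < rad" "rad \<le> 1" "2 * rad \<le> \<epsilon>"
  using \<epsilon>(1) by (auto simp: rad_def)

definition bump :: "(nat \<Rightarrow> real) \<Rightarrow> (nat \<Rightarrow> real) \<Rightarrow> real" where
  "bump q z = max 0 (1 - d z q / rad)"

text \<open>For close \<open>q\<close>, \<open>q'\<close>, an injection of the sphere into itself which takes \<open>q\<close> to
  \<open>q'\<close> and is supported in a small ball around \<open>q\<close>.\<close>

definition push :: "(nat \<Rightarrow> real) \<Rightarrow> (nat \<Rightarrow> real) \<Rightarrow> (nat \<Rightarrow> real) \<Rightarrow> nat \<Rightarrow> real" where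
  "push q q' z = nz k (\<lambda>i. z i + bump q z * (q' i - q i))"

lemma bump_bounds: "0 \<le> bump q z" "bump q z \<le> 1"
  using rad(1) edist_nonneg[of k z q] by (auto simp: bump_def)

lemma bump_0: "rad \<le> d z q \<Longrightarrow> bump q z = 0"
  using rad(1) by (simp add: bump_def)

lemma bump_lipschitz: "\<bar>bump q z' - bump q z\<bar> \<le> d z z' / rad"
proof -
  have "\<bar>max 0 (1 - x) - max 0 (1 - y)\<bar> \<le> \<bar>x - y\<bar>" for x y :: real
    by linarith
  then have "\<bar>bump q z' - bump q z\<bar> \<le> \<bar>d z' q / rad - d z q / rad\<bar>"
    unfolding bump_def .
  also have "\<dots> = \<bar>d z' q - d z q\<bar> / rad"
    using rad(1) by (simp add: diff_divide_distrib[symmetric])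
  also have "\<dots> \<le> d z z' / rad"
    using rad(1) edist_triangle[of k z' q z] edist_triangle[of k z q z'] edist_commute[of k z z']
    by (intro divide_right_mono) auto
  finally show ?thesis .
qed

text \<open>The displacement has length at most rad/4, hence at most 1/4. Normalisation is therefore
  possible, and two such norms have quotient at least 3/5, above the 1/2 required by
  \<open>nz_inj_estimate\<close>.\<close>

lemma push_norm:
  assumes "z \<in> S" "d q q' \<le> rad/4"
  shows "3/4 \<le> L2_set (\<lambda>i. z i + bump q z * (q' i - q i)) {..k}" "L2_set (\<lambda>i. z i + bump q z * (q' i - q i)) {..k} \<le> 5/4"
proof -
  have v: "L2_set (\<lambda>i. bump q z * (q' i - q i)) {..k} \<le> 1/4"
  proof -
    have "L2_set (\<lambda>i. bump q z * (q' i - q i)) {..k} = bump q z * d q' q"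
      using bump_bounds(1) by (simp add: edist_def L2_set_right_distrib)
    also have "\<dots> \<le> 1 * (rad/4)"
      using bump_bounds assms(2) rad(1) edist_commute[of k q q'] edist_nonneg[of k q' q] by (intro mult_mono) auto
    finally show ?thesis using rad(2) by simp
  qed
  have "L2_set (\<lambda>i. (z i + bump q z * (q' i - q i)) + - (bump q z * (q' i - q i))) {..k} \<le>
    L2_set (\<lambda>i. z i + bump q z * (q' i - q i)) {..k} + L2_set (\<lambda>i. - (bump q z * (q' i - q i))) {..k}"
    by (rule L2_set_triangle_ineq)
  moreover have "L2_set (\<lambda>i. - (bump q z * (q' i - q i))) {..k} = L2_set (\<lambda>i. bump q z * (q' i - q i)) {..k}"
    by (simp add: L2_set_def)
  ultimately show "3/4 \<le> L2_set (\<lambda>i. z i + bump q z * (q' i - q i)) {..k}"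
    using v L2_set_Sph[OF assms(1)] by simp
  show "L2_set (\<lambda>i. z i + bump q z * (q' i - q i)) {..k} \<le> 5/4"
    using L2_set_triangle_ineq[of z "\<lambda>i. bump q z * (q' i - q i)" "{..k}"] v L2_set_Sph[OF assms(1)] by simp
qed

lemma push_S: "q \<in> S \<Longrightarrow> q' \<in> S \<Longrightarrow> z \<in> S \<Longrightarrow> d q q' \<le> rad/4 \<Longrightarrow> push q q' z \<in> S"
  unfolding push_def using push_norm(1)[of z q q'] by (intro nz_Sph) (auto simp: Sph_def)

text \<open>Equal normalised vectors are proportional by the quotient of their norms. The case split
  arranges this quotient to be at most 1, exchanging the two points if necessary.\<close>

lemma push_inj:
  assumes q: "d q q' \<le> rad/4" and z: "z \<in> S" "z' \<in> S" and eq: "push q q' z = push q q' z'"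
  shows "z = z'"
proof -
  define n where "n = L2_set (\<lambda>i. z i + bump q z * (q' i - q i)) {..k}"
  define n' where "n' = L2_set (\<lambda>i. z' i + bump q z' * (q' i - q i)) {..k}"
  have n: "3/4 \<le> n" "n \<le> 5/4" "3/4 \<le> n'" "n' \<le> 5/4"
    unfolding n_def n'_def using push_norm[OF z(1) q] push_norm[OF z(2) q] by auto
  have e: "(z i + bump q z * (q' i - q i)) / n = (z' i + bump q z' * (q' i - q i)) / n'" for i
    using fun_cong[OF eq, of i] by (simp add: push_def nz_def n_def n'_def)
  have v: "L2_set (\<lambda>i. q' i - q i) {..k} \<le> rad/4"
    using q edist_commute[of k q q'] by (simp add: edist_def)
  show ?thesis
  proof (cases "n \<le> n'")
    case True
    have "z i + bump q z * (q' i - q i) = n / n' * (z' i + bump q z' * (q' i - q i))" for i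
      using e[of i] n by (simp add: field_simps)
    moreover have "1/2 \<le> n / n'" "n / n' \<le> 1"
      using n True by (auto simp: field_simps)
    ultimately show ?thesis
      using nz_inj_estimate[OF z bump_bounds bump_lipschitz rad(1,2) v] by blast
  next
    case False
    have "z' i + bump q z' * (q' i - q i) = n' / n * (z i + bump q z * (q' i - q i))" for i
      using e[of i] n by (simp add: field_simps)
    moreover have "1/2 \<le> n' / n" "n' / n \<le> 1"
      using n False by (auto simp: field_simps)
    ultimately show ?thesis
      using nz_inj_estimate[OF z(2,1) bump_bounds bump_lipschitz rad(1,2) v] by metis
  qed
qed

lemma push_outside: "z \<in> S \<Longrightarrow> rad \<le> d z q \<Longrightarrow> push q q' z = z"
  by (simp add: push_def bump_0 nz_id)

text \<open>A point pushed out of the ball would be fixed by a second push. Injectivity would then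
  make the original point fixed as well, although it lies inside the ball.\<close>

lemma push_ball:
  assumes "q \<in> S" "q' \<in> S" "z \<in> S" "d q q' \<le> rad/4" "d z q < rad"
  shows "d (push q q' z) q < rad"
proof (rule ccontr)
  assume "\<not> ?thesis"
  then have "push q q' (push q q' z) = push q q' z"
    using push_S[OF assms(1-4)] by (intro push_outside) auto
  then have "push q q' z = z"
    using push_inj[OF assms(4) push_S[OF assms(1-4)] assms(3)] by blast
  with \<open>\<not> ?thesis\<close> assms(5) show False by simp
qed

lemma push_center: "q \<in> S \<Longrightarrow> q' \<in> S \<Longrightarrow> push q q' q = q'"
  using rad(1) nz_id[of q' k] by (simp add: push_def bump_def)

lemma push_same: "z \<in> S \<Longrightarrow> push q q z = z"
  by (simp add: push_def nz_id)

text \<open>The equivariant extension: the translates of the ball are disjoint, so at most one summand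
  is nonzero.\<close>

definition epush :: "(nat \<Rightarrow> real) \<Rightarrow> (nat \<Rightarrow> real) \<Rightarrow> (nat \<Rightarrow> real) \<Rightarrow> nat \<Rightarrow> real" where
  "epush q q' z = (\<lambda>i. z i + (\<Sum>g\<in>carrier G. \<phi> g (push q q' (\<phi> (inv\<^bsub>G\<^esub> g) z)) i - z i))"

lemma inv_closed: "g \<in> carrier G \<Longrightarrow> inv\<^bsub>G\<^esub> g \<in> carrier G"
  by (rule group.inv_closed[OF G(1)])

lemma epush_term:
  assumes "z \<in> S" "g \<in> carrier G" "rad \<le> d (\<phi> (inv\<^bsub>G\<^esub> g) z) q"
  shows "\<phi> g (push q q' (\<phi> (inv\<^bsub>G\<^esub> g) z)) = z"
  using assms push_outside[of "\<phi> (inv\<^bsub>G\<^esub> g) z" q q'] act[OF inv_closed] act_inv' by simp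

lemma ball_unique:
  assumes "b \<in> S" "b' \<in> S" "P b = P b'" "d b q < rad" "d b' q < rad"
  shows "b = b'"
  using \<epsilon>(2)[OF assms(1-3)] edist_triangle[of k b b' q] edist_commute[of k b' q] rad(3) assms(4,5) by simp

lemma epush_in:
  assumes b: "b \<in> S" "d b q < rad" and g: "g \<in> carrier G"
  shows "epush q q' (\<phi> g b) = \<phi> g (push q q' b)"
proof
  fix i
  have z: "\<phi> g b \<in> S" by (rule act[OF g b(1)])
  have "(\<Sum>h\<in>carrier G. \<phi> h (push q q' (\<phi> (inv\<^bsub>G\<^esub> h) (\<phi> g b))) i - \<phi> g b i) =
    (\<Sum>h\<in>{g}. \<phi> h (push q q' (\<phi> (inv\<^bsub>G\<^esub> h) (\<phi> g b))) i - \<phi> g b i)"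
  proof (rule sum.mono_neutral_right)
    show "\<forall>h\<in>carrier G - {g}. \<phi> h (push q q' (\<phi> (inv\<^bsub>G\<^esub> h) (\<phi> g b))) i - \<phi> g b i = 0"
    proof
      fix h assume h: "h \<in> carrier G - {g}"
      let ?b' = "\<phi> (inv\<^bsub>G\<^esub> h) (\<phi> g b)"
      have b': "?b' \<in> S" "P ?b' = P b"
        using h act inv_closed z P_act[OF g b(1)] P_act[of "inv\<^bsub>G\<^esub> h" "\<phi> g b"] by auto
      have "rad \<le> d ?b' q"
      proof (rule ccontr)
        assume "\<not> ?thesis"
        then have "d ?b' q < rad" by (simp only: not_le)
        then have "?b' = b" by (rule ball_unique[OF b'(1) b(1) b'(2) _ b(2)])
        then have "\<phi> (inv\<^bsub>G\<^esub> h \<otimes>\<^bsub>G\<^esub> g) b = b"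
          using act_mult[of "inv\<^bsub>G\<^esub> h" g b] inv_closed[of h] h g b(1) by simp
        then have "inv\<^bsub>G\<^esub> h \<otimes>\<^bsub>G\<^esub> g = \<one>\<^bsub>G\<^esub>"
          using act_free[of "inv\<^bsub>G\<^esub> h \<otimes>\<^bsub>G\<^esub> g" b] inv_closed[of h] h g b(1) monoid.m_closed[OF group.is_monoid[OF G(1)]] by simp
        then have "g = h"
          using h g group.inv_solve_left[OF G(1), of "\<one>\<^bsub>G\<^esub>" h g] by (metis Diff_iff G(1) group.inv_closed group.inv_equality group.inv_inv)
        with h show False by simp
      qed
      then show "\<phi> h (push q q' ?b') i - \<phi> g b i = 0"
        using epush_term[OF z, of h q q'] h by simp
    qed
  qed (use G(2) g in auto)
  then show "epush q q' (\<phi> g b) i = \<phi> g (push q q' b) i"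
    using act_inv[OF g b(1)] by (simp add: epush_def)
qed

lemma epush_out:
  assumes z: "z \<in> S" and out: "\<And>b. b \<in> S \<Longrightarrow> d b q < rad \<Longrightarrow> P b \<noteq> P z"
  shows "epush q q' z = z"
proof
  fix i
  have "\<phi> g (push q q' (\<phi> (inv\<^bsub>G\<^esub> g) z)) i - z i = 0" if g: "g \<in> carrier G" for g
  proof -
    have "rad \<le> d (\<phi> (inv\<^bsub>G\<^esub> g) z) q"
      using out[of "\<phi> (inv\<^bsub>G\<^esub> g) z"] act[OF inv_closed[OF g] z] P_act[OF inv_closed[OF g] z] by force
    from epush_term[OF z g this] show ?thesis by simp
  qed
  then show "epush q q' z i = z i"
    by (simp add: epush_def)
qed

lemma epush_cases:
  assumes "z \<in> S"
  obtains b g where "b \<in> S" "d b q < rad" "g \<in> carrier G" "z = \<phi> g b" "epush q q' z = \<phi> g (push q q' b)"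
  | "\<And>b. b \<in> S \<Longrightarrow> d b q < rad \<Longrightarrow> P b \<noteq> P z" "epush q q' z = z"
proof (cases "\<exists>b\<in>S. d b q < rad \<and> P b = P z")
  case True
  then obtain b where b: "b \<in> S" "d b q < rad" "P b = P z" by blast
  then obtain g where "g \<in> carrier G" "z = \<phi> g b"
    using P_eq[OF b(1) assms] by blast
  then show thesis
    using that(1) b epush_in by blast
next
  case False
  then show thesis
    using that(2) epush_out[OF assms, of q q'] by blast
qed

lemma epush_S:
  assumes "q \<in> S" "q' \<in> S" "z \<in> S" "d q q' \<le> rad/4"
  shows "epush q q' z \<in> S"
  by (rule epush_cases[OF assms(3), of q q']) (use assms push_S act in auto)

text \<open>A push is injective and keeps its ball invariant, while each orbit meets the ball at
  most once. So orbits through the ball stay distinct among themselves and from the orbits outside,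
  and configurations are carried to configurations.\<close>

lemma epush_P_inj:
  assumes q: "q \<in> S" "q' \<in> S" "d q q' \<le> rad/4" and z: "z \<in> S" "w \<in> S" and eq: "P (epush q q' z) = P (epush q q' w)"
  shows "P z = P w"
proof -
  have out: False if b: "b \<in> S" "d b q < rad" "P (push q q' b) = P u" and u: "\<And>b. b \<in> S \<Longrightarrow> d b q < rad \<Longrightarrow> P b \<noteq> P u" for b u
    using u[OF push_S[OF q(1,2) b(1) q(3)] push_ball[OF q(1,2) b(1) q(3) b(2)]] b(3) by simp
  show ?thesis
  proof (rule epush_cases[OF z(1), of q q'])
    fix b g assume b: "b \<in> S" "d b q < rad" "g \<in> carrier G" "z = \<phi> g b" "epush q q' z = \<phi> g (push q q' b)"
    have bz: "P (epush q q' z) = P (push q q' b)"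
      using P_act[OF b(3) push_S[OF q(1,2) b(1) q(3)]] b(5) by simp
    show ?thesis
    proof (rule epush_cases[OF z(2), of q q'])
      fix c h assume c: "c \<in> S" "d c q < rad" "h \<in> carrier G" "w = \<phi> h c" "epush q q' w = \<phi> h (push q q' c)"
      have "P (push q q' b) = P (push q q' c)"
        using P_act[OF c(3) push_S[OF q(1,2) c(1) q(3)]] c(5) eq bz by simp
      then have "push q q' b = push q q' c"
        using push_S[OF q(1,2) _ q(3)] push_ball[OF q(1,2) _ q(3)] b(1,2) c(1,2) by (intro ball_unique) auto
      then have "b = c"
        by (rule push_inj[OF q(3) b(1) c(1)])
      then show ?thesis
        using P_act b c by simp
    next
      assume "\<And>b. b \<in> S \<Longrightarrow> d b q < rad \<Longrightarrow> P b \<noteq> P w" "epush q q' w = w"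
      then show ?thesis
        using out[OF b(1,2), of w] eq bz by metis
    qed
  next
    assume z': "\<And>b. b \<in> S \<Longrightarrow> d b q < rad \<Longrightarrow> P b \<noteq> P z" "epush q q' z = z"
    show ?thesis
    proof (rule epush_cases[OF z(2), of q q'])
      fix c h assume c: "c \<in> S" "d c q < rad" "h \<in> carrier G" "w = \<phi> h c" "epush q q' w = \<phi> h (push q q' c)"
      have "P (push q q' c) = P z"
        using P_act[OF c(3) push_S[OF q(1,2) c(1) q(3)]] c(5) eq z'(2) by simp
      then show ?thesis
        using out[OF c(1,2) _ z'(1)] by blast
    next
      assume "epush q q' w = w"
      then show ?thesis using eq z'(2) by simp
    qed
  qed
qed

lemma epush_center:
  assumes "q \<in> S" "q' \<in> S"
  shows "epush q q' q = q'"
  using epush_in[OF assms(1), of q "\<one>\<^bsub>G\<^esub>" q'] rad(1) act_one assms push_center[OF assms]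
    monoid.one_closed[OF group.is_monoid[OF G(1)]] by simp

lemma epush_same: "z \<in> S \<Longrightarrow> epush q q z = z"
  by (rule epush_cases[of z q q]) (auto simp: push_same)

lemma continuous_on_push:
  assumes c: "continuous_on A f" "continuous_on A f'" "continuous_on A h"
    and A: "\<And>p. p \<in> A \<Longrightarrow> h p \<in> S \<and> d (f p) (f' p) \<le> rad/4"
  shows "continuous_on A (\<lambda>p. push (f p) (f' p) (h p))"
  unfolding push_def
proof (rule continuous_on_nz)
  have "continuous_on A (\<lambda>p. bump (f p) (h p))"
    unfolding bump_def using rad(1)
    by (intro continuous_on_max continuous_on_diff continuous_on_divide continuous_on_const continuous_on_edist c) auto
  then show "continuous_on A (\<lambda>p i. h p i + bump (f p) (h p) * (f' p i - f p i))"
    by (intro continuous_on_coordinatewise_then_product continuous_on_add continuous_on_mult continuous_on_diff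
        continuous_on_product_then_coordinatewise[OF c(1)] continuous_on_product_then_coordinatewise[OF c(2)]
        continuous_on_product_then_coordinatewise[OF c(3)])
  show "L2_set (\<lambda>i. h p i + bump (f p) (h p) * (f' p i - f p i)) {..k} \<noteq> 0" if "p \<in> A" for p
    using push_norm(1)[of "h p" "f p" "f' p"] A[OF that] by auto
qed

text \<open>Joint continuity in the centre, the target and the point is required, because during a
  homotopy the first point, which is the centre, moves too.\<close>

lemma continuous_on_epush:
  assumes c: "continuous_on A f" "continuous_on A f'" "continuous_on A h"
    and A: "\<And>p. p \<in> A \<Longrightarrow> f p \<in> S \<and> f' p \<in> S \<and> h p \<in> S \<and> d (f p) (f' p) \<le> rad/4"
  shows "continuous_on A (\<lambda>p. epush (f p) (f' p) (h p))"
proof -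
  have "continuous_on A (\<lambda>p. \<phi> g (push (f p) (f' p) (\<phi> (inv\<^bsub>G\<^esub> g) (h p))))" if g: "g \<in> carrier G" for g
  proof (rule continuous_on_compose2[OF act_cont[OF g]])
    have "continuous_on A (\<lambda>p. \<phi> (inv\<^bsub>G\<^esub> g) (h p))"
      by (rule continuous_on_compose2[OF act_cont[OF inv_closed[OF g]] c(3)]) (use A in auto)
    then show "continuous_on A (\<lambda>p. push (f p) (f' p) (\<phi> (inv\<^bsub>G\<^esub> g) (h p)))"
      by (rule continuous_on_push[OF c(1,2)]) (use A act[OF inv_closed[OF g]] in auto)
    show "(\<lambda>p. push (f p) (f' p) (\<phi> (inv\<^bsub>G\<^esub> g) (h p))) ` A \<subseteq> S"
      using push_S A act[OF inv_closed[OF g]] by auto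
  qed
  note t = continuous_on_product_then_coordinatewise[OF this]
  show ?thesis
    unfolding epush_def
    by (intro continuous_on_coordinatewise_then_product continuous_on_add continuous_on_sum continuous_on_diff t
        continuous_on_product_then_coordinatewise[OF c(3)])
qed

text \<open>The projection to the first point has a local transport: push the entire configuration
  by the equivariant push from its first point to the new one. The last conclusion is inherited from
  the regularity of the general lifting.\<close>

lemma lift_first_point:
  fixes K :: "'k::metric_space set" and h :: "real \<times> 'k \<Rightarrow> nat \<Rightarrow> real"
  assumes m: "0 < m" and K: "compact K" and h: "continuous_map (top_of_set ({0..1} \<times> K)) (nsphere k) h"
    and e0: "continuous_map (top_of_set K) (top_of_set (OC m {})) e0" "\<And>t. t \<in> K \<Longrightarrow> e0 t 0 = h (0, t)"
  obtains H where "continuous_map (top_of_set ({0..1} \<times> K)) (top_of_set (OC m {})) H"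
    "\<And>s t. s \<in> {0..1} \<Longrightarrow> t \<in> K \<Longrightarrow> H (s, t) 0 = h (s, t)" "\<And>t. t \<in> K \<Longrightarrow> H (0, t) = e0 t"
    "\<And>s t. s \<in> {0..1} \<Longrightarrow> t \<in> K \<Longrightarrow> (\<And>s'. s' \<in> {0..1} \<Longrightarrow> h (s', t) = h (0, t)) \<Longrightarrow> H (s, t) = e0 t"
proof -
  define V where "V = {q \<in> S \<times> S. d (fst q) (snd q) < rad/4}"
  define T where "T = (\<lambda>q::(nat \<Rightarrow> nat \<Rightarrow> real) \<times> (nat \<Rightarrow> real). \<lambda>i\<in>{..<m}. epush (fst q 0) (snd q) (fst q i))"
  have "openin (top_of_set (S \<times> S)) V"
    unfolding V_def by (intro openin_Collect_less continuous_on_edist continuous_on_fst continuous_on_snd continuous_on_id)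
  then have V: "openin (prod_topology (nsphere k) (nsphere k)) V"
    by (simp add: nsphere_eq)
  have Vd: "(b, b) \<in> V" if "b \<in> topspace (nsphere k)" for b
    using that rad(1) by (simp add: V_def)
  \<comment> \<open>The domain of the transport as a plain subset, so that its continuity can be
    checked coordinatewise.\<close>
  let ?Y = "{q \<in> OC m {} \<times> S. (fst q 0, snd q) \<in> V}"
  have top: "subtopology (prod_topology (top_of_set (OC m {})) (nsphere k)) {(e, b). (e 0, b) \<in> V} = top_of_set ?Y"
    by (simp add: nsphere_eq subtopology_subtopology) (rule arg_cong[where f = top_of_set], auto)
  have S: "e i \<in> S" if "e \<in> OC m {}" "i < m" for e i
    using that by (simp add: OC_iff)
  have TOC: "T q \<in> OC m {}" if q: "q \<in> ?Y" for q
  proof -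
    have b: "fst q 0 \<in> S" "snd q \<in> S" "d (fst q 0) (snd q) \<le> rad/4" "fst q \<in> OC m {}"
      using q by (auto simp: V_def)
    have "P (epush (fst q 0) (snd q) (fst q i)) \<noteq> P (epush (fst q 0) (snd q) (fst q l))" if "i < m" "l < m" "i \<noteq> l" for i l
    proof
      assume "P (epush (fst q 0) (snd q) (fst q i)) = P (epush (fst q 0) (snd q) (fst q l))"
      from epush_P_inj[OF b(1-3) S[OF b(4) that(1)] S[OF b(4) that(2)] this] show False
        using b(4) that by (simp add: OC_iff)
    qed
    moreover have "epush (fst q 0) (snd q) (fst q i) \<in> S" if "i < m" for i
      by (rule epush_S[OF b(1,2) S[OF b(4) that] b(3)])
    ultimately show ?thesis
      by (simp add: OC_iff T_def)
  qed
  have comp: "continuous_on ?Y (\<lambda>q. fst q i)" for i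
    by (rule continuous_on_product_then_coordinatewise) (intro continuous_on_fst continuous_on_id)
  have "continuous_on ?Y (\<lambda>q. T q i)" for i
  proof (cases "i < m")
    case True
    have "continuous_on ?Y (\<lambda>q. epush (fst q 0) (snd q) (fst q i))"
      by (rule continuous_on_epush[OF comp _ comp]) (use S m True in \<open>auto simp: V_def intro: continuous_on_snd\<close>)
    then show ?thesis using True by (simp add: T_def)
  qed (simp add: T_def)
  then have "continuous_on ?Y T"
    by (rule continuous_on_coordinatewise_then_product)
  then have T: "continuous_map (subtopology (prod_topology (top_of_set (OC m {})) (nsphere k)) {(e, b). (e 0, b) \<in> V}) (top_of_set (OC m {})) T"
    unfolding top continuous_map_in_subtopology using TOC by (simp add: Pi_iff)
  show thesis
  proof (rule regular_homotopy_lift[of "nsphere k" V "top_of_set (OC m {})" "\<lambda>e. e 0" T K h e0])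
    show "T (e, b) 0 = b" if "e \<in> topspace (top_of_set (OC m {}))" "b \<in> topspace (nsphere k)" "(e 0, b) \<in> V" for e b
      using m that epush_center[of "e 0" b] S[of e 0] by (simp add: T_def)
    show "T (e, e 0) = e" if "e \<in> topspace (top_of_set (OC m {}))" for e
    proof (rule extensionalityI[of _ "{..<m}"])
      show "T (e, e 0) i = e i" if "i \<in> {..<m}" for i
        using epush_same[OF S[of e i]] that \<open>e \<in> _\<close> by (simp add: T_def)
    qed (use that in \<open>auto simp: T_def OC_iff\<close>)
    fix H assume "continuous_map (top_of_set ({0..1} \<times> K)) (top_of_set (OC m {})) H"
      "\<And>s t. s \<in> {0..1} \<Longrightarrow> t \<in> K \<Longrightarrow> H (s, t) 0 = h (s, t)" "\<And>t. t \<in> K \<Longrightarrow> H (0, t) = e0 t"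
      "\<And>s t. s \<in> {0..1} \<Longrightarrow> t \<in> K \<Longrightarrow> (\<And>s'. s' \<in> {0..1} \<Longrightarrow> h (s', t) = h (0, t)) \<Longrightarrow> H (s, t) = e0 t"
    then show thesis by (rule that)
  qed (rule V Vd T K h e0; assumption)+
qed

section \<open>Lifting loops and homotopies of configurations\<close>

lemma OC_loopI:
  assumes "\<And>i. i < m \<Longrightarrow> f i \<in> cube_loops j (nsphere k) (e i)" "e \<in> extensional {..<m}"
    and "\<And>t i l. t \<in> Cube j \<Longrightarrow> i < m \<Longrightarrow> l < m \<Longrightarrow> i \<noteq> l \<Longrightarrow> P (f i t) \<noteq> P (f l t)"
  shows "(\<lambda>t. \<lambda>i\<in>{..<m}. f i t) \<in> cube_loops j (top_of_set (OC m {})) e"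
proof -
  have "continuous_on (Cube j) (\<lambda>t. (\<lambda>i\<in>{..<m}. f i t) i)" for i
    using loops_Sph(1)[OF assms(1)] by (cases "i < m") auto
  then have "continuous_on (Cube j) (\<lambda>t. \<lambda>i\<in>{..<m}. f i t)"
    by (rule continuous_on_coordinatewise_then_product)
  moreover have "(\<lambda>i\<in>{..<m}. f i t) \<in> OC m {}" if "t \<in> Cube j" for t
    using loops_Sph(2)[OF assms(1)] assms(3) that by (simp add: OC_iff)
  moreover have "(\<lambda>i\<in>{..<m}. f i t) = e" if "t \<in> cube_boundary j" for t
    by (rule extensionalityI[of _ "{..<m}"]) (use loops_Sph(3)[OF assms(1)] assms(2) that in auto)
  ultimately show ?thesis
    by (simp add: cube_loops_iff continuous_map_in_subtopology Pi_iff)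
qed

lemma conf_loops_power:
  assumes "v \<in> cube_loops j (conf_space m X) x"
  shows "v \<in> cube_loops j (power_space m X) x" "t \<in> Cube j \<Longrightarrow> v t \<in> topspace (conf_space m X)"
proof -
  have "continuous_map (conf_space m X) (power_space m X) (\<lambda>z. z)"
    unfolding conf_space_def by (rule continuous_map_from_subtopology) simp
  from cube_loops_map[OF this assms] show "v \<in> cube_loops j (power_space m X) x" .
  show "t \<in> Cube j \<Longrightarrow> v t \<in> topspace (conf_space m X)"
    using assms continuous_map_funspace[of "top_of_set (Cube j)" "conf_space m X" v] by (auto simp: cube_loops_iff)
qed

text \<open>Coordinates are lifted one by one. The lifts lie in distinct orbits automatically,
  because their projections are the distinct points of a configuration.\<close>

lemma lift_conf_loop:
  assumes v: "v \<in> cube_loops j (conf_space m X) (Pn m e)" and e: "e \<in> OC m {}" and j: "2 \<le> j"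
  obtains u where "u \<in> cube_loops j (top_of_set (OC m {})) e" "\<And>t. t \<in> Cube j \<Longrightarrow> Pn m (u t) = v t"
proof -
  note vp = conf_loops_power[OF v]
  have "\<exists>f. f \<in> cube_loops j (nsphere k) (e i) \<and> (\<forall>t\<in>Cube j. P (f t) = v t i)" if i: "i < m" for i
  proof -
    have "(\<lambda>t. v t i) \<in> cube_loops j X (P (e i))"
      using loops_power_component[OF vp(1) i] i by (simp add: Pn_def)
    moreover have "e i \<in> S" using e i by (simp add: OC_iff)
    ultimately obtain f where "f \<in> cube_loops j (nsphere k) (e i)" "\<And>t. t \<in> Cube j \<Longrightarrow> P (f t) = v t i"
      using lift_cube[OF _ _ j] by metis
    then show ?thesis by blast
  qed
  then obtain f where f: "\<And>i. i < m \<Longrightarrow> f i \<in> cube_loops j (nsphere k) (e i)" "\<And>i t. i < m \<Longrightarrow> t \<in> Cube j \<Longrightarrow> P (f i t) = v t i"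
    by metis
  have "(\<lambda>t. \<lambda>i\<in>{..<m}. f i t) \<in> cube_loops j (top_of_set (OC m {})) e"
  proof (rule OC_loopI[OF f(1)])
    fix t i l assume "t \<in> Cube j" "i < m" "l < m" "i \<noteq> l"
    then show "P (f i t) \<noteq> P (f l t)"
      using vp(2)[of t] f(2) by (simp add: topspace_conf_space)
  qed (use e in \<open>auto simp: OC_iff\<close>)
  moreover have "Pn m (\<lambda>i\<in>{..<m}. f i t) = v t" if "t \<in> Cube j" for t
    by (rule extensionalityI[of _ "{..<m}"])
      (use f(2) that loops_power_extensional[OF vp(1) that] in \<open>auto simp: Pn_def\<close>)
  ultimately show thesis
    by (rule that)
qed

text \<open>Again coordinatewise. The lifted homotopy ends at \<open>w\<close> by uniqueness of
  lifts, since both agree at the corner of the cube.\<close>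

lemma lift_conf_fhom:
  assumes u: "u \<in> cube_loops j (top_of_set (OC m {})) e" "w \<in> cube_loops j (top_of_set (OC m {})) e"
    and fh: "fhom j (conf_space m X) (\<lambda>_. b) (\<lambda>t. Pn m (u t)) (\<lambda>t. Pn m (w t))" and j: "2 \<le> j"
  shows "fhom j (top_of_set (OC m {})) (\<lambda>_. e) u w"
proof -
  obtain h where h: "continuous_map (top_of_set ({0..1::real} \<times> Cube j)) (conf_space m X) h"
    "\<And>t. t \<in> Cube j \<Longrightarrow> h (0, t) = Pn m (u t)" "\<And>t. t \<in> Cube j \<Longrightarrow> h (1, t) = Pn m (w t)"
    "\<And>s t. s \<in> {0..1} \<Longrightarrow> t \<in> cube_boundary j \<Longrightarrow> h (s, t) = b"
    using fh by (rule fhomE_const) blast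
  have hc: "h p \<in> topspace (conf_space m X)" if "p \<in> {0..1} \<times> Cube j" for p
    using continuous_map_funspace[OF h(1)] that by auto
  have uOC: "u t \<in> OC m {}" "w t \<in> OC m {}" if "t \<in> Cube j" for t
    using u that by (auto simp: cube_loops_iff continuous_map_in_subtopology)
  have comp: "(\<lambda>t. u t i) \<in> cube_loops j (nsphere k) (e i)" "(\<lambda>t. w t i) \<in> cube_loops j (nsphere k) (e i)" if "i < m" for i
    using cube_loops_map[OF continuous_OC_component[OF that] u(1)] cube_loops_map[OF continuous_OC_component[OF that] u(2)] .
  have cb: "corner j \<in> cube_boundary j" using j by (simp add: corner_boundary)
  have "\<exists>H. continuous_map (top_of_set ({0..1} \<times> Cube j)) (nsphere k) H \<and>
    (\<forall>s\<in>{0..1}. \<forall>t\<in>Cube j. P (H (s, t)) = h (s, t) i) \<and> (\<forall>t\<in>Cube j. H (0, t) = u t i \<and> H (1, t) = w t i) \<and>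
    (\<forall>s\<in>{0..1}. \<forall>t\<in>cube_boundary j. H (s, t) = e i)" if i: "i < m" for i
  proof -
    have "continuous_map (conf_space m X) X (\<lambda>z. z i)"
      unfolding conf_space_def by (rule continuous_map_from_subtopology[OF continuous_map_power_proj[OF i]])
    from continuous_map_compose[OF h(1) this] have hi: "continuous_map (top_of_set ({0..1} \<times> Cube j)) X (\<lambda>p. h p i)"
      by (simp add: o_def)
    have ui: "continuous_map (top_of_set (Cube j)) (nsphere k) (\<lambda>t. u t i)"
      using comp(1)[OF i] by (simp add: cube_loops_iff)
    have u0: "P (u t i) = h (0, t) i" if "t \<in> Cube j" for t
      using h(2)[OF that] i by (simp add: Pn_def)
    obtain H where H: "continuous_map (top_of_set ({0..1} \<times> Cube j)) (nsphere k) H"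
      "\<And>s t. s \<in> {0..1} \<Longrightarrow> t \<in> Cube j \<Longrightarrow> P (H (s, t)) = h (s, t) i" "\<And>t. t \<in> Cube j \<Longrightarrow> H (0, t) = u t i"
      using lift_homotopy[OF compact_Cube hi ui u0] by blast
    have bd: "H (s, t) = e i" if st: "s \<in> {0..1}" "t \<in> cube_boundary j" for s t
    proof -
      have "H (s, t) = H (0, t)"
      proof (rule lift_constant[of "\<lambda>s. H (s, t)" "b i"])
        show "continuous_map (top_of_set {0..1}) (nsphere k) (\<lambda>s. H (s, t))"
          by (rule continuous_map_compose_on[OF H(1)])
            (use boundary_subset[OF st(2)] in \<open>auto intro!: continuous_on_Pair continuous_on_id continuous_on_const\<close>)
        show "P (H (r, t)) = b i" if "r \<in> {0..1}" for r
          using H(2)[OF that boundary_subset[OF st(2)]] h(4)[OF that st(2)] by simp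
      qed (rule st(1))
      then show ?thesis
        using H(3)[OF boundary_subset[OF st(2)]] comp(1)[OF i] st(2) by (simp add: cube_loops_iff)
    qed
    have "H (1, t) = w t i" if "t \<in> Cube j" for t
    proof (rule lift_unique[OF connected_Cube _ _ _ corner_Cube _ that])
      show "continuous_map (top_of_set (Cube j)) (nsphere k) (\<lambda>t. H (1, t))"
        by (rule continuous_map_compose_on[OF H(1)]) (auto intro!: continuous_on_Pair continuous_on_id continuous_on_const)
      show "continuous_map (top_of_set (Cube j)) (nsphere k) (\<lambda>t. w t i)"
        using comp(2)[OF i] by (simp add: cube_loops_iff)
      show "P (H (1, t)) = P (w t i)" if "t \<in> Cube j" for t
        using H(2)[of 1 t] h(3)[OF that] that i by (simp add: Pn_def)
      show "H (1, corner j) = w (corner j) i"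
        using bd[of 1, OF _ cb] comp(2)[OF i] cb by (simp add: cube_loops_iff)
    qed
    with H bd show ?thesis by blast
  qed
  then obtain H where "\<And>i. i < m \<Longrightarrow> continuous_map (top_of_set ({0..1} \<times> Cube j)) (nsphere k) (H i) \<and>
    (\<forall>s\<in>{0..1}. \<forall>t\<in>Cube j. P (H i (s, t)) = h (s, t) i) \<and> (\<forall>t\<in>Cube j. H i (0, t) = u t i \<and> H i (1, t) = w t i) \<and>
    (\<forall>s\<in>{0..1}. \<forall>t\<in>cube_boundary j. H i (s, t) = e i)"
    by metis
  then have H: "\<And>i. i < m \<Longrightarrow> continuous_map (top_of_set ({0..1} \<times> Cube j)) (nsphere k) (H i)"
    "\<And>i s t. i < m \<Longrightarrow> s \<in> {0..1} \<Longrightarrow> t \<in> Cube j \<Longrightarrow> P (H i (s, t)) = h (s, t) i"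
    "\<And>i t. i < m \<Longrightarrow> t \<in> Cube j \<Longrightarrow> H i (0, t) = u t i \<and> H i (1, t) = w t i"
    "\<And>i s t. i < m \<Longrightarrow> s \<in> {0..1} \<Longrightarrow> t \<in> cube_boundary j \<Longrightarrow> H i (s, t) = e i"
    by blast+
  have Hc: "continuous_on ({0..1} \<times> Cube j) (H i)" "\<And>p. p \<in> {0..1} \<times> Cube j \<Longrightarrow> H i p \<in> S" if "i < m" for i
    using H(1)[OF that] by (auto simp: nsphere_eq continuous_map_in_subtopology)
  have eext: "e \<in> extensional {..<m}"
    using uOC(1)[OF corner_Cube] u(1) cb by (auto simp: cube_loops_iff OC_iff)
  show ?thesis
  proof (rule fhomI)
    have "continuous_on ({0..1} \<times> Cube j) (\<lambda>p. (\<lambda>i\<in>{..<m}. H i p) i)" for i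
      using Hc(1) by (cases "i < m") auto
    then have "continuous_on ({0..1} \<times> Cube j) (\<lambda>p. \<lambda>i\<in>{..<m}. H i p)"
      by (rule continuous_on_coordinatewise_then_product)
    moreover have "(\<lambda>i\<in>{..<m}. H i p) \<in> OC m {}" if p: "p \<in> {0..1} \<times> Cube j" for p
    proof -
      have "P (H i p) = h p i" if "i < m" for i
        using H(2)[OF that, of "fst p" "snd p"] p by auto
      then show ?thesis
        using Hc(2)[OF _ p] hc[OF p] by (simp add: OC_iff topspace_conf_space)
    qed
    ultimately show "continuous_map (top_of_set ({0..1} \<times> Cube j)) (top_of_set (OC m {})) (\<lambda>p. \<lambda>i\<in>{..<m}. H i p)"
      by (simp add: continuous_map_in_subtopology Pi_iff)
    show "(\<lambda>i\<in>{..<m}. H i (0, t)) = u t" if "t \<in> Cube j" for t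
      by (rule extensionalityI[of _ "{..<m}"]) (use H(3) uOC(1)[OF that] that in \<open>auto simp: OC_iff\<close>)
    show "(\<lambda>i\<in>{..<m}. H i (1, t)) = w t" if "t \<in> Cube j" for t
      by (rule extensionalityI[of _ "{..<m}"]) (use H(3) uOC(2)[OF that] that in \<open>auto simp: OC_iff\<close>)
    show "(\<lambda>i\<in>{..<m}. H i (s, t)) = e" if "s \<in> {0..1}" "t \<in> cube_boundary j" for s t
      by (rule extensionalityI[of _ "{..<m}"]) (use H(4) that eext in auto)
  qed
qed

end

context free_quotient
begin

section \<open>The fibre over a point\<close>

definition ins :: "(nat \<Rightarrow> real) \<Rightarrow> nat \<Rightarrow> (nat \<Rightarrow> nat \<Rightarrow> real) \<Rightarrow> nat \<Rightarrow> nat \<Rightarrow> real" where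
  "ins q m u = (\<lambda>i\<in>{..<Suc m}. case i of 0 \<Rightarrow> q | Suc l \<Rightarrow> u l)"

definition rest :: "nat \<Rightarrow> (nat \<Rightarrow> nat \<Rightarrow> real) \<Rightarrow> nat \<Rightarrow> nat \<Rightarrow> real" where
  "rest m e = (\<lambda>l\<in>{..<m}. e (Suc l))"

lemma ins_simps [simp]: "ins q m u 0 = q" "l < m \<Longrightarrow> ins q m u (Suc l) = u l"
  by (simp_all add: ins_def)

lemma in_orbit_iff:
  assumes "z \<in> S" "q \<in> S"
  shows "z \<in> orbit G \<phi> q \<longleftrightarrow> P z = P q"
proof -
  have "z \<in> orbit G \<phi> q \<longleftrightarrow> (\<exists>g\<in>carrier G. z = \<phi> g q)"
    by (auto simp: orbit_def)
  also have "\<dots> \<longleftrightarrow> P q = P z"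
    using P_eq[OF assms(2,1)] by simp
  finally show ?thesis by auto
qed

lemma ins_OC:
  assumes q: "q \<in> S" and u: "u \<in> OC m (orbit G \<phi> q)"
  shows "ins q m u \<in> OC (Suc m) {}"
proof -
  have uS: "u l \<in> S" "P (u l) \<noteq> P q" if "l < m" for l
    using u that in_orbit_iff[OF _ q] by (auto simp: OC_iff)
  have "P (ins q m u i) \<noteq> P (ins q m u l)" if "i < Suc m" "l < Suc m" "i \<noteq> l" for i l
    using that uS(2)[of "i - 1"] uS(2)[of "l - 1"] u
    by (cases i; cases l) (auto simp: OC_iff dest: not_sym)
  moreover have "ins q m u i \<in> S" if "i < Suc m" for i
    using that uS(1) q by (cases i) auto
  ultimately show ?thesis
    by (simp add: OC_iff) (simp add: ins_def)
qed

lemma rest_OC: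
  assumes e: "e \<in> OC (Suc m) {}" "e 0 = q"
  shows "rest m e \<in> OC m (orbit G \<phi> q)" "ins q m (rest m e) = e"
proof -
  have q: "q \<in> S" using e by (auto simp: OC_iff)
  have "e (Suc l) \<in> S" "P (e (Suc l)) \<noteq> P q" if "l < m" for l
    using e that by (auto simp: OC_iff)
  then show "rest m e \<in> OC m (orbit G \<phi> q)"
    using e(1) in_orbit_iff[OF _ q] by (auto simp: OC_iff rest_def)
  show "ins q m (rest m e) = e"
  proof (rule extensionalityI[of _ "{..<Suc m}"])
    show "ins q m (rest m e) i = e i" if "i \<in> {..<Suc m}" for i
      using that e(2) by (cases i) (auto simp: rest_def)
  qed (use e(1) in \<open>auto simp: OC_iff ins_def\<close>)
qed

lemma rest_ins: "u \<in> OC m R \<Longrightarrow> rest m (ins q m u) = u"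
  by (rule extensionalityI[of _ "{..<m}"]) (auto simp: rest_def OC_iff)

lemma ins_continuous:
  assumes "q \<in> S"
  shows "continuous_map (top_of_set (OC m (orbit G \<phi> q))) (top_of_set (OC (Suc m) {})) (ins q m)"
proof -
  have "continuous_on (OC m (orbit G \<phi> q)) (\<lambda>u. ins q m u i)" for i
    unfolding ins_def by (cases "i < Suc m"; cases i) (auto intro!: continuous_on_coord)
  then have "continuous_on (OC m (orbit G \<phi> q)) (ins q m)"
    by (rule continuous_on_coordinatewise_then_product)
  then show ?thesis
    using ins_OC[OF assms] by (auto simp: continuous_map_in_subtopology)
qed

lemma continuous_on_rest:
  assumes "continuous_on A f"
  shows "continuous_on A (\<lambda>p. rest m (f p))"
proof (rule continuous_on_coordinatewise_then_product)
  show "continuous_on A (\<lambda>p. rest m (f p) i)" for i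
    unfolding rest_def using continuous_on_product_then_coordinatewise[OF assms] by (cases "i < m") auto
qed

lemma insert_first_eq: "insert_first (Suc m) (P q) P u = Pn (Suc m) (ins q m u)"
  by (auto simp: insert_first_def Pn_def ins_def fun_eq_iff split: nat.split)

text \<open>The null homotopy of the first coordinate is lifted to the whole configuration. At its
  end the first point is \<open>q\<close>, so the remaining points lie in the fibre; over the
  boundary the null homotopy is stationary, hence the lift is too.\<close>

lemma fibre_surj:
  assumes q: "q \<in> S" and y: "y \<in> OC m (orbit G \<phi> q)" and v: "v \<in> cube_loops j (top_of_set (OC (Suc m) {})) (ins q m y)"
    and null: "fhom j (nsphere k) (\<lambda>_. q) (\<lambda>t. v t 0) (\<lambda>_. q)"
  obtains u where "u \<in> cube_loops j (top_of_set (OC m (orbit G \<phi> q))) y"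
    "fhom j (top_of_set (OC (Suc m) {})) (\<lambda>_. ins q m y) v (\<lambda>t. ins q m (u t))"
proof -
  obtain h where h: "continuous_map (top_of_set ({0..1::real} \<times> Cube j)) (nsphere k) h"
    "\<And>t. t \<in> Cube j \<Longrightarrow> h (0, t) = v t 0" "\<And>t. t \<in> Cube j \<Longrightarrow> h (1, t) = q"
    "\<And>s t. s \<in> {0..1} \<Longrightarrow> t \<in> cube_boundary j \<Longrightarrow> h (s, t) = q"
    using null by (rule fhomE_const) blast
  have vc: "continuous_map (top_of_set (Cube j)) (top_of_set (OC (Suc m) {})) v" and vb: "\<And>t. t \<in> cube_boundary j \<Longrightarrow> v t = ins q m y"
    using v by (auto simp: cube_loops_iff)
  have h0: "v t 0 = h (0, t)" if "t \<in> Cube j" for t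
    using h(2)[OF that] by simp
  obtain H where H: "continuous_map (top_of_set ({0..1} \<times> Cube j)) (top_of_set (OC (Suc m) {})) H"
    "\<And>s t. s \<in> {0..1} \<Longrightarrow> t \<in> Cube j \<Longrightarrow> H (s, t) 0 = h (s, t)" "\<And>t. t \<in> Cube j \<Longrightarrow> H (0, t) = v t"
    "\<And>s t. s \<in> {0..1} \<Longrightarrow> t \<in> Cube j \<Longrightarrow> (\<And>s'. s' \<in> {0..1} \<Longrightarrow> h (s', t) = h (0, t)) \<Longrightarrow> H (s, t) = v t"
  proof (rule lift_first_point[OF zero_less_Suc compact_Cube h(1) vc h0])
    fix H
    assume "continuous_map (top_of_set ({0..1} \<times> Cube j)) (top_of_set (OC (Suc m) {})) H"
      "\<And>s t. s \<in> {0..1} \<Longrightarrow> t \<in> Cube j \<Longrightarrow> H (s, t) 0 = h (s, t)" "\<And>t. t \<in> Cube j \<Longrightarrow> H (0, t) = v t"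
      "\<And>s t. s \<in> {0..1} \<Longrightarrow> t \<in> Cube j \<Longrightarrow> (\<And>s'. s' \<in> {0..1} \<Longrightarrow> h (s', t) = h (0, t)) \<Longrightarrow> H (s, t) = v t"
    then show thesis by (rule that)
  qed
  have Hb: "H (s, t) = ins q m y" if st: "s \<in> {0..1}" "t \<in> cube_boundary j" for s t
  proof -
    have "H (s, t) = v t"
    proof (rule H(4)[OF st(1) boundary_subset[OF st(2)]])
      fix s' :: real assume "s' \<in> {0..1}"
      then show "h (s', t) = h (0, t)"
        using h(4)[of s' t] h(4)[of 0 t] st(2) by simp
    qed
    then show ?thesis using vb[OF st(2)] by simp
  qed
  have HOC: "H p \<in> OC (Suc m) {}" if "p \<in> {0..1} \<times> Cube j" for p
    using H(1) that by (auto simp: continuous_map_in_subtopology)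
  have H1: "H (1, t) 0 = q" if "t \<in> Cube j" for t
    using H(2)[of 1 t] h(3)[OF that] that by simp
  define u where "u = (\<lambda>t. rest m (H (1, t)))"
  have uH: "ins q m (u t) = H (1, t)" "u t \<in> OC m (orbit G \<phi> q)" if "t \<in> Cube j" for t
    using rest_OC[OF HOC[of "(1, t)"] H1[OF that]] that by (auto simp: u_def)
  have "continuous_on (Cube j) (\<lambda>t. H (1, t))"
  proof (rule continuous_on_compose2)
    show "continuous_on ({0..1} \<times> Cube j) H"
      using H(1) by (simp add: continuous_map_in_subtopology)
  qed (auto intro!: continuous_on_Pair continuous_on_id continuous_on_const)
  then have "continuous_on (Cube j) u"
    unfolding u_def by (rule continuous_on_rest)
  moreover have "u t = y" if "t \<in> cube_boundary j" for t
    using Hb[of 1 t] that rest_ins[OF y] by (simp add: u_def)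
  ultimately have "u \<in> cube_loops j (top_of_set (OC m (orbit G \<phi> q))) y"
    using uH(2) by (simp add: cube_loops_iff continuous_map_in_subtopology Pi_iff)
  moreover have "fhom j (top_of_set (OC (Suc m) {})) (\<lambda>_. ins q m y) v (\<lambda>t. ins q m (u t))"
    by (rule fhomI[OF H(1)]) (simp_all add: H(3) uH(1) Hb)
  ultimately show thesis
    by (rule that)
qed

text \<open>A null homotopy \<open>H\<close> in the total space is followed by the image under the section of
  the reverse of its projection. The projection of the composite then contracts along itself, and
  lifting this contraction moves the composite into the fibre.\<close>

lemma fibre_inj:
  assumes q: "q \<in> S" and y: "y \<in> OC m (orbit G \<phi> q)" and u: "u \<in> cube_loops j (top_of_set (OC m (orbit G \<phi> q))) y"
    and null: "fhom j (top_of_set (OC (Suc m) {})) (\<lambda>_. ins q m y) (\<lambda>t. ins q m (u t)) (\<lambda>_. ins q m y)" and j: "1 \<le> j"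
  shows "fhom j (top_of_set (OC m (orbit G \<phi> q))) (\<lambda>_. y) u (\<lambda>_. y)"
proof -
  let ?E = "top_of_set (OC (Suc m) {})" and ?F = "top_of_set (OC m (orbit G \<phi> q))" and ?I = "{0..1::real}"
  obtain H where H: "continuous_map (top_of_set (?I \<times> Cube j)) ?E H"
    "\<And>t. t \<in> Cube j \<Longrightarrow> H (0, t) = ins q m (u t)" "\<And>t. t \<in> Cube j \<Longrightarrow> H (1, t) = ins q m y"
    "\<And>s t. s \<in> ?I \<Longrightarrow> t \<in> cube_boundary j \<Longrightarrow> H (s, t) = ins q m y"
    using null by (rule fhomE_const) blast
  have uOC: "u t \<in> OC m (orbit G \<phi> q)" if "t \<in> Cube j" for t
    using u that by (auto simp: cube_loops_iff continuous_map_in_subtopology)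
  \<comment> \<open>The section over \<open>q\<close> need not pass through the base point
    \<open>y\<close> of the fibre; a path in the fibre bridges the gap.\<close>
  define y' where "y' = rest m (\<sigma> (Suc m) q)"
  have y': "y' \<in> OC m (orbit G \<phi> q)" "ins q m y' = \<sigma> (Suc m) q"
    unfolding y'_def by (rule rest_OC[OF \<sigma>_OC[OF q] \<sigma>_0], simp)+
  have "finite (orbit G \<phi> q)"
  proof -
    have "orbit G \<phi> q = (\<lambda>g. \<phi> g q) ` carrier G" by (auto simp: orbit_def)
    then show ?thesis using G(2) by simp
  qed
  then obtain c where c: "pathin ?F c" "c 0 = y" "c 1 = y'"
    using OC_path_connected[OF y y'(1)] by (auto simp: joined_def)
  define p where "p = (\<lambda>r. H r 0)"
  have pc: "continuous_map (top_of_set (?I \<times> Cube j)) (nsphere k) p"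
    using continuous_map_compose[OF H(1) continuous_OC_component[of 0]] by (simp add: p_def o_def)
  have pS: "p r \<in> S" if "r \<in> ?I \<times> Cube j" for r
    using continuous_map_funspace[OF pc] that by auto
  have p0: "p (0, t) = q" "p (1, t) = q" if "t \<in> Cube j" for t
    using H(2,3)[OF that] by (simp_all add: p_def)
  have pb: "p (s, t) = q" if "s \<in> ?I" "t \<in> cube_boundary j" for s t
    using H(4)[OF that] by (simp add: p_def)
  \<comment> \<open>Clock of the projected composite: it runs along \<open>p\<close> until time 1/2,
    waits during the bridging path until 3/4, and runs back at double the initial speed.\<close>
  define \<mu> where "\<mu> = (\<lambda>s::real. min (2 * s) (min 1 (4 - 4 * s)))"
  have \<mu>: "\<mu> s \<in> ?I" if "s \<in> ?I" for s
    using that by (auto simp: \<mu>_def)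
  have \<mu>1: "\<mu> s = 2 * s" if "s \<le> 1/2" for s
    using that by (simp add: \<mu>_def)
  have \<mu>2: "\<mu> s = 1" if "1/2 \<le> s" "s \<le> 3/4" for s
    using that by (simp add: \<mu>_def)
  have \<mu>3: "\<mu> s = 4 - 4 * s" if "3/4 \<le> s" for s
    using that by (simp add: \<mu>_def)
  define H' where "H' = (\<lambda>r. if fst r \<le> 1/2 then H (2 * fst r, snd r)
     else if fst r \<le> 3/4 then ins q m (c (4 * fst r - 2)) else \<sigma> (Suc m) (p (4 - 4 * fst r, snd r)))"
  have ic: "continuous_map (top_of_set ?I) ?E (\<lambda>s. ins q m (c s))"
    using continuous_map_compose[OF c(1)[unfolded pathin_def] ins_continuous[OF q]] by (simp add: o_def)
  have sp: "continuous_map (top_of_set (?I \<times> Cube j)) ?E (\<lambda>r. \<sigma> (Suc m) (p r))"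
    using continuous_map_compose[OF pc \<sigma>_continuous] by (simp add: o_def)
  have H'c: "continuous_map (top_of_set (?I \<times> Cube j)) ?E H'"
    unfolding H'_def
  proof (rule continuous_map_paste_le)
    let ?K = "{z \<in> ?I \<times> Cube j. 1/2 \<le> fst z}"
    show "continuous_on (?I \<times> Cube j) fst" by (intro continuous_intros)
    show "continuous_map (top_of_set {z \<in> ?I \<times> Cube j. fst z \<le> 1/2}) ?E (\<lambda>r. H (2 * fst r, snd r))"
      by (rule continuous_map_compose_on[OF H(1)]) (auto intro!: continuous_on_Pair continuous_on_mult continuous_on_const continuous_on_fst continuous_on_snd continuous_on_id)
    show "continuous_map (top_of_set ?K) ?E (\<lambda>r. if fst r \<le> 3/4 then ins q m (c (4 * fst r - 2)) else \<sigma> (Suc m) (p (4 - 4 * fst r, snd r)))"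
    proof (rule continuous_map_paste_le)
      show "continuous_on ?K fst" by (intro continuous_intros)
      show "continuous_map (top_of_set {z \<in> ?K. fst z \<le> 3/4}) ?E (\<lambda>r. ins q m (c (4 * fst r - 2)))"
        by (rule continuous_map_compose_on[OF ic]) (auto intro!: continuous_on_diff continuous_on_mult continuous_on_const continuous_on_fst continuous_on_id)
      show "continuous_map (top_of_set {z \<in> ?K. 3/4 \<le> fst z}) ?E (\<lambda>r. \<sigma> (Suc m) (p (4 - 4 * fst r, snd r)))"
        by (rule continuous_map_compose_on[OF sp]) (auto intro!: continuous_on_Pair continuous_on_diff continuous_on_mult continuous_on_const continuous_on_fst continuous_on_snd continuous_on_id)
      fix z assume z: "z \<in> ?K" "fst z = 3/4"
      then have e: "4 * fst z - 2 = 1" "4 - 4 * fst z = 1" by simp_all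
      show "ins q m (c (4 * fst z - 2)) = \<sigma> (Suc m) (p (4 - 4 * fst z, snd z))"
        unfolding e using z p0(2)[of "snd z"] c(3) y'(2) by auto
    qed
    fix z assume z: "z \<in> ?I \<times> Cube j" "fst z = 1/2"
    then have e: "2 * fst z = 1" "4 * fst z - 2 = 0" "fst z \<le> 3/4" by simp_all
    show "H (2 * fst z, snd z) = (if fst z \<le> 3/4 then ins q m (c (4 * fst z - 2)) else \<sigma> (Suc m) (p (4 - 4 * fst z, snd z)))"
      unfolding e(1,2) using e(3) z H(3)[of "snd z"] c(2) by auto
  qed
  \<comment> \<open>Slowing the clock by the factor 1 - a contracts the projection to its value
    \<open>q\<close> at clock time 0.\<close>
  define K where "K = (\<lambda>a::real \<times> (real \<times> (nat \<Rightarrow> real)). p ((1 - fst a) * \<mu> (fst (snd a)), snd (snd a)))"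
  have "continuous_on (?I \<times> (?I \<times> Cube j)) (\<lambda>a. ((1 - fst a) * \<mu> (fst (snd a)), snd (snd a)))"
    unfolding \<mu>_def by (intro continuous_on_Pair continuous_on_mult continuous_on_min continuous_on_diff
        continuous_on_const continuous_on_fst continuous_on_snd continuous_on_id)
  then have Kc: "continuous_map (top_of_set (?I \<times> (?I \<times> Cube j))) (nsphere k) K"
    unfolding K_def
  proof (rule continuous_map_compose_on[OF pc])
    fix a assume "a \<in> ?I \<times> (?I \<times> Cube j)"
    then show "((1 - fst a) * \<mu> (fst (snd a)), snd (snd a)) \<in> ?I \<times> Cube j"
      using \<mu>[of "fst (snd a)"] by (auto intro: mult_le_one)
  qed
  have H'0: "H' r 0 = K (0, r)" if r: "r \<in> ?I \<times> Cube j" for r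
  proof -
    obtain s t where st: "r = (s, t)" "s \<in> ?I" "t \<in> Cube j" using r by auto
    consider "s \<le> 1/2" | "1/2 < s" "s \<le> 3/4" | "3/4 < s" by linarith
    then show ?thesis
    proof cases
      case 1
      then show ?thesis by (simp add: H'_def K_def st \<mu>1 p_def)
    next
      case 2
      then show ?thesis using p0(2)[OF st(3)] by (simp add: H'_def K_def st \<mu>2)
    next
      case 3
      then show ?thesis by (simp add: H'_def K_def st \<mu>3 \<sigma>_0)
    qed
  qed
  have comp: "compact (?I \<times> Cube j)"
    by (intro compact_Times compact_Icc compact_Cube)
  obtain L where L: "continuous_map (top_of_set (?I \<times> (?I \<times> Cube j))) ?E L"
    "\<And>a r. a \<in> ?I \<Longrightarrow> r \<in> ?I \<times> Cube j \<Longrightarrow> L (a, r) 0 = K (a, r)"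
    "\<And>a r. a \<in> ?I \<Longrightarrow> r \<in> ?I \<times> Cube j \<Longrightarrow> (\<And>a'. a' \<in> ?I \<Longrightarrow> K (a', r) = K (0, r)) \<Longrightarrow> L (a, r) = H' r"
  proof (rule lift_first_point[OF zero_less_Suc comp Kc H'c H'0])
    fix L
    assume 1: "continuous_map (top_of_set (?I \<times> (?I \<times> Cube j))) ?E L"
      and 2: "\<And>a r. a \<in> ?I \<Longrightarrow> r \<in> ?I \<times> Cube j \<Longrightarrow> L (a, r) 0 = K (a, r)"
      and "\<And>r. r \<in> ?I \<times> Cube j \<Longrightarrow> L (0, r) = H' r"
      and 3: "\<And>a r. a \<in> ?I \<Longrightarrow> r \<in> ?I \<times> Cube j \<Longrightarrow> (\<And>a'. a' \<in> ?I \<Longrightarrow> K (a', r) = K (0, r)) \<Longrightarrow> L (a, r) = H' r"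
    from 1 2 3 show thesis by (rule that)
  qed
  have LOC: "L (1, r) \<in> OC (Suc m) {}" if "r \<in> ?I \<times> Cube j" for r
    using L(1) that by (auto simp: continuous_map_in_subtopology)
  have L1: "L (1, r) 0 = q" if "r \<in> ?I \<times> Cube j" for r
    using L(2)[of 1 r] that p0(1)[of "snd r"] by (auto simp: K_def)
  define M where "M = (\<lambda>r. rest m (L (1, r)))"
  have MOC: "M r \<in> OC m (orbit G \<phi> q)" if "r \<in> ?I \<times> Cube j" for r
    unfolding M_def by (rule rest_OC(1)[OF LOC[OF that] L1[OF that]])
  have "continuous_on (?I \<times> Cube j) (\<lambda>r. L (1, r))"
  proof (rule continuous_on_compose2)
    show "continuous_on (?I \<times> (?I \<times> Cube j)) L"
      using L(1) by (simp add: continuous_map_in_subtopology)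
  qed (auto intro!: continuous_on_Pair continuous_on_id continuous_on_const)
  then have Mc: "continuous_map (top_of_set (?I \<times> Cube j)) ?F M"
    unfolding M_def continuous_map_in_subtopology using MOC by (auto simp: M_def intro: continuous_on_rest)
  \<comment> \<open>At times 0 and 1 and over the boundary the contraction is stationary, so the
    lift leaves the composite unchanged there and its ends are still known.\<close>
  have M: "M (s, t) = rest m (H' (s, t))" if "s \<in> ?I" "t \<in> Cube j" "s = 0 \<or> s = 1 \<or> t \<in> cube_boundary j" for s t
  proof -
    have "K (a, (s, t)) = q" if a: "a \<in> ?I" for a
    proof (cases "t \<in> cube_boundary j")
      case True
      have "(1 - a) * \<mu> s \<in> ?I"
        using \<mu>[OF \<open>s \<in> ?I\<close>] a by (auto intro: mult_le_one)
      then show ?thesis using pb[OF _ True] by (simp add: K_def)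
    next
      case False
      then have "\<mu> s = 0" using \<open>s = 0 \<or> s = 1 \<or> t \<in> cube_boundary j\<close> by (auto simp: \<mu>_def)
      then show ?thesis using p0(1)[OF \<open>t \<in> Cube j\<close>] by (simp add: K_def)
    qed
    then have "L (1, (s, t)) = H' (s, t)"
      by (intro L(3)) (use that in auto)
    then show ?thesis by (simp add: M_def)
  qed
  \<comment> \<open>The boundary follows just the bridging path: the null homotopy and the returning
    section are constant there.\<close>
  define \<eta>' where "\<eta>' = (\<lambda>s::real. if s \<le> 1/2 then y else if s \<le> 3/4 then c (4 * s - 2) else y')"
  have fh: "fhom j ?F \<eta>' u (\<lambda>_. y')"
  proof (rule fhomI[OF Mc])
    show "M (0, t) = u t" if "t \<in> Cube j" for t
      using M[of 0 t] that H(2)[OF that] rest_ins[OF uOC[OF that]] by (simp add: H'_def)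
    show "M (1, t) = y'" if "t \<in> Cube j" for t
      using M[of 1 t] that p0(1)[OF that] by (simp add: H'_def y'_def)
    fix s :: real and t assume st: "s \<in> ?I" "t \<in> cube_boundary j"
    have t: "t \<in> Cube j" by (rule boundary_subset[OF st(2)])
    have M': "M (s, t) = rest m (H' (s, t))"
      using M[OF st(1) t] st(2) by simp
    consider "s \<le> 1/2" | "1/2 < s" "s \<le> 3/4" | "3/4 < s" by linarith
    then show "M (s, t) = \<eta>' s"
    proof cases
      case 1
      then show ?thesis
        using H(4)[of "2 * s" t] st rest_ins[OF y] by (simp add: M' H'_def \<eta>'_def)
    next
      case 2
      then have "c (4 * s - 2) \<in> OC m (orbit G \<phi> q)"
        using c(1) by (auto simp: pathin_def continuous_map_in_subtopology)
      with 2 show ?thesis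
        using rest_ins by (simp add: M' H'_def \<eta>'_def)
    next
      case 3
      then show ?thesis
        using pb[of "4 - 4 * s" t] st by (simp add: M' H'_def \<eta>'_def y'_def)
    qed
  qed
  have \<eta>': "pathin ?F \<eta>'" by (rule fhom_pathin[OF fh j])
  \<comment> \<open>Both \<open>u\<close> and the constant map at \<open>y\<close> are thus
    transported to the constant map at \<open>y'\<close>; transport backwards is unique, so they are
    homotopic.\<close>
  have "fhom j ?F \<eta>' (\<lambda>_. y) (\<lambda>_. y')"
    by (rule fhom_const_path[OF \<eta>']) (simp_all add: \<eta>'_def)
  from fhom_unique[OF fhom_rev[OF fh] fhom_rev[OF this] pathin_rev[OF \<eta>']]
  show ?thesis by (simp add: \<eta>'_def)
qed

end

section \<open>Exactness\<close>

locale quotient_configuration = free_quotient k G \<phi> X P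
  for k and G :: "('g, 'm) monoid_scheme" and \<phi> and X :: "'b topology" and P +
  fixes j n :: nat and x :: "nat \<Rightarrow> 'b" and x0 :: 'b and \<gamma> :: "nat \<Rightarrow> real \<Rightarrow> 'b"
  assumes j2: "2 \<le> j" and n1: "1 \<le> n" and xc: "x \<in> topspace (conf_space n X)"
    and path: "\<And>i. i < n \<Longrightarrow> pathin X (\<gamma> i)" "\<And>i. i < n \<Longrightarrow> \<gamma> i 0 = x i" "\<And>i. i < n \<Longrightarrow> \<gamma> i 1 = x0"

sublocale quotient_configuration \<subseteq> power_paths j n X x x0 \<gamma>
  using j2 xc path by unfold_locales (auto simp: topspace_conf_space)

context quotient_configuration
begin

abbreviation "CX \<equiv> conf_space n X"
abbreviation "ci \<equiv> conf_inclusion_hom j n X x \<gamma>"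
abbreviation "\<Delta> \<equiv> diagonal_group j n X x0"

lemma conf_power_continuous: "continuous_map CX (power_space n X) (\<lambda>z. z)"
  unfolding conf_space_def by (rule continuous_map_from_subtopology) simp

lemma CX_component: "i < n \<Longrightarrow> continuous_map CX X (\<lambda>z. z i)"
  unfolding conf_space_def by (rule continuous_map_from_subtopology[OF continuous_map_power_proj])

lemma x0_in: "x0 \<in> topspace X"
  using path(1,3)[of 0] n1 continuous_map_funspace[of "top_of_set {0..1}" X "\<gamma> 0"] by (auto simp: pathin_def)

lemma ci_class:
  assumes f: "f \<in> cube_loops j CX x" and g: "\<And>i. i < n \<Longrightarrow> fhom j X (\<gamma> i) (\<lambda>t. f t i) (g i)"
  shows "ci (cube_class j CX x f) = (\<lambda>i\<in>{..<n}. cube_class j X x0 (g i))"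
proof -
  have "homotopy_hom j (power_space n X) x (\<lambda>z. z) (cube_class j CX x f) = cube_class j (power_space n X) x f"
    using homotopy_hom_class[OF conf_power_continuous f] by simp
  then show ?thesis
    using pid_class[OF conf_loops_power(1)[OF f] g] by (simp add: conf_inclusion_hom_def)
qed

lemma group_CX: "group (homotopy_group j CX x)"
  by (rule group_homotopy_group[OF j xc])

lemma group_\<Delta>: "group \<Delta>"
  unfolding diagonal_group_eq by (rule group.group_diagonal[OF group_homotopy_group[OF j x0_in]])

lemma ci_diagonal:
  assumes "A \<in> carrier (homotopy_group j CX x)"
  shows "ci A \<in> carrier \<Delta>"
proof -
  obtain f where f: "f \<in> cube_loops j CX x" "A = cube_class j CX x f"
    using assms by (rule carrier_homotopy_groupE)
  obtain e where e: "e \<in> OC n {}" "Pn n e = x"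
    by (rule ex_Pn[OF xc])
  have f1: "f \<in> cube_loops j CX (Pn n e)" using f(1) e(2) by simp
  obtain u where u: "u \<in> cube_loops j (top_of_set (OC n {})) e" "\<And>t. t \<in> Cube j \<Longrightarrow> Pn n (u t) = f t"
    by (rule lift_conf_loop[OF f1 e(1) j2]) blast
  have uOC: "u t \<in> OC n {}" if "t \<in> Cube j" for t
    using u(1) that by (auto simp: cube_loops_iff continuous_map_in_subtopology)
  have ui: "(\<lambda>t. u t i) \<in> cube_loops j (nsphere k) (e i)" if "i < n" for i
    by (rule cube_loops_map[OF continuous_OC_component[OF that] u(1)])
  obtain g where g: "\<And>i. i < n \<Longrightarrow> fhom j X (\<gamma> i) (\<lambda>t. f t i) (g i)" "\<And>i. i < n \<Longrightarrow> g i \<in> cube_loops j X x0"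
    using ex_transports[OF conf_loops_power(1)[OF f(1)]] by blast
  have ug: "fhom j X (\<gamma> i) (\<lambda>t. P (u t i)) (g i)" if "i < n" for i
    by (rule fhom_cong[OF g(1)[OF that]]) (use u(2)[symmetric] that in \<open>simp_all add: Pn_def\<close>)
  have g0: "cube_class j X x0 (g i) = cube_class j X x0 (g 0)" if i: "i < n" for i
  proof (cases "i = 0")
    case False
    have n0: "0 < n" using n1 by simp
    have "freely_homotopic j k (\<lambda>t. u t i) (\<lambda>t. u t 0)"
    proof (rule freely_homotopic_distinct[OF odd_k ui[OF i] ui[OF n0]])
      show "u t i \<noteq> u t 0" if "t \<in> Cube j" for t
        using uOC[OF that] i n0 False unfolding OC_iff by metis
    qed
    from transports_agree[OF ui[OF i] ui[OF n0] this ug[OF i] ug[OF n0] path(3)[OF i] path(3)[OF n0] j2]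
    show ?thesis by (rule cube_classI)
  qed simp
  have "(\<lambda>i\<in>{..<n}. cube_class j X x0 (g i)) = (\<lambda>i\<in>{..<n}. cube_class j X x0 (g 0))"
    by (rule restrict_ext) (rule g0, simp)
  with ci_class[OF f(1) g(1)] have "ci A = (\<lambda>i\<in>{..<n}. cube_class j X x0 (g 0))"
    unfolding f(2) by (rule trans)
  then show ?thesis
    unfolding diagonal_group_eq carrier_diagonal using cube_class_carrier[OF g(2)[of 0]] n1 by fastforce
qed

lemma ci_hom: "ci \<in> hom (homotopy_group j CX x) \<Delta>"
proof (rule homI)
  show "ci A \<in> carrier \<Delta>" if "A \<in> carrier (homotopy_group j CX x)" for A
    by (rule ci_diagonal[OF that])
  have "homotopy_hom j (power_space n X) x (\<lambda>z. z) \<in> hom (homotopy_group j CX x) (homotopy_group j (power_space n X) x)"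
    by (rule homotopy_hom_hom[OF j conf_power_continuous]) simp
  from hom_compose[OF this pid_hom]
  have "ci \<in> hom (homotopy_group j CX x) (product_group {..<n} (\<lambda>_. homotopy_group j X x0))"
    by (simp add: conf_inclusion_hom_def[abs_def] o_def)
  from hom_mult[OF this]
  show "ci (A \<otimes>\<^bsub>homotopy_group j CX x\<^esub> B) = ci A \<otimes>\<^bsub>\<Delta>\<^esub> ci B"
    if "A \<in> carrier (homotopy_group j CX x)" "B \<in> carrier (homotopy_group j CX x)" for A B
    using that unfolding diagonal_group_eq mult_diagonal .
qed

text \<open>A class on the quotient is lifted to the sphere and composed with the family of small
  rotations. All rotated copies are freely homotopic to the original, so all coordinates return the
  same class.\<close>

lemma ci_section: "\<exists>s\<in>hom \<Delta> (homotopy_group j CX x). \<forall>a\<in>carrier \<Delta>. ci (s a) = a"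
proof -
  obtain z where z: "z \<in> S" "P z = x0"
    using x0_in P(3) by (metis imageE)
  have n0: "0 < n" using n1 by simp
  obtain \<rho> where \<rho>: "pathin CX \<rho>" "\<rho> 0 = Pn n (\<sigma> n z)" "\<rho> 1 = x"
    by (rule conf_space_path[OF \<sigma>_OC[OF z(1)] xc])
  define \<tau> where "\<tau> = (\<lambda>w. Pn n (\<sigma> n w))"
  have \<tau>: "continuous_map (nsphere k) CX \<tau>"
    using continuous_map_compose[OF \<sigma>_continuous Pn_continuous] by (simp add: \<tau>_def o_def)
  define Pi where "Pi = inv_into (carrier (homotopy_group j (nsphere k) z)) (homotopy_hom j X x0 P)"
  have gz: "group (homotopy_group j (nsphere k) z)"
    by (rule group_homotopy_group[OF j]) (use z in simp)
  have iso: "homotopy_hom j X x0 P \<in> iso (homotopy_group j (nsphere k) z) (homotopy_group j X x0)"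
    using P_iso[OF z(1) j2] z(2) by simp
  have Pi: "Pi \<in> hom (homotopy_group j X x0) (homotopy_group j (nsphere k) z)"
    using group.iso_set_sym[OF gz iso] by (simp add: Pi_def iso_def)
  have PiP: "Pi (homotopy_hom j X x0 P A) = A" if "A \<in> carrier (homotopy_group j (nsphere k) z)" for A
    using iso that unfolding Pi_def by (intro inv_into_f_f) (auto simp: iso_def bij_betw_def)
  have ev: "(\<lambda>a. a 0) \<in> hom \<Delta> (homotopy_group j X x0)"
    unfolding diagonal_group_eq using n0 by (auto simp: hom_def)
  \<comment> \<open>Read from right to left: the common value of a diagonal element, its lift to the
    sphere, the map into configurations, and the change to the prescribed base point. Each factor is
    a homomorphism, hence so is the composite.\<close>
  define s where "s = base_transport j CX \<rho> \<circ> (homotopy_hom j CX (\<tau> z) \<tau> \<circ> (Pi \<circ> (\<lambda>a. a (0::nat))))"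
  have "base_transport j CX \<rho> \<in> hom (homotopy_group j CX (\<tau> z)) (homotopy_group j CX x)"
    using base_transport_iso[OF j \<rho>(1)] \<rho>(2,3) by (simp add: iso_def \<tau>_def)
  moreover have "homotopy_hom j CX (\<tau> z) \<tau> \<in> hom (homotopy_group j (nsphere k) z) (homotopy_group j CX (\<tau> z))"
    by (rule homotopy_hom_hom[OF j \<tau>]) simp
  ultimately have "s \<in> hom \<Delta> (homotopy_group j CX x)"
    unfolding s_def using Pi ev by (intro hom_compose)
  moreover have "ci (s a) = a" if a: "a \<in> carrier \<Delta>" for a
  proof -
    obtain \<alpha> where \<alpha>: "a = (\<lambda>i\<in>{..<n}. \<alpha>)" "\<alpha> \<in> carrier (homotopy_group j X x0)"
      using a unfolding diagonal_group_eq carrier_diagonal by blast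
    have "homotopy_hom j X x0 P ` carrier (homotopy_group j (nsphere k) z) = carrier (homotopy_group j X x0)"
      using iso by (simp add: iso_def bij_betw_def)
    then obtain A where A: "A \<in> carrier (homotopy_group j (nsphere k) z)" "\<alpha> = homotopy_hom j X x0 P A"
      using \<alpha>(2) by (metis imageE)
    obtain f where f: "f \<in> cube_loops j (nsphere k) z" "A = cube_class j (nsphere k) z f"
      using A(1) by (rule carrier_homotopy_groupE)
    have \<alpha>f: "\<alpha> = cube_class j X x0 (\<lambda>t. P (f t))"
      unfolding A(2) f(2) by (rule homotopy_hom_class[OF P(1) f(1)]) (simp add: z(2))
    have "(\<lambda>t. \<tau> (f t)) \<in> cube_loops j CX (\<rho> 0)"
      using cube_loops_map[OF \<tau> f(1)] \<rho>(2) by (simp add: \<tau>_def)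
    then obtain w where w: "fhom j CX \<rho> (\<lambda>t. \<tau> (f t)) w"
      using fhom_exists[OF \<rho>(1)] by blast
    have wl: "w \<in> cube_loops j CX x"
      using fhom_loops(2)[OF w] \<rho>(3) by simp
    have "s a = cube_class j CX x w"
    proof -
      have "s a = base_transport j CX \<rho> (homotopy_hom j CX (\<tau> z) \<tau> A)"
        using n0 PiP[OF A(1)] by (simp add: s_def \<alpha>(1) A(2))
      also have "homotopy_hom j CX (\<tau> z) \<tau> A = cube_class j CX (\<tau> z) (\<lambda>t. \<tau> (f t))"
        unfolding f(2) by (rule homotopy_hom_class[OF \<tau> f(1)]) simp
      also have "base_transport j CX \<rho> \<dots> = cube_class j CX x w"
        by (rule base_transport_class[OF w \<rho>(1)]) (simp_all add: \<rho> \<tau>_def)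
      finally show ?thesis .
    qed
    moreover obtain g where g: "\<And>i. i < n \<Longrightarrow> fhom j X (\<gamma> i) (\<lambda>t. w t i) (g i)" "\<And>i. i < n \<Longrightarrow> g i \<in> cube_loops j X x0"
      using ex_transports[OF conf_loops_power(1)[OF wl]] by blast
    have "cube_class j X x0 (g i) = \<alpha>" if i: "i < n" for i
    proof -
      \<comment> \<open>Coordinate \<open>i\<close> of the section is the rotation by this angle.
        Its transport along \<open>\<rho>\<close> and \<open>\<gamma> i\<close> is compared with the
        unrotated map, transported along the constant path at \<open>x0\<close>.\<close>
      let ?r = "\<eta> * (real i / real n)"
      have r: "fhom j (nsphere k) (\<lambda>s. rot (s * ?r) z) f (\<lambda>t. rot ?r (f t))"
        by (rule fhom_rot[OF odd_k f(1)])
      have rl: "(\<lambda>t. rot ?r (f t)) \<in> cube_loops j (nsphere k) (rot ?r z)"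
        using fhom_loops(2)[OF r] by simp
      have fr: "freely_homotopic j k (\<lambda>t. rot ?r (f t)) f"
        by (rule freely_homotopic_sym) (use r in \<open>auto simp: freely_homotopic_def\<close>)
      have "fhom j X (\<lambda>s. \<rho> s i) (\<lambda>t. \<tau> (f t) i) (\<lambda>t. w t i)"
        by (rule fhom_map[OF CX_component[OF i] w])
      then have "fhom j X (\<lambda>s. \<rho> s i) (\<lambda>t. P (rot ?r (f t))) (\<lambda>t. w t i)"
        by (rule fhom_cong) (use i in \<open>simp_all add: \<tau>_def Pn_def \<sigma>_def\<close>)
      from fhom_trans[OF this g(1)[OF i]]
      have 1: "fhom j X (path_join (\<lambda>s. \<rho> s i) (\<gamma> i)) (\<lambda>t. P (rot ?r (f t))) (g i)" .
      have 2: "fhom j X (\<lambda>_. x0) (\<lambda>t. P (f t)) (\<lambda>t. P (f t))"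
        by (rule fhom_refl) (use cube_loops_map[OF P(1) f(1)] z(2) in simp)
      have "fhom j X (\<lambda>_. x0) (g i) (\<lambda>t. P (f t))"
        by (rule transports_agree[OF rl f(1) fr 1 2 _ _ j2]) (simp_all add: path(3)[OF i])
      then show ?thesis
        unfolding \<alpha>f by (rule cube_classI)
    qed
    ultimately show ?thesis
      using ci_class[OF wl g(1)] by (simp add: \<alpha>(1) cong: restrict_cong)
  qed
  ultimately show ?thesis by blast
qed

theorem ci_image: "ci ` carrier (homotopy_group j CX x) = carrier \<Delta>"
proof
  show "ci ` carrier (homotopy_group j CX x) \<subseteq> carrier \<Delta>"
    using ci_diagonal by blast
  obtain s where s: "s \<in> hom \<Delta> (homotopy_group j CX x)" "\<And>a. a \<in> carrier \<Delta> \<Longrightarrow> ci (s a) = a"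
    using ci_section by blast
  show "carrier \<Delta> \<subseteq> ci ` carrier (homotopy_group j CX x)"
  proof
    fix a assume "a \<in> carrier \<Delta>"
    then show "a \<in> ci ` carrier (homotopy_group j CX x)"
      using s(2) hom_in_carrier[OF s(1)] by (metis image_eqI)
  qed
qed

text \<open>The section and the image are already known. What remains is that the fibre maps
  injectively onto the kernel, and for both halves a class is first lifted from the quotient to
  tuples of points of the sphere.\<close>

theorem split_short_exact_fibre:
  assumes q: "q \<in> S" and n: "n = Suc m" and y: "y \<in> OC m (orbit G \<phi> q)"
    and \<delta>: "pathin CX \<delta>" "\<delta> 0 = insert_first n (P q) P y" "\<delta> 1 = x"
  shows "split_short_exact (homotopy_group j (top_of_set (OC m (orbit G \<phi> q))) y) (homotopy_group j CX x) \<Delta>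
    (base_transport j CX \<delta> \<circ> homotopy_hom j CX (\<delta> 0) (insert_first n (P q) P)) ci"
proof -
  let ?F = "top_of_set (OC m (orbit G \<phi> q))" and ?E = "top_of_set (OC n {})"
  let ?i = "insert_first n (P q) P"
  define f where "f = base_transport j CX \<delta> \<circ> homotopy_hom j CX (\<delta> 0) ?i"
  have i_eq: "?i = (\<lambda>u. Pn n (ins q m u))"
    unfolding n by (rule ext) (rule insert_first_eq)
  have ic: "continuous_map ?F CX ?i"
    unfolding i_eq using continuous_map_compose[OF ins_continuous[OF q] Pn_continuous] by (simp add: o_def n)
  have insOC: "ins q m y \<in> OC n {}" using ins_OC[OF q y] n by simp
  have i0: "?i u 0 = P q" for u by (simp add: n insert_first_def)
  have gF: "group (homotopy_group j ?F y)"
    by (rule group_homotopy_group[OF j]) (use y in simp)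
  have d0: "\<delta> 0 \<in> topspace CX"
    using continuous_map_funspace[OF \<delta>(1)[unfolded pathin_def]] by auto
  have gd: "group (homotopy_group j CX (\<delta> 0))"
    by (rule group_homotopy_group[OF j d0])
  have bt: "base_transport j CX \<delta> \<in> iso (homotopy_group j CX (\<delta> 0)) (homotopy_group j CX x)"
    by (rule base_transport_iso[OF j \<delta>(1)]) (simp_all add: \<delta>(3))
  have ih: "homotopy_hom j CX (\<delta> 0) ?i \<in> hom (homotopy_group j ?F y) (homotopy_group j CX (\<delta> 0))"
    by (rule homotopy_hom_hom[OF j ic]) (rule \<delta>(2))
  have fh: "f \<in> hom (homotopy_group j ?F y) (homotopy_group j CX x)"
    unfolding f_def using bt ih by (intro hom_compose) (auto simp: iso_def)
  have icl: "homotopy_hom j CX (\<delta> 0) ?i (cube_class j ?F y u) = cube_class j CX (\<delta> 0) (\<lambda>t. ?i (u t))"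
    if "u \<in> cube_loops j ?F y" for u
    by (rule homotopy_hom_class[OF ic that]) (rule \<delta>(2))
  have il: "(\<lambda>t. ?i (u t)) \<in> cube_loops j CX (\<delta> 0)" if "u \<in> cube_loops j ?F y" for u
    using cube_loops_map[OF ic that] \<delta>(2) by simp
  have n0: "0 < n" using n by simp
  \<comment> \<open>The track of the first point from \<open>P q\<close> through \<open>x 0\<close>
    to \<open>x0\<close>; transport along it compares first coordinates over the fibre with classes
    at \<open>x0\<close>.\<close>
  define \<beta> where "\<beta> = path_join (\<lambda>s. \<delta> s 0) (\<gamma> 0)"
  have d00: "\<delta> 0 0 = P q" by (simp add: \<delta>(2) i0)
  have "pathin X (\<lambda>s. \<delta> s 0)"
    using continuous_map_compose[OF \<delta>(1)[unfolded pathin_def] CX_component[OF n0]] by (simp add: pathin_def o_def)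
  then have \<beta>: "pathin X \<beta>" "\<beta> 0 = P q" "\<beta> 1 = x0"
    unfolding \<beta>_def using path[OF n0] \<delta>(3) d00 by (auto intro!: pathin_join)
  have \<beta>c: "fhom j X \<beta> (\<lambda>_. P q) (\<lambda>_. x0)"
    by (rule fhom_const_path[OF \<beta>(1)]) (simp_all add: \<beta>)
  have one_X: "\<one>\<^bsub>\<Delta>\<^esub> = (\<lambda>i\<in>{..<n}. cube_class j X x0 (\<lambda>_. x0))"
    unfolding diagonal_group_eq by (simp add: one_homotopy_group)
  \<comment> \<open>Values of \<open>ci\<close> are diagonal, so membership in the kernel is decided
    by coordinate 0 alone.\<close>
  have ker_iff: "ci (cube_class j CX x w) = \<one>\<^bsub>\<Delta>\<^esub> \<longleftrightarrow> fhom j X (\<lambda>_. P q) (\<lambda>t. v t 0) (\<lambda>_. P q)"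
    if v: "fhom j CX \<delta> v w" for v w
  proof -
    have wl: "w \<in> cube_loops j CX x" using fhom_loops(2)[OF v] \<delta>(3) by simp
    obtain g where g: "\<And>i. i < n \<Longrightarrow> fhom j X (\<gamma> i) (\<lambda>t. w t i) (g i)" "\<And>i. i < n \<Longrightarrow> g i \<in> cube_loops j X x0"
      using ex_transports[OF conf_loops_power(1)[OF wl]] by blast
    have \<beta>g: "fhom j X \<beta> (\<lambda>t. v t 0) (g 0)"
      unfolding \<beta>_def by (rule fhom_trans[OF fhom_map[OF CX_component[OF n0] v] g(1)[OF n0]])
    obtain a where a: "ci (cube_class j CX x w) = (\<lambda>i\<in>{..<n}. a)"
      using ci_diagonal[OF cube_class_carrier[OF wl]] unfolding diagonal_group_eq carrier_diagonal by blast
    have "a = cube_class j X x0 (g 0)"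
      using fun_cong[OF trans[OF a[symmetric] ci_class[OF wl g(1)]], of 0] n0 by simp
    then have "ci (cube_class j CX x w) = \<one>\<^bsub>\<Delta>\<^esub> \<longleftrightarrow> cube_class j X x0 (g 0) = cube_class j X x0 (\<lambda>_. x0)"
      unfolding a one_X using n0 by (auto simp: fun_eq_iff restrict_def)
    also have "\<dots> \<longleftrightarrow> fhom j X (\<lambda>_. x0) (g 0) (\<lambda>_. x0)"
      by (rule cube_class_eq_iff[OF g(2)[OF n0] cube_loops_const[OF x0_in]])
    also have "\<dots> \<longleftrightarrow> fhom j X (\<lambda>_. P q) (\<lambda>t. v t 0) (\<lambda>_. P q)"
    proof
      assume "fhom j X (\<lambda>_. x0) (g 0) (\<lambda>_. x0)"
      then have "fhom j X \<beta> (\<lambda>t. v t 0) (\<lambda>_. x0)"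
        using fhom_adjust_right[OF \<beta>g _ \<beta>(1)] \<beta>(3) by simp
      from fhom_unique[OF fhom_rev[OF this] fhom_rev[OF \<beta>c] pathin_rev[OF \<beta>(1)]]
      show "fhom j X (\<lambda>_. P q) (\<lambda>t. v t 0) (\<lambda>_. P q)" by (simp add: \<beta>(2))
    next
      assume "fhom j X (\<lambda>_. P q) (\<lambda>t. v t 0) (\<lambda>_. P q)"
      then have "fhom j X \<beta> (\<lambda>t. v t 0) (\<lambda>_. x0)"
        using fhom_adjust_left[OF _ \<beta>c \<beta>(1)] \<beta>(2) by simp
      from fhom_unique[OF \<beta>g this \<beta>(1)]
      show "fhom j X (\<lambda>_. x0) (g 0) (\<lambda>_. x0)" by (simp add: \<beta>(3))
    qed
    finally show ?thesis .
  qed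
  have ex_w: "\<exists>w. fhom j CX \<delta> v w" if "v \<in> cube_loops j CX (\<delta> 0)" for v
    using fhom_exists[OF \<delta>(1) that] by blast
  have btc: "base_transport j CX \<delta> (cube_class j CX (\<delta> 0) v) = cube_class j CX x w" if "fhom j CX \<delta> v w" for v w
    by (rule base_transport_class[OF that \<delta>(1)]) (simp_all add: \<delta>(3))
  have "kernel (homotopy_group j ?F y) (homotopy_group j CX x) f = {\<one>\<^bsub>homotopy_group j ?F y\<^esub>}"
  proof -
    have "A = \<one>\<^bsub>homotopy_group j ?F y\<^esub>" if A: "A \<in> carrier (homotopy_group j ?F y)" "f A = \<one>\<^bsub>homotopy_group j CX x\<^esub>" for A
    proof -
      obtain u where u: "u \<in> cube_loops j ?F y" "A = cube_class j ?F y u"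
        using A(1) by (rule carrier_homotopy_groupE)
      \<comment> \<open>Transport along \<open>\<delta>\<close> is an isomorphism, so it can be
        cancelled before the null homotopy is lifted.\<close>
      have "base_transport j CX \<delta> (homotopy_hom j CX (\<delta> 0) ?i A) = base_transport j CX \<delta> \<one>\<^bsub>homotopy_group j CX (\<delta> 0)\<^esub>"
        using A(2) hom_one[OF _ gd group_CX, of "base_transport j CX \<delta>"] bt by (simp add: f_def iso_def)
      then have "homotopy_hom j CX (\<delta> 0) ?i A = \<one>\<^bsub>homotopy_group j CX (\<delta> 0)\<^esub>"
        using bt hom_in_carrier[OF ih A(1)] monoid.one_closed[OF group.is_monoid[OF gd]]
        by (auto simp: iso_def bij_betw_def dest: inj_onD)
      then have "cube_class j CX (\<delta> 0) (\<lambda>t. ?i (u t)) = cube_class j CX (\<delta> 0) (\<lambda>_. \<delta> 0)"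
        unfolding u(2) icl[OF u(1)] one_homotopy_group .
      then have "fhom j CX (\<lambda>_. \<delta> 0) (\<lambda>t. ?i (u t)) (\<lambda>_. \<delta> 0)"
        using cube_class_eq_iff[OF il[OF u(1)] cube_loops_const[OF d0]] by simp
      then have *: "fhom j CX (\<lambda>_. \<delta> 0) (\<lambda>t. Pn n (ins q m (u t))) (\<lambda>_. Pn n (ins q m y))"
        by (simp add: \<delta>(2) i_eq)
      have ul: "(\<lambda>t. ins q m (u t)) \<in> cube_loops j ?E (ins q m y)"
        using cube_loops_map[OF ins_continuous[OF q] u(1)] n by simp
      have cl: "(\<lambda>_. ins q m y) \<in> cube_loops j ?E (ins q m y)"
        by (rule cube_loops_const) (use insOC in simp)
      have "fhom j ?E (\<lambda>_. ins q m y) (\<lambda>t. ins q m (u t)) (\<lambda>_. ins q m y)"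
        by (rule lift_conf_fhom[OF ul cl * j2])
      then have "fhom j ?F (\<lambda>_. y) u (\<lambda>_. y)"
        by (intro fibre_inj[OF q y u(1) _ j]) (simp add: n)
      then show ?thesis
        unfolding u(2) one_homotopy_group by (rule cube_classI)
    qed
    moreover have "f \<one>\<^bsub>homotopy_group j ?F y\<^esub> = \<one>\<^bsub>homotopy_group j CX x\<^esub>"
      by (rule hom_one[OF fh gF group_CX])
    moreover have "\<one>\<^bsub>homotopy_group j ?F y\<^esub> \<in> carrier (homotopy_group j ?F y)"
      by (rule monoid.one_closed[OF group.is_monoid[OF gF]])
    ultimately show ?thesis
      unfolding kernel_def by blast
  qed
  moreover have "group_hom (homotopy_group j ?F y) (homotopy_group j CX x) f"
    using gF group_CX fh by (simp add: group_hom_def group_hom_axioms_def)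
  ultimately have "inj_on f (carrier (homotopy_group j ?F y))"
    using group_hom.inj_iff_trivial_ker by blast
  then have mon: "f \<in> mon (homotopy_group j ?F y) (homotopy_group j CX x)"
    using fh by (simp add: mon_def)
  have "f ` carrier (homotopy_group j ?F y) = kernel (homotopy_group j CX x) \<Delta> ci"
  proof (intro equalityI subsetI)
    fix B assume "B \<in> f ` carrier (homotopy_group j ?F y)"
    then obtain A where A: "A \<in> carrier (homotopy_group j ?F y)" "B = f A" by blast
    obtain u where u: "u \<in> cube_loops j ?F y" "A = cube_class j ?F y u"
      using A(1) by (rule carrier_homotopy_groupE)
    obtain w where w: "fhom j CX \<delta> (\<lambda>t. ?i (u t)) w"
      using ex_w[OF il[OF u(1)]] by blast
    have B: "B = cube_class j CX x w"
      unfolding A(2) u(2) f_def o_def icl[OF u(1)] by (rule btc[OF w])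
    have "P q \<in> topspace X" by (rule P_in[OF q])
    then have "fhom j X (\<lambda>_. P q) (\<lambda>t. ?i (u t) 0) (\<lambda>_. P q)"
      unfolding i0 by (intro fhom_refl cube_loops_const)
    then have "ci B = \<one>\<^bsub>\<Delta>\<^esub>"
      unfolding B ker_iff[OF w] .
    moreover have "B \<in> carrier (homotopy_group j CX x)"
      unfolding A(2) by (rule hom_in_carrier[OF fh A(1)])
    ultimately show "B \<in> kernel (homotopy_group j CX x) \<Delta> ci"
      by (simp add: kernel_def)
  next
    fix B assume "B \<in> kernel (homotopy_group j CX x) \<Delta> ci"
    then have B: "B \<in> carrier (homotopy_group j CX x)" "ci B = \<one>\<^bsub>\<Delta>\<^esub>"
      by (auto simp: kernel_def)
    have "base_transport j CX \<delta> ` carrier (homotopy_group j CX (\<delta> 0)) = carrier (homotopy_group j CX x)"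
      using bt by (simp add: iso_def bij_betw_def)
    then obtain A where A: "A \<in> carrier (homotopy_group j CX (\<delta> 0))" "B = base_transport j CX \<delta> A"
      using B(1) by (metis imageE)
    obtain v where v: "v \<in> cube_loops j CX (\<delta> 0)" "A = cube_class j CX (\<delta> 0) v"
      using A(1) by (rule carrier_homotopy_groupE)
    obtain w where w: "fhom j CX \<delta> v w"
      using ex_w[OF v(1)] by blast
    have "B = cube_class j CX x w"
      unfolding A(2) v(2) by (rule btc[OF w])
    then have v0: "fhom j X (\<lambda>_. P q) (\<lambda>t. v t 0) (\<lambda>_. P q)"
      using B(2) ker_iff[OF w] by simp
    have v': "v \<in> cube_loops j CX (Pn n (ins q m y))"
      using v(1) by (simp add: \<delta>(2) i_eq)
    \<comment> \<open>A representative is lifted to the sphere; its first coordinate is null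
      homotopic there too, and then the loop can be deformed into the fibre.\<close>
    obtain u' where u': "u' \<in> cube_loops j ?E (ins q m y)" "\<And>t. t \<in> Cube j \<Longrightarrow> Pn n (u' t) = v t"
      by (rule lift_conf_loop[OF v' insOC j2]) blast
    have l0: "(\<lambda>t. u' t 0) \<in> cube_loops j (nsphere k) q"
      using cube_loops_map[OF continuous_OC_component[OF n0] u'(1)] by simp
    have "fhom j X (\<lambda>_. P q) (\<lambda>t. P (u' t 0)) (\<lambda>_. P q)"
      by (rule fhom_cong[OF v0]) (use u'(2)[symmetric] n0 in \<open>simp_all add: Pn_def\<close>)
    then have "fhom j (nsphere k) (\<lambda>_. q) (\<lambda>t. u' t 0) (\<lambda>_. q)"
      by (rule lift_fhom_const[OF _ l0 cube_loops_const j2]) (use q in simp)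
    from fibre_surj[OF q y u'(1)[unfolded n] this]
    obtain u where u: "u \<in> cube_loops j ?F y" "fhom j ?E (\<lambda>_. ins q m y) u' (\<lambda>t. ins q m (u t))"
      unfolding n by blast
    have "fhom j CX (\<lambda>_. Pn n (ins q m y)) (\<lambda>t. Pn n (u' t)) (\<lambda>t. Pn n (ins q m (u t)))"
      by (rule fhom_map[OF Pn_continuous u(2)])
    then have "fhom j CX (\<lambda>_. \<delta> 0) v (\<lambda>t. ?i (u t))"
      by (rule fhom_cong) (simp_all add: u'(2) \<delta>(2) i_eq)
    then have "A = homotopy_hom j CX (\<delta> 0) ?i (cube_class j ?F y u)"
      unfolding v(2) icl[OF u(1)] by (rule cube_classI)
    then have "B = f (cube_class j ?F y u)"
      unfolding A(2) f_def by simp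
    then show "B \<in> f ` carrier (homotopy_group j ?F y)"
      using cube_class_carrier[OF u(1)] by blast
  qed
  then show ?thesis
    unfolding split_short_exact_def f_def[symmetric]
    using gF group_CX group_\<Delta> mon ci_hom ci_image ci_section by (simp add: epi_def)
qed

end

section \<open>Stereographic projection from an arbitrary point\<close>

text \<open>The inverse of stereographic projection from the point \<open>pole k\<close>;
  \<open>unstereo\<close> is the projection itself.\<close>

definition stereo :: "nat \<Rightarrow> (nat \<Rightarrow> real) \<Rightarrow> nat \<Rightarrow> real" where
  "stereo k v = (\<lambda>i. if i < k then 2 * v i / ((\<Sum>l<k. (v l)\<^sup>2) + 1)
     else if i = k then ((\<Sum>l<k. (v l)\<^sup>2) - 1) / ((\<Sum>l<k. (v l)\<^sup>2) + 1) else 0)"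

definition unstereo :: "nat \<Rightarrow> (nat \<Rightarrow> real) \<Rightarrow> nat \<Rightarrow> real" where
  "unstereo k x = (\<lambda>i. if i < k then x i / (1 - x k) else 0)"

definition pole :: "nat \<Rightarrow> nat \<Rightarrow> real" where
  "pole k = (\<lambda>i. if i = k then 1 else 0)"

lemma Euclidean_space_eq: "Euclidean_space k = top_of_set {v. \<forall>i\<ge>k. v i = 0}"
  by (simp add: Euclidean_space_def euclidean_product_topology)

lemma pole_Sph: "pole k \<in> Sph k"
  by (simp add: Sph_def pole_def if_distrib[where f = "\<lambda>x. x\<^sup>2"] cong: if_cong)

lemma Sph_split: "x \<in> Sph k \<longleftrightarrow> (\<Sum>l<k. (x l)\<^sup>2) = 1 - (x k)\<^sup>2 \<and> (\<forall>i>k. x i = 0)"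
  by (auto simp: Sph_def lessThan_Suc_atMost[symmetric])

lemma Sph_pole_iff:
  assumes "x \<in> Sph k"
  shows "x k = 1 \<longleftrightarrow> x = pole k"
proof
  assume 1: "x k = 1"
  then have "(\<Sum>l<k. (x l)\<^sup>2) = 0" using assms by (simp add: Sph_split)
  then have "x l = 0" if "l < k" for l
    using that by (simp add: sum_nonneg_eq_0_iff)
  then have "x i = pole k i" for i
    using 1 assms by (cases i k rule: linorder_cases) (auto simp: pole_def Sph_split)
  then show "x = pole k" ..
qed (simp add: pole_def)

lemma sum_stereo: "(\<Sum>l<k. (stereo k v l)\<^sup>2) = 4 * (\<Sum>l<k. (v l)\<^sup>2) / ((\<Sum>l<k. (v l)\<^sup>2) + 1)\<^sup>2"
proof -
  have "(\<Sum>l<k. (stereo k v l)\<^sup>2) = (\<Sum>l<k. 4 * (v l)\<^sup>2 / ((\<Sum>l<k. (v l)\<^sup>2) + 1)\<^sup>2)"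
    by (rule sum.cong) (simp_all add: stereo_def power_divide power_mult_distrib)
  then show ?thesis
    by (simp add: sum_divide_distrib sum_distrib_left)
qed

lemma stereo_Sph: "stereo k v \<in> Sph k - {pole k}"
proof -
  define N where "N = (\<Sum>l<k. (v l)\<^sup>2)"
  have N: "0 \<le> N" unfolding N_def by (rule sum_nonneg) simp
  have sk: "stereo k v k = (N - 1) / (N + 1)"
    by (simp add: stereo_def N_def)
  have "4 * N / (N + 1)\<^sup>2 = 1 - ((N - 1) / (N + 1))\<^sup>2"
  proof -
    have "(N + 1)\<^sup>2 \<noteq> 0" using N by simp
    moreover have "4 * N = (N + 1)\<^sup>2 - (N - 1)\<^sup>2" by (simp add: power2_eq_square algebra_simps)
    ultimately show ?thesis unfolding power_divide by (simp only: diff_divide_distrib[of "(N + 1)\<^sup>2"] divide_self if_True simp_thms)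
  qed
  then have "stereo k v \<in> Sph k"
    unfolding Sph_split sum_stereo sk N_def[symmetric] by (simp add: stereo_def)
  moreover have "stereo k v k \<noteq> 1"
    using N by (simp add: sk field_simps)
  ultimately show ?thesis
    by (auto simp: pole_def)
qed

lemma unstereo_stereo:
  assumes "\<forall>i\<ge>k. v i = 0"
  shows "unstereo k (stereo k v) = v"
proof
  fix i
  define N where "N = (\<Sum>l<k. (v l)\<^sup>2)"
  have N: "0 \<le> N" unfolding N_def by (rule sum_nonneg) simp
  have "1 - (N - 1) / (N + 1) = 2 / (N + 1)"
    using N by (simp add: field_simps)
  then show "unstereo k (stereo k v) i = v i"
    using assms N by (simp add: unstereo_def stereo_def N_def[symmetric])
qed

lemma stereo_unstereo:
  assumes x: "x \<in> Sph k - {pole k}"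
  shows "stereo k (unstereo k x) = x"
proof
  fix i
  have 1: "1 - x k \<noteq> 0" using x Sph_pole_iff by force
  have "(\<Sum>l<k. (unstereo k x l)\<^sup>2) = (\<Sum>l<k. (x l)\<^sup>2) / (1 - x k)\<^sup>2"
    by (simp add: unstereo_def power_divide sum_divide_distrib)
  also have "\<dots> = (1 + x k) / (1 - x k)"
    using x 1 by (simp add: Sph_split divide_simps) (simp add: algebra_simps power2_eq_square)
  finally have N: "(\<Sum>l<k. (unstereo k x l)\<^sup>2) = (1 + x k) / (1 - x k)" .
  have N1: "(1 + x k) / (1 - x k) + 1 = 2 / (1 - x k)" "(1 + x k) / (1 - x k) - 1 = 2 * x k / (1 - x k)"
    using 1 by (simp_all add: field_simps)
  consider "i < k" | "i = k" | "k < i" by linarith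
  then show "stereo k (unstereo k x) i = x i"
    unfolding stereo_def N N1 by cases (use 1 x in \<open>auto simp: unstereo_def Sph_split\<close>)
qed

lemma continuous_on_stereo: "continuous_on A (stereo k)"
proof (rule continuous_on_coordinatewise_then_product)
  have "(\<Sum>l<k. (v l)\<^sup>2) + 1 \<noteq> 0" for v :: "nat \<Rightarrow> real"
    using sum_nonneg[of "{..<k}" "\<lambda>l. (v l)\<^sup>2"] by simp
  then show "continuous_on A (\<lambda>v. stereo k v i)" for i
    unfolding stereo_def by (cases "i < k"; cases "i = k") (simp_all, (intro continuous_intros; simp)+)
qed

lemma continuous_on_unstereo: "continuous_on (Sph k - {pole k}) (unstereo k)"
proof (rule continuous_on_coordinatewise_then_product)
  have "1 - x k \<noteq> 0" if "x \<in> Sph k - {pole k}" for x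
    using that Sph_pole_iff by force
  then show "continuous_on (Sph k - {pole k}) (\<lambda>x. unstereo k x i)" for i
    unfolding unstereo_def by (cases "i < k") (simp_all, intro continuous_intros, simp)
qed

text \<open>The reflection exchanging \<open>p\<close> and \<open>q\<close>; for \<open>p = q\<close> the division by zero makes it the identity.\<close>

definition swap_points :: "nat \<Rightarrow> (nat \<Rightarrow> real) \<Rightarrow> (nat \<Rightarrow> real) \<Rightarrow> (nat \<Rightarrow> real) \<Rightarrow> nat \<Rightarrow> real" where
  "swap_points k p q x =
     (\<lambda>i. x i - 2 * dot k x (\<lambda>i. q i - p i) / dot k (\<lambda>i. q i - p i) (\<lambda>i. q i - p i) * (q i - p i))"

lemma dot_diff_scale:
  "dot k (\<lambda>i. x i - a * w i) y = dot k x y - a * dot k w y"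
  "dot k y (\<lambda>i. x i - a * w i) = dot k y x - a * dot k y w"
  by (simp_all add: dot_def sum_distrib_left sum_subtractf algebra_simps)

context
  fixes k :: nat and p q :: "nat \<Rightarrow> real"
  assumes p: "p \<in> Sph k" and q: "q \<in> Sph k"
begin

lemma swap_points_Sph:
  assumes "x \<in> Sph k"
  shows "swap_points k p q x \<in> Sph k"
proof -
  define w where "w = (\<lambda>i. q i - p i)"
  have "dot k (swap_points k p q x) (swap_points k p q x) = dot k x x"
    unfolding swap_points_def w_def[symmetric] w_def[symmetric, THEN fun_cong] dot_diff_scale dot_commute[of k w x]
    by (cases "dot k w w = 0") (simp_all add: field_simps)
  then show ?thesis
    using assms p q by (simp add: Sph_iff swap_points_def)
qed

lemma swap_points_swap_points: "swap_points k p q (swap_points k p q x) = x"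
proof -
  define w where "w = (\<lambda>i. q i - p i)"
  have s: "swap_points k p q x = (\<lambda>i. x i - 2 * dot k x w / dot k w w * w i)" for x
    by (simp add: swap_points_def w_def)
  show ?thesis
    unfolding s dot_diff_scale by (cases "dot k w w = 0") (simp_all add: field_simps)
qed

lemma swap_points_first: "swap_points k p q p = q"
proof -
  define w where "w = (\<lambda>i. q i - p i)"
  have s: "swap_points k p q p = (\<lambda>i. p i - 2 * dot k p w / dot k w w * w i)"
    by (simp add: swap_points_def w_def)
  have pq: "dot k p p = 1" "dot k q q = 1" using p q by (simp_all add: Sph_iff)
  have w2: "w = (\<lambda>i. q i - 1 * p i)" by (simp add: w_def)
  have pw: "dot k p w = dot k p q - 1" "dot k w w = 2 - 2 * dot k p q"
    unfolding w2 dot_diff_scale by (simp_all add: pq dot_commute[of k q p])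
  show ?thesis
  proof (cases "dot k w w = 0")
    case True
    then have "w i = 0" if "i \<le> k" for i
      using that by (simp add: dot_def sum_nonneg_eq_0_iff)
    then have "p i = q i" for i
      using p q by (cases "i \<le> k") (auto simp: w_def Sph_iff)
    then show ?thesis using True by (simp add: s fun_eq_iff)
  next
    case False
    then have "2 * dot k p w / dot k w w = -1"
      unfolding pw by (simp add: field_simps)
    then show ?thesis by (simp add: s w_def)
  qed
qed

lemma continuous_on_swap_points: "continuous_on A (swap_points k p q)"
  unfolding swap_points_def dot_def divide_inverse
  by (intro continuous_on_coordinatewise_then_product continuous_on_diff continuous_on_mult continuous_on_sum
      continuous_on_const continuous_on_coord)

end

text \<open>Projection from the standard pole is combined with the reflection that exchanges the
  pole and \<open>q\<close>.\<close>

lemma homeomorphic_stereographic: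
  assumes q: "q \<in> Sph k"
  obtains s t where "homeomorphic_maps (Euclidean_space k) (top_of_set (Sph k - {q})) s t"
proof
  let ?R = "swap_points k (pole k) q"
  note R = swap_points_Sph[OF pole_Sph q] swap_points_swap_points[OF pole_Sph q] swap_points_first[OF pole_Sph q]
  have Rq: "?R q = pole k" using R(2)[of "pole k"] R(3) by simp
  have R': "?R x \<in> Sph k - {q}" if "x \<in> Sph k - {pole k}" for x
    using that R(1)[of x] R(2)[of x] Rq by auto
  have R'': "?R x \<in> Sph k - {pole k}" if "x \<in> Sph k - {q}" for x
    using that R(1)[of x] R(2)[of x] R(3) by auto
  show "homeomorphic_maps (Euclidean_space k) (top_of_set (Sph k - {q})) (\<lambda>v. ?R (stereo k v)) (\<lambda>x. unstereo k (?R x))"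
    unfolding homeomorphic_maps_def Euclidean_space_eq
  proof (intro conjI ballI)
    show "continuous_map (top_of_set {v. \<forall>i\<ge>k. v i = 0}) (top_of_set (Sph k - {q})) (\<lambda>v. ?R (stereo k v))"
      using continuous_on_compose2[OF continuous_on_swap_points[OF pole_Sph q, of UNIV] continuous_on_stereo] R'[OF stereo_Sph]
      by (simp add: continuous_map_in_subtopology Pi_iff)
    have "continuous_on (Sph k - {q}) (\<lambda>x. unstereo k (?R x))"
      by (rule continuous_on_compose2[OF continuous_on_unstereo continuous_on_swap_points[OF pole_Sph q]]) (rule image_subsetI, rule R'')
    then show "continuous_map (top_of_set (Sph k - {q})) (top_of_set {v. \<forall>i\<ge>k. v i = 0}) (\<lambda>x. unstereo k (?R x))"
      by (simp add: continuous_map_in_subtopology unstereo_def)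
    show "unstereo k (?R (?R (stereo k v))) = v" if "v \<in> topspace (top_of_set {v. \<forall>i\<ge>k. v i = 0})" for v
      using that by (simp add: R(2) unstereo_stereo)
    show "?R (stereo k (unstereo k (?R x))) = x" if "x \<in> topspace (top_of_set (Sph k - {q}))" for x
      using that by (simp add: R(2) stereo_unstereo R'' del: Diff_iff)
  qed
qed

section \<open>Invariance under homeomorphisms\<close>

lemma homotopy_hom_homeomorphic:
  assumes j: "1 \<le> j" and fg: "homeomorphic_maps X Y f g" and x: "x \<in> topspace X"
  shows "homotopy_hom j Y (f x) f \<in> iso (homotopy_group j X x) (homotopy_group j Y (f x))"
proof -
  have fc: "continuous_map X Y f" and gc: "continuous_map Y X g"
    and gf: "\<And>a. a \<in> topspace X \<Longrightarrow> g (f a) = a" and fg': "\<And>b. b \<in> topspace Y \<Longrightarrow> f (g b) = b"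
    using fg by (auto simp: homeomorphic_maps_def)
  have inv: "homotopy_hom j U u h' (homotopy_hom j V (h u) h A) = A"
    if h: "continuous_map U V h" and h': "continuous_map V U h'" and hh: "\<And>a. a \<in> topspace U \<Longrightarrow> h' (h a) = a"
      and u: "u \<in> topspace U" and A: "A \<in> carrier (homotopy_group j U u)"
    for U :: "'c topology" and V :: "'d topology" and h h' u A
  proof -
    obtain f where f: "f \<in> cube_loops j U u" "A = cube_class j U u f"
      using A by (rule carrier_homotopy_groupE)
    have "homotopy_hom j V (h u) h A = cube_class j V (h u) (\<lambda>t. h (f t))"
      unfolding f(2) by (rule homotopy_hom_class[OF h f(1)]) simp
    also have "homotopy_hom j U u h' \<dots> = cube_class j U u (\<lambda>t. h' (h (f t)))"
      by (rule homotopy_hom_class[OF h' cube_loops_map[OF h f(1)]]) (simp add: hh u)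
    also have "\<dots> = A"
      unfolding f(2)
    proof (rule cube_classI, rule fhom_cong[OF fhom_refl[OF f(1)]])
      show "f t = h' (h (f t))" if "t \<in> Cube j" for t
        by (rule hh[symmetric]) (use f(1) that continuous_map_funspace[of "top_of_set (Cube j)" U f] in \<open>auto simp: cube_loops_iff\<close>)
    qed simp_all
    finally show ?thesis .
  qed
  have fh: "homotopy_hom j Y (f x) f \<in> hom (homotopy_group j X x) (homotopy_group j Y (f x))"
    by (rule homotopy_hom_hom[OF j fc]) simp
  have gh: "homotopy_hom j X x g \<in> hom (homotopy_group j Y (f x)) (homotopy_group j X x)"
    by (rule homotopy_hom_hom[OF j gc]) (simp add: gf x)
  have fx: "f x \<in> topspace Y"
    using fc x continuous_map_funspace by blast
  have "bij_betw (homotopy_hom j Y (f x) f) (carrier (homotopy_group j X x)) (carrier (homotopy_group j Y (f x)))"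
  proof (rule bij_betw_byWitness[where f' = "homotopy_hom j X x g"])
    show "\<forall>A\<in>carrier (homotopy_group j X x). homotopy_hom j X x g (homotopy_hom j Y (f x) f A) = A"
      using inv[OF fc gc gf x] by simp
    show "\<forall>A\<in>carrier (homotopy_group j Y (f x)). homotopy_hom j Y (f x) f (homotopy_hom j X x g A) = A"
      using inv[OF gc fc fg' fx] by (simp add: gf x)
  qed (use fh gh in \<open>auto simp: hom_def\<close>)
  with fh show ?thesis by (simp add: iso_def)
qed

text \<open>Agreement of \<open>f'\<close> with the composite is asked for on the carrier alone,
  since maps on homotopy classes are not controlled elsewhere.\<close>

lemma split_short_exact_precompose:
  assumes ses: "split_short_exact A B C f g" and A': "group A'" and h: "h \<in> iso A' A"
    and f': "\<And>a. a \<in> carrier A' \<Longrightarrow> f' a = f (h a)"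
  shows "split_short_exact A' B C f' g"
proof -
  have hb: "h ` carrier A' = carrier A" "inj_on h (carrier A')" and hh: "h \<in> hom A' A"
    using h by (auto simp: iso_def bij_betw_def)
  have f: "f \<in> hom A B" "inj_on f (carrier A)"
    using ses by (auto simp: split_short_exact_def mon_def)
  have "f \<circ> h \<in> hom A' B"
    by (rule hom_compose[OF hh f(1)])
  then have "f' \<in> hom A' B"
    using group.is_monoid[OF A', THEN monoid.m_closed] by (auto simp: hom_def f')
  moreover have "inj_on f' (carrier A')"
    using inj_on_cong[of "carrier A'" f' "f \<circ> h"] comp_inj_on[OF hb(2)] f(2) by (simp add: f' hb(1))
  moreover have "f' ` carrier A' = f ` carrier A"
    unfolding hb(1)[symmetric] image_image by (rule image_cong) (simp_all add: f')
  ultimately show ?thesis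
    using ses A' by (simp add: split_short_exact_def mon_def)
qed

lemma continuous_map_conf_space:
  assumes f: "continuous_map X Y f" and inj: "inj_on f (topspace X)"
  shows "continuous_map (conf_space m X) (conf_space m Y) (\<lambda>v. \<lambda>i\<in>{..<m}. f (v i))"
proof -
  have c: "continuous_map (conf_space m X) Y (\<lambda>v. f (v i))" if "i < m" for i
  proof -
    have "continuous_map (conf_space m X) X (\<lambda>v. v i)"
      unfolding conf_space_def
      by (intro continuous_map_from_subtopology continuous_map_product_projection) (use that in simp)
    from continuous_map_compose[OF this f] show ?thesis by (simp add: o_def)
  qed
  have "continuous_map (conf_space m X) (power_space m Y) (\<lambda>v. \<lambda>i\<in>{..<m}. f (v i))"
    by (auto simp: continuous_map_componentwise c)
  moreover have "f (v i) \<noteq> f (v l)" if "v \<in> topspace (conf_space m X)" "i < m" "l < m" "i \<noteq> l" for v i l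
    using that inj by (auto simp: conf_space_def PiE_def Pi_iff dest: inj_onD)
  ultimately show ?thesis
    unfolding conf_space_def[of m Y] by (auto simp: continuous_map_in_subtopology)
qed

lemma homeomorphic_maps_conf_space:
  assumes "homeomorphic_maps X Y f g"
  shows "homeomorphic_maps (conf_space m X) (conf_space m Y) (\<lambda>v. \<lambda>i\<in>{..<m}. f (v i)) (\<lambda>v. \<lambda>i\<in>{..<m}. g (v i))"
proof -
  have fc: "continuous_map X Y f" and gc: "continuous_map Y X g"
    and gf: "\<And>a. a \<in> topspace X \<Longrightarrow> g (f a) = a" and fg: "\<And>b. b \<in> topspace Y \<Longrightarrow> f (g b) = b"
    using assms by (auto simp: homeomorphic_maps_def)
  have inv: "(\<lambda>i\<in>{..<m}. h' ((\<lambda>i\<in>{..<m}. h (v i)) i)) = v"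
    if "v \<in> topspace (conf_space m U)" "\<And>a. a \<in> topspace U \<Longrightarrow> h' (h a) = a" for U :: "'c topology" and h :: "'c \<Rightarrow> 'd" and h' v
    using that by (auto simp: conf_space_def fun_eq_iff PiE_def Pi_iff extensional_def)
  show ?thesis
    unfolding homeomorphic_maps_def
  proof (intro conjI ballI)
    show "continuous_map (conf_space m X) (conf_space m Y) (\<lambda>v. \<lambda>i\<in>{..<m}. f (v i))"
      by (rule continuous_map_conf_space[OF fc inj_on_inverseI]) (rule gf)
    show "continuous_map (conf_space m Y) (conf_space m X) (\<lambda>v. \<lambda>i\<in>{..<m}. g (v i))"
      by (rule continuous_map_conf_space[OF gc inj_on_inverseI]) (rule fg)
    show "(\<lambda>i\<in>{..<m}. g ((\<lambda>i\<in>{..<m}. f (v i)) i)) = v" if "v \<in> topspace (conf_space m X)" for v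
      by (rule inv[OF that]) (rule gf)
    show "(\<lambda>i\<in>{..<m}. f ((\<lambda>i\<in>{..<m}. g (v i)) i)) = v" if "v \<in> topspace (conf_space m Y)" for v
      by (rule inv[OF that]) (rule fg)
  qed
qed

section \<open>Orbit spaces\<close>

lemma (in group_action) orbit_eq_iff:
  assumes "x \<in> E" "y \<in> E"
  shows "orbit G \<phi> x = orbit G \<phi> y \<longleftrightarrow> (\<exists>g\<in>carrier G. y = \<phi> g x)"
proof
  assume "orbit G \<phi> x = orbit G \<phi> y"
  then have "y \<in> orbit G \<phi> x" using orbit_refl[OF assms(2)] by simp
  then show "\<exists>g\<in>carrier G. y = \<phi> g x" by (auto simp: orbit_def)
next
  assume "\<exists>g\<in>carrier G. y = \<phi> g x"
  then have y: "y \<in> orbit G \<phi> x" by (auto simp: orbit_def)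
  have E: "orbit G \<phi> z \<subseteq> E" if "z \<in> E" for z
    using element_image[OF _ that] by (auto simp: orbit_def)
  show "orbit G \<phi> x = orbit G \<phi> y"
    using orbit_trans[OF assms _ y] orbit_trans[OF assms(2,1) _ orbit_sym[OF assms y]] E[OF assms(1)] E[OF assms(2)] by blast
qed

text \<open>The saturation of an open set is the union of its preimages under the
  translations.\<close>

lemma open_map_orbit_space:
  assumes "free_continuous_action G X \<phi>"
  shows "open_map X (orbit_space G X \<phi>) (orbit G \<phi>)"
  unfolding open_map_def openin_orbit_space
proof (intro allI impI conjI)
  interpret group_action G "topspace X" \<phi>
    using assms by (simp add: free_continuous_action_def)
  have cont: "continuous_map X X (\<phi> g)" if "g \<in> carrier G" for g
    using assms that by (simp add: free_continuous_action_def)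
  fix U assume U: "openin X U"
  then have UX: "U \<subseteq> topspace X" by (rule openin_subset)
  then show "orbit G \<phi> ` U \<subseteq> orbits G (topspace X) \<phi>"
    by (auto simp: orbits_def)
  have "orbit G \<phi> z \<in> orbit G \<phi> ` U \<longleftrightarrow> (\<exists>g\<in>carrier G. \<phi> g z \<in> U)" if z: "z \<in> topspace X" for z
  proof
    assume "orbit G \<phi> z \<in> orbit G \<phi> ` U"
    then obtain u where "u \<in> U" "orbit G \<phi> z = orbit G \<phi> u" by blast
    then show "\<exists>g\<in>carrier G. \<phi> g z \<in> U"
      using orbit_eq_iff[OF z, of u] UX by blast
  next
    assume "\<exists>g\<in>carrier G. \<phi> g z \<in> U"
    then obtain g where "g \<in> carrier G" "\<phi> g z \<in> U" by blast
    then show "orbit G \<phi> z \<in> orbit G \<phi> ` U"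
      using orbit_eq_iff[OF z, of "\<phi> g z"] UX by blast
  qed
  then have "{z \<in> topspace X. orbit G \<phi> z \<in> orbit G \<phi> ` U} = (\<Union>g\<in>carrier G. {z \<in> topspace X. \<phi> g z \<in> U})"
    by blast
  then show "openin X {z \<in> topspace X. orbit G \<phi> z \<in> orbit G \<phi> ` U}"
    using openin_continuous_map_preimage[OF cont U] by auto
qed

lemma free_quotient_orbit_space:
  assumes "3 \<le> k" "odd k" "group G" "finite (carrier G)" "free_continuous_action G (nsphere k) \<phi>"
  shows "free_quotient k G \<phi> (orbit_space G (nsphere k) \<phi>) (orbit G \<phi>)"
proof (rule free_quotient.intro)
  interpret group_action G "Sph k" \<phi>
    using assms(5) by (simp add: free_continuous_action_def)
  show "continuous_map (nsphere k) (orbit_space G (nsphere k) \<phi>) (orbit G \<phi>)"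
    by (rule quotient_imp_continuous_map[OF quotient_map_orbit_space])
  show "orbit G \<phi> ` Sph k = topspace (orbit_space G (nsphere k) \<phi>)"
    by (auto simp: topspace_orbit_space orbits_def)
  show "orbit G \<phi> z = orbit G \<phi> w \<longleftrightarrow> (\<exists>g\<in>carrier G. w = \<phi> g z)" if "z \<in> Sph k" "w \<in> Sph k" for z w
    by (rule orbit_eq_iff[OF that])
  show "open_map (nsphere k) (orbit_space G (nsphere k) \<phi>) (orbit G \<phi>)"
    by (rule open_map_orbit_space[OF assms(5)])
qed (use assms in auto)

text \<open>The orbits are singletons, so the identity serves as quotient map, and configurations of
  the quotient are configurations of points of the sphere.\<close>

lemma free_quotient_trivial:
  assumes "3 \<le> k" "odd k" "group G" "free_continuous_action G (nsphere k) \<phi>" "carrier G = {\<one>\<^bsub>G\<^esub>}"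
  shows "free_quotient k G \<phi> (nsphere k) (\<lambda>z. z)"
proof (rule free_quotient.intro)
  interpret group_action G "Sph k" \<phi>
    using assms(4) by (simp add: free_continuous_action_def)
  show "z = w \<longleftrightarrow> (\<exists>g\<in>carrier G. w = \<phi> g z)" if "z \<in> Sph k" for z w
  proof -
    have "\<phi> \<one>\<^bsub>G\<^esub> z = z" using id_eq_one that by (metis restrict_apply')
    then show ?thesis unfolding assms(5) by auto
  qed
  show "open_map (nsphere k) (nsphere k) (\<lambda>z. z)"
    by (simp add: open_map_def)
qed (use assms in simp_all)

lemma disc_base_point_paths:
  assumes "disc_base_point k n X D x0 x \<gamma>"
  shows "x \<in> topspace (conf_space n X)"
    "\<And>i. i < n \<Longrightarrow> pathin X (\<gamma> i)" "\<And>i. i < n \<Longrightarrow> \<gamma> i 0 = x i" "\<And>i. i < n \<Longrightarrow> \<gamma> i 1 = x0"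
  using assms by (auto simp: disc_base_point_def pathin_def continuous_map_in_subtopology)

context quotient_configuration
begin

lemma insert_first_path:
  assumes "q \<in> S" "n = Suc m" "y \<in> OC m (orbit G \<phi> q)"
  obtains \<delta> where "pathin CX \<delta>" "\<delta> 0 = insert_first n (P q) P y" "\<delta> 1 = x"
proof -
  have "ins q m y \<in> OC n {}" using ins_OC[OF assms(1,3)] assms(2) by simp
  from conf_space_path[OF this xc] show thesis
    using that by (metis assms(2) insert_first_eq)
qed

text \<open>If \<open>P\<close> is injective, distinct orbits means distinct points, so the fibre is
  an ordinary configuration space of the punctured sphere. A homeomorphism with \<open>E\<close>
  acts coordinatewise on it and replaces it in the exact sequence.\<close>

lemma split_short_exact_punctured:
  assumes q: "q \<in> S" and n: "n = Suc m" and inj: "inj_on P S" and orb: "orbit G \<phi> q = {q}"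
    and st: "homeomorphic_maps E (top_of_set (S - {q})) s t" and v: "v \<in> topspace (conf_space m E)"
  shows "\<exists>\<delta>. pathin CX \<delta> \<and> \<delta> 0 = insert_first n (P q) (\<lambda>a. P (s a)) v \<and> \<delta> 1 = x \<and>
    split_short_exact (homotopy_group j (conf_space m E) v) (homotopy_group j CX x) \<Delta>
      (base_transport j CX \<delta> \<circ> homotopy_hom j CX (\<delta> 0) (insert_first n (P q) (\<lambda>a. P (s a)))) ci"
proof -
  let ?s = "\<lambda>v. \<lambda>i\<in>{..<m}. s (v i)"
  have "OC m {q} = PiE {..<m} (\<lambda>_. S - {q}) \<inter> {z. \<forall>i<m. \<forall>l<m. i \<noteq> l \<longrightarrow> z i \<noteq> z l}"
  proof -
    have "P (z i) = P (z l) \<longleftrightarrow> z i = z l" if "z \<in> PiE {..<m} (\<lambda>_. S - {q})" "i < m" "l < m" for z i l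
      using that by (intro inj_on_eq_iff[OF inj]) (auto simp: PiE_def Pi_iff)
    then show ?thesis
      unfolding OC_def by blast
  qed
  then have F: "conf_space m (top_of_set (S - {q})) = top_of_set (OC m {q})"
    by (simp add: conf_space_def product_topology_top_of_set subtopology_subtopology)
  have hs: "homeomorphic_maps (conf_space m E) (top_of_set (OC m {q})) ?s (\<lambda>v. \<lambda>i\<in>{..<m}. t (v i))"
    using homeomorphic_maps_conf_space[OF st, of m] unfolding F .
  then have sc: "continuous_map (conf_space m E) (top_of_set (OC m {q})) ?s"
    by (simp add: homeomorphic_maps_def)
  then have y: "?s v \<in> OC m (orbit G \<phi> q)"
    using v continuous_map_funspace[OF sc] by (auto simp: orb)
  have is_eq: "insert_first n (P q) (\<lambda>a. P (s a)) = (\<lambda>u. insert_first n (P q) P (?s u))"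
    by (auto simp: insert_first_def n fun_eq_iff split: nat.split)
  obtain \<delta> where \<delta>: "pathin CX \<delta>" "\<delta> 0 = insert_first n (P q) P (?s v)" "\<delta> 1 = x"
    using insert_first_path[OF q n y] by blast
  have ic: "continuous_map (top_of_set (OC m {q})) CX (insert_first n (P q) P)"
    unfolding n insert_first_eq[abs_def]
    using continuous_map_compose[OF ins_continuous[OF q] Pn_continuous] by (simp add: o_def orb)
  have "split_short_exact (homotopy_group j (conf_space m E) v) (homotopy_group j CX x) \<Delta>
      (base_transport j CX \<delta> \<circ> homotopy_hom j CX (\<delta> 0) (insert_first n (P q) (\<lambda>a. P (s a)))) ci"
  proof (rule split_short_exact_precompose)
    show "split_short_exact (homotopy_group j (top_of_set (OC m {q})) (?s v)) (homotopy_group j CX x) \<Delta>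
      (base_transport j CX \<delta> \<circ> homotopy_hom j CX (\<delta> 0) (insert_first n (P q) P)) ci"
      using split_short_exact_fibre[OF q n y \<delta>] by (simp only: orb)
    show "group (homotopy_group j (conf_space m E) v)"
      by (rule group_homotopy_group[OF j v])
    show "homotopy_hom j (top_of_set (OC m {q})) (?s v) ?s
      \<in> iso (homotopy_group j (conf_space m E) v) (homotopy_group j (top_of_set (OC m {q})) (?s v))"
      by (rule homotopy_hom_homeomorphic[OF j hs v])
    fix A assume "A \<in> carrier (homotopy_group j (conf_space m E) v)"
    then obtain u where u: "u \<in> cube_loops j (conf_space m E) v" "A = cube_class j (conf_space m E) v u"
      by (rule carrier_homotopy_groupE)
    have "homotopy_hom j CX (\<delta> 0) (insert_first n (P q) (\<lambda>a. P (s a))) A = cube_class j CX (\<delta> 0) (\<lambda>r. insert_first n (P q) P (?s (u r)))"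
      unfolding u(2) is_eq
      by (rule homotopy_hom_class[OF continuous_map_compose[OF sc ic, unfolded o_def] u(1)]) (rule \<delta>(2))
    moreover have "homotopy_hom j (top_of_set (OC m {q})) (?s v) ?s A = cube_class j (top_of_set (OC m {q})) (?s v) (\<lambda>r. ?s (u r))"
      unfolding u(2) by (rule homotopy_hom_class[OF sc u(1)]) simp
    moreover have "homotopy_hom j CX (\<delta> 0) (insert_first n (P q) P) (cube_class j (top_of_set (OC m {q})) (?s v) (\<lambda>r. ?s (u r)))
      = cube_class j CX (\<delta> 0) (\<lambda>r. insert_first n (P q) P (?s (u r)))"
      by (rule homotopy_hom_class[OF ic cube_loops_map[OF sc u(1)]]) (rule \<delta>(2))
    ultimately show "(base_transport j CX \<delta> \<circ> homotopy_hom j CX (\<delta> 0) (insert_first n (P q) (\<lambda>a. P (s a)))) A =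
      (base_transport j CX \<delta> \<circ> homotopy_hom j CX (\<delta> 0) (insert_first n (P q) P)) (homotopy_hom j (top_of_set (OC m {q})) (?s v) ?s A)"
      by simp
  qed
  with \<delta> is_eq show ?thesis by metis
qed

end

theorem proposition3p6:
  fixes k j n :: nat
    and G :: "('g, 'm) monoid_scheme"
    and \<phi> :: "'g \<Rightarrow> (nat \<Rightarrow> real) \<Rightarrow> (nat \<Rightarrow> real)"
    and Q1 :: "nat \<Rightarrow> real"
    and X :: "(nat \<Rightarrow> real) set topology"
    and D :: "(nat \<Rightarrow> real) set set"
    and x0 :: "(nat \<Rightarrow> real) set"
    and x :: "nat \<Rightarrow> (nat \<Rightarrow> real) set"
    and \<gamma> :: "nat \<Rightarrow> real \<Rightarrow> (nat \<Rightarrow> real) set"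
    and F :: "(nat \<Rightarrow> nat \<Rightarrow> real) topology"
    and y :: "nat \<Rightarrow> nat \<Rightarrow> real"
  assumes "k \<ge> 3" and "odd k" and "j \<ge> 2" and "n \<ge> 2"
    and "group G" and "finite (carrier G)"
    and "free_continuous_action G (nsphere k) \<phi>"
    and "Q1 \<in> topspace (nsphere k)"
    and "X = orbit_space G (nsphere k) \<phi>"
    and "disc_base_point k n X D x0 x \<gamma>"
    and "F = orbit_conf_space G \<phi> (n - 1)
                  (subtopology (nsphere k) (topspace (nsphere k) - orbit G \<phi> Q1))"
    and "y \<in> topspace F"
  shows
    "conf_inclusion_hom j n X x \<gamma> ` carrier (homotopy_group j (conf_space n X) x)
       = carrier (diagonal_group j n X x0)
     \<and>
     (\<exists>f g. split_short_exact
         (diagonal_group j n X x0)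
         (homotopy_group j (power_space n X) x)
         (homotopy_group (j - 1) (power_space (n - 1) (loop_space X x0))
            (\<lambda>i\<in>{..<n - 1}. \<lambda>t\<in>{0..1}. x0))
         f g \<and>
       (\<forall>a\<in>carrier (diagonal_group j n X x0). power_identification j n X x \<gamma> (f a) = a))
     \<and>
     (\<exists>\<delta>. pathin (conf_space n X) \<delta> \<and>
       \<delta> 0 = insert_first n (orbit G \<phi> Q1) (orbit G \<phi>) y \<and> \<delta> 1 = x \<and>
       split_short_exact
         (homotopy_group j F y)
         (homotopy_group j (conf_space n X) x)
         (diagonal_group j n X x0)
         (base_transport j (conf_space n X) \<delta> \<circ>
            homotopy_hom j (conf_space n X) (\<delta> 0)
              (insert_first n (orbit G \<phi> Q1) (orbit G \<phi>)))
         (conf_inclusion_hom j n X x \<gamma>))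
     \<and>
     (carrier G = {\<one>\<^bsub>G\<^esub>} \<longrightarrow>
       (\<forall>D' p0 p \<eta> v.
          disc_base_point k n (nsphere k) D' p0 p \<eta> \<longrightarrow>
          v \<in> topspace (conf_space (n - 1) (Euclidean_space k)) \<longrightarrow>
          (\<exists>s \<delta>. homeomorphic_map (Euclidean_space k)
                    (subtopology (nsphere k) (topspace (nsphere k) - {Q1})) s \<and>
             pathin (conf_space n (nsphere k)) \<delta> \<and>
             \<delta> 0 = insert_first n Q1 s v \<and> \<delta> 1 = p \<and>
             split_short_exact
               (homotopy_group j (conf_space (n - 1) (Euclidean_space k)) v)
               (homotopy_group j (conf_space n (nsphere k)) p)
               (diagonal_group j n (nsphere k) p0)
               (base_transport j (conf_space n (nsphere k)) \<delta> \<circ>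
                  homotopy_hom j (conf_space n (nsphere k)) (\<delta> 0) (insert_first n Q1 s))
               (conf_inclusion_hom j n (nsphere k) p \<eta>))))"
proof -
  note k = assms(1,2) and j = assms(3) and G = assms(5,6,7) and X = assms(9) and F = assms(11)
  have Q1: "Q1 \<in> Sph k" using assms(8) by simp
  obtain m where m: "n = Suc m" "n - 1 = m" using assms(4) by (cases n) auto
  interpret Q: free_quotient k G \<phi> X "orbit G \<phi>"
    unfolding X by (rule free_quotient_orbit_space[OF k G])
  interpret Q: quotient_configuration k G \<phi> X "orbit G \<phi>" j n x x0 \<gamma>
    using j assms(4) disc_base_point_paths[OF assms(10)] by unfold_locales auto
  have F': "F = top_of_set (Q.OC m (orbit G \<phi> Q1))"
    unfolding F m(2) topspace_nsphere by (rule Q.orbit_conf_space_eq)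
  have y: "y \<in> Q.OC m (orbit G \<phi> Q1)" using assms(12) by (simp add: F')
  obtain \<delta> where \<delta>: "pathin (conf_space n X) \<delta>" "\<delta> 0 = insert_first n (orbit G \<phi> Q1) (orbit G \<phi>) y" "\<delta> 1 = x"
    using Q.insert_first_path[OF Q1 m(1) y] by blast
  have trivial: "\<exists>s \<delta>. homeomorphic_map (Euclidean_space k) (subtopology (nsphere k) (topspace (nsphere k) - {Q1})) s \<and>
             pathin (conf_space n (nsphere k)) \<delta> \<and> \<delta> 0 = insert_first n Q1 s v \<and> \<delta> 1 = p \<and>
             split_short_exact (homotopy_group j (conf_space (n - 1) (Euclidean_space k)) v)
               (homotopy_group j (conf_space n (nsphere k)) p) (diagonal_group j n (nsphere k) p0)
               (base_transport j (conf_space n (nsphere k)) \<delta> \<circ>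
                  homotopy_hom j (conf_space n (nsphere k)) (\<delta> 0) (insert_first n Q1 s))
               (conf_inclusion_hom j n (nsphere k) p \<eta>)"
    if 1: "carrier G = {\<one>\<^bsub>G\<^esub>}" and D': "disc_base_point k n (nsphere k) D' p0 p \<eta>"
      and v: "v \<in> topspace (conf_space (n - 1) (Euclidean_space k))" for D' p0 p \<eta> v
  proof -
    \<comment> \<open>A second instance with the identity as quotient map: here the base
      configuration and its paths lie in the sphere itself.\<close>
    interpret R: free_quotient k G \<phi> "nsphere k" "\<lambda>z. z"
      by (rule free_quotient_trivial[OF k G(1,3) 1])
    interpret R: quotient_configuration k G \<phi> "nsphere k" "\<lambda>z. z" j n p p0 \<eta>
      using j assms(4) disc_base_point_paths[OF D'] by unfold_locales auto
    have orb: "orbit G \<phi> Q1 = {Q1}"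
      using R.act_one[OF Q1] by (auto simp: orbit_def 1)
    obtain s t where st: "homeomorphic_maps (Euclidean_space k) (top_of_set (Sph k - {Q1})) s t"
      by (rule homeomorphic_stereographic[OF Q1])
    have T: "subtopology (nsphere k) (topspace (nsphere k) - {Q1}) = top_of_set (Sph k - {Q1})"
      by (simp add: nsphere_eq subtopology_subtopology Int_absorb1)
    have "homeomorphic_map (Euclidean_space k) (subtopology (nsphere k) (topspace (nsphere k) - {Q1})) s"
      unfolding T homeomorphic_map_maps using st by blast
    then show ?thesis
      using R.split_short_exact_punctured[OF Q1 m(1) inj_on_id2 orb st v[unfolded m(2)]] unfolding m(2) by blast
  qed
  show ?thesis
    using Q.ci_image Q.split_short_exact_loop_space[OF j] assms(4) \<delta> Q.split_short_exact_fibre[OF Q1 m(1) y \<delta>] trivial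
    unfolding F' by (intro conjI) (auto | blast)+
qed

end
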